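(* Let $(L,h)\to M$ be a positive Hermitian holomorphic line bundle over a compact complex manifold of dimension $n$, let $p\in M$, and let $\phi$ be a local Kähler potential on a coordinate neighborhood $V$ of $p$ ($|e_L|_h^2=e^{-\phi}$). Assume $\phi\in G^a(V)$ for some $a>1$. There is a constant $b>0$ such that for every $\varepsilon>0$ the following holds. Let $b_m(x,z)$ be the almost holomorphic extensions of the Bergman kernel coefficients $b_m(x,\bar x)$ defined by the recursion in the context. Then there exist a neighborhood $U\subset V$ of $p$ and a constant $C$ (depending on $\varepsilon$ but not on $m,\alpha,\beta$) such that for every $m\in\mathbb N$ $$\|b_m(x,z)\|_{L^\infty(U\times U)}\le C^m m!^{2a+2\varepsilon},$$ and, writing $v=(x,z)$, for all multi-indices $\alpha,\beta$ and all $(x,z)\in U\times U$, $$\left|D_v^\alpha D_{\bar v}^\beta b_m(x,z)\right|\le C^{m+|\alpha|+|\beta|}\,m!^{2a+2\varepsilon}\,\alpha!^{a+\varepsilon}\beta!^{a+\varepsilon}\exp\left(-b\,(1-\delta_0(|\beta|))\,|x-\bar z|^{-\frac1{a-1}}\right),$$ where $\delta_0(|\beta|)=1$ if $\beta=0$ and $\delta_0(|\beta|)=0$ otherwise. The constant $b$ is independent of $\alpha,\beta,m,\varepsilon$. In addition, at points of the diagonal $z=\bar x$ these estimates hold with $\varepsilon=0$.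
   Context: $G^a(V)$ is the set of smooth $f$ such that, for some $C_0,C_1>0$, $\|D_z^\alpha D_{\bar z}^\beta f\|_{L^\infty(V)}\le C_0C_1^{|\alpha|+|\beta|}(\alpha!\beta!)^a$ for all multi-indices $\alpha,\beta$. Convention: at $x=\bar z$, the factor $\exp(-b|x-\bar z|^{-1/(a-1)})$ is $0$. Geometric setting. $\omega=-\frac{\sqrt{-1}}2\partial\bar\partial\log h$ is the Kähler form. $K_k$ is the distribution kernel of the orthogonal projection $L^2(M,L^k)\to H^0(M,L^k)$ with respect to the inner product induced by $h^k$ and the volume form $\omega^n/n!$. $e_L$ is a holomorphic frame of $L$ on $V$, $|e_L|^2_h=e^{-\phi}$, and in the frame $e_L^k\otimes\bar e_L^k$ the kernel $K_k(x,y)$ is regarded as a function on $V\times V$. Local holomorphic coordinates identify $p$ with $0\in\mathbb C^n$ and $V$ with a ball centered at $0$ (on which, after shrinking and rescaling, the maps below are defined). $D_x^\alpha$, $D_{\bar x}^\beta$ denote holomorphic and antiholomorphic partial derivatives. Almost holomorphic extensions. An almost holomorphic extension of a smooth $f$ is a smooth function $F(x,z)$ with $F(x,\bar x)=f(x)$ whose antiholomorphic derivatives vanish to infinite order along $z=\bar x$. For a given $\varepsilon>0$ fix a cut-off function $\chi\in G^{1+\varepsilon}(\mathbb R)$ with $\chi(t)=1$ for $|t|\le\frac12$ and $\chi(t)=0$ for $|t|\ge1$. For $f\in G^a$ with Gevrey constants $C_0,C_1$ define $$F(f)(y,z)=\sum_{\alpha,\beta\ge0}\frac{D_x^\alpha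 D_{\bar x}^\beta f}{\alpha!\beta!}\Big(\frac{y+\bar z}2\Big)\Big(\frac{y-\bar z}2\Big)^\alpha\Big(\frac{z-\bar y}2\Big)^\beta\chi\big(|\alpha+\beta|^{2(a-1)}4^{a-1}C_1^2|y-\bar z|^2\big).$$ Set $\psi=F(\phi)$. Bergman coefficients. The functions $b_m(x,\bar x)$ are the coefficients in the on-diagonal expansion $K_k(x,x)e^{-k\phi(x)}\sim\frac{k^n}{\pi^n}\sum_{m\ge0}b_m(x,\bar x)k^{-m}$. Their extensions $b_m(x,z)$ are defined as follows. Let $\theta(x,y,z)=\int_0^1(D_x\psi)(tx+(1-t)y,z)\,dt\in\mathbb C^n$ ($D_x\psi$ is the holomorphic gradient of $\psi$ in its first variable); near $0\in\mathbb C^{3n}$ the map $(x,y,z)\mapsto(x,y,\theta)$ is a diffeomorphism, with inverse $(x,y,\theta)\mapsto(x,y,z(x,y,\theta))$. Let $\Delta_0=\frac{\det\psi_{yz}(y,z)}{\det\theta_z(x,y,z)}$, viewed as a function of $(x,y,\theta)$ when needed. Then $b_0=1$ and for $m\ge1$ $$b_m(x,z(x,x,\theta))=-\sum_{l=1}^m\frac{(D_y\cdot D_\theta)^l}{l!}\Big(b_{m-l}(x,z(x,y,\theta))\,\Delta_0(x,y,\theta)\Big)\Big|_{y=x},\qquad D_y\cdot D_\theta=\sum_i D_{y_i}D_{\theta_i}.$$ *)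

theory Defs
  imports "HOL-Analysis.Analysis" "HOL-Library.Landau_Symbols"
begin

section \<open>Calculus on \<open>\<complex>\<^sup>n\<close>\<close>

text \<open>
  \<open>\<complex>\<^sup>n\<close> is \<open>complex^'n\<close>; products such as \<open>\<complex>\<^sup>2\<^sup>n\<close> are \<open>complex^('n + 'n)\<close>.  Multi-indices are
  functions \<open>'k \<Rightarrow> nat\<close> on the (finite) index type.
\<close>

definition cnjv :: "complex^'n \<Rightarrow> complex^'n" where
  "cnjv z = (\<chi> i. cnj (z $ i))"

primrec Ck_on :: "nat \<Rightarrow> 'a::real_normed_vector set \<Rightarrow> ('a \<Rightarrow> 'b::real_normed_vector) \<Rightarrow> bool" where
  "Ck_on 0 S f \<longleftrightarrow> continuous_on S f"
| "Ck_on (Suc k) S f \<longleftrightarrow>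
     (\<forall>x\<in>S. f differentiable (at x)) \<and> (\<forall>v. Ck_on k S (\<lambda>x. frechet_derivative f (at x) v))"

text \<open>Only used for open \<open>S\<close>.\<close>

definition smooth_on :: "'a::real_normed_vector set \<Rightarrow> ('a \<Rightarrow> 'b::real_normed_vector) \<Rightarrow> bool" where
  "smooth_on S f \<longleftrightarrow> (\<forall>k. Ck_on k S f)"

definition diffeo_onto_image ::
  "'a::real_normed_vector set \<Rightarrow> ('a \<Rightarrow> 'b::real_normed_vector) \<Rightarrow> bool" where
  "diffeo_onto_image W f \<longleftrightarrow>
     open W \<and> open (f ` W) \<and> inj_on f W \<and> smooth_on W f \<and> smooth_on (f ` W) (inv_into W f)"

text \<open>
  The Wirtinger derivatives \<open>\<partial>f/\<partial>z\<^sub>j = (\<partial>f/\<partial>x\<^sub>j - \<i> \<partial>f/\<partial>y\<^sub>j)/2\<close> and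
  \<open>\<partial>f/\<partial>(cnj z\<^sub>j) = (\<partial>f/\<partial>x\<^sub>j + \<i> \<partial>f/\<partial>y\<^sub>j)/2\<close>.
\<close>

definition Dz :: "'k::finite \<Rightarrow> (complex^'k \<Rightarrow> complex) \<Rightarrow> complex^'k \<Rightarrow> complex" where
  "Dz j f w = (frechet_derivative f (at w) (axis j 1)
               - \<i> * frechet_derivative f (at w) (axis j \<i>)) / 2"

definition Dzbar :: "'k::finite \<Rightarrow> (complex^'k \<Rightarrow> complex) \<Rightarrow> complex^'k \<Rightarrow> complex" where
  "Dzbar j f w = (frechet_derivative f (at w) (axis j 1)
                  + \<i> * frechet_derivative f (at w) (axis j \<i>)) / 2"

text \<open>
  Iterated derivatives are taken along an arbitrary enumeration of the index type, which is
  irrelevant for smooth functions.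
\<close>

definition index_enum :: "'k::finite list" where
  "index_enum = (SOME xs. distinct xs \<and> set xs = UNIV)"

definition multi_deriv ::
  "('k::finite \<Rightarrow> (complex^'k \<Rightarrow> complex) \<Rightarrow> complex^'k \<Rightarrow> complex)
    \<Rightarrow> ('k \<Rightarrow> nat) \<Rightarrow> (complex^'k \<Rightarrow> complex) \<Rightarrow> complex^'k \<Rightarrow> complex" where
  "multi_deriv D \<alpha> f = fold (\<lambda>j. D j ^^ \<alpha> j) index_enum f"

definition DD ::
  "('k::finite \<Rightarrow> nat) \<Rightarrow> ('k \<Rightarrow> nat) \<Rightarrow> (complex^'k \<Rightarrow> complex) \<Rightarrow> complex^'k \<Rightarrow> complex" where
  "DD \<alpha> \<beta> f = multi_deriv Dz \<alpha> (multi_deriv Dzbar \<beta> f)"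

definition mi_abs :: "('k::finite \<Rightarrow> nat) \<Rightarrow> nat" where
  "mi_abs \<alpha> = (\<Sum>i\<in>UNIV. \<alpha> i)"

definition mi_fact :: "('k::finite \<Rightarrow> nat) \<Rightarrow> real" where
  "mi_fact \<alpha> = (\<Prod>i\<in>UNIV. fact (\<alpha> i))"

definition mi_pow :: "complex^'k \<Rightarrow> ('k::finite \<Rightarrow> nat) \<Rightarrow> complex" where
  "mi_pow w \<alpha> = (\<Prod>i\<in>UNIV. (w $ i) ^ \<alpha> i)"

section \<open>Gevrey functions\<close>

definition gevrey_with ::
  "real \<Rightarrow> (complex^'n::finite) set \<Rightarrow> (complex^'n \<Rightarrow> complex) \<Rightarrow> real \<Rightarrow> real \<Rightarrow> bool" where
  "gevrey_with a V f C0 C1 \<longleftrightarrow>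
     smooth_on V f \<and> C0 > 0 \<and> C1 > 0 \<and>
     (\<forall>\<alpha> \<beta>. \<forall>w\<in>V. cmod (DD \<alpha> \<beta> f w)
        \<le> C0 * C1 ^ (mi_abs \<alpha> + mi_abs \<beta>) * (mi_fact \<alpha> * mi_fact \<beta>) powr a)"

definition gevrey_real :: "real \<Rightarrow> (real \<Rightarrow> real) \<Rightarrow> bool" where
  "gevrey_real s f \<longleftrightarrow>
     smooth_on UNIV f \<and>
     (\<exists>C0>0. \<exists>C1>0. \<forall>j t. \<bar>(deriv ^^ j) f t\<bar> \<le> C0 * C1 ^ j * (fact j) powr s)"

definition gevrey_cutoff :: "real \<Rightarrow> (real \<Rightarrow> real) \<Rightarrow> bool" where
  "gevrey_cutoff s f \<longleftrightarrow>
     gevrey_real s f \<and> (\<forall>t. \<bar>t\<bar> \<le> 1/2 \<longrightarrow> f t = 1) \<and> (\<forall>t. \<bar>t\<bar> \<ge> 1 \<longrightarrow> f t = 0)"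

text \<open>
  For every \<open>(y, z)\<close> only finitely many terms of the following series are nonzero, because of the
  cut-off \<open>chi\<close> (if \<open>y \<noteq> cnjv z\<close>) or of the powers (if \<open>y = cnjv z\<close>).
\<close>

definition gevrey_extension ::
  "real \<Rightarrow> real \<Rightarrow> (real \<Rightarrow> real) \<Rightarrow> (complex^'n::finite \<Rightarrow> complex)
    \<Rightarrow> complex^'n \<Rightarrow> complex^'n \<Rightarrow> complex" where
  "gevrey_extension a C1 chi f y z =
     (\<Sum>\<^sub>\<infinity>(\<alpha>, \<beta>)\<in>UNIV.
        DD \<alpha> \<beta> f ((1/2) *\<^sub>R (y + cnjv z)) / of_real (mi_fact \<alpha> * mi_fact \<beta>)
        * mi_pow ((1/2) *\<^sub>R (y - cnjv z)) \<alpha> * mi_pow ((1/2) *\<^sub>R (z - cnjv y)) \<beta>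
        * of_real (chi (real (mi_abs \<alpha> + mi_abs \<beta>) powr (2 * (a - 1)) * 4 powr (a - 1)
                        * C1\<^sup>2 * (norm (y - cnjv z))\<^sup>2)))"

section \<open>Compact complex manifolds\<close>

text \<open>
  The manifold is a Hausdorff type \<open>'m\<close>, a chart is a pair \<open>(U, \<kappa>)\<close>.
\<close>

definition Cn_holomorphic_on :: "(complex^'n::finite) set \<Rightarrow> (complex^'n \<Rightarrow> complex) \<Rightarrow> bool" where
  "Cn_holomorphic_on S f \<longleftrightarrow>
     (\<forall>w\<in>S. \<exists>f'. (f has_derivative f') (at w) \<and> (\<forall>c v. f' (c *s v) = c * f' v))"

definition complex_chart ::
  "'m::topological_space set \<Rightarrow> ('m \<Rightarrow> complex^'n::finite) \<Rightarrow> bool" where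
  "complex_chart U \<kappa> \<longleftrightarrow>
     open U \<and> open (\<kappa> ` U) \<and> inj_on \<kappa> U \<and> homeomorphism U (\<kappa> ` U) \<kappa> (inv_into U \<kappa>)"

definition holo_transition ::
  "'m set \<Rightarrow> ('m \<Rightarrow> complex^'n::finite) \<Rightarrow> 'm set \<Rightarrow> ('m \<Rightarrow> complex^'n) \<Rightarrow> bool" where
  "holo_transition U \<kappa> U' \<kappa>' \<longleftrightarrow>
     (\<forall>i. Cn_holomorphic_on (\<kappa> ` (U \<inter> U')) (\<lambda>w. \<kappa>' (inv_into U \<kappa> w) $ i))"

type_synonym ('m, 'n) atlas = "('m set \<times> ('m \<Rightarrow> complex^'n)) set"

definition compact_complex_manifold :: "('m::t2_space, 'n::finite) atlas \<Rightarrow> bool" where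
  "compact_complex_manifold A \<longleftrightarrow>
     compact (UNIV :: 'm set) \<and>
     (\<Union>(U, \<kappa>)\<in>A. U) = UNIV \<and>
     (\<forall>(U, \<kappa>)\<in>A. complex_chart U \<kappa>) \<and>
     (\<forall>(U, \<kappa>)\<in>A. \<forall>(U', \<kappa>')\<in>A. holo_transition U \<kappa> U' \<kappa>')"

definition holomorphic_coordinates ::
  "('m::t2_space, 'n::finite) atlas \<Rightarrow> 'm set \<Rightarrow> ('m \<Rightarrow> complex^'n) \<Rightarrow> bool" where
  "holomorphic_coordinates A V \<kappa> \<longleftrightarrow>
     complex_chart V \<kappa> \<and>
     (\<forall>(U, \<kappa>')\<in>A. holo_transition V \<kappa> U \<kappa>' \<and> holo_transition U \<kappa>' V \<kappa>)"

definition mfd_holomorphic_on ::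
  "('m::t2_space, 'n::finite) atlas \<Rightarrow> 'm set \<Rightarrow> ('m \<Rightarrow> complex) \<Rightarrow> bool" where
  "mfd_holomorphic_on A S f \<longleftrightarrow>
     (\<forall>(U, \<kappa>)\<in>A. Cn_holomorphic_on (\<kappa> ` (U \<inter> S)) (\<lambda>w. f (inv_into U \<kappa> w)))"

definition mfd_smooth_on ::
  "('m::t2_space, 'n::finite) atlas \<Rightarrow> 'm set \<Rightarrow> ('m \<Rightarrow> real) \<Rightarrow> bool" where
  "mfd_smooth_on A S f \<longleftrightarrow>
     (\<forall>(U, \<kappa>)\<in>A. smooth_on (\<kappa> ` (U \<inter> S)) (\<lambda>w. f (inv_into U \<kappa> w)))"

section \<open>Positive Hermitian holomorphic line bundles\<close>

text \<open>
  A line bundle \<open>L\<close> is given by local holomorphic frames \<open>e\<^sub>i\<close> over an open cover \<open>lb_dom L i\<close>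
  (\<open>i \<in> lb_index L\<close>), with transition functions \<open>g\<^sub>i\<^sub>j = lb_trans L i j\<close> such that
  \<open>e\<^sub>j = g\<^sub>i\<^sub>j e\<^sub>i\<close>.  A section \<open>s = s\<^sub>i e\<^sub>i\<close> of \<open>L\<^sup>k\<close> is the family of its components, with
  \<open>s\<^sub>i = g\<^sub>i\<^sub>j\<^sup>k s\<^sub>j\<close>.  The metric is given by \<open>lb_met L i = |e\<^sub>i|\<^sup>2\<^sub>h\<close>.
\<close>

record ('i, 'm) herm_line_bundle =
  lb_index :: "'i set"
  lb_dom :: "'i \<Rightarrow> 'm set"
  lb_trans :: "'i \<Rightarrow> 'i \<Rightarrow> 'm \<Rightarrow> complex"
  lb_met :: "'i \<Rightarrow> 'm \<Rightarrow> real"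

definition hermitian_line_bundle ::
  "('m::t2_space, 'n::finite) atlas \<Rightarrow> ('i, 'm) herm_line_bundle \<Rightarrow> bool" where
  "hermitian_line_bundle A L \<longleftrightarrow>
     (\<forall>i\<in>lb_index L. open (lb_dom L i)) \<and>
     (\<Union>i\<in>lb_index L. lb_dom L i) = UNIV \<and>
     (\<forall>i\<in>lb_index L. \<forall>j\<in>lb_index L.
        mfd_holomorphic_on A (lb_dom L i \<inter> lb_dom L j) (lb_trans L i j) \<and>
        (\<forall>x\<in>lb_dom L i \<inter> lb_dom L j. lb_trans L i j x \<noteq> 0)) \<and>
     (\<forall>i\<in>lb_index L. \<forall>x\<in>lb_dom L i. lb_trans L i i x = 1) \<and>
     (\<forall>i\<in>lb_index L. \<forall>j\<in>lb_index L. \<forall>l\<in>lb_index L.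
        \<forall>x\<in>lb_dom L i \<inter> lb_dom L j \<inter> lb_dom L l.
          lb_trans L i j x * lb_trans L j l x = lb_trans L i l x) \<and>
     (\<forall>i\<in>lb_index L. mfd_smooth_on A (lb_dom L i) (lb_met L i) \<and>
        (\<forall>x\<in>lb_dom L i. lb_met L i x > 0)) \<and>
     (\<forall>i\<in>lb_index L. \<forall>j\<in>lb_index L. \<forall>x\<in>lb_dom L i \<inter> lb_dom L j.
        lb_met L j x = (cmod (lb_trans L i j x))\<^sup>2 * lb_met L i x)"

text \<open>
  The matrix \<open>(\<partial>\<^sup>2f/\<partial>z\<^sub>i\<partial>(cnj z\<^sub>j))\<close>.  In a chart,
  \<open>\<omega> = -(\<i>/2) \<partial>\<partial>bar log h = (\<i>/2) \<Sum> f\<^sub>i\<^sub>j dz\<^sub>i \<and> d(cnj z\<^sub>j)\<close> with \<open>f = - log h\<close>.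
\<close>

definition complex_hessian ::
  "(complex^'n::finite \<Rightarrow> real) \<Rightarrow> complex^'n \<Rightarrow> complex^'n^'n" where
  "complex_hessian f w = (\<chi> i j. Dz i (Dzbar j (\<lambda>w. complex_of_real (f w))) w)"

definition metric_potential ::
  "('i, 'm) herm_line_bundle \<Rightarrow> 'i \<Rightarrow> 'm set \<Rightarrow> ('m \<Rightarrow> complex^'n::finite)
    \<Rightarrow> complex^'n \<Rightarrow> real" where
  "metric_potential L i U \<kappa> w = - ln (lb_met L i (inv_into U \<kappa> w))"

definition positive_line_bundle ::
  "('m::t2_space, 'n::finite) atlas \<Rightarrow> ('i, 'm) herm_line_bundle \<Rightarrow> bool" where
  "positive_line_bundle A L \<longleftrightarrow>
     (\<forall>(U, \<kappa>)\<in>A. \<forall>i\<in>lb_index L. \<forall>w\<in>\<kappa> ` (U \<inter> lb_dom L i). \<forall>v. v \<noteq> 0 \<longrightarrow>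
        Re (\<Sum>j\<in>UNIV. \<Sum>l\<in>UNIV.
              complex_hessian (metric_potential L i U \<kappa>) w $ j $ l * v $ j * cnj (v $ l)) > 0)"

text \<open>
  The measure of the volume form \<open>\<omega>\<^sup>n/n!\<close>: since \<open>(\<i>/2) dz \<and> d(cnj z)\<close> is Lebesgue measure on
  \<open>\<complex>\<close>, its density in a chart is the determinant of the complex Hessian of \<open>- log h\<close>.
\<close>

definition kaehler_volume ::
  "('m::t2_space, 'n::finite) atlas \<Rightarrow> ('i, 'm) herm_line_bundle \<Rightarrow> 'm measure \<Rightarrow> bool" where
  "kaehler_volume A L \<mu> \<longleftrightarrow>
     sets \<mu> = sets borel \<and>
     (\<forall>(U, \<kappa>)\<in>A. \<forall>i\<in>lb_index L. \<forall>B\<in>sets borel. B \<subseteq> U \<inter> lb_dom L i \<longrightarrow>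
        emeasure \<mu> B =
          (\<integral>\<^sup>+ w\<in>\<kappa> ` B. ennreal (Re (det (complex_hessian (metric_potential L i U \<kappa>) w))) \<partial>lborel))"

section \<open>Bergman kernels\<close>

definition lb_at :: "('i, 'm) herm_line_bundle \<Rightarrow> 'm \<Rightarrow> 'i" where
  "lb_at L x = (SOME i. i \<in> lb_index L \<and> x \<in> lb_dom L i)"

definition lb_section ::
  "('i, 'm) herm_line_bundle \<Rightarrow> nat \<Rightarrow> ('i \<Rightarrow> 'm \<Rightarrow> complex) \<Rightarrow> bool" where
  "lb_section L k s \<longleftrightarrow>
     (\<forall>i\<in>lb_index L. \<forall>j\<in>lb_index L. \<forall>x\<in>lb_dom L i \<inter> lb_dom L j.
        s i x = lb_trans L i j x ^ k * s j x)"

definition fibre_inner ::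
  "('i, 'm) herm_line_bundle \<Rightarrow> nat \<Rightarrow> ('i \<Rightarrow> 'm \<Rightarrow> complex) \<Rightarrow> ('i \<Rightarrow> 'm \<Rightarrow> complex)
    \<Rightarrow> 'm \<Rightarrow> complex" where
  "fibre_inner L k s t x =
     (let i = lb_at L x in s i x * cnj (t i x) * of_real (lb_met L i x ^ k))"

definition L2_section ::
  "('i, 'm::t2_space) herm_line_bundle \<Rightarrow> 'm measure \<Rightarrow> nat \<Rightarrow> ('i \<Rightarrow> 'm \<Rightarrow> complex) \<Rightarrow> bool" where
  "L2_section L \<mu> k s \<longleftrightarrow>
     lb_section L k s \<and>
     (\<forall>i\<in>lb_index L. s i \<in> borel_measurable (restrict_space borel (lb_dom L i))) \<and>
     integrable \<mu> (fibre_inner L k s s)"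

definition holomorphic_section ::
  "('m::t2_space, 'n::finite) atlas \<Rightarrow> ('i, 'm) herm_line_bundle \<Rightarrow> nat
    \<Rightarrow> ('i \<Rightarrow> 'm \<Rightarrow> complex) \<Rightarrow> bool" where
  "holomorphic_section A L k s \<longleftrightarrow>
     lb_section L k s \<and> (\<forall>i\<in>lb_index L. mfd_holomorphic_on A (lb_dom L i) (s i))"

text \<open>
  A kernel \<open>K\<close> has components \<open>K\<^sub>i\<^sub>j(x,y)\<close> in the frames \<open>e\<^sub>i\<^sup>k(x) \<otimes> cnj (e\<^sub>j\<^sup>k(y))\<close> and acts on
  sections by \<open>u \<mapsto> \<integral> K(x,y) \<cdot> u(y) h\<^sup>k(y) d\<mu>(y)\<close>.
\<close>

definition kernel_apply ::
  "('i, 'm) herm_line_bundle \<Rightarrow> 'm measure \<Rightarrow> nat \<Rightarrow> ('i \<Rightarrow> 'i \<Rightarrow> 'm \<Rightarrow> 'm \<Rightarrow> complex)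
    \<Rightarrow> ('i \<Rightarrow> 'm \<Rightarrow> complex) \<Rightarrow> 'i \<Rightarrow> 'm \<Rightarrow> complex" where
  "kernel_apply L \<mu> k K u i x =
     (\<integral>y. (let j = lb_at L y in K i j x y * u j y * of_real (lb_met L j y ^ k)) \<partial>\<mu>)"

text \<open>
  The continuity requirement selects the smooth representative, so that the values of the kernel
  on the diagonal make sense.
\<close>

definition bergman_kernel ::
  "('m::t2_space, 'n::finite) atlas \<Rightarrow> ('i, 'm) herm_line_bundle \<Rightarrow> 'm measure \<Rightarrow> nat
    \<Rightarrow> ('i \<Rightarrow> 'i \<Rightarrow> 'm \<Rightarrow> 'm \<Rightarrow> complex) \<Rightarrow> bool" where
  "bergman_kernel A L \<mu> k K \<longleftrightarrow>
     (\<forall>i\<in>lb_index L. \<forall>j\<in>lb_index L.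
        continuous_on (lb_dom L i \<times> lb_dom L j) (\<lambda>(x, y). K i j x y)) \<and>
     (\<forall>i\<in>lb_index L. \<forall>i'\<in>lb_index L. \<forall>j\<in>lb_index L. \<forall>j'\<in>lb_index L.
        \<forall>x\<in>lb_dom L i \<inter> lb_dom L i'. \<forall>y\<in>lb_dom L j \<inter> lb_dom L j'.
          K i j x y = lb_trans L i i' x ^ k * cnj (lb_trans L j j' y ^ k) * K i' j' x y) \<and>
     (\<forall>u. L2_section L \<mu> k u \<longrightarrow>
        holomorphic_section A L k (kernel_apply L \<mu> k K u) \<and>
        (\<forall>s. holomorphic_section A L k s \<longrightarrow>
           (\<integral>x. fibre_inner L k (\<lambda>i x. u i x - kernel_apply L \<mu> k K u i x) s x \<partial>\<mu>) = 0))"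

text \<open>
  A holomorphic frame \<open>e\<^sub>L = \<sigma>\<^sub>i e\<^sub>i\<close> on \<open>V\<close>, given by its components, and the condition
  \<open>|e\<^sub>L|\<^sup>2\<^sub>h = e\<^sup>-\<^sup>\<phi>\<close>, where \<open>\<phi>\<close> is regarded as a function of the coordinates \<open>\<kappa>\<close>.
\<close>

definition holomorphic_frame ::
  "('m::t2_space, 'n::finite) atlas \<Rightarrow> ('i, 'm) herm_line_bundle \<Rightarrow> 'm set
    \<Rightarrow> ('i \<Rightarrow> 'm \<Rightarrow> complex) \<Rightarrow> bool" where
  "holomorphic_frame A L V \<sigma> \<longleftrightarrow>
     (\<forall>i\<in>lb_index L. mfd_holomorphic_on A (V \<inter> lb_dom L i) (\<sigma> i) \<and>
        (\<forall>x\<in>V \<inter> lb_dom L i. \<sigma> i x \<noteq> 0)) \<and>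
     (\<forall>i\<in>lb_index L. \<forall>j\<in>lb_index L. \<forall>x\<in>V \<inter> lb_dom L i \<inter> lb_dom L j.
        \<sigma> i x = lb_trans L i j x * \<sigma> j x)"

definition local_potential ::
  "('i, 'm) herm_line_bundle \<Rightarrow> 'm set \<Rightarrow> ('m \<Rightarrow> complex^'n::finite) \<Rightarrow> ('i \<Rightarrow> 'm \<Rightarrow> complex)
    \<Rightarrow> (complex^'n \<Rightarrow> real) \<Rightarrow> bool" where
  "local_potential L V \<kappa> \<sigma> \<phi> \<longleftrightarrow>
     (\<forall>i\<in>lb_index L. \<forall>x\<in>V \<inter> lb_dom L i. (cmod (\<sigma> i x))\<^sup>2 * lb_met L i x = exp (- \<phi> (\<kappa> x)))"

definition kernel_in_frame ::
  "('i, 'm) herm_line_bundle \<Rightarrow> nat \<Rightarrow> ('i \<Rightarrow> 'm \<Rightarrow> complex) \<Rightarrow> ('i \<Rightarrow> 'i \<Rightarrow> 'm \<Rightarrow> 'm \<Rightarrow> complex)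
    \<Rightarrow> 'm \<Rightarrow> 'm \<Rightarrow> complex" where
  "kernel_in_frame L k \<sigma> K x y =
     (let i = lb_at L x; j = lb_at L y in K i j x y / (\<sigma> i x ^ k * cnj (\<sigma> j y ^ k)))"

text \<open>
  \<open>\<B> m\<close> are the coefficients of
  \<open>K\<^sub>k(x,x) e\<^sup>-\<^sup>k\<^sup>\<phi>\<^sup>(\<^sup>x\<^sup>) \<sim> k\<^sup>n/\<pi>\<^sup>n \<Sum>\<^sub>m b\<^sub>m(x, cnj x) k\<^sup>-\<^sup>m\<close> on \<open>V\<close>, in the coordinates \<open>\<kappa>\<close>.  The expansion is
  required pointwise, which already determines the coefficients.
\<close>

definition bergman_coefficients ::
  "('i, 'm) herm_line_bundle \<Rightarrow> 'm set \<Rightarrow> ('m \<Rightarrow> complex^'n::finite) \<Rightarrow> ('i \<Rightarrow> 'm \<Rightarrow> complex)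
    \<Rightarrow> (complex^'n \<Rightarrow> real) \<Rightarrow> (nat \<Rightarrow> 'i \<Rightarrow> 'i \<Rightarrow> 'm \<Rightarrow> 'm \<Rightarrow> complex)
    \<Rightarrow> (nat \<Rightarrow> complex^'n \<Rightarrow> complex) \<Rightarrow> bool" where
  "bergman_coefficients L V \<kappa> \<sigma> \<phi> K \<B> \<longleftrightarrow>
     (\<forall>x\<in>V. \<forall>N.
        (\<lambda>k. cmod (kernel_in_frame L k \<sigma> (K k) x x * of_real (exp (- (real k * \<phi> (\<kappa> x))))
               - of_real ((real k / pi) ^ CARD('n))
                 * (\<Sum>m<N. \<B> m (\<kappa> x) * of_real (inverse (real k ^ m)))))
          \<in> O(\<lambda>k. real k ^ CARD('n) / real k ^ N))"

section \<open>The recursion for the extended coefficients\<close>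

definition theta ::
  "(complex^'n::finite \<Rightarrow> complex^'n \<Rightarrow> complex) \<Rightarrow> complex^'n \<Rightarrow> complex^'n \<Rightarrow> complex^'n
    \<Rightarrow> complex^'n" where
  "theta \<psi> x y z =
     (\<chi> i. integral {0..1} (\<lambda>t. Dz i (\<lambda>x'. \<psi> x' z) (t *\<^sub>R x + (1 - t) *\<^sub>R y)))"

definition theta_map ::
  "(complex^'n::finite \<Rightarrow> complex^'n \<Rightarrow> complex)
    \<Rightarrow> (complex^'n) \<times> (complex^'n) \<times> (complex^'n)
    \<Rightarrow> (complex^'n) \<times> (complex^'n) \<times> (complex^'n)" where
  "theta_map \<psi> = (\<lambda>(x, y, z). (x, y, theta \<psi> x y z))"

text \<open>
  \<open>z(x,y,\<theta>)\<close>, the third component of the inverse of \<open>theta_map \<psi>\<close> on \<open>W\<close>.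
\<close>

definition theta_inv ::
  "(complex^'n::finite \<Rightarrow> complex^'n \<Rightarrow> complex)
    \<Rightarrow> ((complex^'n) \<times> (complex^'n) \<times> (complex^'n)) set
    \<Rightarrow> complex^'n \<Rightarrow> complex^'n \<Rightarrow> complex^'n \<Rightarrow> complex^'n" where
  "theta_inv \<psi> W x y \<theta> = snd (snd (inv_into W (theta_map \<psi>) (x, y, \<theta>)))"

definition Delta0 ::
  "(complex^'n::finite \<Rightarrow> complex^'n \<Rightarrow> complex) \<Rightarrow> complex^'n \<Rightarrow> complex^'n \<Rightarrow> complex^'n
    \<Rightarrow> complex" where
  "Delta0 \<psi> x y z =
     det (\<chi> i j. Dz j (\<lambda>z'. Dz i (\<lambda>y'. \<psi> y' z') y) z)
     / det (\<chi> i j. Dz j (\<lambda>z'. theta \<psi> x y z' $ i) z)"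

definition Dy_Dtheta ::
  "(complex^'n::finite \<Rightarrow> complex^'n \<Rightarrow> complex) \<Rightarrow> complex^'n \<Rightarrow> complex^'n \<Rightarrow> complex" where
  "Dy_Dtheta G y \<theta> = (\<Sum>i\<in>UNIV. Dz i (\<lambda>y'. Dz i (\<lambda>\<theta>'. G y' \<theta>') \<theta>) y)"

text \<open>
  The recursion is stated at the points \<open>\<theta> = \<theta>(x,x,z)\<close>, for which \<open>z(x,x,\<theta>) = z\<close>.
\<close>

definition bergman_recursion ::
  "(complex^'n::finite \<Rightarrow> complex^'n \<Rightarrow> complex) \<Rightarrow> (complex^'n) set
    \<Rightarrow> (nat \<Rightarrow> complex^'n \<Rightarrow> complex^'n \<Rightarrow> complex) \<Rightarrow> bool" where
  "bergman_recursion \<psi> B bm \<longleftrightarrow>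
     (\<forall>x\<in>B. \<forall>z\<in>B. bm 0 x z = 1) \<and>
     (\<forall>m\<ge>1. \<forall>x\<in>B. \<forall>z\<in>B.
        bm m x z =
          - (\<Sum>l=1..m.
               (Dy_Dtheta ^^ l)
                 (\<lambda>y \<theta>. bm (m - l) x (theta_inv \<psi> (B \<times> B \<times> B) x y \<theta>)
                        * Delta0 \<psi> x y (theta_inv \<psi> (B \<times> B \<times> B) x y \<theta>))
                 x (theta \<psi> x x z)
               / fact l))"

section \<open>The estimates\<close>

definition joint :: "(complex^'n \<Rightarrow> complex^'n \<Rightarrow> complex) \<Rightarrow> complex^('n + 'n) \<Rightarrow> complex" where
  "joint f v = f (\<chi> i. v $ Inl i) (\<chi> i. v $ Inr i)"

definition pair_vec :: "complex^'n \<Rightarrow> complex^'n \<Rightarrow> complex^('n + 'n)" where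
  "pair_vec x z = (\<chi> i. case i of Inl j \<Rightarrow> x $ j | Inr j \<Rightarrow> z $ j)"

text \<open>
  \<open>exp(-b (1 - \<delta>\<^sub>0(l)) |x - cnj z|\<^sup>-\<^sup>1\<^sup>/\<^sup>(\<^sup>a\<^sup>-\<^sup>1\<^sup>))\<close>, where the exponential is read as \<open>0\<close> at
  \<open>x = cnj z\<close> when \<open>l \<noteq> 0\<close> (note that \<open>0 powr s = 0\<close> in HOL).
\<close>

definition flat_factor :: "real \<Rightarrow> real \<Rightarrow> nat \<Rightarrow> complex^'n::finite \<Rightarrow> complex^'n \<Rightarrow> real" where
  "flat_factor a b l x z =
     (if l = 0 then 1
      else if x = cnjv z then 0
      else exp (- b * norm (x - cnjv z) powr (- 1 / (a - 1))))"

definition coefficient_estimates ::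
  "real \<Rightarrow> real \<Rightarrow> real \<Rightarrow> real \<Rightarrow> ((complex^'n::finite) \<times> (complex^'n)) set
    \<Rightarrow> (nat \<Rightarrow> complex^'n \<Rightarrow> complex^'n \<Rightarrow> complex) \<Rightarrow> bool" where
  "coefficient_estimates a \<epsilon> b C S bm \<longleftrightarrow>
     (\<forall>m. \<forall>(x, z)\<in>S. cmod (bm m x z) \<le> C ^ m * (fact m) powr (2 * a + 2 * \<epsilon>)) \<and>
     (\<forall>m \<alpha> \<beta>. \<forall>(x, z)\<in>S.
        cmod (DD \<alpha> \<beta> (joint (bm m)) (pair_vec x z))
          \<le> C ^ (m + mi_abs \<alpha> + mi_abs \<beta>) * (fact m) powr (2 * a + 2 * \<epsilon>)
             * mi_fact \<alpha> powr (a + \<epsilon>) * mi_fact \<beta> powr (a + \<epsilon>)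
             * flat_factor a b (mi_abs \<beta>) x z)"

end

theory Submission
  imports Defs
begin

text \<open>
  \<^emph>\<open>Extension.\<close>  \<open>\<psi>\<close> is a sum over \<open>k\<close> of the degree \<open>k\<close> part of the Taylor series times a
  cut-off.  Where the cut-off of degree \<open>k\<close> does not vanish, all derivatives of this term are
  \<open>O(q\<^sup>k)\<close> with a fixed \<open>q < 1\<close> and with Gevrey constants independent of \<open>k\<close>.  An antiholomorphic
  derivative of a Taylor polynomial of degree \<open>N\<close> telescopes to a single term of degree \<open>N\<close>;
  taking \<open>N\<close> maximal such that the cut-off equals \<open>1\<close> up to degree \<open>N\<close> gives
  \<open>O(q\<^sup>N) = O(exp (-b |x - cnj z| powr (-1/(a-1))))\<close>.

  \<^emph>\<open>Recursion.\<close>  In the coordinates \<open>(x, t, z)\<close> with \<open>t = y - x\<close> the derivatives with respect to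
  \<open>\<theta>\<^sub>i\<close> and \<open>y\<^sub>i\<close> are vector fields with Gevrey coefficients, so no estimate for compositions or for
  the inverse map is needed.  A function whose derivatives of order \<open>j\<close> at a point are bounded by
  \<open>M R\<^sup>j (k+j)!\<^sup>s\<close> is mapped by such a field to one with \<open>(k + 1, c M)\<close> in place of \<open>(k, M)\<close> and the
  same \<open>R\<close>; hence \<open>b\<^sub>m\<close> satisfies these bounds with \<open>k = 2m\<close> and \<open>M = A\<^sup>m\<close>.
\<close>

text \<open>Derivatives are indexed by words in the letters d/dz_j and d/d(cnj z_j), and all bounds
  are pointwise on a set S of points, not sup norms on open sets. Hence one argument serves twice:
  with order a + \<epsilon> on a full neighbourhood, and with order a on the points z = cnj x alone,
  where each cut-off equals 1 nearby and no \<epsilon> is lost. The flat factor is carried as a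
  weight w with values in [0, 1], attached to words with an antiholomorphic letter. Since w * w
  \<le> w, it passes through products, reciprocals and determinants; at z = cnj x it is 0. The
  obstacle is that \<psi> is only almost holomorphic, so z(x,y,\<theta>) is not holomorphic in
  \<theta>: its derivatives and those of its conjugate satisfy a coupled linear system. The coupling
  blocks are flat, and a Schur complement shows that the solution is again almost holomorphic,
  although conjugates enter. The exponent 2a + 2\<epsilon> is the order a + \<epsilon> applied to
  (2m)!. The constant b comes from the decay ratio of the layers and the argument of the cut-off,
  hence from a and C1 only.\<close>

declare split_paired_All [simp del] split_paired_Ex [simp del]

section \<open>Wirtinger derivatives\<close>

text \<open>A letter \<open>(j, b)\<close> is a direction with a flag, \<open>b\<close> marking the
  antiholomorphic derivative. Words of letters replace pairs of multi-indices, so that the Leibniz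
  rule and all estimates run by induction on lists; different orders of differentiation are
  identified by \<open>dops_perm\<close>.\<close>

definition dop :: "'k::finite \<times> bool \<Rightarrow> (complex^'k \<Rightarrow> complex) \<Rightarrow> complex^'k \<Rightarrow> complex" where
  "dop d = (if snd d then Dzbar (fst d) else Dz (fst d))"

text \<open>The head of a word is applied last. Appending a letter at the end therefore means
  differentiating the function first, which is how \<open>gev_dop\<close> and \<open>jet_dop\<close>
  pass from \<open>u\<close> to \<open>dop d u\<close>.\<close>

primrec dops :: "('k::finite \<times> bool) list \<Rightarrow> (complex^'k \<Rightarrow> complex) \<Rightarrow> complex^'k \<Rightarrow> complex" where
  "dops [] f = f"
| "dops (d # ds) f = dop d (dops ds f)"

lemma dops_append: "dops (a @ b) f = dops a (dops b f)"
  by (induction a) auto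

text \<open>\<open>frechet_derivative\<close> is a choice that depends only on the predicate
  \<open>has_derivative\<close> at the point, and the two functions share this predicate. This
  covers points without a derivative as well.\<close>

lemma frechet_derivative_cong_open:
  assumes "open S" "w \<in> S" "\<And>x. x \<in> S \<Longrightarrow> f x = g x"
  shows "frechet_derivative f (at w) = frechet_derivative g (at w)"
proof -
  have "(f has_derivative D) (at w) \<longleftrightarrow> (g has_derivative D) (at w)" for D
    using has_derivative_transform_within_open[OF _ assms(1,2), of f D UNIV g]
      has_derivative_transform_within_open[OF _ assms(1,2), of g D UNIV f] assms(3) by auto
  then show ?thesis unfolding frechet_derivative_def by simp
qed

lemma dop_cong_open:
  assumes "open S" "w \<in> S" "\<And>x. x \<in> S \<Longrightarrow> f x = g x"
  shows "dop d f w = dop d g w"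
  using frechet_derivative_cong_open[OF assms] by (simp add: dop_def Dz_def Dzbar_def)

lemma dops_cong_open:
  assumes "open S" "w \<in> S" "\<And>x. x \<in> S \<Longrightarrow> f x = g x"
  shows "dops ds f w = dops ds g w"
  using assms(2)
proof (induction ds arbitrary: w)
  case (Cons d ds)
  then show ?case using dop_cong_open[OF assms(1) Cons(2), of "dops ds f" "dops ds g" d] by simp
qed (use assms in auto)

lemma dop_has_derivative:
  assumes "(f has_derivative f') (at w)"
  shows "dop d f w = (f' (axis (fst d) 1) + (if snd d then \<i> else -\<i>) * f' (axis (fst d) \<i>)) / 2"
  using frechet_derivative_at[OF assms] by (simp add: dop_def Dz_def Dzbar_def)

lemma vec_complex_expand:
  fixes v :: "complex^'k::finite"
  shows "v = (\<Sum>i\<in>UNIV. Re (v$i) *\<^sub>R axis i 1 + Im (v$i) *\<^sub>R axis i \<i>)"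
proof -
  have "(\<Sum>i\<in>UNIV. Re (v$i) *\<^sub>R axis i 1 + Im (v$i) *\<^sub>R axis i \<i>) $ j = v $ j" for j
  proof -
    have "(\<Sum>i\<in>UNIV. Re (v$i) *\<^sub>R axis i 1 + Im (v$i) *\<^sub>R axis i \<i>) $ j
        = (\<Sum>i\<in>UNIV. if i = j then v $ j else (0::complex))"
      unfolding sum_component by (rule sum.cong) (auto simp: axis_def complex_eq_iff)
    then show ?thesis by simp
  qed
  then show ?thesis by (simp add: vec_eq_iff)
qed

lemma has_derivative_Wirtinger:
  assumes "(f has_derivative f') (at w)"
  shows "f' v = (\<Sum>i\<in>UNIV. v $ i * dop (i,False) f w + cnj (v $ i) * dop (i,True) f w)"
proof -
  interpret bounded_linear f' using assms by (rule has_derivative_bounded_linear)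
  have "f' v = (\<Sum>i\<in>UNIV. Re (v$i) *\<^sub>R f' (axis i 1) + Im (v$i) *\<^sub>R f' (axis i \<i>))"
    by (subst vec_complex_expand) (simp add: sum add scaleR)
  also have "\<dots> = (\<Sum>i\<in>UNIV. v $ i * dop (i,False) f w + cnj (v $ i) * dop (i,True) f w)"
  proof (rule sum.cong)
    fix i
    have v: "v $ i = of_real (Re (v$i)) + \<i> * of_real (Im (v$i))"
        "cnj (v $ i) = of_real (Re (v$i)) - \<i> * of_real (Im (v$i))"
      by (auto simp: complex_eq_iff)
    show "Re (v$i) *\<^sub>R f' (axis i 1) + Im (v$i) *\<^sub>R f' (axis i \<i>)
        = v $ i * dop (i,False) f w + cnj (v $ i) * dop (i,True) f w"
      unfolding dop_has_derivative[OF assms] scaleR_conv_of_real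
      by (subst v(2), subst (3) v(1)) (simp add: field_simps)
  qed simp
  finally show ?thesis .
qed

text \<open>Converse of \<open>has_derivative_Wirtinger\<close>: the coefficients of
  \<open>h $ i\<close> and of its conjugate are the Wirtinger derivatives. Series and integrals are
  differentiated in this form.\<close>

lemma dop_Wirtinger_form:
  assumes "(f has_derivative (\<lambda>h. \<Sum>i\<in>UNIV. h $ i * A i + cnj (h $ i) * B i)) (at (w :: complex^'k::finite))"
  shows "dop d f w = (if snd d then B (fst d) else A (fst d))"
proof -
  have ax: "(\<Sum>i\<in>UNIV. (axis j c :: complex^'k) $ i * A i + cnj ((axis j c :: complex^'k) $ i) * B i) = c * A j + cnj c * B j"
    for j c
  proof -
    have "(\<Sum>i\<in>UNIV. (axis j c :: complex^'k) $ i * A i + cnj ((axis j c :: complex^'k) $ i) * B i)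
        = (\<Sum>i\<in>UNIV. if i = j then c * A j + cnj c * B j else 0)"
      by (rule sum.cong) (auto simp: axis_def)
    then show ?thesis by simp
  qed
  show ?thesis unfolding dop_has_derivative[OF assms] ax by (cases d) (auto simp: field_simps)
qed

lemma dop_const [simp]: "dop d (\<lambda>_. c) = (\<lambda>_. 0)"
  by (rule ext) (simp add: dop_has_derivative[OF has_derivative_const])

lemma dop_add:
  assumes "u differentiable (at w)" "v differentiable (at w)"
  shows "dop d (\<lambda>x. u x + v x) w = dop d u w + dop d v w"
proof -
  obtain u' v' where "(u has_derivative u') (at w)" "(v has_derivative v') (at w)"
    using assms by (auto simp: differentiable_def)
  note h = this
  show ?thesis unfolding dop_has_derivative[OF h(1)] dop_has_derivative[OF h(2)]
      dop_has_derivative[OF has_derivative_add[OF h]] by (simp add: field_simps)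
qed

lemma dop_mult:
  assumes "u differentiable (at w)" "v differentiable (at w)"
  shows "dop d (\<lambda>x. u x * v x) w = dop d u w * v w + u w * dop d v w"
proof -
  obtain u' v' where "(u has_derivative u') (at w)" "(v has_derivative v') (at w)"
    using assms by (auto simp: differentiable_def)
  note h = this
  show ?thesis unfolding dop_has_derivative[OF h(1)] dop_has_derivative[OF h(2)]
      dop_has_derivative[OF has_derivative_mult[OF h]] by (simp add: field_simps)
qed

lemma dop_cmult:
  assumes "u differentiable (at w)"
  shows "dop d (\<lambda>x. c * u x) w = c * dop d u w"
  using dop_mult[of "\<lambda>_. c" w u d] assms by simp

lemma dop_sum:
  assumes "\<And>i. i \<in> I \<Longrightarrow> u i differentiable (at w)"
  shows "dop d (\<lambda>x. \<Sum>i\<in>I. u i x) w = (\<Sum>i\<in>I. dop d (u i) w)"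
  using assms
proof (induction I rule: infinite_finite_induct)
  case (insert i I)
  have "dop d (\<lambda>x. \<Sum>i\<in>insert i I. u i x) w = dop d (\<lambda>x. u i x + (\<Sum>i\<in>I. u i x)) w"
    using insert(1,2) by simp
  also have "\<dots> = dop d (u i) w + dop d (\<lambda>x. \<Sum>i\<in>I. u i x) w"
    by (rule dop_add) (use insert(1,4) in \<open>auto intro!: differentiable_sum\<close>)
  finally show ?case using insert by simp
qed auto

lemma differentiable_cnj:
  assumes "u differentiable (at w)"
  shows "(\<lambda>x. cnj (u x)) differentiable (at w)"
  using assms has_derivative_cnj unfolding differentiable_def by fast

lemma dop_cnj:
  assumes "u differentiable (at w)"
  shows "dop d (\<lambda>x. cnj (u x)) w = cnj (dop (fst d, \<not> snd d) u w)"
proof -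
  obtain u' where h: "(u has_derivative u') (at w)"
    using assms by (auto simp: differentiable_def)
  show ?thesis unfolding dop_has_derivative[OF h] dop_has_derivative[OF has_derivative_cnj[OF h]]
    by simp
qed

lemma has_derivative_coord: "((\<lambda>x. x $ i) has_derivative (\<lambda>x. x $ i)) (at w)"
  using bounded_linear_imp_has_derivative[OF bounded_linear_vec_nth] by auto

lemma differentiable_coord: "(\<lambda>x. x $ i) differentiable (at w)"
  using has_derivative_coord unfolding differentiable_def by blast

lemma dop_coord: "dop d (\<lambda>x. x $ i) = (\<lambda>_. if d = (i, False) then 1 else 0)"
  by (rule ext, cases d) (simp add: dop_has_derivative[OF has_derivative_coord] axis_def)

lemma dop_cnj_coord: "dop d (\<lambda>x. cnj (x $ i)) = (\<lambda>_. if d = (i, True) then 1 else 0)"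
  by (rule ext, cases d) (simp add: dop_cnj differentiable_coord dop_coord)

lemma differentiable_componentwise:
  fixes h :: "'a::real_normed_vector \<Rightarrow> complex^'l::finite"
  assumes "\<And>i. (\<lambda>x. h x $ i) differentiable (at w)"
  shows "h differentiable (at w)"
proof -
  obtain h' where h': "\<And>i. ((\<lambda>x. h x $ i) has_derivative h' i) (at w)"
    using assms unfolding differentiable_def by metis
  have "((\<lambda>x. \<Sum>i\<in>UNIV. Re (h x $ i) *\<^sub>R axis i 1 + Im (h x $ i) *\<^sub>R axis i \<i>) has_derivative
      (\<lambda>x. \<Sum>i\<in>UNIV. Re (h' i x) *\<^sub>R axis i 1 + Im (h' i x) *\<^sub>R axis i \<i>)) (at w)"
    by (intro has_derivative_sum has_derivative_add has_derivative_scaleR_left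
        has_derivative_Re has_derivative_Im h')
  then show ?thesis unfolding vec_complex_expand[symmetric] by (auto simp: differentiable_def)
qed

lemma differentiable_coord_comp:
  fixes h :: "'a::real_normed_vector \<Rightarrow> complex^'l::finite"
  assumes "h differentiable (at w)"
  shows "(\<lambda>x. h x $ i) differentiable (at w)"
  using differentiable_chain_at[OF assms differentiable_coord] by (simp add: o_def)

lemma dop_chain:
  fixes h :: "complex^'k::finite \<Rightarrow> complex^'l::finite"
  assumes f: "f differentiable (at (h w))" and h: "h differentiable (at w)"
  shows "dop d (\<lambda>x. f (h x)) w = (\<Sum>i\<in>UNIV. dop (i,False) f (h w) * dop d (\<lambda>x. h x $ i) w
      + dop (i,True) f (h w) * dop d (\<lambda>x. cnj (h x $ i)) w)"
proof -
  obtain f' h' where f': "(f has_derivative f') (at (h w))" and h': "(h has_derivative h') (at w)"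
    using assms by (auto simp: differentiable_def)
  have c: "((\<lambda>x. h x $ i) has_derivative (\<lambda>x. h' x $ i)) (at w)" for i
    using has_derivative_compose[OF h' has_derivative_coord] .
  have comp: "((\<lambda>x. f (h x)) has_derivative (\<lambda>x. f' (h' x))) (at w)"
    using has_derivative_compose[OF h' f'] .
  show ?thesis
    unfolding dop_has_derivative[OF comp] dop_has_derivative[OF c]
      dop_has_derivative[OF has_derivative_cnj[OF c]] has_derivative_Wirtinger[OF f']
    by (simp add: sum_divide_distrib sum_distrib_left sum.distrib[symmetric])
       (auto intro!: sum.cong simp: field_simps)
qed

text \<open>Smoothness up to order n measured by Wirtinger derivatives instead of the Frechet
  derivatives in \<open>Ck_on\<close>. Closure under \<open>dop\<close> is built in, and closure
  under an algebraic operation is an induction on n that uses only the rule for a single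
  \<open>dop\<close>.\<close>

primrec smk :: "nat \<Rightarrow> (complex^'k::finite) set \<Rightarrow> (complex^'k \<Rightarrow> complex) \<Rightarrow> bool" where
  "smk 0 S f \<longleftrightarrow> (\<forall>x\<in>S. f differentiable (at x))"
| "smk (Suc n) S f \<longleftrightarrow> (\<forall>x\<in>S. f differentiable (at x)) \<and> (\<forall>d. smk n S (dop d f))"

definition sm :: "(complex^'k::finite) set \<Rightarrow> (complex^'k \<Rightarrow> complex) \<Rightarrow> bool" where
  "sm S f \<longleftrightarrow> (\<forall>n. smk n S f)"

lemma smk_differentiable: "smk n S f \<Longrightarrow> x \<in> S \<Longrightarrow> f differentiable (at x)"
  by (cases n) auto

lemma smk_Suc_imp: "smk (Suc n) S f \<Longrightarrow> smk n S f"
  by (induction n arbitrary: f) auto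

lemma differentiable_cong_open:
  assumes "open S" "w \<in> S" "\<And>x. x \<in> S \<Longrightarrow> f x = g x" "f differentiable (at w)"
  shows "g differentiable (at w)"
  using assms has_derivative_transform_within_open[OF _ assms(1,2), of f _ UNIV g]
  unfolding differentiable_def by blast

lemma smk_cong:
  assumes "open S" "\<And>x. x \<in> S \<Longrightarrow> f x = g x" "smk n S f"
  shows "smk n S g"
  using assms(2,3)
proof (induction n arbitrary: f g)
  case 0
  then show ?case using differentiable_cong_open[OF assms(1)] by (metis smk.simps(1))
next
  case (Suc n)
  have "smk n S (dop d g)" for d
  proof (rule Suc.IH)
    show "smk n S (dop d f)" using Suc.prems(2) unfolding smk.simps by blast
    show "dop d f x = dop d g x" if "x \<in> S" for x
      by (rule dop_cong_open[OF assms(1) that Suc.prems(1)])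
  qed
  then show ?case using Suc.prems differentiable_cong_open[OF assms(1)]
    by (metis smk.simps(2))
qed

lemma smk_const: "smk n S (\<lambda>_. c)"
  by (induction n arbitrary: c) auto

lemma smk_coord: "smk n S (\<lambda>x. x $ i)"
  by (cases n) (auto simp: dop_coord smk_const differentiable_coord)

lemma smk_add:
  assumes "open S" "smk n S u" "smk n S v"
  shows "smk n S (\<lambda>x. u x + v x)"
  using assms(2,3)
proof (induction n arbitrary: u v)
  case (Suc n)
  have "smk n S (dop d (\<lambda>x. u x + v x))" for d
    by (rule smk_cong[OF assms(1) _ Suc.IH[of "dop d u" "dop d v"]]) (use Suc.prems in \<open>auto simp: dop_add\<close>)
  then show ?case using Suc.prems by (auto intro!: differentiable_add)
qed (auto intro!: differentiable_add)

lemma smk_mult: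
  assumes "open S" "smk n S u" "smk n S v"
  shows "smk n S (\<lambda>x. u x * v x)"
  using assms(2,3)
proof (induction n arbitrary: u v)
  case (Suc n)
  note s = smk_Suc_imp[OF Suc.prems(1)] smk_Suc_imp[OF Suc.prems(2)]
  have "smk n S (dop d (\<lambda>x. u x * v x))" for d
    by (rule smk_cong[OF assms(1) _ smk_add[OF assms(1) Suc.IH[of "dop d u" v] Suc.IH[of u "dop d v"]]])
       (use Suc.prems s in \<open>auto simp: dop_mult\<close>)
  then show ?case using Suc.prems by (auto intro!: differentiable_mult)
qed (auto intro!: differentiable_mult)

lemma smk_sum:
  assumes "open S" "\<And>i. i \<in> I \<Longrightarrow> smk n S (u i)"
  shows "smk n S (\<lambda>x. \<Sum>i\<in>I. u i x)"
  using assms(2) by (induction I rule: infinite_finite_induct) (auto simp: smk_const smk_add[OF assms(1)])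

lemma smk_cnj:
  assumes "open S" "smk n S u"
  shows "smk n S (\<lambda>x. cnj (u x))"
  using assms(2)
proof (induction n arbitrary: u)
  case (Suc n)
  have "smk n S (dop d (\<lambda>x. cnj (u x)))" for d
    by (rule smk_cong[OF assms(1) _ Suc.IH[of "dop (fst d, \<not> snd d) u"]])
       (use Suc.prems in \<open>auto simp: dop_cnj\<close>)
  then show ?case using Suc.prems by (auto intro!: differentiable_cnj)
qed (auto intro!: differentiable_cnj)

lemma smk_compose:
  fixes h :: "complex^'k::finite \<Rightarrow> complex^'l::finite"
  assumes "open S" "smk n T f" "\<And>i. smk n S (\<lambda>x. h x $ i)" "\<And>x. x \<in> S \<Longrightarrow> h x \<in> T"
  shows "smk n S (\<lambda>x. f (h x))"
  using assms(2,3)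
proof (induction n arbitrary: f)
  case 0
  have "h differentiable (at x)" if "x \<in> S" for x
    using 0(2) that by (intro differentiable_componentwise) auto
  then show ?case using 0(1) assms(4) differentiable_chain_at[of h _ f] by (auto simp: o_def)
next
  case (Suc n)
  have hd: "h differentiable (at x)" if "x \<in> S" for x
    using Suc(3) that by (intro differentiable_componentwise) auto
  have "smk n S (dop d (\<lambda>x. f (h x)))" for d
  proof (rule smk_cong[OF assms(1)])
    show "smk n S (\<lambda>w. \<Sum>i\<in>UNIV. dop (i,False) f (h w) * dop d (\<lambda>x. h x $ i) w
      + dop (i,True) f (h w) * dop d (\<lambda>x. cnj (h x $ i)) w)"
    proof (intro smk_sum[OF assms(1)] smk_add[OF assms(1)] smk_mult[OF assms(1)])
      fix i
      have "smk n S (\<lambda>w. dop (i,fl) f (h w))" for fl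
        by (rule Suc.IH) (use Suc(2) smk_Suc_imp[OF Suc(3)] in auto)
      then show "smk n S (\<lambda>w. dop (i,False) f (h w))" "smk n S (\<lambda>w. dop (i,True) f (h w))" by blast+
      show "smk n S (dop d (\<lambda>x. h x $ i))" using Suc(3)[of i] by simp
      show "smk n S (dop d (\<lambda>x. cnj (h x $ i)))" using smk_cnj[OF assms(1) Suc(3), of i] by simp
    qed
  qed (use Suc(2) hd assms(4) in \<open>auto simp: dop_chain\<close>)
  then show ?case using Suc(2) assms(4) hd differentiable_chain_at[of h _ f] by (auto simp: o_def)
qed

lemma smk_inverse:
  assumes "open S" "smk n S u" "\<And>x. x \<in> S \<Longrightarrow> u x \<noteq> 0"
  shows "smk n S (\<lambda>x. inverse (u x))"
proof -
  have df: "(\<lambda>x. inverse (u x)) differentiable (at x)" if "smk n S u" "x \<in> S" for n x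
    using that assms(3) smk_differentiable by (intro differentiable_inverse) blast+
  have dp: "dop d (\<lambda>x. inverse (u x)) w = - dop d u w * (inverse (u w) * inverse (u w))"
    if ud: "u differentiable (at w)" and "w \<in> S" for d w
  proof -
    obtain u' where h: "(u has_derivative u') (at w)"
      using ud by (auto simp: differentiable_def)
    show ?thesis unfolding dop_has_derivative[OF h]
        dop_has_derivative[OF Deriv.has_derivative_inverse[OF assms(3)[OF that(2)] h]]
      using assms(3)[OF that(2)] by (simp add: divide_simps)
  qed
  show ?thesis using assms(2)
  proof (induction n)
    case (Suc n)
    have I: "smk n S (\<lambda>x. inverse (u x))" using Suc.IH smk_Suc_imp[OF Suc.prems] by blast
    have "smk n S (dop d (\<lambda>x. inverse (u x)))" for d
    proof (rule smk_cong[OF assms(1)])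
      show "smk n S (\<lambda>x. (-1) * dop d u x * (inverse (u x) * inverse (u x)))"
        by (intro smk_mult[OF assms(1)] smk_const I) (use Suc.prems in auto)
    qed (use Suc.prems in \<open>auto simp: dp\<close>)
    then show ?case using df[OF Suc.prems] by auto
  next
    case 0
    show ?case using df[OF 0] by simp
  qed
qed

lemma sm_const: "sm S (\<lambda>_. c)" by (simp add: sm_def smk_const)
lemma sm_coord: "sm S (\<lambda>x. x $ i)" by (simp add: sm_def smk_coord)
lemma sm_add: "open S \<Longrightarrow> sm S u \<Longrightarrow> sm S v \<Longrightarrow> sm S (\<lambda>x. u x + v x)" by (simp add: sm_def smk_add)
lemma sm_mult: "open S \<Longrightarrow> sm S u \<Longrightarrow> sm S v \<Longrightarrow> sm S (\<lambda>x. u x * v x)" by (simp add: sm_def smk_mult)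
lemma sm_sum: "open S \<Longrightarrow> (\<And>i. i \<in> I \<Longrightarrow> sm S (u i)) \<Longrightarrow> sm S (\<lambda>x. \<Sum>i\<in>I. u i x)" by (simp add: sm_def smk_sum)
lemma sm_cnj: "open S \<Longrightarrow> sm S u \<Longrightarrow> sm S (\<lambda>x. cnj (u x))" by (simp add: sm_def smk_cnj)
lemma sm_inverse: "open S \<Longrightarrow> sm S u \<Longrightarrow> (\<And>x. x \<in> S \<Longrightarrow> u x \<noteq> 0) \<Longrightarrow> sm S (\<lambda>x. inverse (u x))"
  by (simp add: sm_def smk_inverse)
lemma sm_compose: "open S \<Longrightarrow> sm T f \<Longrightarrow> (\<And>i. sm S (\<lambda>x. h x $ i)) \<Longrightarrow> (\<And>x. x \<in> S \<Longrightarrow> h x \<in> T)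
   \<Longrightarrow> sm S (\<lambda>x. f (h x))"
  unfolding sm_def by (blast intro: smk_compose)
lemma sm_cong: "open S \<Longrightarrow> (\<And>x. x \<in> S \<Longrightarrow> f x = g x) \<Longrightarrow> sm S f \<Longrightarrow> sm S g"
  unfolding sm_def using smk_cong by blast
lemma sm_dop: "sm S f \<Longrightarrow> sm S (dop d f)"
  unfolding sm_def using smk.simps(2) by blast
lemma sm_dops: "sm S f \<Longrightarrow> sm S (dops ds f)"
  by (induction ds) (auto intro: sm_dop)
lemma sm_differentiable: "sm S f \<Longrightarrow> x \<in> S \<Longrightarrow> f differentiable (at x)"
  unfolding sm_def using smk_differentiable by blast
lemma sm_continuous_on: "sm S f \<Longrightarrow> continuous_on S f"
  by (meson continuous_at_imp_continuous_on differentiable_imp_continuous_within sm_differentiable)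
lemma smk_subset: "smk n S f \<Longrightarrow> T \<subseteq> S \<Longrightarrow> smk n T f"
  by (induction n arbitrary: f) auto
lemma sm_subset: "sm S f \<Longrightarrow> T \<subseteq> S \<Longrightarrow> sm T f"
  unfolding sm_def using smk_subset by blast
lemma sm_prod:
  assumes "open S" "\<And>i. i \<in> I \<Longrightarrow> sm S (u i)"
  shows "sm S (\<lambda>x. \<Prod>i\<in>I. u i x)"
  using assms(2) by (induction I rule: infinite_finite_induct) (auto simp: sm_const sm_mult[OF assms(1)])
lemma sm_power: "open S \<Longrightarrow> sm S u \<Longrightarrow> sm S (\<lambda>x. u x ^ n)"
  by (induction n) (auto simp: sm_const sm_mult)

text \<open>For functions whose iterated derivatives have been identified with explicit expressions,
  such as series and integrals, it remains to differentiate these expressions once.\<close>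

lemma sm_I:
  assumes "\<And>ds x. x \<in> S \<Longrightarrow> dops ds f differentiable (at x)"
  shows "sm S f"
proof -
  have "smk n S (dops ds f)" for n ds
  proof (induction n arbitrary: ds)
    case (Suc n)
    then show ?case using assms by (metis dops.simps(2) smk.simps(2))
  qed (use assms in auto)
  from this[of _ "[]"] show ?thesis by (simp add: sm_def)
qed

section \<open>Comparison with \<open>Ck_on\<close>, and symmetry of second derivatives\<close>

lemma Ck_on_cong:
  assumes "open S" "\<And>x. x \<in> S \<Longrightarrow> f x = g x" "Ck_on k S f"
  shows "Ck_on k S g"
  using assms(2,3)
proof (induction k arbitrary: f g)
  case 0
  then show ?case using continuous_on_cong[of S S f g] by simp
next
  case (Suc k)
  have "Ck_on k S (\<lambda>x. frechet_derivative g (at x) v)" for v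
  proof (rule Suc.IH)
    show "Ck_on k S (\<lambda>x. frechet_derivative f (at x) v)" using Suc.prems(2) by simp
    show "frechet_derivative f (at x) v = frechet_derivative g (at x) v" if "x \<in> S" for x
      by (rule arg_cong[where f="\<lambda>F. F v", OF frechet_derivative_cong_open[OF assms(1) that Suc.prems(1)]])
  qed
  moreover have "g differentiable at x" if "x \<in> S" for x
    by (rule differentiable_cong_open[OF assms(1) that Suc.prems(1)]) (use Suc.prems(2) that in simp_all)
  ultimately show ?case by simp
qed

lemma Ck_on_lincomb:
  fixes f g :: "'a::real_normed_vector \<Rightarrow> complex"
  assumes "open S" "Ck_on k S f" "Ck_on k S g"
  shows "Ck_on k S (\<lambda>x. c * f x + d * g x)"
  using assms(2,3)
proof (induction k arbitrary: f g)
  case 0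
  then show ?case by (auto intro!: continuous_intros)
next
  case (Suc k)
  have *: "((\<lambda>x. c * f x + d * g x) has_derivative
      (\<lambda>v. c * frechet_derivative f (at x) v + d * frechet_derivative g (at x) v)) (at x)" if "x \<in> S" for x
    using Suc.prems that by (intro has_derivative_add has_derivative_mult_right)
      (auto simp: frechet_derivative_works[symmetric])
  have "Ck_on k S (\<lambda>x. frechet_derivative (\<lambda>x. c * f x + d * g x) (at x) v)" for v
    by (rule Ck_on_cong[OF assms(1) _ Suc.IH[of "\<lambda>x. frechet_derivative f (at x) v" "\<lambda>x. frechet_derivative g (at x) v"]])
       (use Suc.prems in \<open>auto simp: frechet_derivative_at[OF *, symmetric]\<close>)
  moreover have "(\<lambda>x. c * f x + d * g x) differentiable at x" if "x \<in> S" for x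
    using *[OF that] by (auto simp: differentiable_def)
  ultimately show ?case by simp
qed

lemma smooth_on_imp_sm:
  fixes f :: "complex^'k::finite \<Rightarrow> complex"
  assumes "open S" "smooth_on S f"
  shows "sm S f"
proof -
  \<comment> \<open>The order drops by one: \<open>Ck_on 0\<close> is continuity, while
    \<open>smk 0\<close> already asks for differentiability.\<close>
  have "smk n S f" if "Ck_on (Suc n) S f" for n f using that
  proof (induction n arbitrary: f)
    case (Suc n)
    have "Ck_on (Suc n) S (dop d f)" for d
    proof -
      have F: "Ck_on (Suc n) S (\<lambda>x. frechet_derivative f (at x) v)" for v
        using Suc.prems unfolding Ck_on.simps(2)[of "Suc n"] by blast
      have "dop d f = (\<lambda>x. (1/2) * frechet_derivative f (at x) (axis (fst d) 1)
        + ((if snd d then \<i> else -\<i>) / 2) * frechet_derivative f (at x) (axis (fst d) \<i>))"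
        by (rule ext) (simp add: dop_def Dz_def Dzbar_def field_simps)
      then show ?thesis by (simp only: Ck_on_lincomb[OF assms(1) F F])
    qed
    then have "smk n S (dop d f)" for d using Suc.IH by blast
    then show ?case using Suc.prems by simp
  qed simp
  then show ?thesis using assms(2) unfolding smooth_on_def sm_def by blast
qed

lemma sm_frechet:
  assumes "open S" "sm S f"
  shows "sm S (\<lambda>x. frechet_derivative f (at x) v)"
proof (rule sm_cong[OF assms(1)])
  show "sm S (\<lambda>x. \<Sum>i\<in>UNIV. v $ i * dop (i,False) f x + cnj (v $ i) * dop (i,True) f x)"
    by (intro sm_sum sm_add sm_mult sm_const sm_dop assms)
  show "(\<Sum>i\<in>UNIV. v $ i * dop (i,False) f x + cnj (v $ i) * dop (i,True) f x) = frechet_derivative f (at x) v"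
    if "x \<in> S" for x
    using has_derivative_Wirtinger[of f "frechet_derivative f (at x)" x v] sm_differentiable[OF assms(2) that]
    by (simp add: frechet_derivative_works)
qed

text \<open>Schwarz's theorem by differentiation under the integral. Along the parallelogram
  \<open>p s t\<close> the difference f(p s t) - f(p 0 t) is the integral of the u-derivative over
  [0, s]. Its t-derivative at 0 is \<open>key\<close>, and the s-derivative of \<open>key\<close> at
  0 is the claim. One-sided derivatives at 0 suffice, so both parameters stay in
  [0, \<delta>].\<close>

lemma frechet_derivative_commute:
  fixes f :: "complex^'k::finite \<Rightarrow> complex"
  assumes "open S" "sm S f" "w \<in> S"
  shows "frechet_derivative (\<lambda>x. frechet_derivative f (at x) u) (at w) v
       = frechet_derivative (\<lambda>x. frechet_derivative f (at x) v) (at w) u"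
proof -
  define D where "D g x = frechet_derivative g (at x)" for g :: "complex^'k \<Rightarrow> complex" and x
  obtain e where e: "e > 0" "ball w e \<subseteq> S" using assms(1,3) open_contains_ball by blast
  \<comment> \<open>Keeps the parallelogram with sides \<delta> u and \<delta> v at w inside the
    ball.\<close>
  define \<delta> where "\<delta> = e / (2 * (norm u + norm v + 1))"
  have \<delta>: "\<delta> > 0" using e by (simp add: \<delta>_def add_nonneg_pos)
  define p where "p s t = w + s *\<^sub>R u + t *\<^sub>R v" for s t
  have pS: "p s t \<in> S" if "s \<in> {0..\<delta>}" "t \<in> {0..\<delta>}" for s t
  proof -
    have "norm (s *\<^sub>R u + t *\<^sub>R v) \<le> \<delta> * norm u + \<delta> * norm v"
      using that by (intro norm_triangle_le add_mono) (auto intro!: mult_right_mono)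
    also have "\<dots> < \<delta> * (2 * (norm u + norm v + 1))"
      using \<delta> by (auto simp: algebra_simps intro!: add_nonneg_pos)
    also have "\<dots> = e"
    proof -
      have "2 * (norm u + norm v + 1) > 0" by (simp add: add_nonneg_pos)
      then show ?thesis unfolding \<delta>_def by simp
    qed
    finally show ?thesis using e(2) by (auto simp: p_def dist_norm subset_iff norm_minus_commute)
  qed
  have ds: "((\<lambda>s. g (p s t)) has_vector_derivative D g (p s t) u) (at s within A)"
    if "sm S g" "p s t \<in> S" for g s t A
  proof -
    have 1: "((\<lambda>s. p s t) has_derivative (\<lambda>h. h *\<^sub>R u)) (at s within A)"
      unfolding p_def by (auto intro!: derivative_eq_intros)
    have 2: "(g has_derivative D g (p s t)) (at (p s t))"
      using sm_differentiable[OF that] by (simp add: D_def frechet_derivative_works)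
    from linear_scale[OF has_derivative_linear[OF 2]]
    show ?thesis using has_derivative_compose[OF 1 2] by (simp add: has_vector_derivative_def)
  qed
  have dt: "((\<lambda>t. g (p s t)) has_vector_derivative D g (p s t) v) (at t within A)"
    if "sm S g" "p s t \<in> S" for g s t A
  proof -
    have 1: "((\<lambda>t. p s t) has_derivative (\<lambda>h. h *\<^sub>R v)) (at t within A)"
      unfolding p_def by (auto intro!: derivative_eq_intros)
    have 2: "(g has_derivative D g (p s t)) (at (p s t))"
      using sm_differentiable[OF that] by (simp add: D_def frechet_derivative_works)
    from linear_scale[OF has_derivative_linear[OF 2]]
    show ?thesis using has_derivative_compose[OF 1 2] by (simp add: has_vector_derivative_def)
  qed
  define fu where "fu x = D f x u" for x
  define fv where "fv x = D f x v" for x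
  define fuv where "fuv x = D fu x v" for x
  have smu: "sm S fu" and smv: "sm S fv"
    using sm_frechet[OF assms(1,2)] by (simp_all add: fu_def[abs_def] fv_def[abs_def] D_def)
  have smuv: "sm S fuv" using sm_frechet[OF assms(1) smu] by (simp add: fuv_def[abs_def] D_def)
  have cont: "continuous_on ({0..\<delta>} \<times> {0..\<delta>}) (\<lambda>(s,t). g (p s t))" if "sm S g" for g
    unfolding split_beta
    by (rule continuous_on_compose2[OF sm_continuous_on[OF that]])
       (use pS in \<open>auto simp: p_def intro!: continuous_intros\<close>)
  have key: "fv (p s 0) - fv (p 0 0) = integral {0..s} (\<lambda>\<sigma>. fuv (p \<sigma> 0))" if s: "s \<in> {0..\<delta>}" for s
  proof -
    have int: "((\<lambda>\<sigma>. fu (p \<sigma> t)) has_integral (f (p s t) - f (p 0 t))) {0..s}" if "t \<in> {0..\<delta>}" for t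
      by (rule fundamental_theorem_of_calculus)
         (use s that pS ds[OF assms(2)] in \<open>auto simp: fu_def\<close>)
    have L: "((\<lambda>t. integral (cbox 0 s) (\<lambda>\<sigma>. fu (p \<sigma> t))) has_vector_derivative
        integral (cbox 0 s) (\<lambda>\<sigma>. fuv (p \<sigma> 0))) (at 0 within {0..\<delta>})"
    proof (rule leibniz_rule_vector_derivative)
      show "((\<lambda>t. fu (p \<sigma> t)) has_vector_derivative fuv (p \<sigma> t)) (at t within {0..\<delta>})"
        if "t \<in> {0..\<delta>}" "\<sigma> \<in> cbox 0 s" for t \<sigma>
        using dt[OF smu pS] that s by (auto simp: fuv_def)
      show "(\<lambda>\<sigma>. fu (p \<sigma> t)) integrable_on cbox 0 s" if "t \<in> {0..\<delta>}" for t
        using int[OF that] by (auto simp: has_integral_integrable)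
      show "continuous_on ({0..\<delta>} \<times> cbox 0 s) (\<lambda>(t, \<sigma>). fuv (p \<sigma> t))"
      proof -
        have "continuous_on ({0..\<delta>} \<times> cbox 0 s) (\<lambda>x. case (snd x, fst x) of (s, t) \<Rightarrow> fuv (p s t))"
          by (rule continuous_on_compose2[OF cont[OF smuv]]) (use s in \<open>auto intro!: continuous_intros\<close>)
        then show ?thesis by (simp add: split_beta)
      qed
    qed (use \<delta> in auto)
    have "((\<lambda>t. f (p s t) - f (p 0 t)) has_vector_derivative
        integral (cbox 0 s) (\<lambda>\<sigma>. fuv (p \<sigma> 0))) (at 0 within {0..\<delta>})"
      by (rule has_vector_derivative_transform[OF _ _ L]) (use \<delta> integral_unique[OF int] in simp_all)
    moreover have "((\<lambda>t. f (p s t) - f (p 0 t)) has_vector_derivative fv (p s 0) - fv (p 0 0)) (at 0 within {0..\<delta>})"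
      unfolding fv_def using s \<delta> by (intro has_vector_derivative_diff dt assms pS) auto
    ultimately show ?thesis
      using vector_derivative_unique_within_closed_interval[of 0 \<delta> 0] \<delta> by fastforce
  qed
  have "continuous_on {0..\<delta>} (\<lambda>\<sigma>. fuv (p \<sigma> 0))"
  proof -
    have "continuous_on {0..\<delta>} (\<lambda>\<sigma>. case (\<sigma>, 0) of (s, t) \<Rightarrow> fuv (p s t))"
      by (rule continuous_on_compose2[OF cont[OF smuv]]) (use \<delta> in \<open>auto intro!: continuous_intros\<close>)
    then show ?thesis by simp
  qed
  from integral_has_vector_derivative[OF this, of 0] \<delta>
  have "((\<lambda>s. integral {0..s} (\<lambda>\<sigma>. fuv (p \<sigma> 0))) has_vector_derivative fuv (p 0 0)) (at 0 within {0..\<delta>})"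
    by auto
  then have "((\<lambda>s. fv (p s 0) - fv (p 0 0)) has_vector_derivative fuv (p 0 0)) (at 0 within {0..\<delta>})"
    by (rule has_vector_derivative_transform[rotated 2]) (use \<delta> key in auto)
  moreover have "((\<lambda>s. fv (p s 0) - fv (p 0 0)) has_vector_derivative D fv (p 0 0) u - 0) (at 0 within {0..\<delta>})"
    using \<delta> by (intro has_vector_derivative_diff ds smv pS has_vector_derivative_const) auto
  ultimately have "fuv (p 0 0) = D fv (p 0 0) u"
    using vector_derivative_unique_within_closed_interval[of 0 \<delta> 0] \<delta> by fastforce
  then show ?thesis by (simp add: p_def fuv_def fu_def[abs_def] fv_def[abs_def] D_def)
qed

lemma dop_commute:
  fixes f :: "complex^'k::finite \<Rightarrow> complex"
  assumes "open S" "sm S f" "w \<in> S"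
  shows "dop c (dop d f) w = dop d (dop c f) w"
proof -
  define E where "E g v x = frechet_derivative g (at x) v" for g :: "complex^'k \<Rightarrow> complex" and x v
  define k where "k d = (if snd d then \<i>/2 else -\<i>/2)" for d :: "'k \<times> bool"
  have dE: "dop d g x = (1/2) * E g (axis (fst d) 1) x + k d * E g (axis (fst d) \<i>) x" for d g x
    by (simp add: dop_def Dz_def Dzbar_def E_def k_def field_simps)
  have smE: "sm S (E f v)" for v unfolding E_def by (rule sm_frechet[OF assms(1,2)])
  have df: "E f v differentiable (at w)" for v using sm_differentiable[OF smE assms(3)] .
  have lin: "E (\<lambda>x. c * E f v x + d * E f v' x) u w = c * E (E f v) u w + d * E (E f v') u w" for c d v v' u
  proof -
    have "((\<lambda>x. c * E f v x + d * E f v' x) has_derivative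
       (\<lambda>u. c * frechet_derivative (E f v) (at w) u + d * frechet_derivative (E f v') (at w) u)) (at w)"
      using df by (intro has_derivative_add has_derivative_mult_right) (auto simp: frechet_derivative_works[symmetric])
    from fun_cong[OF frechet_derivative_at[OF this], of u, symmetric] show ?thesis
      by (simp only: E_def[of "\<lambda>x. c * E f v x + d * E f v' x"] E_def[of "E f v"] E_def[of "E f v'"])
  qed
  have com: "E (E f v) u w = E (E f u) v w" for u v
    using frechet_derivative_commute[OF assms, of v u] by (simp add: E_def[abs_def])
  have main: "dop c (dop d f) w
      = (1/2) * ((1/2) * E (E f (axis (fst d) 1)) (axis (fst c) 1) w + k d * E (E f (axis (fst d) \<i>)) (axis (fst c) 1) w)
      + k c * ((1/2) * E (E f (axis (fst d) 1)) (axis (fst c) \<i>) w + k d * E (E f (axis (fst d) \<i>)) (axis (fst c) \<i>) w)"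
    for c d
  proof -
    have "dop d f = (\<lambda>x. (1/2) * E f (axis (fst d) 1) x + k d * E f (axis (fst d) \<i>) x)"
      by (rule ext) (rule dE)
    then have "E (dop d f) u w = (1/2) * E (E f (axis (fst d) 1)) u w + k d * E (E f (axis (fst d) \<i>)) u w" for u
      by (simp only: ) (rule lin)
    note h = this
    show ?thesis unfolding dE[of c "dop d f" w] h ..
  qed
  show ?thesis unfolding main[of c d] main[of d c]
      com[of "axis (fst d) 1" "axis (fst c) 1"] com[of "axis (fst d) 1" "axis (fst c) \<i>"]
      com[of "axis (fst d) \<i>" "axis (fst c) 1"] com[of "axis (fst d) \<i>" "axis (fst c) \<i>"]
    by algebra
qed

lemma dops_move:
  assumes "open S" "sm S f" "w \<in> S"
  shows "dops (b1 @ x # b2) f w = dops (x # b1 @ b2) f w"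
  using assms(3)
proof (induction b1 arbitrary: w)
  case (Cons c b1)
  have "dops ((c # b1) @ x # b2) f w = dop c (dops (x # b1 @ b2) f) w"
    using dop_cong_open[OF assms(1) Cons.prems Cons.IH] by simp
  also have "\<dots> = dop x (dop c (dops (b1 @ b2) f)) w"
    using dop_commute[OF assms(1) sm_dops[OF assms(2)] Cons.prems] by simp
  finally show ?case by simp
qed simp

lemma dops_perm:
  assumes "open S" "sm S f" "w \<in> S" "mset a = mset b"
  shows "dops a f w = dops b f w"
  using assms(3,4)
proof (induction a arbitrary: b w)
  case (Cons x a)
  then have "x \<in> set b" by (metis list.set_intros(1) mset_eq_setD)
  then obtain b1 b2 where b: "b = b1 @ x # b2" by (meson split_list)
  then have "mset a = mset (b1 @ b2)" using Cons.prems by simp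
  then have "dops a f y = dops (b1 @ b2) f y" if "y \<in> S" for y using Cons.IH that by blast
  then have "dop x (dops a f) w = dop x (dops (b1 @ b2) f) w"
    by (intro dop_cong_open[OF assms(1) Cons.prems(1)])
  then show ?case using dops_move[OF assms(1,2) Cons.prems(1), of b1 x b2] b by simp
qed simp

section \<open>The Leibniz rule\<close>

text \<open>Every distribution of the letters over two factors, kept as a list of 2^n pairs so that
  repetitions count. The Leibniz rule then carries no binomial coefficients; they appear when terms
  are collected by length in \<open>sum_list_splits\<close>.\<close>

primrec splits :: "'a list \<Rightarrow> ('a list \<times> 'a list) list" where
  "splits [] = [([], [])]"
| "splits (d # ds) = map (\<lambda>(a, b). (d # a, b)) (splits ds) @ map (\<lambda>(a, b). (a, d # b)) (splits ds)"

lemma splits_length: "(a, b) \<in> set (splits ds) \<Longrightarrow> length a + length b = length ds"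
  by (induction ds arbitrary: a b) auto

lemma splits_set: "(a, b) \<in> set (splits ds) \<Longrightarrow> set ds = set a \<union> set b"
  by (induction ds arbitrary: a b) fastforce+

lemma sum_binomial_Suc:
  fixes g :: "nat \<Rightarrow> nat \<Rightarrow> 'a::comm_semiring_1"
  shows "(\<Sum>j\<le>n. of_nat (n choose j) * g (Suc j) (n - j)) + (\<Sum>j\<le>n. of_nat (n choose j) * g j (Suc (n - j)))
      = (\<Sum>j\<le>Suc n. of_nat (Suc n choose j) * g j (Suc n - j))"
proof -
  have "(\<Sum>j\<le>n. of_nat (n choose j) * g j (Suc (n - j))) = (\<Sum>j\<le>Suc n. of_nat (n choose j) * g j (Suc n - j))"
    by (simp add: Suc_diff_le binomial_eq_0)
  also have "\<dots> = g 0 (Suc n) + (\<Sum>j\<le>n. of_nat (n choose Suc j) * g (Suc j) (n - j))"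
    by (subst sum.atMost_Suc_shift) simp
  finally show ?thesis
    by (subst sum.atMost_Suc_shift) (simp add: sum.distrib algebra_simps)
qed

lemma sum_list_splits:
  fixes g :: "nat \<Rightarrow> nat \<Rightarrow> 'a::comm_semiring_1"
  shows "(\<Sum>(a, b)\<leftarrow>splits ds. g (length a) (length b))
      = (\<Sum>j\<le>length ds. of_nat (length ds choose j) * g j (length ds - j))"
proof (induction ds arbitrary: g)
  case (Cons d ds)
  have "(\<Sum>(a, b)\<leftarrow>splits (d # ds). g (length a) (length b))
     = (\<Sum>(a, b)\<leftarrow>splits ds. g (Suc (length a)) (length b)) + (\<Sum>(a, b)\<leftarrow>splits ds. g (length a) (Suc (length b)))"
    by (simp add: case_prod_unfold o_def)
  then show ?case unfolding Cons[of "\<lambda>i j. g (Suc i) j"] Cons[of "\<lambda>i j. g i (Suc j)"] sum_binomial_Suc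
    by simp
qed simp

lemma dop_sum_list:
  assumes "\<And>p. p \<in> set xs \<Longrightarrow> g p differentiable (at w)"
  shows "dop d (\<lambda>x. \<Sum>p\<leftarrow>xs. g p x) w = (\<Sum>p\<leftarrow>xs. dop d (g p) w)
     \<and> (\<lambda>x. \<Sum>p\<leftarrow>xs. g p x) differentiable (at w)"
  using assms by (induction xs) (auto simp: dop_add)

lemma dops_mult:
  assumes "open S" "sm S u" "sm S v" "w \<in> S"
  shows "dops ds (\<lambda>x. u x * v x) w = (\<Sum>(a, b)\<leftarrow>splits ds. dops a u w * dops b v w)"
  using assms(4)
proof (induction ds arbitrary: w)
  case (Cons d ds)
  have D: "dops a u differentiable (at w)" "dops a v differentiable (at w)" for a
    using sm_differentiable[OF sm_dops] assms Cons.prems by blast+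
  have "dops (d # ds) (\<lambda>x. u x * v x) w = dop d (\<lambda>w. \<Sum>p\<leftarrow>splits ds. dops (fst p) u w * dops (snd p) v w) w"
    using dop_cong_open[OF assms(1) Cons.prems Cons.IH] by (simp add: split_beta)
  also have "\<dots> = (\<Sum>p\<leftarrow>splits ds. dop d (\<lambda>w. dops (fst p) u w * dops (snd p) v w) w)"
    using D by (intro dop_sum_list[THEN conjunct1]) (auto intro!: differentiable_mult)
  also have "\<dots> = (\<Sum>(a, b)\<leftarrow>splits (d # ds). dops a u w * dops b v w)"
    using D by (simp add: dop_mult split_beta o_def sum_list_addf)
  finally show ?case .
qed simp

lemma dops_add:
  assumes "open S" "sm S u" "sm S v" "w \<in> S"
  shows "dops ds (\<lambda>x. u x + v x) w = dops ds u w + dops ds v w"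
  using assms(4)
proof (induction ds arbitrary: w)
  case (Cons d ds)
  have D: "dops a u differentiable (at w)" "dops a v differentiable (at w)" for a
    using sm_differentiable[OF sm_dops] assms Cons.prems by blast+
  show ?case using dop_cong_open[OF assms(1) Cons.prems Cons.IH] by (simp add: dop_add D)
qed simp

lemma dops_sum:
  assumes "open S" "\<And>i. i \<in> I \<Longrightarrow> sm S (u i)" "w \<in> S"
  shows "dops ds (\<lambda>x. \<Sum>i\<in>I. u i x) w = (\<Sum>i\<in>I. dops ds (u i) w)"
  using assms(3)
proof (induction ds arbitrary: w)
  case (Cons d ds)
  have D: "dops a (u i) differentiable (at w)" if "i \<in> I" for a i
    using sm_differentiable[OF sm_dops] assms that Cons.prems by blast
  show ?case using dop_cong_open[OF assms(1) Cons.prems Cons.IH] by (simp add: dop_sum D)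
qed simp

lemma dops_const: "dops ds (\<lambda>_. c) = (\<lambda>_. if ds = [] then c else 0)"
  by (induction ds) auto

lemma dops_cmult:
  assumes "open S" "sm S u" "w \<in> S"
  shows "dops ds (\<lambda>x. c * u x) w = c * dops ds u w"
  using assms(3)
proof (induction ds arbitrary: w)
  case (Cons d ds)
  have D: "dops a u differentiable (at w)" for a
    using sm_differentiable[OF sm_dops] assms Cons.prems by blast
  show ?case using dop_cong_open[OF assms(1) Cons.prems Cons.IH] by (simp add: dop_cmult D)
qed simp

lemma dops_cnj:
  assumes "open S" "sm S u" "w \<in> S"
  shows "dops ds (\<lambda>x. cnj (u x)) w = cnj (dops (map (\<lambda>d. (fst d, \<not> snd d)) ds) u w)"
  using assms(3)
proof (induction ds arbitrary: w)
  case (Cons d ds)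
  have D: "dops a u differentiable (at w)" for a
    using sm_differentiable[OF sm_dops] assms Cons.prems by blast
  show ?case using dop_cong_open[OF assms(1) Cons.prems Cons.IH] by (simp add: dop_cnj D)
qed simp

text \<open>A single antiholomorphic letter anywhere in the word suffices, matching
  \<open>flat_factor\<close>, which only asks whether \<beta> is zero.\<close>

definition anti :: "('k \<times> bool) list \<Rightarrow> bool" where
  "anti ds \<longleftrightarrow> (\<exists>d\<in>set ds. snd d)"

lemma anti_simps [simp]: "\<not> anti []" "anti (d # ds) \<longleftrightarrow> snd d \<or> anti ds"
  by (auto simp: anti_def)

lemma anti_append [simp]: "anti (a @ b) \<longleftrightarrow> anti a \<or> anti b"
  by (auto simp: anti_def)

lemma anti_splits: "(a, b) \<in> set (splits ds) \<Longrightarrow> anti ds \<longleftrightarrow> anti a \<or> anti b"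
  using splits_set[of a b ds] by (auto simp: anti_def)

lemma norm_sum_list_le: "norm (sum_list xs) \<le> (\<Sum>x\<leftarrow>xs. norm x)"
  by (induction xs) (auto intro: norm_triangle_le)

lemma norm_dops_mult_le:
  assumes "open S" "sm S u" "sm S v" "w \<in> S"
    and "\<And>a b. (a, b) \<in> set (splits ds) \<Longrightarrow> cmod (dops a u w) * cmod (dops b v w) \<le> g (length a) (length b)"
  shows "cmod (dops ds (\<lambda>x. u x * v x) w)
     \<le> (\<Sum>j\<le>length ds. real (length ds choose j) * g j (length ds - j))"
proof -
  have "cmod (dops ds (\<lambda>x. u x * v x) w) \<le> (\<Sum>(a, b)\<leftarrow>splits ds. cmod (dops a u w) * cmod (dops b v w))"
    unfolding dops_mult[OF assms(1-4)]
    by (rule order.trans[OF norm_sum_list_le]) (simp add: case_prod_unfold o_def norm_mult)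
  also have "\<dots> \<le> (\<Sum>(a, b)\<leftarrow>splits ds. g (length a) (length b))"
    by (rule sum_list_mono) (use assms(5) in auto)
  also have "\<dots> = (\<Sum>j\<le>length ds. real (length ds choose j) * g j (length ds - j))"
    using sum_list_splits[of g ds] by simp
  finally show ?thesis .
qed

text \<open>The binomial coefficient of n is at most that of k + n, which for s \<ge> 1 is at most
  its own power s; with that power the factorials combine exactly. This is why the shift k survives
  the Leibniz rule without loss.\<close>

lemma choose_fact_powr_le:
  assumes "s \<ge> 1" "j \<le> n"
  shows "real (n choose j) * (fact j powr s * fact (k + (n - j)) powr s) \<le> fact (k + n) powr s"
proof -
  have "real (n choose j) \<le> real ((k + n) choose j)"
    by (intro of_nat_mono binomial_right_mono) simp
  also have "\<dots> \<le> real ((k + n) choose j) powr s"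
    using assms powr_mono[of 1 s "real ((k + n) choose j)"] by (simp add: Suc_le_eq)
  finally have "real (n choose j) * (fact j powr s * fact (k + (n - j)) powr s)
    \<le> real ((k + n) choose j) powr s * (fact j powr s * fact (k + (n - j)) powr s)"
    by (intro mult_right_mono) auto
  also have "\<dots> = (real ((k + n) choose j) * (fact j * fact (k + (n - j)))) powr s"
    by (simp add: powr_mult)
  also have "real ((k + n) choose j) * (fact j * fact (k + (n - j))) = fact (k + n)"
    using binomial_fact_lemma[of j "k + n"] assms(2)
    by (metis (no_types, lifting) Nat.add_diff_assoc mult.commute of_nat_fact of_nat_mult trans_le_add2)
  finally show ?thesis .
qed

lemma geometric_half_le: "(\<Sum>j\<le>n. (1/2::real) ^ j) \<le> 2"
proof -
  have "(\<Sum>j\<le>n. (1/2::real) ^ j) = 2 - (1/2) ^ n"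
    by (induction n) auto
  then show ?thesis by simp
qed

text \<open>
  Multiplication by a Gevrey function does not change the radius \<open>R\<close> nor the shift \<open>k\<close> of the
  factorials; this keeps the constants under control in the iteration.
\<close>

lemma leibniz_bound:
  assumes "open S" "sm S u" "sm S v" "w \<in> S" and s: "s \<ge> 1"
    and C: "0 \<le> C" "2 * C \<le> R" and A: "0 \<le> A" and M: "0 \<le> M" and om: "0 \<le> om"
    and uv: "\<And>a b. (a, b) \<in> set (splits ds) \<Longrightarrow> \<exists>x y. x * y \<le> om \<and> 0 \<le> x \<and> 0 \<le> y \<and>
        cmod (dops a u w) \<le> A * C ^ length a * fact (length a) powr s * x \<and>
        cmod (dops b v w) \<le> M * R ^ length b * fact (k + length b) powr s * y"
  shows "cmod (dops ds (\<lambda>x. u x * v x) w) \<le> 2 * A * M * R ^ length ds * fact (k + length ds) powr s * om"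
proof -
  define n where "n = length ds"
  have R: "0 \<le> R" using C by simp
  define g where "g i j = (A * C ^ i * fact i powr s) * (M * R ^ j * fact (k + j) powr s) * om" for i j
  have "cmod (dops ds (\<lambda>x. u x * v x) w) \<le> (\<Sum>j\<le>n. real (n choose j) * g j (n - j))"
    unfolding n_def
  proof (rule norm_dops_mult_le[OF assms(1-4)])
    fix a b assume "(a, b) \<in> set (splits ds)"
    from uv[OF this] obtain x y where xy: "x * y \<le> om" "0 \<le> x" "0 \<le> y"
        "cmod (dops a u w) \<le> A * C ^ length a * fact (length a) powr s * x"
        "cmod (dops b v w) \<le> M * R ^ length b * fact (k + length b) powr s * y" by blast
    have "cmod (dops a u w) * cmod (dops b v w)
        \<le> (A * C ^ length a * fact (length a) powr s * x) * (M * R ^ length b * fact (k + length b) powr s * y)"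
      using xy A C by (intro mult_mono) auto
    also have "\<dots> = (A * C ^ length a * fact (length a) powr s) * (M * R ^ length b * fact (k + length b) powr s) * (x * y)"
      by simp
    also have "\<dots> \<le> g (length a) (length b)"
      unfolding g_def using xy A C M R by (intro mult_left_mono) auto
    finally show "cmod (dops a u w) * cmod (dops b v w) \<le> g (length a) (length b)" .
  qed
  also have "\<dots> \<le> (\<Sum>j\<le>n. (A * M * R ^ n * fact (k + n) powr s * om) * (1/2) ^ j)"
  proof (rule sum_mono)
    fix j assume "j \<in> {..n}"
    then have j: "j \<le> n" by simp
    \<comment> \<open>Here \<open>2 * C \<le> R\<close> is used: each letter falling on u gains 1/2,
      so the sum over j is geometric and costs a factor 2 instead of a larger R.\<close>
    have "C ^ j * R ^ (n - j) \<le> (R/2) ^ j * R ^ (n - j)"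
      using C R by (intro mult_right_mono power_mono) auto
    also have "\<dots> = R ^ n * (1/2) ^ j"
      using j by (simp add: power_divide power_add[symmetric])
    finally have CR: "C ^ j * R ^ (n - j) \<le> R ^ n * (1/2) ^ j" .
    have "real (n choose j) * g j (n - j) = (A * M * om) * ((C ^ j * R ^ (n - j)) *
        (real (n choose j) * (fact j powr s * fact (k + (n - j)) powr s)))"
      unfolding g_def by simp
    also have "\<dots> \<le> (A * M * om) * ((R ^ n * (1/2) ^ j) * fact (k + n) powr s)"
      using A M om C R by (intro mult_left_mono mult_mono[OF CR choose_fact_powr_le[OF s j]]) auto
    finally show "real (n choose j) * g j (n - j) \<le> (A * M * R ^ n * fact (k + n) powr s * om) * (1/2) ^ j"
      by (simp add: mult_ac)
  qed
  also have "\<dots> = (A * M * R ^ n * fact (k + n) powr s * om) * (\<Sum>j\<le>n. (1/2) ^ j)"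
    by (simp add: sum_distrib_left)
  also have "\<dots> \<le> (A * M * R ^ n * fact (k + n) powr s * om) * 2"
    using A M om R by (intro mult_left_mono geometric_half_le) auto
  finally show ?thesis by (simp add: n_def mult_ac)
qed

text \<open>For bounds of exponential type the binomial theorem makes the rates add. This is applied
  to powers of the linear forms, where factorials would be wasteful.\<close>

lemma leibniz_exp_bound:
  assumes "open S" "sm S u" "sm S v" "w \<in> S"
    and "0 \<le> A" "0 \<le> B" "0 \<le> c" "0 \<le> d"
    and "\<And>a. cmod (dops a u w) \<le> A * c ^ length a" "\<And>b. cmod (dops b v w) \<le> B * d ^ length b"
  shows "cmod (dops ds (\<lambda>x. u x * v x) w) \<le> A * B * (c + d) ^ length ds"
proof -
  define n where "n = length ds"
  have "cmod (dops ds (\<lambda>x. u x * v x) w) \<le> (\<Sum>j\<le>n. real (n choose j) * ((A * c ^ j) * (B * d ^ (n - j))))"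
    unfolding n_def
    by (rule norm_dops_mult_le[OF assms(1-4)]) (use assms in \<open>auto intro!: mult_mono\<close>)
  also have "\<dots> = A * B * (\<Sum>j\<le>n. real (n choose j) * c ^ j * d ^ (n - j))"
    by (simp add: sum_distrib_left mult_ac)
  also have "\<dots> = A * B * (c + d) ^ n" by (simp add: binomial_ring)
  finally show ?thesis by (simp add: n_def)
qed

section \<open>Gevrey classes on a set of points\<close>

text \<open>
  \<open>om False\<close> bounds the holomorphic derivatives, \<open>om True\<close> those containing at least one
  antiholomorphic derivative.
\<close>

definition gev :: "real \<Rightarrow> (complex^'k::finite) set \<Rightarrow> (complex^'k) set \<Rightarrow> (bool \<Rightarrow> complex^'k \<Rightarrow> real)
    \<Rightarrow> (complex^'k \<Rightarrow> complex) \<Rightarrow> bool" where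
  "gev s D S om u \<longleftrightarrow> sm D u \<and> (\<exists>C\<ge>1. \<forall>P\<in>S. \<forall>ds.
     cmod (dops ds u P) \<le> C * C ^ length ds * fact (length ds) powr s * om (anti ds) P)"

lemma gev_sm: "gev s D S om u \<Longrightarrow> sm D u" by (simp add: gev_def)

lemma gev_mono:
  assumes "gev s D S om u" "\<And>b P. P \<in> S \<Longrightarrow> om b P \<le> om' b P"
  shows "gev s D S om' u"
proof -
  from assms(1) obtain C where C: "C \<ge> 1"
    "\<And>P ds. P \<in> S \<Longrightarrow> cmod (dops ds u P) \<le> C * C ^ length ds * fact (length ds) powr s * om (anti ds) P"
    unfolding gev_def by blast
  have "cmod (dops ds u P) \<le> C * C ^ length ds * fact (length ds) powr s * om' (anti ds) P" if "P \<in> S" for P ds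
    using C(2)[OF that, of ds] by (rule order.trans) (use C(1) assms(2)[OF that] in \<open>auto intro!: mult_left_mono\<close>)
  then show ?thesis using C(1) assms(1) unfolding gev_def by blast
qed

lemma gev_const:
  fixes S :: "(complex^'k::finite) set"
  assumes "\<And>P. P \<in> S \<Longrightarrow> om False P = 1" "\<And>P. P \<in> S \<Longrightarrow> om True P \<ge> 0"
  shows "gev s D S om (\<lambda>_. c)"
  unfolding gev_def
proof (intro conjI exI[of _ "max 1 (cmod c)"] ballI allI)
  fix P and ds :: "('k \<times> bool) list" assume P: "P \<in> S"
  have "om (anti ds) P \<ge> 0" using assms[OF P] by (cases "anti ds") auto
  then show "cmod (dops ds (\<lambda>_. c) P)
      \<le> max 1 (cmod c) * max 1 (cmod c) ^ length ds * fact (length ds) powr s * om (anti ds) P"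
    using assms[OF P] by (cases "ds = []") (auto simp: dops_const)
qed (auto simp: sm_const)

lemma gev_add:
  assumes "open D" "S \<subseteq> D" "gev s D S om u" "gev s D S om v" "\<And>b P. P \<in> S \<Longrightarrow> om b P \<ge> 0"
  shows "gev s D S om (\<lambda>x. u x + v x)"
proof -
  obtain C where C: "C \<ge> 1"
    "\<And>P ds. P \<in> S \<Longrightarrow> cmod (dops ds u P) \<le> C * C ^ length ds * fact (length ds) powr s * om (anti ds) P"
    using assms(3) unfolding gev_def by blast
  obtain C' where C': "C' \<ge> 1"
    "\<And>P ds. P \<in> S \<Longrightarrow> cmod (dops ds v P) \<le> C' * C' ^ length ds * fact (length ds) powr s * om (anti ds) P"
    using assms(4) unfolding gev_def by blast
  have sm: "sm D u" "sm D v" using assms by (auto simp: gev_def)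
  have "cmod (dops ds (\<lambda>x. u x + v x) P)
      \<le> (C + C') * (C + C') ^ length ds * fact (length ds) powr s * om (anti ds) P" if P: "P \<in> S" for P ds
  proof -
    have "cmod (dops ds (\<lambda>x. u x + v x) P) \<le> cmod (dops ds u P) + cmod (dops ds v P)"
      using dops_add[OF assms(1) sm] P assms(2) norm_triangle_ineq by (metis subsetD)
    also have "\<dots> \<le> C * C ^ length ds * fact (length ds) powr s * om (anti ds) P
        + C' * C' ^ length ds * fact (length ds) powr s * om (anti ds) P"
      using C C' P by (intro add_mono) auto
    also have "\<dots> \<le> C * (C + C') ^ length ds * fact (length ds) powr s * om (anti ds) P
        + C' * (C + C') ^ length ds * fact (length ds) powr s * om (anti ds) P"
      using C(1) C'(1) assms(5)[OF P] by (intro add_mono mult_right_mono mult_left_mono power_mono) auto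
    also have "\<dots> = (C + C') * (C + C') ^ length ds * fact (length ds) powr s * om (anti ds) P"
      by (simp add: algebra_simps)
    finally show ?thesis .
  qed
  moreover have "C + C' \<ge> 1" using C C' by simp
  ultimately show ?thesis using sm_add[OF assms(1) sm] unfolding gev_def by blast
qed

text \<open>A word has an antiholomorphic letter exactly if one of its two parts has one, so the
  weights only have to be submultiplicative along \<open>b \<or> c\<close>. Three separate weights
  allow products of a flat and a merely bounded factor.\<close>

lemma gev_mult:
  assumes "open D" "S \<subseteq> D" "s \<ge> 1" "gev s D S om1 u" "gev s D S om2 v"
    and om: "\<And>b P. P \<in> S \<Longrightarrow> om1 b P \<ge> 0" "\<And>b P. P \<in> S \<Longrightarrow> om2 b P \<ge> 0"
      "\<And>b c P. P \<in> S \<Longrightarrow> om1 b P * om2 c P \<le> om (b \<or> c) P"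
  shows "gev s D S om (\<lambda>x. u x * v x)"
proof -
  obtain C where C: "C \<ge> 1"
    "\<And>P ds. P \<in> S \<Longrightarrow> cmod (dops ds u P) \<le> C * C ^ length ds * fact (length ds) powr s * om1 (anti ds) P"
    using assms(4) unfolding gev_def by blast
  obtain C' where C': "C' \<ge> 1"
    "\<And>P ds. P \<in> S \<Longrightarrow> cmod (dops ds v P) \<le> C' * C' ^ length ds * fact (length ds) powr s * om2 (anti ds) P"
    using assms(5) unfolding gev_def by blast
  have sm: "sm D u" "sm D v" using assms by (auto simp: gev_def)
  define R where "R = 2 * C * C'"
  have CC: "C \<le> C * C'" "C' \<le> C * C'" "1 \<le> C * C'" using C(1) C'(1) mult_mono[of 1 C 1 C'] by auto
  have R: "2 * C \<le> R" "C' \<le> R" "R \<ge> 1" using CC by (auto simp: R_def)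
  have "cmod (dops ds (\<lambda>x. u x * v x) P)
      \<le> R * R ^ length ds * fact (length ds) powr s * om (anti ds) P" if P: "P \<in> S" for P ds
  proof -
    have "cmod (dops ds (\<lambda>x. u x * v x) P) \<le> 2 * C * C' * R ^ length ds * fact (0 + length ds) powr s * om (anti ds) P"
    proof (rule leibniz_bound[OF assms(1) sm _ assms(3), where C = C])
      show "0 \<le> om (anti ds) P"
        using order.trans[OF _ om(3)[OF P, of "anti ds" "anti ds"]] om(1,2)[OF P] by simp
      fix a b assume ab: "(a, b) \<in> set (splits ds)"
      have "cmod (dops b v P) \<le> C' * C' ^ length b * fact (length b) powr s * om2 (anti b) P"
        using C' P by blast
      also have "\<dots> \<le> C' * R ^ length b * fact (length b) powr s * om2 (anti b) P"
        using C'(1) R om(2)[OF P] by (intro mult_right_mono mult_left_mono power_mono) auto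
      finally have bv: "cmod (dops b v P) \<le> C' * R ^ length b * fact (0 + length b) powr s * om2 (anti b) P" by simp
      show "\<exists>x y. x * y \<le> om (anti ds) P \<and> 0 \<le> x \<and> 0 \<le> y \<and>
        cmod (dops a u P) \<le> C * C ^ length a * fact (length a) powr s * x \<and>
        cmod (dops b v P) \<le> C' * R ^ length b * fact (0 + length b) powr s * y"
        by (intro exI[of _ "om1 (anti a) P"] exI[of _ "om2 (anti b) P"] conjI bv C(2)[OF P] om(1,2)[OF P])
           (use om(3)[OF P, of "anti a" "anti b"] anti_splits[OF ab] in simp)
    qed (use C(1) C'(1) R assms(2) P in auto)
    then show ?thesis by (simp add: R_def)
  qed
  then show ?thesis using sm_mult[OF assms(1) sm] R(3) unfolding gev_def by blast
qed

lemma gev_sum: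
  assumes "open D" "S \<subseteq> D" "\<And>i. i \<in> I \<Longrightarrow> gev s D S om (u i)" "\<And>b P. P \<in> S \<Longrightarrow> om b P \<ge> 0"
  shows "gev s D S om (\<lambda>x. \<Sum>i\<in>I. u i x)"
proof -
  have z: "gev s D S om (\<lambda>_. 0)"
    unfolding gev_def using assms(4) by (auto intro!: exI[of _ 1] simp: sm_const dops_const)
  show ?thesis using assms(3)
    by (induction I rule: infinite_finite_induct) (auto intro: z gev_add[OF assms(1,2) _ _ assms(4)])
qed

lemma gev_cong:
  assumes "open D" "S \<subseteq> D" "\<And>x. x \<in> D \<Longrightarrow> u x = v x" "gev s D S om u"
  shows "gev s D S om v"
proof -
  have "dops ds u P = dops ds v P" if "P \<in> S" for P ds
    by (rule dops_cong_open[OF assms(1) subsetD[OF assms(2) that] assms(3)])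
  moreover have "sm D v" using sm_cong[OF assms(1,3) gev_sm[OF assms(4)]] .
  ultimately show ?thesis using assms(4) by (simp add: gev_def)
qed

lemma power_powr_swap: "(x::real) > 0 \<Longrightarrow> (x ^ n) powr s = (x powr s) ^ n"
  by (subst (1 2) powr_realpow[symmetric]) (simp_all add: powr_powr mult.commute)

lemma fact_Suc_powr_le:
  assumes "s \<ge> 0"
  shows "(fact (Suc n) :: real) powr s \<le> (2 powr s) ^ Suc n * fact n powr s"
proof -
  have "real (Suc n) \<le> 2 ^ Suc n"
    by (metis less_exp of_nat_le_iff of_nat_numeral of_nat_power order_less_imp_le)
  then have "(fact (Suc n) :: real) powr s \<le> (2 ^ Suc n * fact n) powr s"
    using assms by (intro powr_mono2) auto
  also have "\<dots> = (2 powr s) ^ Suc n * fact n powr s"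
  proof -
    have "((2::real) ^ Suc n) powr s = (2 powr s) ^ Suc n"
      by (rule power_powr_swap) simp
    then show ?thesis by (simp add: powr_mult)
  qed
  finally show ?thesis .
qed

text \<open>The letter d joins every word, so the weight rises to \<open>om (b \<or> snd d)\<close>:
  after an antiholomorphic derivative even the function itself carries the weight of antiholomorphic
  words. The factorial of length n + 1 is brought back to n! by enlarging the geometric
  constant.\<close>

lemma gev_dop:
  assumes "gev s D S om u" "s \<ge> 0" "\<And>b P. P \<in> S \<Longrightarrow> om b P \<ge> 0"
    and "\<And>b P. P \<in> S \<Longrightarrow> om (b \<or> snd d) P \<le> om' b P"
  shows "gev s D S om' (dop d u)"
proof -
  obtain C where C: "C \<ge> 1"
    "\<And>P ds. P \<in> S \<Longrightarrow> cmod (dops ds u P) \<le> C * C ^ length ds * fact (length ds) powr s * om (anti ds) P"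
    using assms(1) unfolding gev_def by blast
  define q where "q = 2 powr s"
  have q: "q \<ge> 1" using assms(2) by (simp add: q_def ge_one_powr_ge_zero)
  define K where "K = C * C * q"
  have K: "K \<ge> C * q" "K \<ge> 1"
    using C(1) q mult_right_mono[of C "C * C" q] mult_mono[of 1 "C*C" 1 q] mult_mono[of 1 C 1 C] by (auto simp: K_def)
  have "cmod (dops ds (dop d u) P) \<le> K * K ^ length ds * fact (length ds) powr s * om' (anti ds) P"
    if P: "P \<in> S" for P ds
  proof -
    have "dops ds (dop d u) = dops (ds @ [d]) u" by (simp add: dops_append)
    then have "cmod (dops ds (dop d u) P)
        \<le> C * C ^ Suc (length ds) * fact (Suc (length ds)) powr s * om (anti ds \<or> snd d) P"
      using C(2)[OF P, of "ds @ [d]"] by (simp del: fact_Suc)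
    also have "\<dots> \<le> C * C ^ Suc (length ds) * (q ^ Suc (length ds) * fact (length ds) powr s) * om' (anti ds) P"
      using fact_Suc_powr_le[OF assms(2)] C(1) assms(3,4)[OF P] unfolding q_def
      by (intro mult_mono mult_left_mono) (auto simp del: fact_Suc)
    also have "\<dots> = K * (C * q) ^ length ds * fact (length ds) powr s * om' (anti ds) P"
      by (simp add: K_def power_mult_distrib mult_ac)
    also have "\<dots> \<le> K * K ^ length ds * fact (length ds) powr s * om' (anti ds) P"
    proof -
      have "om' (anti ds) P \<ge> 0" using order.trans[OF assms(3,4)[OF P]] .
      then show ?thesis using C(1) q K by (intro mult_right_mono mult_left_mono power_mono) auto
    qed
    finally show ?thesis .
  qed
  then show ?thesis using K(2) sm_dop assms(1) unfolding gev_def by blast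
qed

text \<open>Conjugation exchanges the two kinds of letters, so the only weight that survives is one
  bounding both \<open>om True\<close> and \<open>om False\<close>.\<close>

lemma gev_cnj:
  assumes "open D" "S \<subseteq> D" "gev s D S om u" "\<And>b P. P \<in> S \<Longrightarrow> om b P \<le> \<omega> P"
  shows "gev s D S (\<lambda>_. \<omega>) (\<lambda>x. cnj (u x))"
proof -
  obtain C where C: "C \<ge> 1"
    "\<And>P ds. P \<in> S \<Longrightarrow> cmod (dops ds u P) \<le> C * C ^ length ds * fact (length ds) powr s * om (anti ds) P"
    using assms(3) unfolding gev_def by blast
  have sm: "sm D u" using assms(3) gev_sm by blast
  have "cmod (dops ds (\<lambda>x. cnj (u x)) P) \<le> C * C ^ length ds * fact (length ds) powr s * \<omega> P" if P: "P \<in> S" for P ds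
  proof -
    have "cmod (dops ds (\<lambda>x. cnj (u x)) P) = cmod (dops (map (\<lambda>d. (fst d, \<not> snd d)) ds) u P)"
      using dops_cnj[OF assms(1) sm, of P ds] P assms(2) by auto
    also have "\<dots> \<le> C * C ^ length ds * fact (length ds) powr s * om (anti (map (\<lambda>d. (fst d, \<not> snd d)) ds)) P"
      using C(2)[OF P, of "map (\<lambda>d. (fst d, \<not> snd d)) ds"] by simp
    also have "\<dots> \<le> C * C ^ length ds * fact (length ds) powr s * \<omega> P"
      using C(1) assms(4)[OF P] by (intro mult_left_mono) auto
    finally show ?thesis .
  qed
  then show ?thesis using sm_cnj[OF assms(1) sm] C(1) unfolding gev_def by blast
qed

text \<open>The weight of almost holomorphic functions. \<open>w = 1\<close> gives the plain Gevrey
  class; \<open>w = 0\<close> makes all derivatives with an antiholomorphic letter vanish at the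
  points considered.\<close>

definition omG :: "('a \<Rightarrow> real) \<Rightarrow> bool \<Rightarrow> 'a \<Rightarrow> real" where
  "omG w b P = (if b then w P else 1)"

lemma omG_one: "omG (\<lambda>_. 1) = (\<lambda>_ _. 1)"
  by (intro ext) (simp add: omG_def)

text \<open>Values in [0, 1] give \<open>w P * w P \<le> w P\<close> and \<open>w P \<le> 1\<close>,
  which makes \<open>omG w\<close> submultiplicative along \<open>b \<or> c\<close>.\<close>

definition unit_weight :: "('a \<Rightarrow> real) \<Rightarrow> 'a set \<Rightarrow> bool" where
  "unit_weight w S \<longleftrightarrow> (\<forall>P\<in>S. 0 \<le> w P \<and> w P \<le> 1)"

lemma unit_weight_one: "unit_weight (\<lambda>_. 1) S" by (simp add: unit_weight_def)

lemma omG_props: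
  assumes "unit_weight w S" "P \<in> S"
  shows "0 \<le> omG w b P" "omG w b P \<le> 1" "w P \<le> omG w b P" "omG w b P * omG w c P \<le> omG w (b \<or> c) P"
    "omG w (b \<or> c) P \<le> omG w b P" "0 \<le> w P" "w P \<le> 1"
  using assms by (auto simp: omG_def unit_weight_def mult_le_one mult_left_le)

lemma gevG_mult:
  assumes "open D" "S \<subseteq> D" "s \<ge> 1" "unit_weight w S" "gev s D S (omG w) u" "gev s D S (omG w) v"
  shows "gev s D S (omG w) (\<lambda>x. u x * v x)"
  by (rule gev_mult[OF assms(1-3,5,6)]) (use omG_props[OF assms(4)] in auto)

lemma gevG_const:
  assumes "unit_weight w S"
  shows "gev s D S (omG w) (\<lambda>_. c)"
  using assms by (intro gev_const) (auto simp: omG_def unit_weight_def)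

lemma gevG_prod:
  assumes "open D" "S \<subseteq> D" "s \<ge> 1" "unit_weight w S" "\<And>i. i \<in> I \<Longrightarrow> gev s D S (omG w) (u i)"
  shows "gev s D S (omG w) (\<lambda>x. \<Prod>i\<in>I. u i x)"
  using assms(5)
  by (induction I rule: infinite_finite_induct) (auto intro: gevG_const[OF assms(4)] gevG_mult[OF assms(1-4)])

lemma gevG_det:
  fixes M :: "complex^'k::finite \<Rightarrow> complex^'n::finite^'n"
  assumes "open D" "S \<subseteq> D" "s \<ge> 1" "unit_weight w S" "\<And>i j. gev s D S (omG w) (\<lambda>q. M q $ i $ j)"
  shows "gev s D S (omG w) (\<lambda>q. det (M q))"
  unfolding det_def
  by (intro gev_sum gevG_mult gevG_prod gevG_const assms omG_props(1)[OF assms(4)])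

section \<open>Reciprocals and inverse matrices\<close>

lemma sum_splits_Nil:
  fixes f :: "'a list \<Rightarrow> 'a list \<Rightarrow> 'b::comm_monoid_add"
  shows "(\<Sum>(a, b)\<leftarrow>splits ds. f a b) = f [] ds + (\<Sum>(a, b)\<leftarrow>splits ds. if a = [] then 0 else f a b)"
proof (induction ds arbitrary: f)
  case (Cons d ds)
  have "(\<Sum>(a, b)\<leftarrow>splits (d # ds). if a = [] then 0 else f a b)
      = (\<Sum>(a, b)\<leftarrow>splits ds. f (d # a) b) + (\<Sum>(a, b)\<leftarrow>splits ds. if a = [] then 0 else f a (d # b))"
    by (simp add: case_prod_unfold o_def cong: if_cong)
  moreover have "(\<Sum>(a, b)\<leftarrow>splits (d # ds). f a b)
      = (\<Sum>(a, b)\<leftarrow>splits ds. f (d # a) b) + (\<Sum>(a, b)\<leftarrow>splits ds. f a (d # b))"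
    by (simp add: case_prod_unfold o_def)
  ultimately show ?case using Cons[of "\<lambda>a b. f a (d # b)"] by (simp add: add_ac)
qed simp

text \<open>For a nonempty word the derivative of u * v = 1 is zero. The term in which all letters
  fall on v is isolated by \<open>sum_splits_Nil\<close>, the others contain shorter words on v, and
  division by |u| \<ge> c gives an induction on the length.\<close>

lemma gevG_inverse:
  assumes D: "open D" and SD: "S \<subseteq> D" and s: "s \<ge> 1" and w: "unit_weight w S" and g: "gev s D S (omG w) u"
    and nz: "\<And>x. x \<in> D \<Longrightarrow> u x \<noteq> 0" and c: "c > 0" "\<And>P. P \<in> S \<Longrightarrow> c \<le> cmod (u P)"
  shows "gev s D S (omG w) (\<lambda>x. inverse (u x))"
proof -
  obtain C where C: "C \<ge> 1"
    "\<And>P ds. P \<in> S \<Longrightarrow> cmod (dops ds u P) \<le> C * C ^ length ds * fact (length ds) powr s * omG w (anti ds) P"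
    using g unfolding gev_def by blast
  have sm: "sm D u" using g gev_sm by blast
  define v where "v = (\<lambda>x. inverse (u x))"
  have smv: "sm D v" unfolding v_def by (rule sm_inverse[OF D sm nz])
  \<comment> \<open>Large enough for \<open>2 * C \<le> R\<close> and for \<open>CR\<close>, which
    closes the induction.\<close>
  define R where "R = 2 * C * (1 + C / c)"
  have R: "R \<ge> 1" "R > 0" "2 * C \<le> R"
  proof -
    have "C * 1 \<le> C * (1 + C / c)" using C c by (intro mult_left_mono) auto
    then show "R \<ge> 1" "2 * C \<le> R" "R > 0" using C unfolding R_def by linarith+
  qed
  have CR: "C / c * (2 * (C / R)) \<le> 1"
    using C c by (simp add: R_def divide_simps)
  have main: "cmod (dops ds v P) \<le> (1/c) * R ^ length ds * fact (length ds) powr s * omG w (anti ds) P"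
    if P: "P \<in> S" for P ds
  proof (induction "length ds" arbitrary: ds rule: less_induct)
    case less
    note om = omG_props[OF w P]
    show ?case
    proof (cases "ds = []")
      case True
      then show ?thesis using c(1) c(2)[OF P] by (simp add: v_def omG_def norm_divide inverse_eq_divide frac_le)
    next
      case False
      define n where "n = length ds"
      have n: "n > 0" using False by (simp add: n_def)
      have PD: "P \<in> D" using P SD by blast
      define f where "f a b = dops a u P * dops b v P" for a b
      define g where "g i j = (if i = 0 then 0 else (C * C ^ i * fact i powr s) * ((1/c) * R ^ j * fact j powr s) * omG w (anti ds) P)"
        for i j :: nat
      have "dops ds (\<lambda>x. u x * v x) P = dops ds (\<lambda>_. 1) P"
        by (rule dops_cong_open[OF D PD]) (use nz in \<open>auto simp: v_def\<close>)
      also have "\<dots> = 0" using False by (simp add: dops_const)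
      finally have "f [] ds = - (\<Sum>(a, b)\<leftarrow>splits ds. if a = [] then 0 else f a b)"
        using dops_mult[OF D sm smv PD, of ds] sum_splits_Nil[of f ds] by (simp add: f_def eq_neg_iff_add_eq_0)
      then have "cmod (f [] ds) \<le> (\<Sum>(a, b)\<leftarrow>splits ds. cmod (if a = [] then 0 else f a b))"
        by (simp only: norm_minus_cancel)
           (rule order.trans[OF norm_sum_list_le], simp add: case_prod_unfold o_def)
      also have "\<dots> \<le> (\<Sum>(a, b)\<leftarrow>splits ds. g (length a) (length b))"
      proof (rule sum_list_mono, clarify)
        fix a b assume ab: "(a, b) \<in> set (splits ds)"
        show "cmod (if a = [] then 0 else f a b) \<le> g (length a) (length b)"
        proof (cases "a = []")
          case False
          have b: "length b < length ds" using splits_length[OF ab] False by (cases a) auto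
          have "cmod (f a b) \<le> (C * C ^ length a * fact (length a) powr s * omG w (anti a) P)
              * ((1/c) * R ^ length b * fact (length b) powr s * omG w (anti b) P)"
            unfolding f_def norm_mult using C om(1) by (intro mult_mono C(2)[OF P] less[OF b]) auto
          also have "\<dots> = (C * C ^ length a * fact (length a) powr s)
              * ((1/c) * R ^ length b * fact (length b) powr s) * (omG w (anti a) P * omG w (anti b) P)" by simp
          also have "\<dots> \<le> (C * C ^ length a * fact (length a) powr s)
              * ((1/c) * R ^ length b * fact (length b) powr s) * omG w (anti ds) P"
            using om(4)[of "anti a" "anti b"] C c R unfolding anti_splits[OF ab] by (intro mult_left_mono) auto
          finally show ?thesis using False by (simp add: g_def)
        qed (simp add: g_def)
      qed
      also have "\<dots> = (\<Sum>j\<le>n. real (n choose j) * g j (n - j))"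
        using sum_list_splits[of g ds] by (simp add: n_def)
      also have "\<dots> \<le> (\<Sum>j\<le>n. (if j = 0 then 0 else C * (1/c) * R ^ n * fact n powr s * omG w (anti ds) P * (2 * (C / R)) * (1/2) ^ j))"
      proof (rule sum_mono)
        fix j assume "j \<in> {..n}"
        then have j: "j \<le> n" by simp
        show "real (n choose j) * g j (n - j) \<le> (if j = 0 then 0 else C * (1/c) * R ^ n * fact n powr s * omG w (anti ds) P * (2 * (C / R)) * (1/2) ^ j)"
        proof (cases "j = 0")
          case False
          then obtain i where i: "j = Suc i" by (cases j) auto
          have "C ^ j * R ^ (n - j) = R ^ n * (C / R) ^ j"
            using j R(2) by (simp add: power_divide power_diff field_simps)
          \<comment> \<open>Since j \<ge> 1, one factor C / R is kept apart and the remaining j - 1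
            are bounded by 1/2. The saved factor cancels C / c through \<open>CR\<close>.\<close>
          also have "(C / R) ^ j \<le> (C / R) * (1/2) ^ i"
            using C(1) R unfolding i power_Suc by (intro mult_left_mono power_mono) (auto simp: field_simps)
          also have "\<dots> = (2 * (C / R)) * (1/2) ^ j" by (simp add: i)
          finally have CRj: "C ^ j * R ^ (n - j) \<le> R ^ n * ((2 * (C / R)) * (1/2) ^ j)"
            using R(2) by simp
          have "real (n choose j) * g j (n - j) = (C * (1/c) * omG w (anti ds) P) * ((C ^ j * R ^ (n - j)) *
              (real (n choose j) * (fact j powr s * fact (0 + (n - j)) powr s)))"
            using False unfolding g_def by simp
          also have "\<dots> \<le> (C * (1/c) * omG w (anti ds) P) * ((R ^ n * ((2 * (C / R)) * (1/2) ^ j)) * fact (0 + n) powr s)"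
            using C c om(1) R(2) by (intro mult_left_mono mult_mono[OF CRj choose_fact_powr_le[OF s j]]) auto
          finally show ?thesis using False by (simp add: mult_ac)
        qed (simp add: g_def)
      qed
      also have "\<dots> = C * (1/c) * R ^ n * fact n powr s * omG w (anti ds) P * (2 * (C / R)) * (\<Sum>j\<le>n. if j = 0 then 0 else (1/2) ^ j)"
        by (simp add: sum_distrib_left if_distrib cong: if_cong)
      also have "\<dots> \<le> C * (1/c) * R ^ n * fact n powr s * omG w (anti ds) P * (2 * (C / R)) * 1"
      proof (rule mult_left_mono)
        have "(\<Sum>j\<le>n. if j = 0 then 0 else (1/2::real) ^ j) = 1 - (1/2) ^ n" by (induction n) auto
        then show "(\<Sum>j\<le>n. if j = 0 then 0 else (1/2::real) ^ j) \<le> 1" by simp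
      qed (use C c R om(1) in auto)
      also have "\<dots> = (C / c * (2 * (C / R))) * (R ^ n * fact n powr s * omG w (anti ds) P)" by simp
      also have "\<dots> \<le> 1 * (R ^ n * fact n powr s * omG w (anti ds) P)"
        using CR om(1) R by (intro mult_right_mono) auto
      finally have "cmod (u P) * cmod (dops ds v P) \<le> R ^ n * fact n powr s * omG w (anti ds) P"
        by (simp add: f_def norm_mult)
      moreover have "c * cmod (dops ds v P) \<le> cmod (u P) * cmod (dops ds v P)"
        by (rule mult_right_mono[OF c(2)[OF P]]) simp
      ultimately have "c * cmod (dops ds v P) \<le> R ^ n * fact n powr s * omG w (anti ds) P" by linarith
      then show ?thesis using c(1) by (simp add: n_def field_simps)
    qed
  qed
  have "cmod (dops ds v P) \<le> max (1/c) R * max (1/c) R ^ length ds * fact (length ds) powr s * omG w (anti ds) P"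
    if P: "P \<in> S" for P ds
    by (rule order.trans[OF main[OF P]], intro mult_right_mono mult_mono power_mono)
       (use R omG_props(1)[OF w P] c(1) in auto)
  moreover have "max (1/c) R \<ge> 1" using R by auto
  ultimately show ?thesis unfolding gev_def using smv v_def by blast
qed

text \<open>Cramer's rule for the columns of the identity matrix. It reduces the regularity of an
  inverse matrix to sums, products and one reciprocal.\<close>

lemma matrix_inv_cramer:
  fixes M :: "complex^'n::finite^'n"
  assumes "det M \<noteq> 0"
  shows "matrix_inv M $ i $ j = det (\<chi> a b. if b = i then (if a = j then 1 else 0) else M $ a $ b) * inverse (det M)"
proof -
  have inv: "invertible M" using assms invertible_det_nz by blast
  define x where "x = matrix_inv M *v axis j 1"
  have "M *v x = axis j 1"
    using someI_ex[OF inv[unfolded invertible_def]]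
    by (simp add: x_def matrix_vector_mul_assoc matrix_inv_def)
  then have "x = (\<chi> k. det (\<chi> a b. if b = k then (axis j 1::complex^'n) $ a else M $ a $ b) / det M)"
    using cramer[OF assms] by blast
  from arg_cong[where f="\<lambda>v. v $ i", OF this]
  have "x $ i = det (\<chi> a b. if b = i then (axis j 1::complex^'n) $ a else M $ a $ b) / det M"
    by (simp only: vec_lambda_beta)
  moreover have "x $ i = matrix_inv M $ i $ j"
  proof -
    have "x $ i = (\<Sum>k\<in>UNIV. if k = j then matrix_inv M $ i $ j else 0)"
      unfolding x_def matrix_vector_mult_def vec_lambda_beta
      by (rule sum.cong) (auto simp: axis_def)
    then show ?thesis by simp
  qed
  moreover have "(axis j 1::complex^'n) $ a = (if a = j then 1 else 0)" for a
    by (simp add: axis_def)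
  ultimately show ?thesis by (simp only: divide_inverse)
qed

lemma gevG_matrix_inv:
  fixes M :: "complex^'k::finite \<Rightarrow> complex^'n::finite^'n"
  assumes "open D" "S \<subseteq> D" "s \<ge> 1" "unit_weight w S" "\<And>i j. gev s D S (omG w) (\<lambda>q. M q $ i $ j)"
    and nz: "\<And>q. q \<in> D \<Longrightarrow> det (M q) \<noteq> 0" and c: "c > 0" "\<And>P. P \<in> S \<Longrightarrow> c \<le> cmod (det (M P))"
  shows "gev s D S (omG w) (\<lambda>q. matrix_inv (M q) $ i $ j)"
proof (rule gev_cong[OF assms(1,2)])
  show "gev s D S (omG w) (\<lambda>q. det (\<chi> a b. if b = i then (if a = j then 1 else 0) else M q $ a $ b) * inverse (det (M q)))"
  proof (intro gevG_mult[OF assms(1-4)] gevG_det[OF assms(1-4)] gevG_inverse[OF assms(1-4) _ nz c] assms(5))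
    show "gev s D S (omG w) (\<lambda>q. (\<chi> a b. if b = i then (if a = j then 1 else 0) else M q $ a $ b) $ a $ b)" for a b
      using assms(5) by (cases "b = i") (auto intro: gevG_const[OF assms(4)])
  qed
  show "det (\<chi> a b. if b = i then (if a = j then 1 else 0) else M q $ a $ b) * inverse (det (M q))
      = matrix_inv (M q) $ i $ j" if "q \<in> D" for q
    by (rule matrix_inv_cramer[OF nz[OF that], symmetric])
qed

text \<open>Unlike in \<open>gev\<close>, the constants are explicit, since the recursion must
  control them for all m. The shift k counts the derivatives already consumed; R stays fixed
  throughout and only k and M change.\<close>

definition jet :: "real \<Rightarrow> (complex^'k::finite) set \<Rightarrow> (complex^'k) set \<Rightarrow> (complex^'k \<Rightarrow> real) \<Rightarrow> real
    \<Rightarrow> nat \<Rightarrow> real \<Rightarrow> (complex^'k \<Rightarrow> complex) \<Rightarrow> bool" where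
  "jet s D S w R k M u \<longleftrightarrow> sm D u \<and> (\<forall>P\<in>S. \<forall>ds.
     cmod (dops ds u P) \<le> M * R ^ length ds * fact (k + length ds) powr s * omG w (anti ds) P)"

lemma jet_mult:
  assumes "open D" "S \<subseteq> D" "s \<ge> 1" "unit_weight w S" "sm D a" "C \<ge> 1" "2 * C \<le> R" "M \<ge> 0"
    and a: "\<And>P ds. P \<in> S \<Longrightarrow> cmod (dops ds a P) \<le> C * C ^ length ds * fact (length ds) powr s * omG w (anti ds) P"
    and u: "jet s D S w R k M u"
  shows "jet s D S w R k (2 * C * M) (\<lambda>x. a x * u x)"
  unfolding jet_def
proof (intro conjI ballI allI)
  have smu: "sm D u" using u by (simp add: jet_def)
  show "sm D (\<lambda>x. a x * u x)" by (rule sm_mult[OF assms(1,5) smu])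
  fix P ds assume P: "P \<in> S"
  note om = omG_props[OF assms(4) P]
  show "cmod (dops ds (\<lambda>x. a x * u x) P) \<le> 2 * C * M * R ^ length ds * fact (k + length ds) powr s * omG w (anti ds) P"
  proof (rule leibniz_bound[OF assms(1,5) smu _ assms(3), where C = C])
    fix b c assume bc: "(b, c) \<in> set (splits ds)"
    show "\<exists>x y. x * y \<le> omG w (anti ds) P \<and> 0 \<le> x \<and> 0 \<le> y \<and>
        cmod (dops b a P) \<le> C * C ^ length b * fact (length b) powr s * x \<and>
        cmod (dops c u P) \<le> M * R ^ length c * fact (k + length c) powr s * y"
      by (intro exI[of _ "omG w (anti b) P"] exI[of _ "omG w (anti c) P"] conjI a[OF P] om(1))
         (use om(4)[of "anti b" "anti c"] anti_splits[OF bc] u P in \<open>auto simp: jet_def\<close>)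
  qed (use assms P om in auto)
qed

text \<open>Pure reindexing: one more letter raises the length by one, so a factor R moves into M
  and the shift grows by one. In contrast to \<open>gev_dop\<close>, the rate R is kept.\<close>

lemma jet_dop:
  assumes "unit_weight w S" "jet s D S w R k M u" "R \<ge> 0" "M \<ge> 0"
  shows "jet s D S w R (Suc k) (R * M) (dop d u)"
  unfolding jet_def
proof (intro conjI ballI allI)
  show "sm D (dop d u)" using assms(2) by (intro sm_dop) (simp add: jet_def)
  fix P ds assume P: "P \<in> S"
  have "cmod (dops (ds @ [d]) u P) \<le> M * R ^ length (ds @ [d]) * fact (k + length (ds @ [d])) powr s * omG w (anti (ds @ [d])) P"
    using assms(2) P unfolding jet_def by blast
  also have "\<dots> \<le> M * R ^ length (ds @ [d]) * fact (k + length (ds @ [d])) powr s * omG w (anti ds) P"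
    using omG_props(5)[OF assms(1) P] assms(3,4) by (intro mult_left_mono) auto
  finally show "cmod (dops ds (dop d u) P) \<le> R * M * R ^ length ds * fact (Suc k + length ds) powr s * omG w (anti ds) P"
    by (simp add: dops_append mult_ac del: fact_Suc)
qed

lemma jet_sum:
  assumes "open D" "S \<subseteq> D" "finite I" "\<And>i. i \<in> I \<Longrightarrow> jet s D S w R k (M i) (u i)"
  shows "jet s D S w R k (\<Sum>i\<in>I. M i) (\<lambda>x. \<Sum>i\<in>I. u i x)"
  unfolding jet_def
proof (intro conjI ballI allI)
  have sm: "sm D (u i)" if "i \<in> I" for i using assms(4)[OF that] by (simp add: jet_def)
  then show "sm D (\<lambda>x. \<Sum>i\<in>I. u i x)" by (intro sm_sum[OF assms(1)])
  fix P ds assume P: "P \<in> S"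
  have "dops ds (\<lambda>x. \<Sum>i\<in>I. u i x) P = (\<Sum>i\<in>I. dops ds (u i) P)"
    by (rule dops_sum[OF assms(1) sm subsetD[OF assms(2) P]])
  also have "cmod \<dots> \<le> (\<Sum>i\<in>I. M i * R ^ length ds * fact (k + length ds) powr s * omG w (anti ds) P)"
    by (rule sum_norm_le) (use assms(4) P in \<open>auto simp: jet_def\<close>)
  finally show "cmod (dops ds (\<lambda>x. \<Sum>i\<in>I. u i x) P)
      \<le> (\<Sum>i\<in>I. M i) * R ^ length ds * fact (k + length ds) powr s * omG w (anti ds) P"
    by (simp add: sum_distrib_right)
qed

lemma gev_uniform:
  assumes "finite I" "\<And>i. i \<in> I \<Longrightarrow> gev s D S om (u i)" "\<And>b P. P \<in> S \<Longrightarrow> om b P \<ge> 0"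
  shows "\<exists>C\<ge>1. \<forall>i\<in>I. \<forall>P\<in>S. \<forall>ds. cmod (dops ds (u i) P) \<le> C * C ^ length ds * fact (length ds) powr s * om (anti ds) P"
proof -
  have "\<exists>C. \<forall>i\<in>I. C i \<ge> 1 \<and> (\<forall>P\<in>S. \<forall>ds. cmod (dops ds (u i) P) \<le> C i * C i ^ length ds * fact (length ds) powr s * om (anti ds) P)"
    using assms(2) unfolding gev_def by (intro bchoice) blast
  then obtain C where C: "\<And>i. i \<in> I \<Longrightarrow> C i \<ge> 1"
    "\<And>i P ds. i \<in> I \<Longrightarrow> P \<in> S \<Longrightarrow> cmod (dops ds (u i) P) \<le> C i * C i ^ length ds * fact (length ds) powr s * om (anti ds) P"
    by blast
  define B where "B = 1 + (\<Sum>i\<in>I. C i)"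
  have B: "C i \<le> B" if "i \<in> I" for i
    using member_le_sum[of i I C] that C(1) assms(1) by (fastforce simp: B_def)
  have "B \<ge> 1" using C(1) sum_nonneg[of I C] by (force simp: B_def)
  moreover have "cmod (dops ds (u i) P) \<le> B * B ^ length ds * fact (length ds) powr s * om (anti ds) P"
    if "i \<in> I" "P \<in> S" for i P ds
    by (rule order.trans[OF C(2)[OF that]])
       (use B[OF that(1)] C(1)[OF that(1)] assms(3)[OF that(2)] in \<open>auto intro!: mult_right_mono mult_mono power_mono\<close>)
  ultimately show ?thesis by blast
qed

lemma jet_vector_field:
  fixes c :: "'k::finite \<times> bool \<Rightarrow> complex^'k \<Rightarrow> complex"
  assumes "open D" "S \<subseteq> D" "s \<ge> 1" "unit_weight w S" "\<And>d. sm D (c d)" "C \<ge> 1" "2 * C \<le> R" "M \<ge> 0"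
    and c: "\<And>d P ds. P \<in> S \<Longrightarrow> cmod (dops ds (c d) P) \<le> C * C ^ length ds * fact (length ds) powr s * omG w (anti ds) P"
    and u: "jet s D S w R k M u"
  shows "jet s D S w R (Suc k) (real CARD('k \<times> bool) * (2 * C * R) * M) (\<lambda>x. \<Sum>d\<in>UNIV. c d x * dop d u x)"
proof -
  have "jet s D S w R (Suc k) (\<Sum>d\<in>(UNIV :: ('k \<times> bool) set). 2 * C * (R * M)) (\<lambda>x. \<Sum>d\<in>UNIV. c d x * dop d u x)"
    by (intro jet_sum[OF assms(1,2)] jet_mult[OF assms(1-4)] jet_dop[OF assms(4)]) (use assms in auto)
  then show ?thesis by (simp add: mult_ac)
qed

section \<open>Multi-indices and words\<close>

text \<open>\<open>rev\<close> because \<open>fold\<close> in \<open>multi_deriv\<close> applies the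
  first entry of \<open>index_enum\<close> innermost, while the head of a word is outermost.\<close>

definition mi_word :: "bool \<Rightarrow> ('k::finite \<Rightarrow> nat) \<Rightarrow> ('k \<times> bool) list" where
  "mi_word fl \<alpha> = concat (map (\<lambda>j. replicate (\<alpha> j) (j, fl)) (rev index_enum))"

lemma index_enum: "distinct (index_enum :: 'k::finite list)" "set (index_enum :: 'k list) = UNIV"
proof -
  have "\<exists>xs :: 'k list. distinct xs \<and> set xs = UNIV"
    using finite_distinct_list[OF finite_class.finite_UNIV] by blast
  from someI_ex[OF this] show "distinct (index_enum :: 'k::finite list)" "set (index_enum :: 'k list) = UNIV"
    by (auto simp: index_enum_def)
qed

lemma dops_replicate: "dops (replicate n d) f = (dop d ^^ n) f"
  by (induction n) auto

lemma fold_dop: "fold (\<lambda>j. dop (j, fl) ^^ \<alpha> j) xs f = dops (concat (map (\<lambda>j. replicate (\<alpha> j) (j, fl)) (rev xs))) f"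
  by (induction xs arbitrary: f) (auto simp: dops_append dops_replicate)

lemma DD_eq_dops:
  fixes \<alpha> :: "'k::finite \<Rightarrow> nat"
  shows "DD \<alpha> \<beta> f = dops (mi_word False \<alpha> @ mi_word True \<beta>) f"
  unfolding DD_def multi_deriv_def mi_word_def dops_append fold_dop[symmetric] by (simp add: dop_def)

lemma sum_list_index_enum: "(\<Sum>j\<leftarrow>rev (index_enum::'k::finite list). f j) = (\<Sum>j\<in>UNIV. f j)"
  using sum_list_distinct_conv_sum_set[of "rev (index_enum::'k list)" f] index_enum[where 'k='k] by simp

lemma count_concat_replicate:
  "count (mset (concat (map (\<lambda>j. replicate (\<alpha> j) (j, fl)) xs))) (i, b) = (if b = fl then (\<Sum>j\<leftarrow>xs. if j = i then \<alpha> j else 0) else 0)"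
  by (induction xs) auto

lemma count_mi_word: "count (mset (mi_word fl \<alpha>)) (i, b) = (if b = fl then \<alpha> i else 0)"
  unfolding mi_word_def count_concat_replicate sum_list_index_enum by simp

lemma length_mi_word: "length (mi_word fl \<alpha>) = mi_abs \<alpha>"
  by (simp add: mi_word_def length_concat o_def sum_list_index_enum mi_abs_def)

lemma anti_mi_word: "anti (mi_word fl \<alpha>) \<longleftrightarrow> fl \<and> mi_abs \<alpha> \<noteq> 0"
  using index_enum[where 'k='a] by (auto simp: anti_def mi_word_def mi_abs_def)

text \<open>Normal form of a word. Together with \<open>dops_perm\<close> it transfers bounds known
  for multi-indices, as in \<open>gevrey_with\<close>, to arbitrary words.\<close>

lemma mset_eq_mi_words:
  fixes ds :: "('k::finite \<times> bool) list"
  shows "mset ds = mset (mi_word False (\<lambda>i. count (mset ds) (i, False)) @ mi_word True (\<lambda>i. count (mset ds) (i, True)))"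
proof (rule multiset_eqI)
  fix x :: "'k \<times> bool"
  obtain i b where "x = (i, b)" by (cases x)
  then show "count (mset ds) x = count (mset (mi_word False (\<lambda>i. count (mset ds) (i, False))
      @ mi_word True (\<lambda>i. count (mset ds) (i, True)))) x"
    by (cases b) (simp_all add: count_mi_word)
qed

section \<open>Series of smooth functions\<close>

text \<open>For each word the M-test, applied to the words with one letter more, gives the uniform
  convergence of derivatives that \<open>has_derivative_series\<close> asks for on a convex set.
  Thus \<open>dop d (U ds) = U (d # ds)\<close> on S, and induction on the word identifies
  \<open>U ds\<close> with the derivative of the sum.\<close>

lemma series_dops:
  fixes u :: "nat \<Rightarrow> complex^'k::finite \<Rightarrow> complex"
  assumes S: "open S" "convex S" and sm: "\<And>k. sm S (u k)"
    and M: "\<And>ds. summable (M ds)" "\<And>ds k v. v \<in> S \<Longrightarrow> cmod (dops ds (u k) v) \<le> M ds k"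
  shows "sm S (\<lambda>v. \<Sum>k. u k v)"
    and "v \<in> S \<Longrightarrow> dops ds (\<lambda>v. \<Sum>k. u k v) v = (\<Sum>k. dops ds (u k) v)"
proof -
  define U where "U ds v = (\<Sum>k. dops ds (u k) v)" for ds v
  have summ: "summable (\<lambda>k. dops ds (u k) v)" if "v \<in> S" for ds v
    by (rule summable_comparison_test'[OF M(1), of 0]) (use M(2) that in auto)
  define G where "G ds v h = (\<Sum>i\<in>UNIV. h $ i * U ((i,False) # ds) v + cnj (h $ i) * U ((i,True) # ds) v)"
    for ds v and h :: "complex^'k"
  define F where "F ds k v h = (\<Sum>i\<in>UNIV. h $ i * dop (i,False) (dops ds (u k)) v + cnj (h $ i) * dop (i,True) (dops ds (u k)) v)"
    for ds k v and h :: "complex^'k"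
  have der: "(U ds has_derivative G ds v) (at v)" if v: "v \<in> S" for ds v
  proof -
    have "\<exists>g. \<forall>x\<in>S. (\<lambda>n. dops ds (u n) x) sums g x \<and> (g has_derivative G ds x) (at x within S)"
    proof (rule has_derivative_series[OF S(2)])
      show "(dops ds (u k) has_derivative F ds k x) (at x within S)" if x: "x \<in> S" for k x
      proof -
        obtain f' where f': "(dops ds (u k) has_derivative f') (at x)"
          using sm_differentiable[OF sm_dops[OF sm] x] by (auto simp: differentiable_def)
        have "f' = F ds k x" unfolding F_def by (rule ext) (rule has_derivative_Wirtinger[OF f'])
        then show ?thesis using f' has_derivative_at_withinI by blast
      qed
      show "\<forall>\<^sub>F n in sequentially. \<forall>x\<in>S. \<forall>h. norm ((\<Sum>i<n. F ds i x h) - G ds x h) \<le> e * norm h" if e: "e > 0" for e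
      proof -
        \<comment> \<open>There are two Wirtinger terms for each of the \<open>CARD('k)\<close>
          coordinates.\<close>
        define e' where "e' = e / real (2 * CARD('k))"
        have e': "e' > 0" using e by (simp add: e'_def)
        have "\<forall>\<^sub>F n in sequentially. \<forall>x\<in>S. dist (\<Sum>k<n. dops (d # ds) (u k) x) (U (d # ds) x) < e'" for d
        proof -
          have "uniform_limit S (\<lambda>n x. \<Sum>k<n. dops (d # ds) (u k) x) (\<lambda>x. \<Sum>k. dops (d # ds) (u k) x) sequentially"
            by (rule Weierstrass_m_test[OF M(2) M(1)])
          then show ?thesis using e' unfolding U_def uniform_limit_iff by blast
        qed
        then have "\<forall>\<^sub>F n in sequentially. \<forall>d\<in>UNIV. \<forall>x\<in>S. dist (\<Sum>k<n. dops (d # ds) (u k) x) (U (d # ds) x) < e'"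
          by (intro eventually_ball_finite) auto
        then show ?thesis
        proof eventually_elim
          case (elim n)
          show ?case
          proof (intro ballI allI)
            fix x and h :: "complex^'k" assume x: "x \<in> S"
            define E where "E d = (\<Sum>k<n. dops (d # ds) (u k) x) - U (d # ds) x" for d
            have E: "cmod (E d) \<le> e'" for d using elim x by (auto simp: E_def dist_norm less_imp_le)
            have "(\<Sum>k<n. F ds k x h) - G ds x h = (\<Sum>i\<in>UNIV. h $ i * E (i,False) + cnj (h $ i) * E (i,True))"
              unfolding F_def G_def E_def
              by (subst sum.swap) (simp add: sum.distrib sum_distrib_left sum_subtractf algebra_simps)
            also have "cmod \<dots> \<le> (\<Sum>i\<in>(UNIV::'k set). 2 * e' * norm h)"
            proof (rule sum_norm_le)
              fix i
              have hi: "cmod (h $ i) \<le> norm h" by (rule Finite_Cartesian_Product.norm_nth_le)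
              have "cmod (h $ i * E (i,False) + cnj (h $ i) * E (i,True)) \<le> cmod (h $ i) * cmod (E (i,False)) + cmod (h $ i) * cmod (E (i,True))"
                by (rule order.trans[OF norm_triangle_ineq]) (simp add: norm_mult)
              also have "\<dots> \<le> norm h * e' + norm h * e'"
                using E hi e' by (intro add_mono mult_mono) auto
              finally show "cmod (h $ i * E (i,False) + cnj (h $ i) * E (i,True)) \<le> 2 * e' * norm h" by simp
            qed
            also have "\<dots> = e * norm h" by (simp add: e'_def)
            finally show "norm ((\<Sum>i<n. F ds i x h) - G ds x h) \<le> e * norm h" .
          qed
        qed
      qed
      show "v \<in> S" by (rule v)
      show "(\<lambda>n. dops ds (u n) v) sums U ds v" unfolding U_def by (rule summable_sums[OF summ[OF v]])
    qed
    then obtain g where g: "\<And>x. x \<in> S \<Longrightarrow> (\<lambda>n. dops ds (u n) x) sums g x"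
      "\<And>x. x \<in> S \<Longrightarrow> (g has_derivative G ds x) (at x within S)" by blast
    have "(g has_derivative G ds v) (at v)" using g(2)[OF v] at_within_open[OF v S(1)] by simp
    then show ?thesis
      by (rule has_derivative_transform_within_open[OF _ S(1) v]) (use g(1) in \<open>auto simp: U_def sums_iff\<close>)
  qed
  have dU: "dop d (U ds) v = U (d # ds) v" if "v \<in> S" for d ds v
    unfolding dop_Wirtinger_form[OF der[OF that, unfolded G_def]] by (cases d) auto
  have main: "dops ds (U []) v = U ds v" if "v \<in> S" for ds v using that
  proof (induction ds arbitrary: v)
    case (Cons d ds)
    show ?case using dop_cong_open[OF S(1) Cons.prems Cons.IH] dU[OF Cons.prems] by simp
  qed simp
  have U0: "U [] = (\<lambda>v. \<Sum>k. u k v)" by (rule ext) (simp add: U_def)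
  show "v \<in> S \<Longrightarrow> dops ds (\<lambda>v. \<Sum>k. u k v) v = (\<Sum>k. dops ds (u k) v)"
    using main[of v ds] U0 by (simp add: U_def)
  show "sm S (\<lambda>v. \<Sum>k. u k v)"
  proof (rule sm_I)
    fix ds x assume x: "x \<in> S"
    have "U ds differentiable (at x)" using der[OF x] by (auto simp: differentiable_def)
    then show "dops ds (\<lambda>v. \<Sum>k. u k v) differentiable (at x)"
      unfolding U0[symmetric] by (rule differentiable_cong_open[OF S(1) x main[symmetric], rotated])
  qed
qed

section \<open>Factorials and powers\<close>

lemma power_le_fact_exp:
  assumes "(x::real) \<ge> 0"
  shows "x ^ n \<le> fact n * exp x"
proof -
  have s: "(\<lambda>n. x ^ n / fact n) sums exp x"
    using exp_converges[of x] by (simp add: divide_inverse mult.commute)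
  have "x ^ n / fact n = (\<Sum>k\<in>{n}. x ^ k / fact k)" by simp
  also have "\<dots> \<le> exp x"
    using sum_le_suminf[of "\<lambda>n. x ^ n / fact n" "{n}"] s assms by (auto simp: sums_iff)
  finally show ?thesis by (simp add: field_simps)
qed

lemma power_le_fact_exp_scaled:
  assumes "(x::real) \<ge> 0" "\<eta> > 0"
  shows "x ^ n \<le> (1/\<eta>) ^ n * fact n * exp (\<eta> * x)"
proof -
  have "(\<eta> * x) ^ n \<le> fact n * exp (\<eta> * x)" using assms by (intro power_le_fact_exp) simp
  then show ?thesis using assms by (simp add: power_mult_distrib field_simps)
qed

text \<open>Trades n factors x^p for n!^p and an exponential in x. With \<eta> small, that
  exponential is later absorbed by the geometric decay in the degree.\<close>

lemma powr_power_le_fact_exp: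
  assumes "(x::real) > 0" "\<eta> > 0" "p \<ge> 0"
  shows "(x powr p) ^ n \<le> ((1/\<eta>) powr p) ^ n * fact n powr p * exp (p * \<eta> * x)"
proof -
  have "(x powr p) ^ n = (x ^ n) powr p" using assms by (simp add: power_powr_swap)
  also have "\<dots> \<le> ((1/\<eta>) ^ n * fact n * exp (\<eta> * x)) powr p"
    using assms by (intro powr_mono2 power_le_fact_exp_scaled) auto
  also have "\<dots> = ((1/\<eta>) powr p) ^ n * fact n powr p * exp (p * \<eta> * x)"
    using assms by (simp add: powr_mult power_powr_swap) (simp add: powr_def mult_ac)
  finally show ?thesis .
qed

text \<open>A weak Stirling bound, k! \<le> 2 (k/2)^k, from Bernoulli's inequality (1 + 1/k)^k \<ge>
  2. The gain 2^(-k) is the source of the geometric decay of the layers.\<close>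

lemma fact_le_half_power: "fact k * 2 ^ k \<le> 2 * real k ^ k"
proof (induction k)
  case (Suc k)
  show ?case
  proof (cases "k = 0")
    case False
    have "2 * real k ^ k \<le> real (Suc k) ^ k"
    proof -
      have "2 = 1 + real k * (1 / real k)" using False by simp
      also have "\<dots> \<le> (1 + 1 / real k) ^ k"
      proof (rule Bernoulli_inequality)
        have "0 \<le> 1 / real k" by simp
        then show "- 1 \<le> 1 / real k" by linarith
      qed
      finally have "2 * real k ^ k \<le> (1 + 1 / real k) ^ k * real k ^ k"
        by (intro mult_right_mono) auto
      also have "\<dots> = real (Suc k) ^ k"
        using False by (simp add: power_mult_distrib[symmetric] field_simps)
      finally show ?thesis .
    qed
    have "fact (Suc k) * 2 ^ Suc k = 2 * real (Suc k) * (fact k * 2 ^ k)" by simp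
    also have "\<dots> \<le> 2 * real (Suc k) * (2 * real k ^ k)"
      using Suc by (intro mult_left_mono) auto
    also have "\<dots> \<le> 2 * real (Suc k) * real (Suc k) ^ k"
      using \<open>2 * real k ^ k \<le> real (Suc k) ^ k\<close> by (intro mult_left_mono) auto
    finally show ?thesis by (simp only: power_Suc mult.assoc)
  qed simp
qed simp

lemma fact_add_le: "(fact (m + n) :: real) \<le> 2 ^ (m + n) * (fact m * fact n)"
proof -
  have "(fact (m + n) :: real) = real ((m + n) choose m) * (fact m * fact n)"
    using binomial_fact_lemma[of m "m + n"]
    by (metis add_diff_cancel_left' le_add1 mult.commute of_nat_fact of_nat_mult)
  also have "\<dots> \<le> 2 ^ (m + n) * (fact m * fact n)"
  proof (rule mult_right_mono)
    have "real ((m + n) choose m) \<le> real (2 ^ (m + n))"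
      by (rule of_nat_mono) (rule binomial_le_pow2)
    then show "real ((m + n) choose m) \<le> 2 ^ (m + n)" by simp
  qed simp
  finally show ?thesis .
qed

lemma prod_fact_le_fact_sum: "finite I \<Longrightarrow> (\<Prod>i\<in>I. fact (c i) :: real) \<le> fact (\<Sum>i\<in>I. c i)"
proof (induction I rule: finite_induct)
  case (insert i I)
  have "fact (c i) * fact (\<Sum>i\<in>I. c i) \<le> (fact (c i + (\<Sum>i\<in>I. c i)) :: real)"
    by (metis fact_fact_dvd_fact dvd_imp_le fact_gt_zero of_nat_fact of_nat_le_iff of_nat_mult)
  moreover have "fact (c i) * (\<Prod>i\<in>I. fact (c i) :: real) \<le> fact (c i) * fact (\<Sum>i\<in>I. c i)"
    using insert by (intro mult_left_mono) auto
  ultimately show ?case using insert(1,2) by (simp, linarith)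
qed simp

lemma fact_sum_le_prod_fact:
  "finite I \<Longrightarrow> (fact (\<Sum>i\<in>I. c i) :: real) \<le> (2 ^ card I) ^ (\<Sum>i\<in>I. c i) * (\<Prod>i\<in>I. fact (c i))"
proof (induction I rule: finite_induct)
  case (insert i I)
  define s where "s = (\<Sum>i\<in>I. c i)"
  have "(fact (c i + s) :: real) \<le> 2 ^ (c i + s) * (fact (c i) * fact s)" by (rule fact_add_le)
  also have "\<dots> \<le> 2 ^ (c i + s) * (fact (c i) * ((2 ^ card I) ^ (c i + s) * (\<Prod>i\<in>I. fact (c i))))"
  proof (intro mult_left_mono)
    have "(fact s :: real) \<le> (2 ^ card I) ^ s * (\<Prod>i\<in>I. fact (c i))" using insert by (simp add: s_def)
    also have "\<dots> \<le> (2 ^ card I) ^ (c i + s) * (\<Prod>i\<in>I. fact (c i))"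
      by (intro mult_right_mono power_increasing prod_nonneg) auto
    finally show "(fact s :: real) \<le> (2 ^ card I) ^ (c i + s) * (\<Prod>i\<in>I. fact (c i))" .
  qed auto
  also have "\<dots> = (2 ^ card (insert i I)) ^ (c i + s) * (\<Prod>i\<in>insert i I. fact (c i))"
    using insert(1,2) by (simp add: power_mult_distrib)
  finally show ?case using insert(1,2) by (simp add: s_def)
qed simp

lemma finite_mi_abs: "finite {\<gamma> :: 'k::finite \<Rightarrow> nat. mi_abs \<gamma> = k}"
  and card_mi_abs: "card {\<gamma> :: 'k::finite \<Rightarrow> nat. mi_abs \<gamma> = k} \<le> (k + 1) ^ CARD('k)"
proof -
  have sub: "{\<gamma> :: 'k \<Rightarrow> nat. mi_abs \<gamma> = k} \<subseteq> PiE UNIV (\<lambda>_. {..k})"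
    by (auto simp: mi_abs_def intro: member_le_sum)
  have fin: "finite (PiE (UNIV::'k set) (\<lambda>_. {..k}))" by (intro finite_PiE) auto
  show "finite {\<gamma> :: 'k::finite \<Rightarrow> nat. mi_abs \<gamma> = k}" using finite_subset[OF sub fin] .
  show "card {\<gamma> :: 'k::finite \<Rightarrow> nat. mi_abs \<gamma> = k} \<le> (k + 1) ^ CARD('k)"
    using card_mono[OF fin sub] by (simp add: card_PiE)
qed

section \<open>The coordinates of the extension\<close>

definition yv :: "complex^('n::finite + 'n) \<Rightarrow> complex^'n" where "yv v = (\<chi> i. v $ Inl i)"
definition zv :: "complex^('n::finite + 'n) \<Rightarrow> complex^'n" where "zv v = (\<chi> i. v $ Inr i)"
definition D2 :: "real \<Rightarrow> (complex^('n::finite + 'n)) set" where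
  "D2 r = {v. yv v \<in> ball 0 r \<and> zv v \<in> ball 0 r}"
definition mid :: "complex^('n::finite + 'n) \<Rightarrow> complex^'n" where
  "mid v = (1/2) *\<^sub>R (yv v + cnjv (zv v))"
definition rho :: "complex^('n::finite + 'n) \<Rightarrow> real" where
  "rho v = norm (yv v - cnjv (zv v))"
text \<open>The variables of the Taylor expansion: (y_i - cnj z_i)/2 for \<open>False\<close> and
  (z_i - cnj y_i)/2 for \<open>True\<close>. They vanish where z = cnj y, and the second is minus
  the conjugate of the first.\<close>

definition lin :: "'n::finite \<times> bool \<Rightarrow> complex^('n + 'n) \<Rightarrow> complex" where
  "lin e v = (1/2) * (if snd e then v $ Inr (fst e) - cnj (v $ Inl (fst e)) else v $ Inl (fst e) - cnj (v $ Inr (fst e)))"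

text \<open>
  \<open>mid\<close> depends on \<open>y\<^sub>i\<close> and \<open>cnj z\<^sub>i\<close> holomorphically, on \<open>cnj y\<^sub>i\<close> and \<open>z\<^sub>i\<close>
  antiholomorphically; \<open>mdir d\<close> is the derivative of \<open>f\<close> that \<open>d\<close> induces on \<open>f \<circ> mid\<close>.
\<close>

definition mdir :: "('n + 'n) \<times> bool \<Rightarrow> 'n \<times> bool" where
  "mdir d = (case fst d of Inl i \<Rightarrow> (i, snd d) | Inr i \<Rightarrow> (i, \<not> snd d))"

lemma linear_yv: "linear yv" and linear_zv: "linear zv"
  by (auto intro!: linearI simp: yv_def zv_def vec_eq_iff)

lemma norm_cnjv [simp]: "norm (cnjv z) = norm z"
  by (simp add: cnjv_def norm_vec_def L2_set_def)

lemma D2_eq: "D2 r = (yv -` ball 0 r) \<inter> (zv -` ball 0 r)"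
  by (auto simp: D2_def)

lemma open_D2: "open (D2 r)"
  unfolding D2_eq
  by (intro open_Int open_vimage open_ball linear_continuous_on)
     (simp_all add: linear_conv_bounded_linear[symmetric] linear_yv linear_zv)

lemma convex_D2: "convex (D2 r)"
  unfolding D2_eq by (intro convex_Int convex_linear_vimage linear_yv linear_zv convex_ball)

lemma mid_in_ball: "v \<in> D2 r \<Longrightarrow> mid v \<in> ball 0 r"
proof -
  assume "v \<in> D2 r"
  then have "norm (yv v) < r" "norm (zv v) < r" by (auto simp: D2_def)
  moreover have "norm (mid v) \<le> (norm (yv v) + norm (zv v)) / 2"
    unfolding mid_def using norm_triangle_ineq[of "yv v" "cnjv (zv v)"] by simp
  ultimately show ?thesis by simp
qed

lemma mid_nth: "mid v $ i = (1/2) * (v $ Inl i + cnj (v $ Inr i))"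
  by (simp add: mid_def yv_def zv_def cnjv_def vector_scaleR_component) (simp add: scaleR_conv_of_real)

lemma differentiable_cnj_coord: "(\<lambda>x. cnj (x $ i)) differentiable (at w)"
  by (intro differentiable_cnj differentiable_coord)

lemma sm_mid: "sm UNIV (\<lambda>v. mid v $ i)"
  unfolding mid_nth by (intro sm_mult sm_const sm_add sm_cnj sm_coord open_UNIV)

lemma dop_diff:
  assumes "u differentiable (at w)" "v differentiable (at w)"
  shows "dop d (\<lambda>x. u x - v x) w = dop d u w - dop d v w"
  using dop_add[OF assms(1), of "\<lambda>x. (-1) * v x" d] dop_cmult[OF assms(2), of d "-1"] assms(2)
  by simp

lemma dop_mid_nth: "dop d (\<lambda>v. mid v $ i) v = (if mdir d = (i, False) then 1/2 else 0)"
proof -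
  have "dop d (\<lambda>v. mid v $ i) v = (1/2) * ((if d = (Inl i, False) then 1 else 0) + (if d = (Inr i, True) then 1 else 0))"
    unfolding mid_nth
    by (subst dop_cmult, intro differentiable_add differentiable_coord differentiable_cnj_coord)
       (simp only: dop_add differentiable_coord differentiable_cnj_coord dop_coord dop_cnj_coord)
  then show ?thesis by (cases d) (auto simp: mdir_def split: sum.splits)
qed

lemma dop_cnj_mid_nth: "dop d (\<lambda>v. cnj (mid v $ i)) v = (if mdir d = (i, True) then 1/2 else 0)"
proof -
  have "dop d (\<lambda>v. cnj (mid v $ i)) v = cnj (dop (fst d, \<not> snd d) (\<lambda>v. mid v $ i) v)"
    by (rule dop_cnj) (rule sm_differentiable[OF sm_mid], simp)
  then show ?thesis by (cases d) (auto simp: mdir_def dop_mid_nth split: sum.splits)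
qed

lemma dop_mid:
  assumes "g differentiable (at (mid v))"
  shows "dop d (\<lambda>v. g (mid v)) v = (1/2) * dop (mdir d) g (mid v)"
proof -
  have "mid differentiable (at v)"
    by (intro differentiable_componentwise) (rule sm_differentiable[OF sm_mid], simp)
  from dop_chain[OF assms this, of d]
  have "dop d (\<lambda>v. g (mid v)) v = (\<Sum>i\<in>UNIV. dop (i, False) g (mid v) * (if mdir d = (i, False) then 1/2 else 0)
      + dop (i, True) g (mid v) * (if mdir d = (i, True) then 1/2 else 0))"
    unfolding dop_mid_nth dop_cnj_mid_nth .
  also have "\<dots> = (\<Sum>i\<in>UNIV. if i = fst (mdir d) then (1/2) * dop (mdir d) g (mid v) else 0)"
  proof (rule sum.cong)
    obtain j b where "mdir d = (j, b)" by (cases "mdir d")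
    then show "dop (i, False) g (mid v) * (if mdir d = (i, False) then 1/2 else 0)
        + dop (i, True) g (mid v) * (if mdir d = (i, True) then 1/2 else 0)
        = (if i = fst (mdir d) then (1/2) * dop (mdir d) g (mid v) else 0)" for i
      by (cases b) auto
  qed simp
  finally show ?thesis by simp
qed

lemma sm_comp_mid: "sm (ball 0 r) g \<Longrightarrow> sm (D2 r) (\<lambda>v. g (mid v))"
  by (rule sm_compose[OF open_D2 _ sm_subset[OF sm_mid]]) (auto intro: mid_in_ball simp del: mem_ball)

text \<open>Each letter moves exactly one coordinate of \<open>mid\<close>, or its conjugate, with
  factor 1/2. The chain rule has a single term, and words go to words.\<close>

lemma dops_mid:
  assumes "sm (ball 0 r) g" "v \<in> D2 r"
  shows "dops ds (\<lambda>v. g (mid v)) v = (1/2) ^ length ds * dops (map mdir ds) g (mid v)"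
  using assms(2)
proof (induction ds arbitrary: v)
  case (Cons d ds)
  have df: "dops (map mdir ds) g differentiable (at (mid v))"
    using sm_differentiable[OF sm_dops[OF assms(1)]] mid_in_ball[OF Cons.prems] .
  have "(\<lambda>v. dops (map mdir ds) g (mid v)) differentiable (at v)"
    using sm_differentiable[OF sm_comp_mid[OF sm_dops[OF assms(1)]] Cons.prems] .
  then show ?case using dop_cong_open[OF open_D2 Cons.prems Cons.IH] by (simp add: dop_cmult dop_mid[OF df])
qed simp

lemma sm_lin: "sm S (lin e)"
proof -
  have "sm UNIV (\<lambda>v. (1/2) * (v $ i + (-1) * cnj (v $ j)))" for i j
    by (intro sm_mult sm_const sm_add sm_cnj sm_coord open_UNIV)
  then have "sm UNIV (lin e)" unfolding lin_def[abs_def] by (cases "snd e") auto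
  then show ?thesis using sm_subset by blast
qed

text \<open>The letters acting on the form e are those with \<open>mdir d = e\<close>, the same ones
  that induce the derivative e on functions of \<open>mid\<close>. The sign is negative for
  antiholomorphic letters, which makes the derivatives of the Taylor polynomials telescope.\<close>

lemma dop_lin: "dop d (lin e) = (\<lambda>_. if mdir d = e then (if snd d then -1/2 else 1/2) else 0)"
proof
  fix v
  have *: "dop d (\<lambda>v. (1/2) * (v $ i - cnj (v $ j))) v
      = (1/2) * ((if d = (i, False) then 1 else 0) - (if d = (j, True) then 1 else 0))" for i j
    by (subst dop_cmult, intro differentiable_diff differentiable_coord differentiable_cnj_coord)
       (simp only: dop_diff differentiable_coord differentiable_cnj_coord dop_coord dop_cnj_coord)
  show "dop d (lin e) v = (if mdir d = e then (if snd d then -1/2 else 1/2) else 0)"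
  proof (cases e)
    case (Pair i b)
    have "lin (i, False) = (\<lambda>v. (1/2) * (v $ Inl i - cnj (v $ Inr i)))"
      "lin (i, True) = (\<lambda>v. (1/2) * (v $ Inr i - cnj (v $ Inl i)))"
      unfolding lin_def by simp_all
    then have E: "dop d (lin e) v = (1/2) * (if b then (if d = (Inr i, False) then 1 else 0) - (if d = (Inl i, True) then 1 else 0)
        else (if d = (Inl i, False) then 1 else 0) - (if d = (Inr i, True) then 1 else 0))"
      unfolding Pair by (cases b) (simp_all only: * if_True if_False)
    show ?thesis unfolding E unfolding Pair
      by (cases d; cases "fst d"; cases "snd d"; cases b) (auto simp: mdir_def)
  qed
qed

lemma lin_True: "lin (i, True) v = - cnj (lin (i, False) v)"
  by (simp add: lin_def diff_divide_distrib)

text \<open>The squared distance is a polynomial in the linear forms, hence smooth also where it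
  vanishes; this is why the argument of the cut-off is quadratic.\<close>

lemma rho_sq: "of_real ((rho v)\<^sup>2) = (\<Sum>i\<in>UNIV. (-4) * (lin (i, False) v * lin (i, True) v))"
proof -
  have "(rho v)\<^sup>2 = (\<Sum>i\<in>UNIV. (cmod (v $ Inl i - cnj (v $ Inr i)))\<^sup>2)"
    by (simp add: rho_def norm_vec_def L2_set_def yv_def zv_def cnjv_def sum_nonneg)
  also have "of_real \<dots> = (\<Sum>i\<in>UNIV. (-4) * (lin (i, False) v * lin (i, True) v))"
    unfolding of_real_sum
  proof (rule sum.cong)
    fix i
    have "v $ Inl i - cnj (v $ Inr i) = 2 * lin (i, False) v" by (simp add: lin_def)
    then show "of_real ((cmod (v $ Inl i - cnj (v $ Inr i)))\<^sup>2) = (-4) * (lin (i, False) v * lin (i, True) v)"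
      unfolding complex_norm_square lin_True by simp
  qed simp
  finally show ?thesis .
qed

lemma cmod_lin_le: "cmod (lin e v) \<le> rho v / 2"
proof -
  have "cmod (lin (i, False) v) \<le> rho v / 2" for i
  proof -
    have "cmod ((yv v - cnjv (zv v)) $ i) \<le> rho v" unfolding rho_def by (rule Finite_Cartesian_Product.norm_nth_le)
    then show ?thesis by (simp add: lin_def yv_def zv_def cnjv_def norm_mult)
  qed
  then show ?thesis by (cases e; cases "snd e") (auto simp: lin_True)
qed

definition pw :: "('n::finite \<times> bool \<Rightarrow> nat) \<Rightarrow> complex^('n + 'n) \<Rightarrow> complex" where
  "pw \<gamma> v = (\<Prod>e\<in>UNIV. lin e v ^ \<gamma> e)"

lemma sm_pw: "sm UNIV (pw \<gamma>)"
  unfolding pw_def[abs_def] by (intro sm_prod sm_power sm_lin open_UNIV)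

lemma dops_lin_bound:
  assumes h: "h > 0" "cmod (lin e v) \<le> h"
  shows "cmod (dops ds (lin e) v) \<le> h * (1/h) ^ length ds"
proof (cases ds rule: rev_cases)
  case (snoc ds' d)
  then show ?thesis using h(1)
    by (cases "ds' = []") (auto simp: dops_append dop_lin dops_const)
qed (use h in simp)

lemma dops_lin_power_bound:
  assumes h: "h > 0" "cmod (lin e v) \<le> h"
  shows "cmod (dops ds (\<lambda>v. lin e v ^ m) v) \<le> h ^ m * (real m / h) ^ length ds"
proof (induction m arbitrary: ds)
  case 0
  then show ?case by (simp add: dops_const)
next
  case (Suc m)
  have "cmod (dops ds (\<lambda>v. lin e v * lin e v ^ m) v) \<le> h * h ^ m * (1/h + real m / h) ^ length ds"
    by (rule leibniz_exp_bound[OF open_UNIV sm_lin sm_power[OF open_UNIV sm_lin] _ _ _ _ _ dops_lin_bound[OF h] Suc.IH])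
       (use h in auto)
  then show ?case by (simp add: add_divide_distrib)
qed

text \<open>Each form is bounded by h and its derivatives by h * (1/h)^n, like an exponential of
  rate 1/h. Rates add under multiplication, so a monomial of degree k has rate k/h.\<close>

lemma dops_pw_bound:
  assumes h: "h > 0" "\<And>e. cmod (lin e v) \<le> h"
  shows "cmod (dops ds (pw \<gamma>) v) \<le> h ^ mi_abs \<gamma> * (real (mi_abs \<gamma>) / h) ^ length ds"
proof -
  have "finite I \<Longrightarrow> cmod (dops ds (\<lambda>v. \<Prod>e\<in>I. lin e v ^ \<gamma> e) v) \<le> h ^ (\<Sum>e\<in>I. \<gamma> e) * (real (\<Sum>e\<in>I. \<gamma> e) / h) ^ length ds"
    for I ds
  proof (induction I arbitrary: ds rule: finite_induct)
    case empty
    then show ?case by (simp add: dops_const)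
  next
    case (insert e I)
    have "cmod (dops ds (\<lambda>v. lin e v ^ \<gamma> e * (\<Prod>e\<in>I. lin e v ^ \<gamma> e)) v)
      \<le> h ^ \<gamma> e * h ^ (\<Sum>e\<in>I. \<gamma> e) * (real (\<gamma> e) / h + real (\<Sum>e\<in>I. \<gamma> e) / h) ^ length ds"
      by (rule leibniz_exp_bound[OF open_UNIV _ _ _ _ _ _ _ dops_lin_power_bound[OF h] insert.IH])
         (use h in \<open>auto intro!: sm_power sm_prod sm_lin divide_nonneg_pos sum_nonneg\<close>)
    then show ?case using insert(1,2) by (simp add: power_add add_divide_distrib)
  qed
  from this[of UNIV] show ?thesis by (simp add: pw_def[abs_def] mi_abs_def)
qed

section \<open>Pairs of multi-indices, and words of derivatives of the potential\<close>

lemma prod_pair_bool: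
  fixes h :: "'n::finite \<times> bool \<Rightarrow> 'a::comm_monoid_mult"
  shows "(\<Prod>e\<in>UNIV. h e) = (\<Prod>i\<in>UNIV. h (i, False)) * (\<Prod>i\<in>UNIV. h (i, True))"
proof -
  have "(\<Prod>e\<in>UNIV. h e) = (\<Prod>i\<in>UNIV. \<Prod>b\<in>UNIV. h (i, b))"
    by (simp add: prod.cartesian_product UNIV_Times_UNIV[symmetric] del: UNIV_Times_UNIV)
  then show ?thesis by (simp add: UNIV_bool prod.distrib mult.commute)
qed

lemma sum_pair_bool:
  fixes h :: "'n::finite \<times> bool \<Rightarrow> 'a::comm_monoid_add"
  shows "(\<Sum>e\<in>UNIV. h e) = (\<Sum>i\<in>UNIV. h (i, False)) + (\<Sum>i\<in>UNIV. h (i, True))"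
proof -
  have "(\<Sum>e\<in>UNIV. h e) = (\<Sum>i\<in>UNIV. \<Sum>b\<in>UNIV. h (i, b))"
    by (simp add: sum.cartesian_product UNIV_Times_UNIV[symmetric] del: UNIV_Times_UNIV)
  then show ?thesis by (simp add: UNIV_bool sum.distrib add.commute)
qed

text \<open>A pair (\<alpha>, \<beta>) is encoded as one multi-index \<gamma> on
  \<open>'n \<times> bool\<close>; this is its word in normal form.\<close>

definition wd :: "('n::finite \<times> bool \<Rightarrow> nat) \<Rightarrow> ('n \<times> bool) list" where
  "wd \<gamma> = mi_word False (\<lambda>i. \<gamma> (i, False)) @ mi_word True (\<lambda>i. \<gamma> (i, True))"

lemma count_wd: "count (mset (wd \<gamma>)) e = \<gamma> e"
  by (cases e; cases "snd e") (auto simp: wd_def count_mi_word)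

lemma length_wd: "length (wd \<gamma>) = mi_abs \<gamma>"
  by (simp add: wd_def length_mi_word) (simp add: mi_abs_def sum_pair_bool)

lemma mi_fact_pos: "mi_fact \<gamma> > 0" by (auto simp: mi_fact_def intro: prod_pos)

locale gevrey_potential =
  fixes f :: "complex^'n::finite \<Rightarrow> complex" and a C0 C1 r :: real
  assumes a: "a > 1" and r: "r > 0" and gw: "gevrey_with a (ball 0 r) f C0 C1"
begin

lemma C0: "C0 > 0" and C1: "C1 > 0" and smf: "sm (ball 0 r) f"
  using gw smooth_on_imp_sm[of "ball 0 r" f] by (auto simp: gevrey_with_def)

lemma word_bound:
  assumes "w \<in> ball 0 r"
  shows "cmod (dops es f w) \<le> C0 * C1 ^ length es * (\<Prod>e\<in>UNIV. fact (count (mset es) e)) powr a"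
proof -
  define \<alpha> where "\<alpha> i = count (mset es) (i, False)" for i
  define \<beta> where "\<beta> i = count (mset es) (i, True)" for i
  have m: "mset es = mset (mi_word False \<alpha> @ mi_word True \<beta>)"
    unfolding \<alpha>_def \<beta>_def by (rule mset_eq_mi_words)
  have "dops es f w = DD \<alpha> \<beta> f w"
    unfolding DD_eq_dops by (rule dops_perm[OF open_ball smf assms m])
  moreover have "cmod (DD \<alpha> \<beta> f w) \<le> C0 * C1 ^ (mi_abs \<alpha> + mi_abs \<beta>) * (mi_fact \<alpha> * mi_fact \<beta>) powr a"
    using gw assms unfolding gevrey_with_def by blast
  moreover have "length es = mi_abs \<alpha> + mi_abs \<beta>"
    using arg_cong[OF m, of size] by (simp add: length_mi_word)
  moreover have "mi_fact \<alpha> * mi_fact \<beta> = (\<Prod>e\<in>UNIV. fact (count (mset es) e))"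
    by (simp add: prod_pair_bool mi_fact_def \<alpha>_def \<beta>_def)
  ultimately show ?thesis by simp
qed

text \<open>The optional letter in \<open>es\<close> makes room for the derivative of f that remains
  after telescoping. Splitting (c + \<gamma>)! leaves 2^k in front of \<gamma>!; its power a is
  compensated later by the halves in \<open>lin\<close> and the factor 4^(a-1) in the
  cut-off.\<close>

lemma derivative_bound:
  assumes v: "v \<in> D2 r" and es: "length es \<le> 1"
  shows "cmod (dops ds (\<lambda>v. dops (es @ wd \<gamma>) f (mid v)) v)
    \<le> (C0 * max 1 C1 * 4 powr a) * (C1 ^ mi_abs \<gamma> * (2 ^ mi_abs \<gamma> * mi_fact \<gamma>) powr a)
        * (C1 * 4 powr a) ^ length ds * fact (length ds) powr a"
proof -
  define n k j where "n = length ds" and "k = mi_abs \<gamma>" and "j = length es"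
  define c where "c e = count (mset (map mdir ds @ es)) e" for e
  have "cmod (dops ds (\<lambda>v. dops (es @ wd \<gamma>) f (mid v)) v)
      = (1/2) ^ n * cmod (dops (map mdir ds @ es @ wd \<gamma>) f (mid v))"
    unfolding dops_mid[OF sm_dops[OF smf] v] by (simp add: norm_mult norm_power dops_append n_def norm_divide)
  also have "\<dots> \<le> 1 * cmod (dops (map mdir ds @ es @ wd \<gamma>) f (mid v))"
    by (intro mult_right_mono) (auto simp: power_le_one)
  also have "\<dots> \<le> C0 * C1 ^ (n + j + k) * (\<Prod>e\<in>UNIV. fact (c e + \<gamma> e)) powr a"
    using word_bound[OF mid_in_ball[OF v], of "map mdir ds @ es @ wd \<gamma>"]
    by (simp add: n_def j_def k_def length_wd c_def count_wd add.assoc)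
  \<comment> \<open>Of the two factors 2^(n+1) in 4^(n+1), one comes from splitting (c + \<gamma>)!,
    the other from (n+1)! \<le> 2^(n+1) n!; \<open>es\<close> is counted as if it had length
    one.\<close>
  also have "\<dots> \<le> C0 * (max 1 C1 * C1 ^ n * C1 ^ k) * (4 ^ Suc n * 2 ^ k * fact n * mi_fact \<gamma>) powr a"
  proof (intro mult_mono powr_mono2)
    have "C1 ^ j \<le> max 1 C1" using es by (cases "j = 0") (auto simp: j_def le_Suc_eq)
    then have "C1 ^ j * (C1 ^ n * C1 ^ k) \<le> max 1 C1 * (C1 ^ n * C1 ^ k)"
      using C1 by (intro mult_right_mono) auto
    then show "C1 ^ (n + j + k) \<le> max 1 C1 * C1 ^ n * C1 ^ k" by (simp add: power_add mult_ac)
    have sc: "(\<Sum>e\<in>UNIV. c e) = n + j"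
    proof -
      have "(\<Sum>e\<in>UNIV. c e) = size (mset (map mdir ds @ es))"
        unfolding c_def size_multiset_overloaded_eq
        by (rule sum.mono_neutral_right) (auto simp: count_eq_zero_iff simp del: mset_append)
      then show ?thesis by (simp add: n_def j_def)
    qed
    have "(\<Prod>e\<in>UNIV. fact (c e + \<gamma> e) :: real) \<le> (\<Prod>e\<in>UNIV. 2 ^ (c e + \<gamma> e) * (fact (c e) * fact (\<gamma> e)))"
      by (rule prod_mono) (auto intro: fact_add_le)
    also have "\<dots> = 2 ^ (n + j + k) * ((\<Prod>e\<in>UNIV. fact (c e)) * mi_fact \<gamma>)"
      by (simp add: prod.distrib mi_fact_def power_sum[symmetric] sum.distrib sc mi_abs_def k_def)
    also have "\<dots> \<le> 2 ^ (Suc n + k) * ((2 ^ Suc n * fact n) * mi_fact \<gamma>)"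
    proof (intro mult_mono power_increasing)
      have "(\<Prod>e\<in>UNIV. fact (c e) :: real) \<le> fact (n + j)"
        using prod_fact_le_fact_sum[of UNIV c] sc by simp
      also have "\<dots> \<le> fact (Suc n)" using es by (intro fact_mono) (simp add: j_def)
      also have "\<dots> \<le> 2 ^ Suc n * fact n"
        using fact_add_le[of n 1] by simp
      finally show "(\<Prod>e\<in>UNIV. fact (c e) :: real) \<le> 2 ^ Suc n * fact n" .
    qed (use es mi_fact_pos[of \<gamma>] in \<open>auto simp: j_def intro!: mult_nonneg_nonneg prod_nonneg\<close>)
    also have "\<dots> = 4 ^ Suc n * 2 ^ k * fact n * mi_fact \<gamma>"
    proof -
      have "(4::real) ^ Suc n = 2 ^ Suc n * 2 ^ Suc n" by (simp add: power_mult_distrib[symmetric])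
      then show ?thesis by (simp add: power_add mult_ac)
    qed
    finally show "(\<Prod>e\<in>UNIV. fact (c e + \<gamma> e) :: real) \<le> 4 ^ Suc n * 2 ^ k * fact n * mi_fact \<gamma>" .
  qed (use a C0 C1 in \<open>auto intro!: prod_nonneg\<close>)
  also have "\<dots> = (C0 * max 1 C1 * 4 powr a) * (C1 ^ k * (2 ^ k * mi_fact \<gamma>) powr a) * (C1 * 4 powr a) ^ n * fact n powr a"
    using mi_fact_pos[of \<gamma>] by (simp add: powr_mult power_powr_swap power_mult_distrib mult_ac)
  finally show ?thesis by (simp add: n_def k_def)
qed

end

section \<open>Taylor layers and their geometric decay\<close>

definition layer :: "(complex^'n::finite \<Rightarrow> complex) \<Rightarrow> ('n \<times> bool) list \<Rightarrow> nat \<Rightarrow> (complex^('n + 'n) \<Rightarrow> complex)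
    \<Rightarrow> complex^('n + 'n) \<Rightarrow> complex" where
  "layer f es k X v = (\<Sum>\<gamma> | mi_abs \<gamma> = k.
     of_real (1 / mi_fact \<gamma>) * (X v * (pw \<gamma> v * dops (es @ wd \<gamma>) f (mid v))))"

lemma mi_fact_le: "mi_fact \<gamma> \<le> fact (mi_abs \<gamma>)"
  unfolding mi_fact_def mi_abs_def by (rule prod_fact_le_fact_sum) simp

text \<open>This is 2^(-(a-1)/2), the square root of the ratio that \<open>mi_fact_powr_le\<close>
  provides. One root is kept as the decay of the layers, the other pays for the small exponentials
  in \<open>term_bound\<close> and for the number of multi-indices in
  \<open>layer_bound\<close>.\<close>

definition decay :: "real \<Rightarrow> real" where
  "decay a = exp (- ((a - 1) * ln 2 / 2))"

lemma mi_fact_powr_le: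
  assumes "a \<ge> 1"
  shows "(mi_fact \<gamma> / max 1 (real (mi_abs \<gamma>)) ^ mi_abs \<gamma>) powr (a - 1) \<le> 2 powr (a - 1) * decay a ^ (2 * mi_abs \<gamma>)"
proof -
  define k where "k = mi_abs \<gamma>"
  have "mi_fact \<gamma> * 2 ^ k \<le> fact k * 2 ^ k" unfolding k_def by (intro mult_right_mono mi_fact_le) auto
  also have "\<dots> \<le> 2 * real k ^ k" by (rule fact_le_half_power)
  also have "\<dots> \<le> 2 * max 1 (real k) ^ k" by (intro mult_left_mono power_mono) auto
  finally have "mi_fact \<gamma> / max 1 (real k) ^ k \<le> 2 * (1/2) ^ k"
    by (simp add: field_simps)
  then have "(mi_fact \<gamma> / max 1 (real k) ^ k) powr (a - 1) \<le> (2 * (1/2) ^ k) powr (a - 1)"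
    using assms mi_fact_pos[of \<gamma>] by (intro powr_mono2) auto
  also have "\<dots> = 2 powr (a - 1) * ((1/2) powr (a - 1)) ^ k"
    by (simp add: powr_mult power_powr_swap)
  also have "(1/2::real) powr (a - 1) = decay a ^ 2"
    by (simp add: powr_def decay_def ln_div flip: exp_of_nat_mult)
  finally show ?thesis by (simp add: k_def power_mult)
qed

lemma decay_bounds: "a > 1 \<Longrightarrow> 0 < decay a \<and> decay a < 1"
  by (simp add: decay_def)

context gevrey_potential
begin

lemma sm_derivative: "sm (D2 r) (\<lambda>v. dops es f (mid v))"
  by (rule sm_comp_mid[OF sm_dops[OF smf]])

lemma sm_term:
  "sm (D2 r) X \<Longrightarrow> sm (D2 r) (\<lambda>v. c * (X v * (pw \<gamma> v * dops es f (mid v))))"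
  by (intro sm_mult open_D2 sm_const sm_derivative sm_subset[OF sm_pw]) auto

lemma sm_layer: "sm (D2 r) X \<Longrightarrow> sm (D2 r) (layer f es k X)"
  unfolding layer_def[abs_def] by (intro sm_sum open_D2 sm_term)

text \<open>On the support of the cut-off the linear forms are at most h, so the monomial
  contributes h^k against C1^k 2^(ka) \<gamma>!^(a-1) from the derivatives of f divided by
  \<gamma>!. The product is (\<gamma>!/k^k)^(a-1), which is geometrically small. A derivative costs
  k^a on the monomial and k^(a-1) on X; this is traded for n!^a, respectively n!^(a-1), and an
  exponential weaker than the decay. Thus a cut-off of order \<sigma> leads to the order \<sigma> +
  a - 1.\<close>

lemma term_bound:
  assumes s: "\<sigma> \<ge> 1" and A: "A \<ge> 0"
  obtains K R where "K > 0" "R \<ge> 1"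
    "\<And>v \<gamma> es X M ds. v \<in> D2 r \<Longrightarrow> length es \<le> 1 \<Longrightarrow> sm (D2 r) X \<Longrightarrow> 0 \<le> M \<Longrightarrow>
      (\<And>ds. cmod (dops ds X v) \<le> M * (A * max 1 (real (mi_abs \<gamma>)) powr (a - 1)) ^ length ds * fact (length ds) powr \<sigma>) \<Longrightarrow>
      (mi_abs \<gamma> \<ge> 1 \<Longrightarrow> rho v * (2 powr (a - 1) * C1 * real (mi_abs \<gamma>) powr (a - 1)) \<le> 1) \<Longrightarrow>
      cmod (dops ds (\<lambda>v. of_real (1 / mi_fact \<gamma>) * (X v * (pw \<gamma> v * dops (es @ wd \<gamma>) f (mid v)))) v)
        \<le> K * M * (decay a ^ mi_abs \<gamma> * exp (- ((a - 1) * ln 2 / 4) * real (mi_abs \<gamma>))) * R ^ length ds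
            * fact (length ds) powr (\<sigma> + a - 1)"
proof -
  \<comment> \<open>Chosen so that
    \<open>E\<^sup>2 * decay a = exp (- ((a - 1) * ln 2 / 4))\<close>: the two factors E^k, from X
    and from the monomial, use up only half of the exponent in one \<open>decay a\<close>.\<close>
  define \<eta> where "\<eta> = (a - 1) * ln 2 / (8 * a)"
  have \<eta>: "\<eta> > 0" using a by (simp add: \<eta>_def)
  define s where "s = \<sigma> + a - 1"
  have s1: "s \<ge> 1" "s \<ge> a" using s a by (auto simp: s_def)
  define E where "E = exp (a * \<eta>)"
  have E: "E \<ge> 1" using \<eta> a by (simp add: E_def)
  define c1 where "c1 = 2 powr a * C1 * (1/\<eta>) powr a"
  define c2 where "c2 = A * (1/\<eta>) powr (a - 1)"
  define c3 where "c3 = C1 * 4 powr a"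
  have c: "c1 \<ge> 0" "c2 \<ge> 0" "c3 \<ge> 0" using C1 A by (auto simp: c1_def c2_def c3_def)
  define R where "R = 1 + 2 * (c1 + c2 + c3)"
  have R: "2 * c1 \<le> R" "2 * c2 \<le> R" "c3 \<le> R" "R \<ge> 1" using c by (auto simp: R_def)
  define K1 where "K1 = C0 * max 1 C1 * 4 powr a"
  have K1: "K1 > 0" using C0 by (simp add: K1_def)
  define K where "K = 4 * K1 * E\<^sup>2 * 2 powr (a - 1)"
  have K: "K > 0" using K1 E by (simp add: K_def)
  show thesis
  proof (rule that[OF K R(4)])
    fix v :: "complex^('n + 'n)" and \<gamma> :: "'n \<times> bool \<Rightarrow> nat" and es :: "('n \<times> bool) list" and X M
      and ds :: "(('n + 'n) \<times> bool) list"
    assume v: "v \<in> D2 r" and es: "length es \<le> 1" and X: "sm (D2 r) X" and M: "0 \<le> M"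
      and Xb: "\<And>ds. cmod (dops ds X v) \<le> M * (A * max 1 (real (mi_abs \<gamma>)) powr (a - 1)) ^ length ds * fact (length ds) powr \<sigma>"
      and rk: "mi_abs \<gamma> \<ge> 1 \<Longrightarrow> rho v * (2 powr (a - 1) * C1 * real (mi_abs \<gamma>) powr (a - 1)) \<le> 1"
    define k where "k = mi_abs \<gamma>"
    define \<kappa> where "\<kappa> = max 1 (real k)"
    have \<kappa>: "\<kappa> \<ge> 1" "real k \<le> \<kappa>" "\<kappa> \<le> 1 + real k" by (auto simp: \<kappa>_def)
    \<comment> \<open>\<open>lin\<close> is bounded by half of \<open>rho\<close>, and
      \<open>rk\<close> bounds \<open>rho\<close> by 1 / (2^(a-1) C1 k^(a-1)). With \<kappa> = max 1
      k the value stays positive for k = 0.\<close>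
    define h where "h = 1 / (2 powr a * C1 * \<kappa> powr (a - 1))"
    have h: "h > 0" using C1 \<kappa> by (simp add: h_def)
    have eE: "exp (a * \<eta> * \<kappa>) \<le> E * E ^ k"
    proof -
      have "exp (a * \<eta> * \<kappa>) \<le> exp (a * \<eta> * (1 + real k))" using \<kappa> \<eta> a by simp
      also have "\<dots> = E * E ^ k"
        by (simp add: E_def distrib_left exp_add mult.commute flip: exp_of_nat_mult)
      finally show ?thesis .
    qed
    have pwb: "cmod (dops ds (pw \<gamma>) v) \<le> (h ^ k * (E * E ^ k)) * c1 ^ length ds * fact (length ds) powr a" for ds
    proof -
      define n where "n = length ds"
      have "cmod (dops ds (pw \<gamma>) v) \<le> h ^ k * (real k / h) ^ n"
      proof (cases "k = 0")
        case True
        then have "\<gamma> = (\<lambda>_. 0)" by (auto simp: k_def mi_abs_def)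
        then have "pw \<gamma> = (\<lambda>_. 1)" by (auto simp: pw_def)
        then show ?thesis using True by (auto simp: dops_const n_def)
      next
        case False
        then have "\<kappa> = real k" by (simp add: \<kappa>_def)
        then have "rho v * (2 powr (a - 1) * C1 * \<kappa> powr (a - 1)) \<le> 1" using rk False by (simp add: k_def)
        moreover have "(2::real) powr a = 2 * 2 powr (a - 1)"
          using powr_add[of 2 1 "a - 1"] by simp
        ultimately have "rho v / 2 \<le> h" using C1 \<kappa> by (simp add: h_def field_simps)
        then have "cmod (lin e v) \<le> h" for e using cmod_lin_le[of e v] by linarith
        then show ?thesis using dops_pw_bound[OF h, of v ds \<gamma>] by (simp add: k_def n_def)
      qed
      also have "\<dots> \<le> h ^ k * (\<kappa> / h) ^ n"
        using \<kappa> h by (intro mult_left_mono power_mono divide_right_mono) auto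
      also have "\<kappa> / h = (2 powr a * C1) * \<kappa> powr a"
        using \<kappa> powr_add[of \<kappa> 1 "a - 1"] by (simp add: h_def)
      also have "h ^ k * ((2 powr a * C1) * \<kappa> powr a) ^ n = h ^ k * ((2 powr a * C1) ^ n * (\<kappa> powr a) ^ n)"
        by (simp add: power_mult_distrib)
      also have "\<dots> \<le> h ^ k * ((2 powr a * C1) ^ n * (((1/\<eta>) powr a) ^ n * fact n powr a * (E * E ^ k)))"
      proof (intro mult_left_mono)
        have "(\<kappa> powr a) ^ n \<le> ((1/\<eta>) powr a) ^ n * fact n powr a * exp (a * \<eta> * \<kappa>)"
          using \<kappa> \<eta> a by (intro powr_power_le_fact_exp) auto
        also have "\<dots> \<le> ((1/\<eta>) powr a) ^ n * fact n powr a * (E * E ^ k)"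
          using eE by (intro mult_left_mono) auto
        finally show "(\<kappa> powr a) ^ n \<le> ((1/\<eta>) powr a) ^ n * fact n powr a * (E * E ^ k)" .
      qed (use h C1 in auto)
      finally show ?thesis by (simp add: c1_def n_def power_mult_distrib mult_ac)
    qed
    have Xb': "cmod (dops ds X v) \<le> (M * (E * E ^ k)) * c2 ^ length ds * fact (length ds) powr s" for ds
    proof -
      define n where "n = length ds"
      have "cmod (dops ds X v) \<le> M * (A ^ n * (\<kappa> powr (a - 1)) ^ n) * fact n powr \<sigma>"
        using Xb[of ds] by (simp add: n_def \<kappa>_def k_def power_mult_distrib)
      also have "\<dots> \<le> M * (A ^ n * (((1/\<eta>) powr (a - 1)) ^ n * fact n powr (a - 1) * (E * E ^ k))) * fact n powr \<sigma>"
      proof (intro mult_left_mono mult_right_mono)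
        have "(\<kappa> powr (a - 1)) ^ n \<le> ((1/\<eta>) powr (a - 1)) ^ n * fact n powr (a - 1) * exp ((a - 1) * \<eta> * \<kappa>)"
          using \<kappa> \<eta> a by (intro powr_power_le_fact_exp) auto
        also have "\<dots> \<le> ((1/\<eta>) powr (a - 1)) ^ n * fact n powr (a - 1) * (E * E ^ k)"
        proof (intro mult_left_mono order.trans[OF _ eE])
          show "exp ((a - 1) * \<eta> * \<kappa>) \<le> exp (a * \<eta> * \<kappa>)" using \<kappa> \<eta> by simp
        qed auto
        finally show "(\<kappa> powr (a - 1)) ^ n \<le> ((1/\<eta>) powr (a - 1)) ^ n * fact n powr (a - 1) * (E * E ^ k)" .
      qed (use M A in auto)
      also have "\<dots> = (M * (E * E ^ k)) * c2 ^ n * (fact n powr (a - 1) * fact n powr \<sigma>)"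
        by (simp add: c2_def power_mult_distrib mult_ac)
      also have "fact n powr (a - 1) * fact n powr \<sigma> = (fact n :: real) powr s"
        unfolding s_def powr_add[symmetric] by (simp add: algebra_simps)
      finally show ?thesis by (simp add: n_def)
    qed
    define G where "G = C1 ^ k * (2 ^ k * mi_fact \<gamma>) powr a"
    have G: "G \<ge> 0" using C1 by (simp add: G_def)
    have db: "cmod (dops ds (\<lambda>v. dops (es @ wd \<gamma>) f (mid v)) v) \<le> (K1 * G) * R ^ length ds * fact (0 + length ds) powr a" for ds
    proof -
      have "cmod (dops ds (\<lambda>v. dops (es @ wd \<gamma>) f (mid v)) v) \<le> (K1 * G) * c3 ^ length ds * fact (length ds) powr a"
        using derivative_bound[OF v es, of ds \<gamma>] by (simp add: K1_def G_def c3_def k_def)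
      also have "\<dots> \<le> (K1 * G) * R ^ length ds * fact (length ds) powr a"
        using K1 G c R by (intro mult_right_mono mult_left_mono power_mono) auto
      finally show ?thesis by simp
    qed
    have smd: "sm (D2 r) (\<lambda>v. dops (es @ wd \<gamma>) f (mid v))" by (rule sm_derivative)
    have smp: "sm (D2 r) (pw \<gamma>)" by (rule sm_subset[OF sm_pw]) simp
    have Ek: "0 \<le> E * E ^ k" using E by simp
    have b1: "cmod (dops ds (\<lambda>v. pw \<gamma> v * dops (es @ wd \<gamma>) f (mid v)) v)
        \<le> 2 * (h ^ k * (E * E ^ k)) * (K1 * G) * R ^ length ds * fact (0 + length ds) powr a * 1" for ds
      by (rule leibniz_bound[OF open_D2 smp smd v, where C = c1])
         (use a c R h Ek K1 G in \<open>auto intro!: exI[of _ 1] mult_nonneg_nonneg pwb db[simplified]\<close>)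
    have "cmod (dops ds (\<lambda>v. X v * (pw \<gamma> v * dops (es @ wd \<gamma>) f (mid v))) v)
        \<le> 2 * (M * (E * E ^ k)) * (2 * (h ^ k * (E * E ^ k)) * (K1 * G)) * R ^ length ds * fact (0 + length ds) powr s * 1"
    proof (rule leibniz_bound[OF open_D2 X sm_mult[OF open_D2 smp smd] v s1(1), where C = c2])
      fix x y assume "(x, y) \<in> set (splits ds)"
      have "cmod (dops y (\<lambda>v. pw \<gamma> v * dops (es @ wd \<gamma>) f (mid v)) v)
        \<le> 2 * (h ^ k * (E * E ^ k)) * (K1 * G) * R ^ length y * fact (length y) powr a" using b1[of y] by simp
      also have "\<dots> \<le> 2 * (h ^ k * (E * E ^ k)) * (K1 * G) * R ^ length y * fact (length y) powr s"
        using h Ek K1 G R s1 by (intro mult_left_mono powr_mono) (auto intro!: mult_nonneg_nonneg)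
      finally show "\<exists>b c. b * c \<le> 1 \<and> 0 \<le> b \<and> 0 \<le> c \<and>
         cmod (dops x X v) \<le> M * (E * E ^ k) * c2 ^ length x * fact (length x) powr s * b \<and>
         cmod (dops y (\<lambda>x. pw \<gamma> x * dops (es @ wd \<gamma>) f (mid x)) v)
           \<le> 2 * (h ^ k * (E * E ^ k)) * (K1 * G) * R ^ length y * fact (0 + length y) powr s * c"
        using Xb'[of x] by (intro exI[of _ 1]) auto
    qed (use c R M Ek h K1 G in \<open>auto intro!: mult_nonneg_nonneg\<close>)
    then have b2: "cmod (dops ds (\<lambda>v. X v * (pw \<gamma> v * dops (es @ wd \<gamma>) f (mid v))) v)
        \<le> 4 * K1 * M * (E * E ^ k)\<^sup>2 * (h ^ k * G) * R ^ length ds * fact (length ds) powr s"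
      by (simp add: power2_eq_square mult_ac)
    have num: "(1 / mi_fact \<gamma>) * (E ^ k)\<^sup>2 * (h ^ k * G)
        \<le> 2 powr (a - 1) * (decay a ^ k * exp (- ((a - 1) * ln 2 / 4) * real k))"
    proof -
      \<comment> \<open>The powers of C1 and of 2^a in h and G cancel exactly.\<close>
      have "(1 / mi_fact \<gamma>) * (h ^ k * G) = (mi_fact \<gamma> / \<kappa> ^ k) powr (a - 1)"
      proof -
        have hk: "h ^ k = 1 / ((2 powr a) ^ k * C1 ^ k * (\<kappa> powr (a - 1)) ^ k)"
          by (simp add: h_def power_divide power_mult_distrib)
        have gk: "G = C1 ^ k * ((2 powr a) ^ k * mi_fact \<gamma> powr a)"
          using mi_fact_pos[of \<gamma>] by (simp add: G_def powr_mult power_powr_swap)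
        have mk: "mi_fact \<gamma> powr a = mi_fact \<gamma> * mi_fact \<gamma> powr (a - 1)"
          using powr_add[of "mi_fact \<gamma>" 1 "a - 1"] mi_fact_pos[of \<gamma>] by simp
        have rhs: "(mi_fact \<gamma> / \<kappa> ^ k) powr (a - 1) = mi_fact \<gamma> powr (a - 1) / (\<kappa> powr (a - 1)) ^ k"
          using mi_fact_pos[of \<gamma>] \<kappa> by (simp add: powr_divide power_powr_swap)
        show ?thesis unfolding hk gk mk rhs using C1 mi_fact_pos[of \<gamma>] by (simp add: field_simps)
      qed
      also have "\<dots> \<le> 2 powr (a - 1) * decay a ^ (2 * k)"
        using mi_fact_powr_le[of a \<gamma>] a by (simp add: k_def \<kappa>_def)
      finally have 1: "(1 / mi_fact \<gamma>) * (h ^ k * G) \<le> 2 powr (a - 1) * decay a ^ (2 * k)" .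
      have EE: "E\<^sup>2 * decay a = exp (- ((a - 1) * ln 2 / 4))"
        using a by (simp add: E_def \<eta>_def decay_def field_simps flip: exp_of_nat_mult exp_add)
      have "(E ^ k)\<^sup>2 * ((1 / mi_fact \<gamma>) * (h ^ k * G)) \<le> (E ^ k)\<^sup>2 * (2 powr (a - 1) * decay a ^ (2 * k))"
        by (rule mult_left_mono[OF 1]) simp
      also have "\<dots> = 2 powr (a - 1) * (decay a ^ k * (E\<^sup>2 * decay a) ^ k)"
      proof -
        have "(E ^ k)\<^sup>2 = (E\<^sup>2) ^ k" "decay a ^ (2 * k) = decay a ^ k * decay a ^ k"
          by (simp add: power_mult[symmetric] mult.commute) (simp add: mult_2 power_add)
        then show ?thesis by (simp add: power_mult_distrib mult_ac)
      qed
      also have "(E\<^sup>2 * decay a) ^ k = exp (- ((a - 1) * ln 2 / 4) * real k)"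
        unfolding EE by (simp add: exp_of_nat_mult[symmetric] mult.commute)
      finally show ?thesis by (simp add: mult_ac)
    qed
    have "cmod (dops ds (\<lambda>v. of_real (1 / mi_fact \<gamma>) * (X v * (pw \<gamma> v * dops (es @ wd \<gamma>) f (mid v)))) v)
        = (1 / mi_fact \<gamma>) * cmod (dops ds (\<lambda>v. X v * (pw \<gamma> v * dops (es @ wd \<gamma>) f (mid v))) v)"
      using mi_fact_pos[of \<gamma>]
      by (subst dops_cmult[OF open_D2 _ v]) (auto simp: norm_mult norm_divide intro!: sm_mult open_D2 X smp smd)
    also have "\<dots> \<le> (1 / mi_fact \<gamma>) * (4 * K1 * M * (E * E ^ k)\<^sup>2 * (h ^ k * G) * R ^ length ds * fact (length ds) powr s)"
      using b2 mi_fact_pos[of \<gamma>] by (intro mult_left_mono) auto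
    also have "\<dots> = 4 * K1 * E\<^sup>2 * M * R ^ length ds * fact (length ds) powr s * ((1 / mi_fact \<gamma>) * (E ^ k)\<^sup>2 * (h ^ k * G))"
      by (simp add: power_mult_distrib mult_ac)
    also have "\<dots> \<le> 4 * K1 * E\<^sup>2 * M * R ^ length ds * fact (length ds) powr s
        * (2 powr (a - 1) * (decay a ^ k * exp (- ((a - 1) * ln 2 / 4) * real k)))"
      using K1 M R by (intro mult_left_mono[OF num]) auto
    finally show "cmod (dops ds (\<lambda>v. of_real (1 / mi_fact \<gamma>) * (X v * (pw \<gamma> v * dops (es @ wd \<gamma>) f (mid v)))) v)
        \<le> K * M * (decay a ^ mi_abs \<gamma> * exp (- ((a - 1) * ln 2 / 4) * real (mi_abs \<gamma>))) * R ^ length ds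
            * fact (length ds) powr (\<sigma> + a - 1)"
      by (simp add: K_def k_def s_def mult_ac)
  qed
qed

text \<open>There are only polynomially many multi-indices of degree k; their number is absorbed by
  the factor exp (-\<tau> k) set aside in \<open>term_bound\<close>.\<close>

lemma layer_bound:
  assumes s: "\<sigma> \<ge> 1" and A: "A \<ge> 0"
  obtains K R where "K > 0" "R \<ge> 1"
    "\<And>v k es X M ds. v \<in> D2 r \<Longrightarrow> length es \<le> 1 \<Longrightarrow> sm (D2 r) X \<Longrightarrow> 0 \<le> M \<Longrightarrow>
      (\<And>ds. cmod (dops ds X v) \<le> M * (A * max 1 (real k) powr (a - 1)) ^ length ds * fact (length ds) powr \<sigma>) \<Longrightarrow>
      (k \<ge> 1 \<Longrightarrow> rho v * (2 powr (a - 1) * C1 * real k powr (a - 1)) \<le> 1) \<Longrightarrow>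
      cmod (dops ds (layer f es k X) v) \<le> K * M * decay a ^ k * R ^ length ds * fact (length ds) powr (\<sigma> + a - 1)"
proof -
  obtain K R where K: "K > 0" and R: "R \<ge> 1" and tb:
    "\<And>v \<gamma> es X M ds. v \<in> D2 r \<Longrightarrow> length es \<le> 1 \<Longrightarrow> sm (D2 r) X \<Longrightarrow> 0 \<le> M \<Longrightarrow>
      (\<And>ds. cmod (dops ds X v) \<le> M * (A * max 1 (real (mi_abs \<gamma>)) powr (a - 1)) ^ length ds * fact (length ds) powr \<sigma>) \<Longrightarrow>
      (mi_abs \<gamma> \<ge> 1 \<Longrightarrow> rho v * (2 powr (a - 1) * C1 * real (mi_abs \<gamma>) powr (a - 1)) \<le> 1) \<Longrightarrow>
      cmod (dops ds (\<lambda>v. of_real (1 / mi_fact \<gamma>) * (X v * (pw \<gamma> v * dops (es @ wd \<gamma>) f (mid v)))) v)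
        \<le> K * M * (decay a ^ mi_abs \<gamma> * exp (- ((a - 1) * ln 2 / 4) * real (mi_abs \<gamma>))) * R ^ length ds
            * fact (length ds) powr (\<sigma> + a - 1)"
    using term_bound[OF assms] by blast
  define \<tau> where "\<tau> = (a - 1) * ln 2 / 4"
  have \<tau>: "\<tau> > 0" using a by (simp add: \<tau>_def)
  define m where "m = CARD('n \<times> bool)"
  define B where "B = (1/\<tau>) ^ m * fact m * exp \<tau>"
  have B: "B > 0" using \<tau> by (simp add: B_def)
  have cnt: "real (card {\<gamma> :: 'n \<times> bool \<Rightarrow> nat. mi_abs \<gamma> = k}) * exp (- \<tau> * real k) \<le> B" for k
  proof -
    have "real (card {\<gamma> :: 'n \<times> bool \<Rightarrow> nat. mi_abs \<gamma> = k}) \<le> real ((k + 1) ^ m)"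
      unfolding m_def by (rule of_nat_mono[OF card_mi_abs])
    also have "\<dots> \<le> (1/\<tau>) ^ m * fact m * exp (\<tau> * (1 + real k))"
      using power_le_fact_exp_scaled[of "1 + real k" \<tau> m] \<tau> by (simp add: add.commute)
    finally have "real (card {\<gamma> :: 'n \<times> bool \<Rightarrow> nat. mi_abs \<gamma> = k}) * exp (- \<tau> * real k)
        \<le> (1/\<tau>) ^ m * fact m * exp (\<tau> * (1 + real k)) * exp (- \<tau> * real k)" by (intro mult_right_mono) auto
    also have "\<dots> = B" by (simp add: B_def algebra_simps flip: exp_add)
    finally show ?thesis .
  qed
  show thesis
  proof (rule that[of "K * B" R])
    fix v :: "complex^('n + 'n)" and k and es :: "('n \<times> bool) list" and X M
      and ds :: "(('n + 'n) \<times> bool) list"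
    assume v: "v \<in> D2 r" and es: "length es \<le> 1" and X: "sm (D2 r) X" and M: "0 \<le> M"
      and Xb: "\<And>ds. cmod (dops ds X v) \<le> M * (A * max 1 (real k) powr (a - 1)) ^ length ds * fact (length ds) powr \<sigma>"
      and rk: "k \<ge> 1 \<Longrightarrow> rho v * (2 powr (a - 1) * C1 * real k powr (a - 1)) \<le> 1"
    have "dops ds (layer f es k X) v = (\<Sum>\<gamma> | mi_abs \<gamma> = k.
        dops ds (\<lambda>v. of_real (1 / mi_fact \<gamma>) * (X v * (pw \<gamma> v * dops (es @ wd \<gamma>) f (mid v)))) v)"
      unfolding layer_def[abs_def] by (rule dops_sum[OF open_D2 sm_term[OF X] v])
    also have "cmod \<dots> \<le> (\<Sum>\<gamma> | mi_abs (\<gamma> :: 'n \<times> bool \<Rightarrow> nat) = k. K * M * (decay a ^ k * exp (- \<tau> * real k)) * R ^ length ds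
            * fact (length ds) powr (\<sigma> + a - 1))"
    proof (rule sum_norm_le)
      fix \<gamma> :: "'n \<times> bool \<Rightarrow> nat" assume "\<gamma> \<in> {\<gamma>. mi_abs \<gamma> = k}"
      then have k: "k = mi_abs \<gamma>" by simp
      show "cmod (dops ds (\<lambda>v. of_real (1 / mi_fact \<gamma>) * (X v * (pw \<gamma> v * dops (es @ wd \<gamma>) f (mid v)))) v)
        \<le> K * M * (decay a ^ k * exp (- \<tau> * real k)) * R ^ length ds * fact (length ds) powr (\<sigma> + a - 1)"
        using tb[OF v es X M Xb[unfolded k] rk[unfolded k], of ds] unfolding k \<tau>_def by simp
    qed
    also have "\<dots> = (K * M * decay a ^ k * R ^ length ds * fact (length ds) powr (\<sigma> + a - 1))
        * (real (card {\<gamma> :: 'n \<times> bool \<Rightarrow> nat. mi_abs \<gamma> = k}) * exp (- \<tau> * real k))"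
      by (simp add: mult_ac)
    also have "\<dots> \<le> (K * M * decay a ^ k * R ^ length ds * fact (length ds) powr (\<sigma> + a - 1)) * B"
      using cnt[of k] K M R decay_bounds[OF a] by (intro mult_left_mono) auto
    finally show "cmod (dops ds (layer f es k X) v) \<le> K * B * M * decay a ^ k * R ^ length ds * fact (length ds) powr (\<sigma> + a - 1)"
      by (simp add: mult_ac)
  qed (use K B R in auto)
qed

end

section \<open>The cut-off\<close>

lemma gevrey_real_derivs:
  assumes "gevrey_real s g"
  shows "((deriv ^^ j) g has_real_derivative (deriv ^^ Suc j) g t) (at t)"
proof -
  have D: "(h has_real_derivative deriv h t) (at t) \<and> deriv h t = frechet_derivative h (at t) 1"
    if "Ck_on (Suc 0) UNIV h" for h :: "real \<Rightarrow> real" and t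
  proof -
    have h: "(h has_derivative frechet_derivative h (at t)) (at t)"
      using that by (simp add: frechet_derivative_works[symmetric])
    define c where "c = frechet_derivative h (at t) 1"
    have "frechet_derivative h (at t) x = c * x" for x
      using linear_scale[OF has_derivative_linear[OF h], of x 1] by (simp add: c_def mult.commute)
    then have "frechet_derivative h (at t) = (*) c" by (rule ext)
    then have "(h has_real_derivative c) (at t)"
      using h unfolding has_field_derivative_def by (simp only:)
    note hc = this
    show ?thesis using hc unfolding DERIV_imp_deriv[OF hc] c_def by simp
  qed
  have Ck: "Ck_on k UNIV ((deriv ^^ j) g)" for k j
  proof (induction j arbitrary: k)
    case 0
    then show ?case using assms by (simp add: gevrey_real_def smooth_on_def)
  next
    case (Suc j)
    have "deriv ((deriv ^^ j) g) = (\<lambda>t. frechet_derivative ((deriv ^^ j) g) (at t) 1)"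
      using D[OF Suc.IH] by (intro ext) blast
    then show ?case using Suc.IH[of "Suc k"] by simp
  qed
  show ?thesis using D[OF Ck, THEN conjunct1, of j t] by (simp only: funpow.simps comp_apply)
qed

lemma real_comp_dop:
  fixes h :: "complex^'k::finite \<Rightarrow> real"
  assumes "(\<lambda>v. complex_of_real (h v)) differentiable (at v)" "(\<xi> has_real_derivative \<xi>') (at (h v))"
  shows "(\<lambda>v. complex_of_real (\<xi> (h v))) differentiable (at v)"
    and "dop d (\<lambda>v. complex_of_real (\<xi> (h v))) v = of_real \<xi>' * dop d (\<lambda>v. of_real (h v)) v"
proof -
  obtain G' where G': "((\<lambda>v. complex_of_real (h v)) has_derivative G') (at v)"
    using assms(1) by (auto simp: differentiable_def)
  have hR: "(h has_derivative (\<lambda>x. Re (G' x))) (at v)"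
    using has_derivative_Re[OF G'] by simp
  have "((\<lambda>v. complex_of_real (h v)) has_derivative (\<lambda>x. of_real (Re (G' x)))) (at v)"
    by (rule has_derivative_of_real[OF hR])
  then have Gr: "G' x = of_real (Re (G' x))" for x
    using has_derivative_unique[OF G'] by metis
  have "((\<lambda>v. \<xi> (h v)) has_derivative (\<lambda>x. Re (G' x) * \<xi>')) (at v)"
    by (rule DERIV_compose_FDERIV[OF assms(2) hR])
  from has_derivative_of_real[OF this]
  have c: "((\<lambda>v. complex_of_real (\<xi> (h v))) has_derivative (\<lambda>x. of_real (Re (G' x) * \<xi>'))) (at v)" .
  then show "(\<lambda>v. complex_of_real (\<xi> (h v))) differentiable (at v)" by (auto simp: differentiable_def)
  have q: "complex_of_real (Re (G' x) * \<xi>') = of_real \<xi>' * G' x" for x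
    unfolding of_real_mult Gr[symmetric] by (rule mult.commute)
  show "dop d (\<lambda>v. complex_of_real (\<xi> (h v))) v = of_real \<xi>' * dop d (\<lambda>v. of_real (h v)) v"
    unfolding dop_has_derivative[OF c] dop_has_derivative[OF G'] q by (simp add: algebra_simps)
qed

text \<open>The family \<xi> lists a function with all its derivatives. Proving all indices j at
  once makes the induction on the order of smoothness go through.\<close>

lemma sm_real_comp:
  fixes h :: "complex^'k::finite \<Rightarrow> real"
  assumes "open S" "sm S (\<lambda>v. complex_of_real (h v))" "\<And>j t. (\<xi> j has_real_derivative \<xi> (Suc j) t) (at t)"
  shows "sm S (\<lambda>v. complex_of_real (\<xi> j (h v)))"
proof -
  have "smk n S (\<lambda>v. complex_of_real (\<xi> j (h v)))" for n j
  proof (induction n arbitrary: j)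
    case 0
    show ?case using real_comp_dop(1)[OF sm_differentiable[OF assms(2)] assms(3)] by simp
  next
    case (Suc n)
    have "smk n S (dop d (\<lambda>v. complex_of_real (\<xi> j (h v))))" for d
    proof (rule smk_cong[OF assms(1)])
      show "smk n S (\<lambda>v. of_real (\<xi> (Suc j) (h v)) * dop d (\<lambda>v. of_real (h v)) v)"
        using sm_dop[OF assms(2), of d] by (intro smk_mult assms(1) Suc) (simp add: sm_def)
    qed (simp add: real_comp_dop(2)[OF sm_differentiable[OF assms(2)] assms(3)])
    then show ?case using real_comp_dop(1)[OF sm_differentiable[OF assms(2)] assms(3)] by simp
  qed
  then show ?thesis by (simp add: sm_def)
qed

lemma sm_rho_sq: "sm S (\<lambda>v. of_real ((rho v)\<^sup>2))"
proof -
  have "sm UNIV (\<lambda>v. \<Sum>i\<in>UNIV. (-4) * (lin (i, False) v * lin (i, True) v))"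
    by (intro sm_sum sm_mult sm_const sm_lin open_UNIV)
  then show ?thesis unfolding rho_sq[symmetric] by (rule sm_subset) simp
qed

lemma dop_rho_sq:
  "dop d (\<lambda>v. of_real ((rho v)\<^sup>2)) = (\<lambda>v. (if snd d then 2 else -2) * lin (fst (mdir d), \<not> snd (mdir d)) v)"
proof
  fix v :: "complex^('a + 'a)"
  obtain j b where m: "mdir d = (j, b)" by (cases "mdir d")
  have dl: "lin e differentiable (at v)" for e by (rule sm_differentiable[OF sm_lin[of UNIV]]) simp
  have "dop d (\<lambda>v. of_real ((rho v)\<^sup>2)) v
      = (\<Sum>i\<in>UNIV. (-4) * (dop d (lin (i, False)) v * lin (i, True) v + lin (i, False) v * dop d (lin (i, True)) v))"
    unfolding rho_sq
  proof (subst dop_sum)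
    show "(\<lambda>v. (-4) * (lin (i, False) v * lin (i, True) v)) differentiable (at v)" for i
      by (intro differentiable_mult differentiable_const dl)
    show "(\<Sum>i\<in>UNIV. dop d (\<lambda>v. (-4) * (lin (i, False) v * lin (i, True) v)) v)
      = (\<Sum>i\<in>UNIV. (-4) * (dop d (lin (i, False)) v * lin (i, True) v + lin (i, False) v * dop d (lin (i, True)) v))"
      by (subst dop_cmult, intro differentiable_mult dl) (simp only: dop_mult[OF dl dl])
  qed
  also have "\<dots> = (\<Sum>i\<in>UNIV. if i = j then (if snd d then 2 else -2) * lin (j, \<not> b) v else 0)"
    unfolding dop_lin m by (rule sum.cong) (cases b; auto)+
  finally show "dop d (\<lambda>v. of_real ((rho v)\<^sup>2)) v = (if snd d then 2 else -2) * lin (fst (mdir d), \<not> snd (mdir d)) v"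
    by (simp add: m)
qed

text \<open>Induction over the innermost letter, for all j at once: up to sign, one derivative of
  \<xi>_j(l^2 rho^2) is 2 l^2 times a linear form times \<xi>_(j+1)(l^2 rho^2), and the Leibniz rule
  with shift j + 1 closes the argument without an iterated chain rule. Where l rho \<le> 1, the form
  with its factor has size l and first derivatives at most l^2, so each derivative costs one
  l.\<close>

lemma cutoff_jets:
  fixes \<xi> :: "nat \<Rightarrow> real \<Rightarrow> real"
  assumes der: "\<And>j t. (\<xi> j has_real_derivative \<xi> (Suc j) t) (at t)"
    and bd: "\<And>j t. \<bar>\<xi> j t\<bar> \<le> D0 * D1 ^ j * fact j powr \<sigma>" and D: "D0 > 0" "D1 > 0" and s: "\<sigma> \<ge> 1"
    and l: "l \<ge> 0" "l * rho v \<le> 1"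
  shows "cmod (dops ds (\<lambda>v. of_real (\<xi> j (l\<^sup>2 * (rho v)\<^sup>2))) v)
      \<le> D0 * D1 ^ j * ((2 + 2 * D1) * l) ^ length ds * fact (j + length ds) powr \<sigma>"
proof (induction "length ds" arbitrary: ds j rule: less_induct)
  case less
  have smh: "sm UNIV (\<lambda>v. complex_of_real (l\<^sup>2 * (rho v)\<^sup>2))"
  proof -
    have "sm UNIV (\<lambda>v. complex_of_real (l\<^sup>2) * complex_of_real ((rho v)\<^sup>2))"
      by (intro sm_mult sm_const sm_rho_sq open_UNIV)
    then show ?thesis by simp
  qed
  show ?case
  proof (cases ds rule: rev_cases)
    case Nil
    then show ?thesis using bd[of j "l\<^sup>2 * (rho v)\<^sup>2"] by simp
  next
    case (snoc ds' d)
    define e where "e = (fst (mdir d), \<not> snd (mdir d))"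
    define K where "K = complex_of_real (l\<^sup>2) * (if snd d then 2 else -2)"
    have dh: "dop d (\<lambda>v. complex_of_real (l\<^sup>2 * (rho v)\<^sup>2)) = (\<lambda>v. K * lin e v)"
    proof
      fix v
      have "dop d (\<lambda>v. complex_of_real (l\<^sup>2) * complex_of_real ((rho v)\<^sup>2)) v = complex_of_real (l\<^sup>2) * dop d (\<lambda>v. complex_of_real ((rho v)\<^sup>2)) v"
        by (rule dop_cmult, rule sm_differentiable[OF sm_rho_sq[of UNIV]]) simp
      then show "dop d (\<lambda>v. complex_of_real (l\<^sup>2 * (rho v)\<^sup>2)) v = K * lin e v"
        unfolding of_real_mult by (simp only: dop_rho_sq K_def e_def mult.assoc)
    qed
    have dX: "dop d (\<lambda>v. of_real (\<xi> j (l\<^sup>2 * (rho v)\<^sup>2))) = (\<lambda>v. (K * lin e v) * of_real (\<xi> (Suc j) (l\<^sup>2 * (rho v)\<^sup>2)))"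
      by (rule ext) (unfold real_comp_dop(2)[OF sm_differentiable[OF smh UNIV_I] der] dh, rule mult.commute)
    have smX: "sm UNIV (\<lambda>v. complex_of_real (\<xi> (Suc j) (l\<^sup>2 * (rho v)\<^sup>2)))"
      by (rule sm_real_comp[where \<xi> = \<xi> and h = "\<lambda>v. l\<^sup>2 * (rho v)\<^sup>2", OF open_UNIV smh der])
    have smK: "sm UNIV (\<lambda>v. K * lin e v)" by (intro sm_mult sm_const sm_lin open_UNIV)
    have Kb: "cmod (dops b (\<lambda>v. K * lin e v) v) \<le> l * l ^ length b * fact (length b) powr \<sigma> * 1" for b
    proof -
      have K: "cmod K = 2 * l\<^sup>2" by (simp add: K_def norm_mult norm_power)
      have "cmod (dops b (\<lambda>v. K * lin e v) v) = 2 * l\<^sup>2 * cmod (dops b (lin e) v)"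
        by (subst dops_cmult[OF open_UNIV sm_lin]) (simp_all add: norm_mult K)
      also have "\<dots> \<le> l * l ^ length b"
      proof (cases b rule: rev_cases)
        case Nil
        have "2 * l\<^sup>2 * cmod (lin e v) \<le> 2 * l\<^sup>2 * (rho v / 2)" by (intro mult_left_mono cmod_lin_le) simp
        also have "\<dots> = l * (l * rho v)" by (simp add: power2_eq_square)
        also have "\<dots> \<le> l * 1" using l by (intro mult_left_mono) auto
        finally show ?thesis using Nil by simp
      next
        case (snoc b' d')
        then show ?thesis using l
          by (cases "b' = []") (auto simp: dops_append dop_lin dops_const power2_eq_square)
      qed
      also have "\<dots> \<le> l * l ^ length b * fact (length b) powr \<sigma>"
        using mult_left_mono[of 1 "fact (length b) powr \<sigma>" "l * l ^ length b"] l s by (simp add: ge_one_powr_ge_zero)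
      finally show ?thesis by simp
    qed
    have "cmod (dops ds (\<lambda>v. of_real (\<xi> j (l\<^sup>2 * (rho v)\<^sup>2))) v)
        = cmod (dops ds' (\<lambda>v. (K * lin e v) * of_real (\<xi> (Suc j) (l\<^sup>2 * (rho v)\<^sup>2))) v)"
      by (simp add: snoc dops_append dX)
    also have "\<dots> \<le> 2 * l * (D0 * D1 ^ Suc j) * ((2 + 2 * D1) * l) ^ length ds' * fact (Suc j + length ds') powr \<sigma> * 1"
    proof (rule leibniz_bound[OF open_UNIV smK smX _ s, where C = l])
      fix x y assume xy: "(x, y) \<in> set (splits ds')"
      have "length y < length ds" using splits_length[OF xy] snoc by simp
      from less[OF this, of "Suc j"] Kb[of x]
      show "\<exists>b c. b * c \<le> 1 \<and> 0 \<le> b \<and> 0 \<le> c \<and>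
         cmod (dops x (\<lambda>v. K * lin e v) v) \<le> l * l ^ length x * fact (length x) powr \<sigma> * b \<and>
         cmod (dops y (\<lambda>x. of_real (\<xi> (Suc j) (l\<^sup>2 * (rho x)\<^sup>2))) v)
           \<le> D0 * D1 ^ Suc j * ((2 + 2 * D1) * l) ^ length y * fact (Suc j + length y) powr \<sigma> * c"
        by (intro exI[of _ 1]) simp
    qed (use D l in \<open>auto simp: algebra_simps\<close>)
    also have "\<dots> \<le> D0 * D1 ^ j * ((2 + 2 * D1) * l) ^ length ds * fact (j + length ds) powr \<sigma>"
    proof -
      define T where "T = D0 * D1 ^ j * ((2 + 2 * D1) * l) ^ length ds' * fact (Suc j + length ds') powr \<sigma>"
      \<comment> \<open>In the rate (2 + 2 D1) l the summand 2 l meets the requirement of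
        \<open>leibniz_bound\<close>; 2 D1 l pays for passing from D1^j to D1^(j+1) and for the
        constant 2 l produced by that lemma.\<close>
      have "T * (2 * D1 * l) \<le> T * ((2 + 2 * D1) * l)"
        using D l by (intro mult_left_mono mult_right_mono) (auto simp: T_def)
      then show ?thesis by (simp add: T_def snoc mult_ac)
    qed
    finally show ?thesis .
  qed
qed

section \<open>The antiholomorphic derivatives of the partial sums\<close>

lemma pw_split: "pw \<gamma> v = lin e v ^ \<gamma> e * (\<Prod>e'\<in>UNIV - {e}. lin e' v ^ \<gamma> e')"
  unfolding pw_def by (rule prod.remove) auto

lemma dop_lin_power:
  "dop d (\<lambda>v. lin e v ^ m) v = of_nat m * lin e v ^ (m - 1) * dop d (lin e) v"
proof (induction m)
  case (Suc m)
  have "dop d (\<lambda>v. lin e v * lin e v ^ m) v = dop d (lin e) v * lin e v ^ m + lin e v * dop d (\<lambda>v. lin e v ^ m) v"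
    by (rule dop_mult) (rule sm_differentiable[of UNIV], auto intro: sm_lin sm_power)+
  then show ?case using Suc by (cases m) (auto simp: algebra_simps)
qed simp

lemma dop_pw:
  "dop d (pw \<gamma>) v = of_nat (\<gamma> (mdir d)) * (if snd d then -1/2 else 1/2) * pw (\<gamma>(mdir d := \<gamma> (mdir d) - 1)) v"
proof -
  define e where "e = mdir d"
  have z: "finite I \<Longrightarrow> e \<notin> I \<Longrightarrow> dop d (\<lambda>v. \<Prod>e'\<in>I. lin e' v ^ \<gamma> e') v = 0" for I
  proof (induction I rule: finite_induct)
    case (insert e' I)
    have "dop d (\<lambda>v. lin e' v ^ \<gamma> e' * (\<Prod>e'\<in>I. lin e' v ^ \<gamma> e')) v
       = dop d (\<lambda>v. lin e' v ^ \<gamma> e') v * (\<Prod>e'\<in>I. lin e' v ^ \<gamma> e') + lin e' v ^ \<gamma> e' * dop d (\<lambda>v. \<Prod>e'\<in>I. lin e' v ^ \<gamma> e') v"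
      by (rule dop_mult) (rule sm_differentiable[of UNIV], auto intro!: sm_lin sm_power sm_prod)+
    then show ?case using insert by (auto simp: dop_lin_power dop_lin e_def)
  qed simp
  have "dop d (\<lambda>v. lin e v ^ \<gamma> e * (\<Prod>e'\<in>UNIV - {e}. lin e' v ^ \<gamma> e')) v
       = dop d (\<lambda>v. lin e v ^ \<gamma> e) v * (\<Prod>e'\<in>UNIV - {e}. lin e' v ^ \<gamma> e') + lin e v ^ \<gamma> e * dop d (\<lambda>v. \<Prod>e'\<in>UNIV - {e}. lin e' v ^ \<gamma> e') v"
    by (rule dop_mult) (rule sm_differentiable[of UNIV], auto intro!: sm_lin sm_power sm_prod)+
  moreover have pwe: "pw \<gamma> = (\<lambda>v. lin e v ^ \<gamma> e * (\<Prod>e'\<in>UNIV - {e}. lin e' v ^ \<gamma> e'))"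
    by (rule ext) (rule pw_split)
  ultimately have "dop d (pw \<gamma>) v = of_nat (\<gamma> e) * lin e v ^ (\<gamma> e - 1) * dop d (lin e) v * (\<Prod>e'\<in>UNIV - {e}. lin e' v ^ \<gamma> e')"
    using z[of "UNIV - {e}"] unfolding pwe by (simp add: dop_lin_power)
  moreover have "pw (\<gamma>(e := \<gamma> e - 1)) v = lin e v ^ (\<gamma> e - 1) * (\<Prod>e'\<in>UNIV - {e}. lin e' v ^ \<gamma> e')"
    by (subst pw_split[of _ _ e]) (auto intro!: prod.cong)
  ultimately show ?thesis by (simp add: dop_lin e_def)
qed

lemma mi_fact_Suc: "mi_fact (\<gamma>(e := Suc (\<gamma> e))) = real (Suc (\<gamma> e)) * mi_fact \<gamma>"
proof -
  have "mi_fact \<gamma> = fact (\<gamma> e) * (\<Prod>e'\<in>UNIV - {e}. fact (\<gamma> e'))" for \<gamma> :: "'a \<Rightarrow> nat"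
    unfolding mi_fact_def by (rule prod.remove) auto
  from this[of "\<gamma>(e := Suc (\<gamma> e))"] this[of \<gamma>]
  show ?thesis by (simp cong: prod.cong_simp)
qed

lemma mi_abs_Suc: "mi_abs (\<gamma>(e := Suc (\<gamma> e))) = Suc (mi_abs \<gamma>)"
proof -
  have "mi_abs \<gamma> = \<gamma> e + (\<Sum>e'\<in>UNIV - {e}. \<gamma> e')" for \<gamma> :: "'a \<Rightarrow> nat"
    unfolding mi_abs_def by (rule sum.remove) auto
  from this[of "\<gamma>(e := Suc (\<gamma> e))"] this[of \<gamma>]
  show ?thesis by (simp cong: sum.cong_simp)
qed

lemma bij_betw_mi_Suc:
  "bij_betw (\<lambda>\<gamma>. \<gamma>(e := Suc (\<gamma> e))) {\<gamma>. mi_abs \<gamma> = k} {\<gamma>. mi_abs \<gamma> = Suc k \<and> \<gamma> e > 0}"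
proof (rule bij_betwI[where g = "\<lambda>\<gamma>. \<gamma>(e := \<gamma> e - 1)"])
  show "(\<lambda>\<gamma>. \<gamma>(e := \<gamma> e - 1)) \<in> {\<gamma>. mi_abs \<gamma> = Suc k \<and> \<gamma> e > 0} \<rightarrow> {\<gamma>. mi_abs \<gamma> = k}"
  proof
    fix \<gamma> assume g: "\<gamma> \<in> {\<gamma>. mi_abs \<gamma> = Suc k \<and> \<gamma> e > 0}"
    have "(\<gamma>(e := \<gamma> e - 1))(e := Suc ((\<gamma>(e := \<gamma> e - 1)) e)) = \<gamma>" using g by (auto simp: fun_eq_iff)
    then show "\<gamma>(e := \<gamma> e - 1) \<in> {\<gamma>. mi_abs \<gamma> = k}" using mi_abs_Suc[of "\<gamma>(e := \<gamma> e - 1)" e] g by simp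
  qed
qed (auto simp: mi_abs_Suc fun_eq_iff)

context gevrey_potential
begin

text \<open>The letter acts either on a derivative of f, giving half the layer k of the derivative
  of f in direction \<open>mdir d\<close>, or on the monomial, lowering one exponent with the
  opposite sign. Reindexing by \<gamma> + e turns the second sum into the layer k - 1 of the same
  derivative of f.\<close>

lemma dop_layer:
  assumes v: "v \<in> D2 r" and d: "snd d"
  shows "dop d (layer f [] k (\<lambda>_. 1)) v
    = (1/2) * layer f [mdir d] k (\<lambda>_. 1) v - (if k = 0 then 0 else (1/2) * layer f [mdir d] (k - 1) (\<lambda>_. 1) v)"
proof -
  define e where "e = mdir d"
  define F where "F \<gamma> = dops (wd \<gamma>) f (mid v)" for \<gamma>
  define G where "G \<gamma> = dops (e # wd \<gamma>) f (mid v)" for \<gamma>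
  have df: "dops es f differentiable (at (mid v))" for es
    by (rule sm_differentiable[OF sm_dops[OF smf] mid_in_ball[OF v]])
  have dp: "pw \<gamma> differentiable (at v)" for \<gamma> :: "'n \<times> bool \<Rightarrow> nat" by (rule sm_differentiable[OF sm_pw]) simp
  have dm: "(\<lambda>v. dops es f (mid v)) differentiable (at v)" for es by (rule sm_differentiable[OF sm_derivative v])
  have "dop d (layer f [] k (\<lambda>_. 1)) v
     = (\<Sum>\<gamma> | mi_abs \<gamma> = k. dop d (\<lambda>v. of_real (1 / mi_fact \<gamma>) * (pw \<gamma> v * dops (wd \<gamma>) f (mid v))) v)"
    unfolding layer_def[abs_def] mult_1 append_Nil using dp dm by (intro dop_sum differentiable_mult differentiable_const)
  also have "\<dots> = (\<Sum>\<gamma> | mi_abs \<gamma> = k. (1/2) * (of_real (1 / mi_fact \<gamma>) * (pw \<gamma> v * G \<gamma>))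
      - (1/2) * (of_real (real (\<gamma> e) / mi_fact \<gamma>) * (pw (\<gamma>(e := \<gamma> e - 1)) v * F \<gamma>)))"
  proof (rule sum.cong)
    fix \<gamma> :: "'n \<times> bool \<Rightarrow> nat"
    have "dop d (\<lambda>v. of_real (1 / mi_fact \<gamma>) * (pw \<gamma> v * dops (wd \<gamma>) f (mid v))) v
       = of_real (1 / mi_fact \<gamma>) * (dop d (pw \<gamma>) v * F \<gamma> + pw \<gamma> v * ((1/2) * G \<gamma>))"
      by (subst dop_cmult, intro differentiable_mult dp dm)
         (simp only: dop_mult[OF dp dm] dop_mid[OF df] F_def G_def e_def dops.simps)
    note t = this
    show "dop d (\<lambda>v. of_real (1 / mi_fact \<gamma>) * (pw \<gamma> v * dops (wd \<gamma>) f (mid v))) v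
      = (1/2) * (of_real (1 / mi_fact \<gamma>) * (pw \<gamma> v * G \<gamma>))
      - (1/2) * (of_real (real (\<gamma> e) / mi_fact \<gamma>) * (pw (\<gamma>(e := \<gamma> e - 1)) v * F \<gamma>))"
      unfolding t dop_pw e_def[symmetric] using d by (simp add: diff_divide_distrib algebra_simps)
  qed simp
  also have "\<dots> = (1/2) * layer f [e] k (\<lambda>_. 1) v
      - (1/2) * (\<Sum>\<gamma> | mi_abs \<gamma> = k. of_real (real (\<gamma> e) / mi_fact \<gamma>) * (pw (\<gamma>(e := \<gamma> e - 1)) v * F \<gamma>))"
    by (simp add: layer_def G_def sum_subtractf sum_distrib_left)
  also have "(\<Sum>\<gamma> | mi_abs \<gamma> = k. of_real (real (\<gamma> e) / mi_fact \<gamma>) * (pw (\<gamma>(e := \<gamma> e - 1)) v * F \<gamma>))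
     = (if k = 0 then 0 else layer f [e] (k - 1) (\<lambda>_. 1) v)"
  proof (cases k)
    case 0
    have "\<gamma> e = 0" if "mi_abs \<gamma> = 0" for \<gamma> :: "'n \<times> bool \<Rightarrow> nat" using that by (simp add: mi_abs_def)
    then show ?thesis using 0 by (auto intro!: sum.neutral)
  next
    case (Suc j)
    have "(\<Sum>\<gamma> | mi_abs \<gamma> = k. of_real (real (\<gamma> e) / mi_fact \<gamma>) * (pw (\<gamma>(e := \<gamma> e - 1)) v * F \<gamma>))
      = (\<Sum>\<gamma> | mi_abs \<gamma> = Suc j \<and> \<gamma> e > 0. of_real (real (\<gamma> e) / mi_fact \<gamma>) * (pw (\<gamma>(e := \<gamma> e - 1)) v * F \<gamma>))"
      using finite_mi_abs[where 'k = "'n \<times> bool", of k] Suc by (intro sum.mono_neutral_right) auto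
    also have "\<dots> = (\<Sum>\<gamma> | mi_abs \<gamma> = j. of_real (real (Suc (\<gamma> e)) / mi_fact (\<gamma>(e := Suc (\<gamma> e)))) * (pw \<gamma> v * F (\<gamma>(e := Suc (\<gamma> e)))))"
      by (subst sum.reindex_bij_betw[OF bij_betw_mi_Suc, symmetric]) simp
    also have "\<dots> = layer f [e] j (\<lambda>_. 1) v"
      unfolding layer_def
    proof (rule sum.cong)
      fix \<gamma> :: "'n \<times> bool \<Rightarrow> nat"
      have "mset (wd (\<gamma>(e := Suc (\<gamma> e)))) = mset (e # wd \<gamma>)"
        by (rule multiset_eqI) (simp add: count_wd)
      then have "F (\<gamma>(e := Suc (\<gamma> e))) = dops ([e] @ wd \<gamma>) f (mid v)"
        unfolding F_def by (intro dops_perm[OF open_ball smf mid_in_ball[OF v]]) simp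
      moreover have "real (Suc (\<gamma> e)) / mi_fact (\<gamma>(e := Suc (\<gamma> e))) = 1 / mi_fact \<gamma>"
        unfolding mi_fact_Suc by simp
      ultimately show "of_real (real (Suc (\<gamma> e)) / mi_fact (\<gamma>(e := Suc (\<gamma> e)))) * (pw \<gamma> v * F (\<gamma>(e := Suc (\<gamma> e))))
         = of_real (1 / mi_fact \<gamma>) * (1 * (pw \<gamma> v * dops ([e] @ wd \<gamma>) f (mid v)))" by (simp only: mult_1)
    qed simp
    finally show ?thesis using Suc by simp
  qed
  finally show ?thesis by (simp add: e_def)
qed

lemma dop_partial_sum:
  assumes "v \<in> D2 r" "snd d"
  shows "dop d (\<lambda>v. \<Sum>k\<le>N. layer f [] k (\<lambda>_. 1) v) v = (1/2) * layer f [mdir d] N (\<lambda>_. 1) v"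
proof -
  have "dop d (\<lambda>v. \<Sum>k\<le>N. layer f [] k (\<lambda>_. 1) v) v = (\<Sum>k\<le>N. dop d (layer f [] k (\<lambda>_. 1)) v)"
    by (rule dop_sum) (rule sm_differentiable[OF sm_layer[OF sm_const] assms(1)])
  also have "\<dots> = (1/2) * layer f [mdir d] N (\<lambda>_. 1) v"
    by (induction N) (simp_all add: dop_layer[OF assms])
  finally show ?thesis .
qed

end

section \<open>The almost holomorphic extension\<close>

lemma continuous_rho_sq: "continuous_on UNIV (\<lambda>v. c * (rho v)\<^sup>2)"
proof -
  have "continuous_on UNIV (\<lambda>v. Re (complex_of_real ((rho v)\<^sup>2)))"
    by (intro continuous_on_Re sm_continuous_on sm_rho_sq)
  then show ?thesis by (intro continuous_on_mult continuous_on_const) simp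
qed

lemma open_rho_less: "open {v. c * (rho v)\<^sup>2 < t}" and open_rho_greater: "open {v. t < c * (rho v)\<^sup>2}"
  by (intro open_Collect_less continuous_rho_sq continuous_on_const)+

lemma rho_nonneg: "rho v \<ge> 0" by (simp add: rho_def)

context gevrey_potential
begin

text \<open>The argument of the cut-off of degree k is the square of \<open>lam k * rho v\<close>,
  see \<open>lam_sq\<close>: the cut-off is 1 while this square is at most 1/2 and 0 once it reaches
  1. Since \<open>0 powr (a - 1) = 0\<close>, the layer of degree 0 is never cut.\<close>

definition lam :: "nat \<Rightarrow> real" where
  "lam k = 2 powr (a - 1) * C1 * real k powr (a - 1)"

definition cutX :: "(real \<Rightarrow> real) \<Rightarrow> nat \<Rightarrow> complex^('n + 'n) \<Rightarrow> complex" where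
  "cutX chi k v = of_real (chi ((lam k)\<^sup>2 * (rho v)\<^sup>2))"

definition psi2 :: "(real \<Rightarrow> real) \<Rightarrow> complex^('n + 'n) \<Rightarrow> complex" where
  "psi2 chi v = (\<Sum>k. layer f [] k (cutX chi k) v)"

lemma lam_nonneg: "lam k \<ge> 0" using C1 by (simp add: lam_def)

lemma lam_mono: "i \<le> k \<Longrightarrow> lam i \<le> lam k"
  unfolding lam_def using C1 a by (intro mult_left_mono powr_mono2) auto

lemma lam_le: "lam k \<le> 2 powr (a - 1) * C1 * max 1 (real k) powr (a - 1)"
  unfolding lam_def using C1 a by (intro mult_left_mono powr_mono2) auto

lemma lam_sq: "(lam k)\<^sup>2 = real k powr (2 * (a - 1)) * 4 powr (a - 1) * C1\<^sup>2"
proof -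
  have "(real k powr (a - 1))\<^sup>2 = real k powr (2 * (a - 1))"
    by (simp add: power2_eq_square powr_add[symmetric])
  moreover have "(2 powr (a - 1))\<^sup>2 = (4::real) powr (a - 1)"
    by (simp add: power2_eq_square powr_mult[symmetric])
  ultimately show ?thesis by (simp add: lam_def power_mult_distrib)
qed

lemma lam_unbounded: "\<exists>k0. \<forall>k\<ge>k0. t \<le> lam k"
proof -
  define c where "c = 2 powr (a - 1) * C1"
  have c: "c > 0" using C1 by (simp add: c_def)
  define T where "T = max 1 (t / c)"
  obtain k0 :: nat where k0: "T powr (1 / (a - 1)) \<le> real k0" using real_arch_simple by blast
  have "t \<le> lam k" if "k \<ge> k0" for k
  proof -
    have "T = (T powr (1 / (a - 1))) powr (a - 1)" using a by (simp add: powr_powr T_def)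
    also have "\<dots> \<le> real k powr (a - 1)" using k0 that a by (intro powr_mono2) auto
    finally have "t / c \<le> real k powr (a - 1)" by (simp add: T_def)
    then have "t \<le> c * real k powr (a - 1)" using c by (simp add: field_simps)
    then show ?thesis by (simp add: lam_def c_def)
  qed
  then show ?thesis by blast
qed

text \<open>At each point only finitely many multi-indices contribute, because of the monomials
  where \<open>rho v = 0\<close> and because of the cut-off elsewhere. So the infinite sum is finite
  and may be regrouped by degree.\<close>

lemma gevrey_extension_eq:
  assumes chi: "\<And>t. \<bar>t\<bar> \<ge> 1 \<Longrightarrow> chi t = 0"
  shows "joint (gevrey_extension a C1 chi f) v = psi2 chi v"
proof -
  define h where "h \<gamma> = of_real (1 / mi_fact \<gamma>) * (cutX chi (mi_abs \<gamma>) v * (pw \<gamma> v * dops (wd \<gamma>) f (mid v)))" for \<gamma>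
  define \<Gamma> :: "('n \<Rightarrow> nat) \<times> ('n \<Rightarrow> nat) \<Rightarrow> 'n \<times> bool \<Rightarrow> nat" where
    "\<Gamma> = (\<lambda>(\<alpha>, \<beta>) e. if snd e then \<beta> (fst e) else \<alpha> (fst e))"
  have bij: "bij_betw \<Gamma> UNIV UNIV"
    by (rule bij_betwI[where g = "\<lambda>\<gamma>. (\<lambda>i. \<gamma> (i, False), \<lambda>i. \<gamma> (i, True))"])
       (auto simp: \<Gamma>_def fun_eq_iff)
  have H: "DD \<alpha> \<beta> f ((1/2) *\<^sub>R (yv v + cnjv (zv v))) / of_real (mi_fact \<alpha> * mi_fact \<beta>)
        * mi_pow ((1/2) *\<^sub>R (yv v - cnjv (zv v))) \<alpha> * mi_pow ((1/2) *\<^sub>R (zv v - cnjv (yv v))) \<beta>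
        * of_real (chi (real (mi_abs \<alpha> + mi_abs \<beta>) powr (2 * (a - 1)) * 4 powr (a - 1)
                        * C1\<^sup>2 * (norm (yv v - cnjv (zv v)))\<^sup>2)) = h (\<Gamma> (\<alpha>, \<beta>))" for \<alpha> \<beta>
  proof -
    have l: "lin (i, False) v = ((1/2) *\<^sub>R (yv v - cnjv (zv v))) $ i"
      "lin (i, True) v = ((1/2) *\<^sub>R (zv v - cnjv (yv v))) $ i" for i
      by (simp_all add: lin_def yv_def zv_def cnjv_def vector_scaleR_component) (simp_all add: scaleR_conv_of_real)
    have 1: "wd (\<Gamma> (\<alpha>, \<beta>)) = mi_word False \<alpha> @ mi_word True \<beta>" by (simp add: wd_def \<Gamma>_def)
    have 2: "mi_fact (\<Gamma> (\<alpha>, \<beta>)) = mi_fact \<alpha> * mi_fact \<beta>"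
      by (simp add: mi_fact_def prod_pair_bool \<Gamma>_def)
    have 3: "mi_abs (\<Gamma> (\<alpha>, \<beta>)) = mi_abs \<alpha> + mi_abs \<beta>"
      by (simp add: mi_abs_def sum_pair_bool \<Gamma>_def)
    have 4: "pw (\<Gamma> (\<alpha>, \<beta>)) v = mi_pow ((1/2) *\<^sub>R (yv v - cnjv (zv v))) \<alpha> * mi_pow ((1/2) *\<^sub>R (zv v - cnjv (yv v))) \<beta>"
      unfolding pw_def prod_pair_bool mi_pow_def l by (simp add: \<Gamma>_def)
    show ?thesis
      unfolding h_def 1 2 3 4 cutX_def lam_sq DD_eq_dops mid_def rho_def by simp
  qed
  have "joint (gevrey_extension a C1 chi f) v = infsum (\<lambda>x. h (\<Gamma> x)) UNIV"
    unfolding joint_def gevrey_extension_def yv_def[symmetric] zv_def[symmetric] H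
    by (rule infsum_cong) (simp add: case_prod_beta)
  also have "\<dots> = infsum h UNIV" by (rule infsum_reindex_bij_betw[OF bij])
  finally have J: "joint (gevrey_extension a C1 chi f) v = infsum h UNIV" .
  obtain k0 where k0: "\<And>\<gamma>. mi_abs \<gamma> \<ge> k0 \<Longrightarrow> h \<gamma> = 0"
  proof (cases "rho v = 0")
    case True
    have "h \<gamma> = 0" if "mi_abs \<gamma> \<ge> 1" for \<gamma>
    proof -
      have "\<exists>e. \<gamma> e > 0"
      proof (rule ccontr)
        assume "\<nexists>e. \<gamma> e > 0"
        then have "mi_abs \<gamma> = 0" by (simp add: mi_abs_def)
        then show False using that by simp
      qed
      then obtain e where e: "\<gamma> e > 0" by blast
      have "lin e v = 0" using cmod_lin_le[of e v] True by simp
      then show ?thesis using e pw_split[of \<gamma> v e] by (simp add: h_def)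
    qed
    then show ?thesis using that by blast
  next
    case False
    then have rp: "rho v > 0" using rho_nonneg[of v] by linarith
    obtain k0 where k0: "\<And>k. k \<ge> k0 \<Longrightarrow> 1 / rho v \<le> lam k" using lam_unbounded by blast
    have "h \<gamma> = 0" if "mi_abs \<gamma> \<ge> k0" for \<gamma>
    proof -
      have "1 \<le> lam (mi_abs \<gamma>) * rho v" using k0[OF that] rp by (simp add: field_simps)
      then have "1 \<le> (lam (mi_abs \<gamma>) * rho v)\<^sup>2" by (rule one_le_power)
      then have "chi ((lam (mi_abs \<gamma>))\<^sup>2 * (rho v)\<^sup>2) = 0" by (intro chi) (simp add: power_mult_distrib)
      then show ?thesis by (simp add: h_def cutX_def)
    qed
    then show ?thesis using that by blast
  qed
  have fin: "finite {\<gamma> :: 'n \<times> bool \<Rightarrow> nat. mi_abs \<gamma> < k0}"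
  proof -
    have "{\<gamma> :: 'n \<times> bool \<Rightarrow> nat. mi_abs \<gamma> < k0} = (\<Union>k<k0. {\<gamma>. mi_abs \<gamma> = k})" by auto
    then show ?thesis using finite_mi_abs by auto
  qed
  have lay: "layer f [] k (cutX chi k) v = sum h {\<gamma>. mi_abs \<gamma> = k}" for k
    unfolding layer_def h_def by (rule sum.cong) auto
  have "infsum h UNIV = infsum h {\<gamma>. mi_abs \<gamma> < k0}"
    by (rule infsum_cong_neutral) (use k0 in \<open>auto simp: not_less\<close>)
  also have "\<dots> = sum h {\<gamma>. mi_abs \<gamma> < k0}" by (rule infsum_finite[OF fin])
  also have "\<dots> = (\<Sum>k<k0. sum h {\<gamma> \<in> {\<gamma>. mi_abs \<gamma> < k0}. mi_abs \<gamma> = k})"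
    by (rule sum.group[OF fin, symmetric]) auto
  also have "\<dots> = (\<Sum>k<k0. sum h {\<gamma>. mi_abs \<gamma> = k})"
    by (rule sum.cong) (auto intro!: sum.cong)
  also have "\<dots> = psi2 chi v"
    unfolding psi2_def lay
    by (rule suminf_finite[symmetric]) (use k0 in \<open>auto intro!: sum.neutral simp: not_less\<close>)
  finally show ?thesis using J by simp
qed

lemma sm_cutX:
  assumes "gevrey_cutoff s chi"
  shows "sm S (cutX chi k)"
proof -
  have g: "gevrey_real s chi" using assms by (simp add: gevrey_cutoff_def)
  have "sm UNIV (\<lambda>v. complex_of_real ((lam k)\<^sup>2) * complex_of_real ((rho v)\<^sup>2))"
    by (intro sm_mult sm_const sm_rho_sq open_UNIV)
  then have "sm UNIV (\<lambda>v. complex_of_real ((lam k)\<^sup>2 * (rho v)\<^sup>2))" by simp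
  from sm_real_comp[where \<xi> = "\<lambda>j. (deriv ^^ j) chi" and j = 0, OF open_UNIV this gevrey_real_derivs[OF g]]
  have "sm UNIV (cutX chi k)" by (simp add: cutX_def[abs_def])
  then show ?thesis by (rule sm_subset) simp
qed

lemma cutX_bound:
  assumes cut: "gevrey_cutoff s chi" and s: "s \<ge> 1"
  obtains M A where "M > 0" "A \<ge> 0"
    "\<And>k v ds. lam k * rho v \<le> 1 \<Longrightarrow>
       cmod (dops ds (cutX chi k) v) \<le> M * (A * max 1 (real k) powr (a - 1)) ^ length ds * fact (length ds) powr s"
proof -
  have g: "gevrey_real s chi" using cut by (simp add: gevrey_cutoff_def)
  then obtain D0 D1 where D: "D0 > 0" "D1 > 0" and bd: "\<And>j t. \<bar>(deriv ^^ j) chi t\<bar> \<le> D0 * D1 ^ j * fact j powr s"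
    by (auto simp: gevrey_real_def)
  define A where "A = (2 + 2 * D1) * (2 powr (a - 1) * C1)"
  show thesis
  proof (rule that[OF D(1), of A])
    show "A \<ge> 0" using D C1 by (simp add: A_def)
    fix k and v :: "complex^('n + 'n)" and ds :: "(('n + 'n) \<times> bool) list" assume kv: "lam k * rho v \<le> 1"
    have "cmod (dops ds (cutX chi k) v) \<le> D0 * D1 ^ 0 * ((2 + 2 * D1) * lam k) ^ length ds * fact (0 + length ds) powr s"
      using cutoff_jets[where \<xi> = "\<lambda>j. (deriv ^^ j) chi" and j = 0, OF gevrey_real_derivs[OF g] bd D s lam_nonneg kv, of ds]
      by (simp add: cutX_def[abs_def])
    also have "\<dots> \<le> D0 * (A * max 1 (real k) powr (a - 1)) ^ length ds * fact (length ds) powr s"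
    proof -
      have "(2 + 2 * D1) * lam k \<le> A * max 1 (real k) powr (a - 1)"
        using mult_left_mono[OF lam_le[of k], of "2 + 2 * D1"] D by (simp add: A_def mult_ac)
      then show ?thesis using D lam_nonneg[of k] by (auto intro!: mult_right_mono mult_left_mono power_mono)
    qed
    finally show "cmod (dops ds (cutX chi k) v) \<le> D0 * (A * max 1 (real k) powr (a - 1)) ^ length ds * fact (length ds) powr s" .
  qed
qed

text \<open>The strict inequality describes an open set on which the cut-off is identically 0. On
  the complement \<open>lam k * rho v \<le> 1\<close> the layer bounds apply, so the two cases leave
  no gap.\<close>

lemma layer_far:
  assumes cut: "gevrey_cutoff s chi" and v: "v \<in> D2 r" and kv: "lam k * rho v > 1"
  shows "dops ds (layer f [] k (cutX chi k)) v = 0"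
proof -
  let ?O = "D2 r \<inter> {v. 1 < (lam k)\<^sup>2 * (rho v)\<^sup>2}"
  have "1 < (lam k * rho v)\<^sup>2" using kv by (simp add: one_less_power)
  then have vO: "v \<in> ?O" using v by (simp add: power_mult_distrib)
  have "layer f [] k (cutX chi k) x = 0" if "x \<in> ?O" for x
  proof -
    have "cutX chi k x = 0" using cut that by (auto simp: gevrey_cutoff_def cutX_def)
    then show ?thesis by (simp add: layer_def)
  qed
  then have "dops ds (layer f [] k (cutX chi k)) v = dops ds (\<lambda>_. 0) v"
    by (rule dops_cong_open[OF open_Int[OF open_D2 open_rho_greater] vO])
  then show ?thesis by (simp add: dops_const)
qed

lemma layer_near:
  assumes cut: "gevrey_cutoff s chi" and v: "v \<in> D2 r" and kv: "(lam k)\<^sup>2 * (rho v)\<^sup>2 < 1/2"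
  shows "dops ds (layer f [] k (cutX chi k)) v = dops ds (layer f [] k (\<lambda>_. 1)) v"
proof -
  let ?O = "D2 r \<inter> {v. (lam k)\<^sup>2 * (rho v)\<^sup>2 < 1/2}"
  have vO: "v \<in> ?O" using v kv by simp
  have "layer f [] k (cutX chi k) x = layer f [] k (\<lambda>_. 1) x" if "x \<in> ?O" for x
  proof -
    have "0 \<le> (lam k)\<^sup>2 * (rho x)\<^sup>2" by simp
    then have "cutX chi k x = 1" using cut that by (auto simp: gevrey_cutoff_def cutX_def)
    then show ?thesis by (simp add: layer_def)
  qed
  then show ?thesis by (rule dops_cong_open[OF open_Int[OF open_D2 open_rho_less] vO])
qed

text \<open>With the constant 1 in place of a cut-off one may take \<sigma> = 1, and the order is
  exactly a. This is the origin of \<epsilon> = 0 on the points z = cnj x.\<close>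

lemma layer_one_bound:
  obtains K R where "K > 0" "R \<ge> 1"
    "\<And>v k es ds. v \<in> D2 r \<Longrightarrow> length es \<le> 1 \<Longrightarrow> lam k * rho v \<le> 1 \<Longrightarrow>
      cmod (dops ds (layer f es k (\<lambda>_. 1)) v) \<le> K * decay a ^ k * R ^ length ds * fact (length ds) powr a"
proof -
  obtain K R where K: "K > 0" "R \<ge> 1" and lb:
    "\<And>v k es X M ds. v \<in> D2 r \<Longrightarrow> length es \<le> 1 \<Longrightarrow> sm (D2 r) X \<Longrightarrow> 0 \<le> M \<Longrightarrow>
      (\<And>ds. cmod (dops ds X v) \<le> M * (1 * max 1 (real k) powr (a - 1)) ^ length ds * fact (length ds) powr 1) \<Longrightarrow>
      (k \<ge> 1 \<Longrightarrow> rho v * (2 powr (a - 1) * C1 * real k powr (a - 1)) \<le> 1) \<Longrightarrow>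
      cmod (dops ds (layer f es k X) v) \<le> K * M * decay a ^ k * R ^ length ds * fact (length ds) powr (1 + a - 1)"
    using layer_bound[of 1 1] by (metis order_refl zero_le_one)
  show thesis
  proof (rule that[OF K])
    fix v :: "complex^('n + 'n)" and k and es :: "('n \<times> bool) list" and ds :: "(('n + 'n) \<times> bool) list"
    assume v: "v \<in> D2 r" "length es \<le> 1" and kv: "lam k * rho v \<le> 1"
    have "cmod (dops ds (layer f es k (\<lambda>_. 1)) v) \<le> K * 1 * decay a ^ k * R ^ length ds * fact (length ds) powr (1 + a - 1)"
    proof (rule lb[OF v sm_const])
      show "cmod (dops ds (\<lambda>_. 1) v) \<le> 1 * (1 * max 1 (real k) powr (a - 1)) ^ length ds * fact (length ds) powr 1"
        for ds :: "(('n + 'n) \<times> bool) list"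
        by (cases ds) (auto simp: dops_const)
    qed (use kv in \<open>auto simp: lam_def mult_ac\<close>)
    then show "cmod (dops ds (layer f es k (\<lambda>_. 1)) v) \<le> K * decay a ^ k * R ^ length ds * fact (length ds) powr a" by simp
  qed
qed

lemma layer_cut_bound:
  assumes cut: "gevrey_cutoff (1 + \<epsilon>) chi" and e: "\<epsilon> > 0"
  obtains K R where "K > 0" "R \<ge> 1"
    "\<And>v k ds. v \<in> D2 r \<Longrightarrow>
      cmod (dops ds (layer f [] k (cutX chi k)) v) \<le> K * decay a ^ k * R ^ length ds * fact (length ds) powr (a + \<epsilon>)"
proof -
  obtain M A where M: "M > 0" "A \<ge> 0" and cb: "\<And>k v ds. lam k * rho v \<le> 1 \<Longrightarrow>
       cmod (dops ds (cutX chi k) v) \<le> M * (A * max 1 (real k) powr (a - 1)) ^ length ds * fact (length ds) powr (1 + \<epsilon>)"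
    using cutX_bound[OF cut] e by (metis add_increasing2 less_imp_le order_refl)
  obtain K R where K: "K > 0" "R \<ge> 1" and lb:
    "\<And>v k es X M ds. v \<in> D2 r \<Longrightarrow> length es \<le> 1 \<Longrightarrow> sm (D2 r) X \<Longrightarrow> 0 \<le> M \<Longrightarrow>
      (\<And>ds. cmod (dops ds X v) \<le> M * (A * max 1 (real k) powr (a - 1)) ^ length ds * fact (length ds) powr (1 + \<epsilon>)) \<Longrightarrow>
      (k \<ge> 1 \<Longrightarrow> rho v * (2 powr (a - 1) * C1 * real k powr (a - 1)) \<le> 1) \<Longrightarrow>
      cmod (dops ds (layer f es k X) v) \<le> K * M * decay a ^ k * R ^ length ds * fact (length ds) powr (1 + \<epsilon> + a - 1)"
    using layer_bound[of "1 + \<epsilon>" A] M(2) e by (metis add_increasing2 less_imp_le order_refl)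
  show thesis
  proof (rule that[of "K * M" R])
    fix v :: "complex^('n + 'n)" and k and ds :: "(('n + 'n) \<times> bool) list"
    assume v: "v \<in> D2 r"
    show "cmod (dops ds (layer f [] k (cutX chi k)) v) \<le> K * M * decay a ^ k * R ^ length ds * fact (length ds) powr (a + \<epsilon>)"
    proof (cases "lam k * rho v \<le> 1")
      case True
      have "cmod (dops ds (layer f [] k (cutX chi k)) v) \<le> K * M * decay a ^ k * R ^ length ds * fact (length ds) powr (1 + \<epsilon> + a - 1)"
        by (rule lb[OF v _ sm_cutX[OF cut] less_imp_le[OF M(1)] cb[OF True]]) (use True in \<open>auto simp: lam_def mult_ac\<close>)
      then show ?thesis by (simp add: add.commute)
    next
      case False
      then show ?thesis using layer_far[OF cut v, of k ds] K M decay_bounds[OF a] by simp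
    qed
  qed (use K M in auto)
qed

section \<open>Smoothness, Gevrey bounds and flatness of the extension\<close>

lemma psi2_series:
  assumes cut: "gevrey_cutoff (1 + \<epsilon>) chi" and e: "\<epsilon> > 0"
  shows "sm (D2 r) (psi2 chi)"
    and "v \<in> D2 r \<Longrightarrow> dops ds (psi2 chi) v = (\<Sum>k. dops ds (layer f [] k (cutX chi k)) v)"
    and "v \<in> D2 r \<Longrightarrow> summable (\<lambda>k. cmod (dops ds (layer f [] k (cutX chi k)) v))"
proof -
  obtain K R where K: "K > 0" "R \<ge> 1" and lb: "\<And>v k ds. v \<in> D2 r \<Longrightarrow>
      cmod (dops ds (layer f [] k (cutX chi k)) v) \<le> K * decay a ^ k * R ^ length ds * fact (length ds) powr (a + \<epsilon>)"
    using layer_cut_bound[OF assms] by blast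
  define B where "B ds k = K * decay a ^ k * R ^ length ds * fact (length ds) powr (a + \<epsilon>)"
    for ds :: "(('n + 'n) \<times> bool) list" and k
  have sB: "summable (B ds)" for ds
    unfolding B_def by (intro summable_mult summable_mult2 summable_geometric) (use decay_bounds[OF a] in simp)
  have lB: "cmod (dops ds (layer f [] k (cutX chi k)) v) \<le> B ds k" if "v \<in> D2 r" for v ds k
    using lb[OF that] by (simp add: B_def)
  note sd = series_dops[of "D2 r" "\<lambda>k. layer f [] k (cutX chi k)" B,
      OF open_D2 convex_D2 sm_layer[OF sm_cutX[OF cut]] sB lB]
  have p: "psi2 chi = (\<lambda>v. \<Sum>k. layer f [] k (cutX chi k) v)" by (rule ext) (rule psi2_def)
  show "sm (D2 r) (psi2 chi)" unfolding p by (rule sd(1))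
  show "v \<in> D2 r \<Longrightarrow> dops ds (psi2 chi) v = (\<Sum>k. dops ds (layer f [] k (cutX chi k)) v)"
    unfolding p by (rule sd(2))
  show "v \<in> D2 r \<Longrightarrow> summable (\<lambda>k. cmod (dops ds (layer f [] k (cutX chi k)) v))"
    by (rule summable_comparison_test'[OF sB, of 0]) (use lB in auto)
qed

lemma suminf_geometric_bound:
  assumes "\<And>k. cmod (g k) \<le> B * q ^ k" "0 \<le> q" "q < 1" "summable (\<lambda>k. cmod (g k))"
  shows "cmod (\<Sum>k. g k) \<le> B / (1 - q)"
proof -
  have "cmod (\<Sum>k. g k) \<le> (\<Sum>k. cmod (g k))" by (rule summable_norm[OF assms(4)])
  also have "\<dots> \<le> (\<Sum>k. B * q ^ k)"
    by (rule suminf_le[OF assms(1,4)]) (intro summable_mult summable_geometric, use assms in simp)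
  also have "\<dots> = B / (1 - q)"
    using assms suminf_geometric[of q] by (subst suminf_mult) (auto intro!: summable_geometric)
  finally show ?thesis .
qed

text \<open>Where \<open>rho v = 0\<close> each layer agrees near v with the one without cut-off,
  whose order is a. For words with an antiholomorphic letter the series is split at N: the layers up
  to N have no cut-off near v and telescope to one layer of degree N; the rest is a geometric tail
  from degree N + 1 on.\<close>

lemma psi2_bounds:
  assumes cut: "gevrey_cutoff (1 + \<epsilon>) chi" and e: "\<epsilon> > 0"
  obtains K R where "K > 0" "R \<ge> 1"
    "\<And>v ds. v \<in> D2 r \<Longrightarrow> cmod (dops ds (psi2 chi) v) \<le> K * R ^ length ds * fact (length ds) powr (a + \<epsilon>)"
    "\<And>v ds. v \<in> D2 r \<Longrightarrow> rho v = 0 \<Longrightarrow> cmod (dops ds (psi2 chi) v) \<le> K * R ^ length ds * fact (length ds) powr a"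
    "\<And>v ds N. v \<in> D2 r \<Longrightarrow> anti ds \<Longrightarrow> (lam N)\<^sup>2 * (rho v)\<^sup>2 < 1/2 \<Longrightarrow>
       cmod (dops ds (psi2 chi) v) \<le> K * decay a ^ N * R ^ length ds * fact (length ds) powr (a + \<epsilon>)"
proof -
  obtain K1 R1 where K1: "K1 > 0" "R1 \<ge> 1" and b1: "\<And>v k es ds. v \<in> D2 r \<Longrightarrow> length es \<le> 1 \<Longrightarrow> lam k * rho v \<le> 1 \<Longrightarrow>
      cmod (dops ds (layer f es k (\<lambda>_. 1)) v) \<le> K1 * decay a ^ k * R1 ^ length ds * fact (length ds) powr a"
    using layer_one_bound by blast
  obtain K2 R2 where K2: "K2 > 0" "R2 \<ge> 1" and b2: "\<And>v k ds. v \<in> D2 r \<Longrightarrow>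
      cmod (dops ds (layer f [] k (cutX chi k)) v) \<le> K2 * decay a ^ k * R2 ^ length ds * fact (length ds) powr (a + \<epsilon>)"
    using layer_cut_bound[OF assms] by blast
  define q where "q = decay a"
  have q: "0 < q" "q < 1" using decay_bounds[OF a] by (auto simp: q_def)
  define R where "R = max R1 R2"
  define K where "K = (K1 + K2) / (1 - q)"
  have R: "R \<ge> 1" "R1 \<le> R" "R2 \<le> R" using K1 by (auto simp: R_def)
  have K: "K1 / (1 - q) \<le> K" "K2 / (1 - q) \<le> K" "K1 + K2 / (1 - q) \<le> K" "K > 0"
  proof -
    have "K1 * (1 - q) \<le> K1" using K1 q by simp
    then have "K1 \<le> K1 / (1 - q)" using q by (simp add: field_simps)
    then show "K1 + K2 / (1 - q) \<le> K" by (simp add: K_def add_divide_distrib)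
  qed (use K1 K2 q in \<open>auto simp: K_def divide_right_mono\<close>)
  note ser = psi2_series[OF assms]
  have RR: "R1 ^ n \<le> R ^ n" "R2 ^ n \<le> R ^ n" for n using R K1 K2 by (auto intro!: power_mono)
  have aa: "(fact n :: real) powr a \<le> fact n powr (a + \<epsilon>)" for n
    using e by (intro powr_mono) auto
  show thesis
  proof (rule that[OF K(4) R(1)])
    fix v :: "complex^('n + 'n)" and ds :: "(('n + 'n) \<times> bool) list"
    assume v: "v \<in> D2 r"
    define n where "n = length ds"
    have "cmod (dops ds (psi2 chi) v) \<le> (K2 * R2 ^ n * fact n powr (a + \<epsilon>)) / (1 - q)"
      unfolding ser(2)[OF v] by (rule suminf_geometric_bound[OF _ _ q(2) ser(3)[OF v]])
        (use b2[OF v, of ds] q in \<open>auto simp: n_def q_def mult_ac\<close>)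
    also have "\<dots> = (K2 / (1 - q)) * R2 ^ n * fact n powr (a + \<epsilon>)" by simp
    also have "\<dots> \<le> K * R ^ n * fact n powr (a + \<epsilon>)"
      using K RR K2 by (intro mult_right_mono mult_mono) auto
    finally show "cmod (dops ds (psi2 chi) v) \<le> K * R ^ length ds * fact (length ds) powr (a + \<epsilon>)" by (simp add: n_def)
  next
    fix v :: "complex^('n + 'n)" and ds :: "(('n + 'n) \<times> bool) list"
    assume v: "v \<in> D2 r" and rv: "rho v = 0"
    define n where "n = length ds"
    have "cmod (dops ds (layer f [] k (cutX chi k)) v) \<le> (K1 * R1 ^ n * fact n powr a) * q ^ k" for k
      using b1[OF v, of "[]" k ds] layer_near[OF cut v, of k ds] rv by (simp add: n_def q_def mult_ac)
    then have "cmod (dops ds (psi2 chi) v) \<le> (K1 * R1 ^ n * fact n powr a) / (1 - q)"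
      unfolding ser(2)[OF v] by (rule suminf_geometric_bound[OF _ less_imp_le[OF q(1)] q(2) ser(3)[OF v]])
    also have "\<dots> = (K1 / (1 - q)) * R1 ^ n * fact n powr a" by simp
    also have "\<dots> \<le> K * R ^ n * fact n powr a"
      using K RR K1 by (intro mult_right_mono mult_mono) auto
    finally show "cmod (dops ds (psi2 chi) v) \<le> K * R ^ length ds * fact (length ds) powr a" by (simp add: n_def)
  next
    fix v :: "complex^('n + 'n)" and ds :: "(('n + 'n) \<times> bool) list" and N
    assume v: "v \<in> D2 r" and an: "anti ds" and N: "(lam N)\<^sup>2 * (rho v)\<^sup>2 < 1/2"
    define n where "n = length ds"
    have near: "(lam k)\<^sup>2 * (rho v)\<^sup>2 < 1/2" if "k \<le> N" for k
    proof -
      have "(lam k)\<^sup>2 * (rho v)\<^sup>2 \<le> (lam N)\<^sup>2 * (rho v)\<^sup>2"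
        using lam_mono[OF that] lam_nonneg by (intro mult_right_mono power_mono) auto
      then show ?thesis using N by linarith
    qed
    have lN: "lam N * rho v \<le> 1"
    proof -
      have "(lam N * rho v)\<^sup>2 \<le> 1\<^sup>2" using N by (simp add: power_mult_distrib)
      then show ?thesis by (rule power2_le_imp_le) simp
    qed
    obtain d where d: "d \<in> set ds" "snd d" using an by (auto simp: anti_def)
    then obtain ds1 ds2 where ds: "ds = ds1 @ d # ds2" by (meson split_list)
    define ds' where "ds' = ds1 @ ds2"
    have sm1: "sm (D2 r) (layer f es k (\<lambda>_. 1))" for es k by (rule sm_layer[OF sm_const])
    define P where "P v = (\<Sum>k\<le>N. layer f [] k (\<lambda>_. 1) v)" for v
    have smP: "sm (D2 r) P" unfolding P_def[abs_def] by (intro sm_sum open_D2 sm1)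
    have "(\<Sum>k<Suc N. dops ds (layer f [] k (cutX chi k)) v) = (\<Sum>k\<le>N. dops ds (layer f [] k (\<lambda>_. 1)) v)"
      unfolding lessThan_Suc_atMost by (rule sum.cong) (use layer_near[OF cut v near] in auto)
    also have "\<dots> = dops ds P v"
      unfolding P_def[abs_def] by (rule dops_sum[OF open_D2 sm1 v, symmetric])
    \<comment> \<open>The antiholomorphic letter is moved to the innermost place, where it meets the
      partial sum.\<close>
    also have "\<dots> = dops (ds' @ [d]) P v"
      by (rule dops_perm[OF open_D2 smP v]) (simp add: ds ds'_def)
    also have "\<dots> = dops ds' (\<lambda>v. (1/2) * layer f [mdir d] N (\<lambda>_. 1) v) v"
      unfolding dops_append dops.simps
      by (rule dops_cong_open[OF open_D2 v]) (unfold P_def, rule dop_partial_sum[OF _ d(2)])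
    also have "\<dots> = (1/2) * dops ds' (layer f [mdir d] N (\<lambda>_. 1)) v"
      by (rule dops_cmult[OF open_D2 sm1 v])
    finally have h: "(\<Sum>k<Suc N. dops ds (layer f [] k (cutX chi k)) v) = (1/2) * dops ds' (layer f [mdir d] N (\<lambda>_. 1)) v" .
    have "cmod (\<Sum>k<Suc N. dops ds (layer f [] k (cutX chi k)) v) = (1/2) * cmod (dops ds' (layer f [mdir d] N (\<lambda>_. 1)) v)"
      unfolding h by (simp add: norm_mult norm_divide)
    also have "\<dots> \<le> 1 * (K1 * q ^ N * R1 ^ length ds' * fact (length ds') powr a)"
      unfolding q_def by (rule mult_mono) (use b1[OF v _ lN, of "[mdir d]" ds'] in auto)
    also have "\<dots> \<le> 1 * (K1 * q ^ N * R ^ n * fact n powr (a + \<epsilon>))"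
    proof (intro mult_left_mono mult_mono)
      have len: "length ds' \<le> n" by (simp add: ds ds'_def n_def)
      have "R1 ^ length ds' \<le> R ^ length ds'" by (rule RR)
      also have "\<dots> \<le> R ^ n" using R len by (intro power_increasing) auto
      finally show "R1 ^ length ds' \<le> R ^ n" .
      have "(fact (length ds') :: real) powr a \<le> fact n powr a"
        using len a by (intro powr_mono2) (auto intro: fact_mono)
      then show "(fact (length ds') :: real) powr a \<le> fact n powr (a + \<epsilon>)" using aa[of n] by linarith
    qed (use K1 q R in auto)
    finally have I: "cmod (\<Sum>k<Suc N. dops ds (layer f [] k (cutX chi k)) v) \<le> K1 * (q ^ N * R ^ n * fact n powr (a + \<epsilon>))"
      by (simp add: mult_ac)
    have sN: "summable (\<lambda>k. cmod (dops ds (layer f [] (k + Suc N) (cutX chi (k + Suc N))) v))"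
      using summable_ignore_initial_segment[OF ser(3)[OF v, of ds], of "Suc N"] .
    have "cmod (\<Sum>k. dops ds (layer f [] (k + Suc N) (cutX chi (k + Suc N))) v) \<le> (K2 * q ^ N * R ^ n * fact n powr (a + \<epsilon>)) / (1 - q)"
    proof (rule suminf_geometric_bound[OF _ less_imp_le[OF q(1)] q(2) sN])
      fix k
      have "cmod (dops ds (layer f [] (k + Suc N) (cutX chi (k + Suc N))) v)
         \<le> K2 * q ^ (k + Suc N) * R2 ^ n * fact n powr (a + \<epsilon>)"
        unfolding q_def n_def by (rule b2[OF v])
      also have "\<dots> \<le> K2 * q ^ (k + N) * R ^ n * fact n powr (a + \<epsilon>)"
        using q K2 RR[of n] by (intro mult_right_mono mult_mono power_decreasing) auto
      finally show "cmod (dops ds (layer f [] (k + Suc N) (cutX chi (k + Suc N))) v)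
         \<le> K2 * q ^ N * R ^ n * fact n powr (a + \<epsilon>) * q ^ k" by (simp add: power_add mult_ac)
    qed
    then have T: "cmod (\<Sum>k. dops ds (layer f [] (k + Suc N) (cutX chi (k + Suc N))) v)
       \<le> (K2 / (1 - q)) * (q ^ N * R ^ n * fact n powr (a + \<epsilon>))" by simp
    have "dops ds (psi2 chi) v = (\<Sum>k. dops ds (layer f [] (k + Suc N) (cutX chi (k + Suc N))) v)
        + (\<Sum>k<Suc N. dops ds (layer f [] k (cutX chi k)) v)"
      unfolding ser(2)[OF v] by (rule suminf_split_initial_segment[OF summable_norm_cancel[OF ser(3)[OF v]]])
    also have "cmod \<dots> \<le> (K2 / (1 - q)) * (q ^ N * R ^ n * fact n powr (a + \<epsilon>)) + K1 * (q ^ N * R ^ n * fact n powr (a + \<epsilon>))"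
      by (rule norm_triangle_le[OF add_mono[OF T I]])
    also have "\<dots> = (K1 + K2 / (1 - q)) * (q ^ N * R ^ n * fact n powr (a + \<epsilon>))" by (simp add: algebra_simps)
    also have "\<dots> \<le> K * (q ^ N * R ^ n * fact n powr (a + \<epsilon>))"
      using K q R by (intro mult_right_mono) auto
    finally show "cmod (dops ds (psi2 chi) v) \<le> K * decay a ^ N * R ^ length ds * fact (length ds) powr (a + \<epsilon>)"
      by (simp add: q_def n_def mult_ac)
  qed
qed

text \<open>The constant b of the theorem. The cut-off argument of degree k is at least 1/2 exactly
  when k \<ge> (2 4^(a-1) C1^2)^(-1/(2(a-1))) rho^(-1/(a-1)), and (a-1) ln 2 / 2 is minus the
  logarithm of \<open>decay a\<close>.\<close>

definition flat_const :: real where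
  "flat_const = (a - 1) * ln 2 / 2 * (2 * 4 powr (a - 1) * C1\<^sup>2) powr (- 1 / (2 * (a - 1)))"

lemma flat_const_pos: "flat_const > 0"
  using a C1 by (simp add: flat_const_def)

text \<open>\<open>flat_factor\<close> for \<beta> \<noteq> 0 as a function of the joint variable.
  The value at \<open>rho v = 0\<close> is set by hand, since \<open>0 powr s = 0\<close> would give
  1 there.\<close>

definition wt :: "complex^('n + 'n) \<Rightarrow> real" where
  "wt v = (if rho v = 0 then 0 else exp (- flat_const * rho v powr (- 1 / (a - 1))))"

lemma unit_weight_wt: "unit_weight wt S"
  using flat_const_pos by (auto simp: unit_weight_def wt_def)

text \<open>N is the predecessor of the least degree k at which the cut-off argument reaches 1/2.
  Then \<open>decay a ^ k \<le> wt v\<close> by the choice of \<open>flat_const\<close>, and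
  stepping back from k to N costs the factor 1 / decay a.\<close>

lemma choose_level:
  assumes "rho v > 0"
  obtains N where "(lam N)\<^sup>2 * (rho v)\<^sup>2 < 1/2" "decay a ^ N \<le> wt v / decay a"
proof -
  obtain k1 where "1 / rho v \<le> lam k1" using lam_unbounded by blast
  then have "1 \<le> lam k1 * rho v" using assms by (simp add: field_simps)
  then have "1 \<le> (lam k1 * rho v)\<^sup>2" by (rule one_le_power)
  then have ex: "\<not> (lam k1)\<^sup>2 * (rho v)\<^sup>2 < 1/2" by (simp add: power_mult_distrib)
  define k where "k = (LEAST k. \<not> (lam k)\<^sup>2 * (rho v)\<^sup>2 < 1/2)"
  have k: "\<not> (lam k)\<^sup>2 * (rho v)\<^sup>2 < 1/2" unfolding k_def by (rule LeastI[of "\<lambda>k. \<not> (lam k)\<^sup>2 * (rho v)\<^sup>2 < 1/2", OF ex])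
  \<comment> \<open>Degree 0 is never cut, so the least such k has a predecessor.\<close>
  have "lam 0 = 0" by (simp add: lam_def)
  then have "k \<noteq> 0" using k by (intro notI) simp
  then obtain N where N: "k = Suc N" by (cases k) auto
  have N2: "(lam N)\<^sup>2 * (rho v)\<^sup>2 < 1/2"
    using not_less_Least[of N "\<lambda>k. \<not> (lam k)\<^sup>2 * (rho v)\<^sup>2 < 1/2"] N unfolding k_def by auto
  define B where "B = 2 * 4 powr (a - 1) * C1\<^sup>2"
  have B: "B > 0" using C1 by (simp add: B_def)
  have "1 / (B * (rho v)\<^sup>2) \<le> real k powr (2 * (a - 1))"
  proof -
    have "1 \<le> real k powr (2 * (a - 1)) * (B * (rho v)\<^sup>2)"
      using k unfolding lam_sq B_def by (simp add: mult_ac)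
    moreover have "B * (rho v)\<^sup>2 > 0" using B assms by simp
    ultimately show ?thesis by (simp only: pos_divide_le_eq)
  qed
  then have "(1 / (B * (rho v)\<^sup>2)) powr (1 / (2 * (a - 1))) \<le> (real k powr (2 * (a - 1))) powr (1 / (2 * (a - 1)))"
    using B assms a by (intro powr_mono2) auto
  also have "\<dots> = real k" using a N by (simp add: powr_powr)
  also have "(1 / (B * (rho v)\<^sup>2)) powr (1 / (2 * (a - 1))) = B powr (- 1 / (2 * (a - 1))) * rho v powr (- 1 / (a - 1))"
  proof -
    have "(rho v)\<^sup>2 = rho v powr 2" using assms by simp
    then have "(1 / (B * (rho v)\<^sup>2)) powr (1 / (2 * (a - 1))) = (B powr (-1) * rho v powr (-2)) powr (1 / (2 * (a - 1)))"
      using B assms by (simp add: powr_minus divide_inverse)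
    also have "\<dots> = B powr (- 1 / (2 * (a - 1))) * rho v powr (- 1 / (a - 1))"
    proof -
      have "(-1) * (1 / (2 * (a - 1))) = - 1 / (2 * (a - 1))" "(-2) * (1 / (2 * (a - 1))) = - 1 / (a - 1)"
        using a by (simp_all add: field_simps)
      then show ?thesis by (simp only: powr_mult powr_ge_zero powr_powr)
    qed
    finally show ?thesis .
  qed
  finally have kb: "B powr (- 1 / (2 * (a - 1))) * rho v powr (- 1 / (a - 1)) \<le> real k" .
  have "decay a ^ k = exp (- ((a - 1) * ln 2 / 2 * real k))"
    by (simp add: decay_def exp_of_nat_mult[symmetric] mult.commute)
  also have "\<dots> \<le> exp (- ((a - 1) * ln 2 / 2 * (B powr (- 1 / (2 * (a - 1))) * rho v powr (- 1 / (a - 1)))))"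
    using mult_left_mono[OF kb, of "(a - 1) * ln 2 / 2"] a by simp
  also have "\<dots> = wt v" using assms by (simp add: wt_def flat_const_def B_def mult_ac)
  finally have "decay a ^ N * decay a \<le> wt v" by (simp add: N mult.commute)
  then have "decay a ^ N \<le> wt v / decay a" using decay_bounds[OF a] by (simp add: field_simps)
  then show thesis using that N2 by blast
qed

lemma psi2_gev:
  assumes cut: "gevrey_cutoff (1 + \<epsilon>) chi" and e: "\<epsilon> > 0"
  shows "gev (a + \<epsilon>) (D2 r) (D2 r) (omG wt) (psi2 chi)"
    and "gev a (D2 r) {v \<in> D2 r. rho v = 0} (omG (\<lambda>_. 0)) (psi2 chi)"
proof -
  obtain K R where K: "K > 0" "R \<ge> 1" and
    b1: "\<And>v ds. v \<in> D2 r \<Longrightarrow> cmod (dops ds (psi2 chi) v) \<le> K * R ^ length ds * fact (length ds) powr (a + \<epsilon>)" and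
    b2: "\<And>v ds. v \<in> D2 r \<Longrightarrow> rho v = 0 \<Longrightarrow> cmod (dops ds (psi2 chi) v) \<le> K * R ^ length ds * fact (length ds) powr a" and
    b3: "\<And>v ds N. v \<in> D2 r \<Longrightarrow> anti ds \<Longrightarrow> (lam N)\<^sup>2 * (rho v)\<^sup>2 < 1/2 \<Longrightarrow>
       cmod (dops ds (psi2 chi) v) \<le> K * decay a ^ N * R ^ length ds * fact (length ds) powr (a + \<epsilon>)"
    using psi2_bounds[OF assms] by blast
  have dec: "0 < decay a" "decay a < 1" using decay_bounds[OF a] by auto
  define C where "C = max (K / decay a) R"
  have "K \<le> K / decay a" using K dec by (simp add: field_simps)
  then have C: "C \<ge> 1" "K \<le> C" "K / decay a \<le> C" "R \<le> C" using K by (auto simp: C_def)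
  have Cn: "R ^ n \<le> C ^ n" for n using C K by (intro power_mono) auto
  \<comment> \<open>Where \<open>rho v = 0\<close> the third bound holds for every N, and N may tend
    to infinity.\<close>
  have z: "dops ds (psi2 chi) v = 0" if v: "v \<in> D2 r" "rho v = 0" "anti ds" for v ds
  proof -
    have "(\<lambda>N. K * decay a ^ N * R ^ length ds * fact (length ds) powr (a + \<epsilon>)) \<longlonglongrightarrow> K * 0 * R ^ length ds * fact (length ds) powr (a + \<epsilon>)"
      by (intro tendsto_intros LIMSEQ_power_zero) (use dec in simp)
    then have "cmod (dops ds (psi2 chi) v) \<le> K * 0 * R ^ length ds * fact (length ds) powr (a + \<epsilon>)"
      by (rule LIMSEQ_le_const) (use b3[OF v(1,3)] v(2) in auto)
    then show ?thesis by simp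
  qed
  have sm: "sm (D2 r) (psi2 chi)" by (rule psi2_series(1)[OF assms])
  have "cmod (dops ds (psi2 chi) v) \<le> C * C ^ length ds * fact (length ds) powr (a + \<epsilon>) * omG wt (anti ds) v"
    if v: "v \<in> D2 r" for v ds
  proof (cases "anti ds")
    case False
    have "cmod (dops ds (psi2 chi) v) \<le> K * R ^ length ds * fact (length ds) powr (a + \<epsilon>)" by (rule b1[OF v])
    also have "\<dots> \<le> C * C ^ length ds * fact (length ds) powr (a + \<epsilon>)"
      using C Cn K by (intro mult_right_mono mult_mono) auto
    finally show ?thesis using False by (simp add: omG_def)
  next
    case True
    show ?thesis
    proof (cases "rho v = 0")
      case True
      then show ?thesis using z[OF v True \<open>anti ds\<close>] \<open>anti ds\<close> by (simp add: omG_def wt_def)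
    next
      case False
      then have "rho v > 0" using rho_nonneg[of v] by linarith
      then obtain N where N: "(lam N)\<^sup>2 * (rho v)\<^sup>2 < 1/2" "decay a ^ N \<le> wt v / decay a" using choose_level by blast
      have w: "wt v \<ge> 0" by (simp add: wt_def)
      have "cmod (dops ds (psi2 chi) v) \<le> K * decay a ^ N * R ^ length ds * fact (length ds) powr (a + \<epsilon>)"
        by (rule b3[OF v True N(1)])
      also have "\<dots> \<le> K * (wt v / decay a) * C ^ length ds * fact (length ds) powr (a + \<epsilon>)"
        using N(2) Cn K w dec by (intro mult_right_mono mult_mono) auto
      also have "\<dots> = (K / decay a) * (C ^ length ds * fact (length ds) powr (a + \<epsilon>) * wt v)" by simp
      also have "\<dots> \<le> C * (C ^ length ds * fact (length ds) powr (a + \<epsilon>) * wt v)"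
        using C w by (intro mult_right_mono) auto
      finally show ?thesis using True by (simp add: omG_def mult_ac)
    qed
  qed
  then show "gev (a + \<epsilon>) (D2 r) (D2 r) (omG wt) (psi2 chi)" unfolding gev_def using sm C by blast
  have "cmod (dops ds (psi2 chi) v) \<le> C * C ^ length ds * fact (length ds) powr a * omG (\<lambda>_. 0) (anti ds) v"
    if v: "v \<in> D2 r" "rho v = 0" for v ds
  proof (cases "anti ds")
    case False
    have "cmod (dops ds (psi2 chi) v) \<le> K * R ^ length ds * fact (length ds) powr a" by (rule b2[OF v])
    also have "\<dots> \<le> C * C ^ length ds * fact (length ds) powr a"
      using C Cn K by (intro mult_right_mono mult_mono) auto
    finally show ?thesis using False by (simp add: omG_def)
  qed (use z[OF v] in \<open>simp add: omG_def\<close>)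
  then show "gev a (D2 r) {v \<in> D2 r. rho v = 0} (omG (\<lambda>_. 0)) (psi2 chi)"
    unfolding gev_def using sm C by blast
qed

end

section \<open>Differentiation under the integral sign\<close>

text \<open>\<open>leibniz_rule\<close> takes the derivative as a continuous family of bounded
  linear maps. \<open>L\<close> assembles it from the Wirtinger derivatives, its continuity is
  checked componentwise by \<open>cd\<close>, and \<open>dop_Wirtinger_form\<close> reads off the
  derivative of the integral.\<close>

lemma dop_integral:
  fixes h :: "real \<Rightarrow> complex^'k::finite \<Rightarrow> complex"
  assumes D: "open D" "convex D" and q: "q \<in> D"
    and df: "\<And>s q. s \<in> {0..1} \<Longrightarrow> q \<in> D \<Longrightarrow> h s differentiable (at q)"
    and cd: "\<And>d. continuous_on (D \<times> {0..1}) (\<lambda>x. dop d (h (snd x)) (fst x))"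
    and ch: "\<And>q. q \<in> D \<Longrightarrow> continuous_on {0..1} (\<lambda>s. h s q)"
  shows "(\<lambda>q. integral {0..1} (\<lambda>s. h s q)) differentiable (at q)"
    and "dop d (\<lambda>q. integral {0..1} (\<lambda>s. h s q)) q = integral {0..1} (\<lambda>s. dop d (h s) q)"
proof -
  define L where "L q s v = (\<Sum>i\<in>UNIV. v $ i * dop (i,False) (h s) q + cnj (v $ i) * dop (i,True) (h s) q)"
    for q s and v :: "complex^'k"
  have bl: "bounded_linear (L q s)" for q s
  proof -
    have 1: "bounded_linear (\<lambda>v :: complex^'k. v $ i * c)" for i c
      by (rule bounded_linear_compose[OF bounded_linear_mult_left bounded_linear_vec_nth])
    have 2: "bounded_linear (\<lambda>v :: complex^'k. cnj (v $ i) * c)" for i c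
      by (rule bounded_linear_compose[OF bounded_linear_mult_left bounded_linear_compose[OF bounded_linear_cnj bounded_linear_vec_nth]])
    show ?thesis unfolding L_def by (intro bounded_linear_sum bounded_linear_add 1 2)
  qed
  define fx where "fx q s = Blinfun (L q s)" for q s
  have fx: "blinfun_apply (fx q s) = L q s" for q s
    unfolding fx_def by (rule bounded_linear_Blinfun_apply[OF bl])
  have cfx: "continuous_on (D \<times> {0..1}) (\<lambda>x. fx (fst x) (snd x))"
    by (rule continuous_on_blinfun_componentwise) (unfold fx L_def, intro continuous_intros cd)
  have cont1: "continuous_on {0..1} (\<lambda>s. dop d (h s) q)" if "q \<in> D" for d q
  proof -
    have "continuous_on {0..1} (\<lambda>s. dop d (h (snd (q, s))) (fst (q, s)))"
      by (rule continuous_on_compose2[OF cd]) (use that in \<open>auto intro!: continuous_intros\<close>)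
    then show ?thesis by simp
  qed
  have der: "((\<lambda>q. integral (cbox 0 1) (\<lambda>s. h s q)) has_derivative integral (cbox 0 1) (fx q)) (at q within D)"
  proof (rule leibniz_rule[OF _ _ _ q D(2)])
    show "((\<lambda>x. h t x) has_derivative blinfun_apply (fx x t)) (at x within D)" if "x \<in> D" "t \<in> cbox 0 1" for x t
    proof -
      have "h t differentiable (at x)" using df that by simp
      then obtain f' where f': "(h t has_derivative f') (at x)" by (auto simp: differentiable_def)
      have "f' = L x t" unfolding L_def by (rule ext) (rule has_derivative_Wirtinger[OF f'])
      then show ?thesis using has_derivative_at_withinI[OF f'] by (simp add: fx)
    qed
    show "(\<lambda>s. h s x) integrable_on cbox 0 1" if "x \<in> D" for x
      using integrable_continuous_interval[OF ch[OF that]] by simp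
    show "continuous_on (D \<times> cbox 0 1) (\<lambda>(x, t). fx x t)" using cfx by (simp add: case_prod_unfold)
  qed
  have int: "(\<lambda>s. dop d (h s) q) integrable_on {0..1}" for d
    by (rule integrable_continuous_interval[OF cont1[OF q]])
  have fxint: "fx q integrable_on cbox 0 1"
  proof -
    have "continuous_on {0..1} (\<lambda>s. fx (fst (q, s)) (snd (q, s)))"
      by (rule continuous_on_compose2[OF cfx]) (use q in \<open>auto intro!: continuous_intros\<close>)
    then show ?thesis using integrable_continuous_interval[of 0 1 "fx q"] by simp
  qed
  have "blinfun_apply (integral (cbox 0 1) (fx q)) v
      = (\<Sum>i\<in>UNIV. v $ i * integral {0..1} (\<lambda>s. dop (i,False) (h s) q) + cnj (v $ i) * integral {0..1} (\<lambda>s. dop (i,True) (h s) q))" for v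
  proof -
    have i: "(\<lambda>s. v $ i * dop (i,False) (h s) q) integrable_on {0..1}" "(\<lambda>s. cnj (v $ i) * dop (i,True) (h s) q) integrable_on {0..1}" for i
      by (intro integrable_on_mult_right int)+
    have "blinfun_apply (integral (cbox 0 1) (fx q)) v = integral {0..1} (\<lambda>s. L q s v)"
      using blinfun_apply_integral[OF fxint, of v] by (simp add: fx)
    also have "\<dots> = (\<Sum>k\<in>UNIV. integral {0..1} (\<lambda>s. v $ k * dop (k,False) (h s) q + cnj (v $ k) * dop (k,True) (h s) q))"
      unfolding L_def by (rule integral_sum) (auto intro!: integrable_add i)
    also have "\<dots> = (\<Sum>i\<in>UNIV. v $ i * integral {0..1} (\<lambda>s. dop (i,False) (h s) q) + cnj (v $ i) * integral {0..1} (\<lambda>s. dop (i,True) (h s) q))"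
      by (rule sum.cong) (simp_all add: integral_add[OF i])
    finally show ?thesis .
  qed
  then have e: "blinfun_apply (integral (cbox 0 1) (fx q)) = (\<lambda>v. \<Sum>i\<in>UNIV. v $ i * integral {0..1} (\<lambda>s. dop (i,False) (h s) q)
      + cnj (v $ i) * integral {0..1} (\<lambda>s. dop (i,True) (h s) q))"
    by (rule ext)
  have "((\<lambda>q. integral {0..1} (\<lambda>s. h s q)) has_derivative
     (\<lambda>v. \<Sum>i\<in>UNIV. v $ i * integral {0..1} (\<lambda>s. dop (i,False) (h s) q) + cnj (v $ i) * integral {0..1} (\<lambda>s. dop (i,True) (h s) q))) (at q)"
    using der unfolding e at_within_open[OF q D(1)] by simp
  note F = this
  show "(\<lambda>q. integral {0..1} (\<lambda>s. h s q)) differentiable (at q)" using F by (auto simp: differentiable_def)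
  show "dop d (\<lambda>q. integral {0..1} (\<lambda>s. h s q)) q = integral {0..1} (\<lambda>s. dop d (h s) q)"
    unfolding dop_Wirtinger_form[OF F] by (cases d) auto
qed

section \<open>The space of the variables \<open>x\<close>, \<open>t = y - x\<close>, \<open>z\<close>\<close>

definition xc :: "complex^('n::finite + ('n + 'n)) \<Rightarrow> complex^'n" where "xc q = (\<chi> i. q $ Inl i)"
definition tc :: "complex^('n::finite + ('n + 'n)) \<Rightarrow> complex^'n" where "tc q = (\<chi> i. q $ Inr (Inl i))"
definition zc :: "complex^('n::finite + ('n + 'n)) \<Rightarrow> complex^'n" where "zc q = (\<chi> i. q $ Inr (Inr i))"
definition trip :: "complex^'n::finite \<Rightarrow> complex^'n \<Rightarrow> complex^'n \<Rightarrow> complex^('n + ('n + 'n))" where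
  "trip x t z = (\<chi> k. case k of Inl i \<Rightarrow> x $ i | Inr j \<Rightarrow> (case j of Inl i \<Rightarrow> t $ i | Inr i \<Rightarrow> z $ i))"

lemma trip_simps [simp]:
  "trip x t z $ Inl i = x $ i" "trip x t z $ Inr (Inl i) = t $ i" "trip x t z $ Inr (Inr i) = z $ i"
  "xc (trip x t z) = x" "tc (trip x t z) = t" "zc (trip x t z) = z" "trip (xc q) (tc q) (zc q) = q"
  by (auto simp: trip_def xc_def tc_def zc_def vec_eq_iff split: sum.splits)

lemma pair_vec_simps [simp]:
  "pair_vec x z $ Inl i = x $ i" "pair_vec x z $ Inr i = z $ i" "yv (pair_vec x z) = x" "zv (pair_vec x z) = z"
  "pair_vec (yv v) (zv v) = v"
  by (auto simp: pair_vec_def yv_def zv_def vec_eq_iff split: sum.splits)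

lemma joint_pair_vec [simp]: "joint f (pair_vec x z) = f x z"
  by (simp add: joint_def)

definition D3 :: "real \<Rightarrow> (complex^('n::finite + ('n + 'n))) set" where
  "D3 r = {q. xc q \<in> ball 0 r \<and> xc q + tc q \<in> ball 0 r \<and> zc q \<in> ball 0 r}"

text \<open>The point (s x + (1 - s) y, z) at which \<theta>(x, y, z) integrates the gradient of
  \<psi>, written with y = x + t. For t = 0 it does not depend on s.\<close>

definition seg :: "real \<Rightarrow> complex^('n::finite + ('n + 'n)) \<Rightarrow> complex^('n + 'n)" where
  "seg s q = pair_vec (xc q + (1 - s) *\<^sub>R tc q) (zc q)"

text \<open>The letter that d induces on a function composed with \<open>seg s\<close>. Letters in t
  act like those in x with an additional factor 1 - s; \<open>is_t\<close> detects them.\<close>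

definition tdir :: "('n + ('n + 'n)) \<times> bool \<Rightarrow> ('n + 'n) \<times> bool" where
  "tdir d = (case fst d of Inl i \<Rightarrow> (Inl i, snd d) | Inr j \<Rightarrow> (case j of Inl i \<Rightarrow> (Inl i, snd d) | Inr i \<Rightarrow> (Inr i, snd d)))"

definition is_t :: "('n + ('n + 'n)) \<times> bool \<Rightarrow> bool" where
  "is_t d \<longleftrightarrow> (\<exists>i. fst d = Inr (Inl i))"

lemma linear_xc: "linear xc" and linear_tc: "linear tc" and linear_zc: "linear zc"
  by (auto intro!: linearI simp: xc_def tc_def zc_def vec_eq_iff)

lemma D3_eq: "D3 r = (xc -` ball 0 r) \<inter> ((\<lambda>q. xc q + tc q) -` ball 0 r) \<inter> (zc -` ball 0 r)"
  by (auto simp: D3_def)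

lemma open_D3: "open (D3 r)"
  unfolding D3_eq
  by (intro open_Int open_vimage open_ball linear_continuous_on)
     (simp_all add: linear_conv_bounded_linear[symmetric] linear_xc linear_tc linear_zc linear_compose_add)

lemma convex_D3: "convex (D3 r)"
  unfolding D3_eq
  by (intro convex_Int convex_linear_vimage linear_xc linear_zc convex_ball linear_compose_add linear_tc)

lemma seg_in_D2:
  assumes "q \<in> D3 r" "s \<in> {0..1}"
  shows "seg s q \<in> D2 r"
proof -
  have "xc q + (1 - s) *\<^sub>R tc q = s *\<^sub>R xc q + (1 - s) *\<^sub>R (xc q + tc q)"
    by (simp add: algebra_simps)
  also have "\<dots> \<in> ball 0 r"
    using assms by (intro convexD[OF convex_ball]) (auto simp: D3_def)
  finally show ?thesis using assms by (simp add: D2_def seg_def D3_def)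
qed

lemma dop_chain_single:
  fixes h :: "complex^'k::finite \<Rightarrow> complex^'l::finite"
  assumes "f differentiable (at (h w))" "\<And>k. (\<lambda>x. h x $ k) differentiable (at w)"
    and "\<And>k. dop d (\<lambda>x. h x $ k) w = (if e = (k, False) then c else 0)"
    and "\<And>k. dop d (\<lambda>x. cnj (h x $ k)) w = (if e = (k, True) then c else 0)"
  shows "dop d (\<lambda>x. f (h x)) w = c * dop e f (h w)"
proof -
  obtain k b where e: "e = (k, b)" by (cases e)
  have "dop d (\<lambda>x. f (h x)) w = (\<Sum>i\<in>UNIV. dop (i, False) f (h w) * (if e = (i, False) then c else 0)
      + dop (i, True) f (h w) * (if e = (i, True) then c else 0))"
    unfolding dop_chain[OF assms(1) differentiable_componentwise[OF assms(2)]] assms(3,4) ..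
  also have "\<dots> = (\<Sum>i\<in>UNIV. if i = k then c * dop e f (h w) else 0)"
    by (rule sum.cong) (auto simp: e)
  finally show ?thesis by simp
qed

lemma seg_nth: "seg s q $ Inl i = q $ Inl i + of_real (1 - s) * q $ Inr (Inl i)" "seg s q $ Inr i = q $ Inr (Inr i)"
  by (simp_all add: seg_def xc_def tc_def zc_def scaleR_conv_of_real[where 'a=complex])

lemma sm_seg: "sm UNIV (\<lambda>q. seg s q $ k)"
  by (cases k) (auto simp: seg_nth intro!: sm_add sm_mult sm_const sm_coord)

lemma dop_seg_nth: "dop d (\<lambda>q. seg s q $ k) q = (if tdir d = (k, False) then (if is_t d then of_real (1 - s) else 1) else 0)"
proof (cases k)
  case (Inl i)
  have "dop d (\<lambda>q. q $ Inl i + of_real (1 - s) * q $ Inr (Inl i)) q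
     = (if d = (Inl i, False) then 1 else 0) + of_real (1 - s) * (if d = (Inr (Inl i), False) then 1 else 0)"
    by (subst dop_add, intro differentiable_coord, intro differentiable_mult differentiable_const differentiable_coord,
        subst dop_cmult, rule differentiable_coord) (simp only: dop_coord)
  note h = this
  show ?thesis unfolding Inl seg_nth h
    by (cases d) (auto simp: tdir_def is_t_def split: sum.splits)
next
  case (Inr i)
  show ?thesis unfolding Inr seg_nth dop_coord
    by (cases d) (auto simp: tdir_def is_t_def split: sum.splits)
qed

lemma tdir_flip: "tdir (fst d, \<not> snd d) = (fst (tdir d), \<not> snd (tdir d))" "is_t (fst d, b) = is_t d"
  by (auto simp: tdir_def is_t_def split: sum.splits)

lemma dop_cnj_seg_nth: "dop d (\<lambda>q. cnj (seg s q $ k)) q = (if tdir d = (k, True) then (if is_t d then of_real (1 - s) else 1) else 0)"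
proof -
  have "dop d (\<lambda>q. cnj (seg s q $ k)) q = cnj (dop (fst d, \<not> snd d) (\<lambda>q. seg s q $ k) q)"
    by (rule dop_cnj) (rule sm_differentiable[OF sm_seg], simp)
  then show ?thesis unfolding dop_seg_nth tdir_flip by (cases "tdir d") auto
qed

lemma dop_seg:
  assumes "g differentiable (at (seg s q))"
  shows "dop d (\<lambda>q. g (seg s q)) q = (if is_t d then of_real (1 - s) else 1) * dop (tdir d) g (seg s q)"
  by (rule dop_chain_single[OF assms _ dop_seg_nth dop_cnj_seg_nth]) (rule sm_differentiable[OF sm_seg], simp)

lemma sm_comp_seg: "sm (D2 r) g \<Longrightarrow> s \<in> {0..1} \<Longrightarrow> sm (D3 r) (\<lambda>q. g (seg s q))"
  by (rule sm_compose[OF open_D3 _ sm_subset[OF sm_seg]]) (auto intro: seg_in_D2)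

text \<open>The power j counts derivatives in t, each of which brings out a factor 1 - s. With it
  the class is closed under all derivatives; the components of \<theta> are cases with j =
  0.\<close>

definition seg_int :: "nat \<Rightarrow> (complex^('n::finite + 'n) \<Rightarrow> complex) \<Rightarrow> complex^('n + ('n + 'n)) \<Rightarrow> complex" where
  "seg_int j g q = integral {0..1} (\<lambda>s. of_real ((1 - s) ^ j) * g (seg s q))"

lemma continuous_seg: "continuous_on S (\<lambda>x. seg (snd x) (fst x))"
proof -
  have "continuous_on S (\<lambda>x. seg (snd x) (fst x) $ k)" for k
    by (cases k) (auto simp: seg_nth intro!: continuous_intros)
  then have "continuous_on S (\<lambda>x. \<chi> k. seg (snd x) (fst x) $ k)" by (rule continuous_on_vec_lambda)
  then show ?thesis by simp
qed

lemma dop_seg_int: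
  assumes g: "sm (D2 r) g" and q: "q \<in> D3 r"
  shows "seg_int j g differentiable (at q)"
    and "dop d (seg_int j g) q = seg_int (if is_t d then Suc j else j) (dop (tdir d) g) q"
proof -
  define h where "h s q = of_real ((1 - s) ^ j) * g (seg s q)" for s q
  have dg: "g differentiable (at (seg s q))" if "s \<in> {0..1}" "q \<in> D3 r" for s q
    by (rule sm_differentiable[OF g seg_in_D2[OF that(2,1)]])
  have dgs: "(\<lambda>q. g (seg s q)) differentiable (at q)" if "s \<in> {0..1}" "q \<in> D3 r" for s q
    by (rule sm_differentiable[OF sm_comp_seg[OF g that(1)] that(2)])
  have dh: "h s differentiable (at q)" if "s \<in> {0..1}" "q \<in> D3 r" for s q
    unfolding h_def[abs_def] by (intro differentiable_mult differentiable_const dgs that)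
  have dph: "dop d (h s) q = of_real ((1 - s) ^ (if is_t d then Suc j else j)) * dop (tdir d) g (seg s q)"
    if "s \<in> {0..1}" "q \<in> D3 r" for s q d
    unfolding h_def[abs_def] dop_cmult[OF dgs[OF that]] dop_seg[OF dg[OF that]] by simp
  have cg: "continuous_on (D3 r \<times> {0..1}) (\<lambda>x. of_real ((1 - snd x) ^ i) * g' (seg (snd x) (fst x)))" if "sm (D2 r) g'" for g' i
    by (intro continuous_intros continuous_on_compose2[OF sm_continuous_on[OF that] continuous_seg])
       (auto intro: seg_in_D2)
  have c1: "continuous_on (D3 r \<times> {0..1}) (\<lambda>x. dop d (h (snd x)) (fst x))" for d
  proof -
    have "continuous_on (D3 r \<times> {0..1}) (\<lambda>x. dop d (h (snd x)) (fst x))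
      \<longleftrightarrow> continuous_on (D3 r \<times> {0..1}) (\<lambda>x. of_real ((1 - snd x) ^ (if is_t d then Suc j else j)) * dop (tdir d) g (seg (snd x) (fst x)))"
      by (rule continuous_on_cong) (auto simp: dph)
    then show ?thesis using cg[OF sm_dop[OF g]] by simp
  qed
  have c2: "continuous_on {0..1} (\<lambda>s. h s q)" if "q \<in> D3 r" for q
  proof -
    have "continuous_on {0..1} (\<lambda>s. of_real ((1 - snd (q, s)) ^ j) * g (seg (snd (q, s)) (fst (q, s))))"
      by (rule continuous_on_compose2[OF cg[OF g, of j]]) (use that in \<open>auto intro!: continuous_intros\<close>)
    then show ?thesis by (simp add: h_def)
  qed
  have I: "seg_int j g = (\<lambda>q. integral {0..1} (\<lambda>s. h s q))" by (rule ext) (simp add: seg_int_def h_def)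
  note L = dop_integral[OF open_D3 convex_D3 q, of h, OF dh c1 c2]
  show "seg_int j g differentiable (at q)" unfolding I by (rule L(1))
  show "dop d (seg_int j g) q = seg_int (if is_t d then Suc j else j) (dop (tdir d) g) q"
  proof -
    have "dop d (seg_int j g) q = integral {0..1} (\<lambda>s. dop d (h s) q)" unfolding I by (rule L(2))
    also have "\<dots> = seg_int (if is_t d then Suc j else j) (dop (tdir d) g) q"
      unfolding seg_int_def by (rule integral_cong) (rule dph[OF _ q])
    finally show ?thesis .
  qed
qed

lemma dops_seg_int:
  assumes g: "sm (D2 r) g"
  shows "\<exists>i. \<forall>q\<in>D3 r. dops ds (seg_int j g) q = seg_int i (dops (map tdir ds) g) q"
proof (induction ds)
  case (Cons d ds)
  then obtain i where i: "\<And>q. q \<in> D3 r \<Longrightarrow> dops ds (seg_int j g) q = seg_int i (dops (map tdir ds) g) q" by blast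
  have "dops (d # ds) (seg_int j g) q = seg_int (if is_t d then Suc i else i) (dops (map tdir (d # ds)) g) q" if "q \<in> D3 r" for q
    using dop_cong_open[OF open_D3 that i] dop_seg_int(2)[OF sm_dops[OF g] that] by simp
  then show ?case by blast
qed auto

lemma sm_seg_int:
  fixes g :: "complex^('n::finite + 'n) \<Rightarrow> complex"
  assumes g: "sm (D2 r) g"
  shows "sm (D3 r) (seg_int j g)"
proof (rule sm_I)
  fix ds and q :: "complex^('n + ('n + 'n))" assume q: "q \<in> D3 r"
  obtain i where i: "\<And>q. q \<in> D3 r \<Longrightarrow> dops ds (seg_int j g) q = seg_int i (dops (map tdir ds) g) q"
    using dops_seg_int[OF g] by blast
  show "dops ds (seg_int j g) differentiable (at q)"
    by (rule differentiable_cong_open[OF open_D3 q i[symmetric] dop_seg_int(1)[OF sm_dops[OF g] q]])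
qed

text \<open>The points y = x over S, at which the recursion evaluates. Estimates are made only
  there, although derivatives in t are taken as well.\<close>

definition lift3 :: "(complex^('n::finite + 'n)) set \<Rightarrow> (complex^('n + ('n + 'n))) set" where
  "lift3 S = {q. tc q = 0 \<and> pair_vec (xc q) (zc q) \<in> S}"

definition pr :: "complex^('n::finite + ('n + 'n)) \<Rightarrow> complex^('n + 'n)" where
  "pr q = pair_vec (xc q) (zc q)"

lemma lift3_subset: "S \<subseteq> D2 r \<Longrightarrow> lift3 S \<subseteq> D3 r"
  by (auto simp: lift3_def D2_def D3_def subset_iff)

lemma seg_lift3: "q \<in> lift3 S \<Longrightarrow> seg s q = pr q" and pr_in: "q \<in> lift3 S \<Longrightarrow> pr q \<in> S"
  by (auto simp: lift3_def seg_def pr_def)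

lemma anti_map_tdir: "anti (map tdir ds) = anti ds"
  by (induction ds) (auto simp: tdir_def split: sum.splits)

text \<open>At t = 0 the whole segment collapses to the point \<open>pr q\<close>, and the powers of
  1 - s are at most 1. So bounds for g at the points of S alone pass to the integral, in particular
  for S the set of points z = cnj x.\<close>

lemma gev_seg_int:
  assumes g: "gev s (D2 r) S om g" and S: "S \<subseteq> D2 r"
  shows "gev s (D3 r) (lift3 S) (\<lambda>b q. om b (pr q)) (seg_int j g)"
proof -
  obtain C where C: "C \<ge> 1"
    "\<And>P ds. P \<in> S \<Longrightarrow> cmod (dops ds g P) \<le> C * C ^ length ds * fact (length ds) powr s * om (anti ds) P"
    using g unfolding gev_def by blast
  have sm: "sm (D2 r) g" using g gev_sm by blast
  have "cmod (dops ds (seg_int j g) q) \<le> C * C ^ length ds * fact (length ds) powr s * om (anti ds) (pr q)"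
    if q: "q \<in> lift3 S" for q ds
  proof -
    obtain i where i: "\<And>q. q \<in> D3 r \<Longrightarrow> dops ds (seg_int j g) q = seg_int i (dops (map tdir ds) g) q"
      using dops_seg_int[OF sm] by blast
    have qD: "q \<in> D3 r" using lift3_subset[OF S] q by blast
    have "cmod (integral {0..1} (\<lambda>s. of_real ((1 - s) ^ i) * dops (map tdir ds) g (pr q)))
        \<le> cmod (dops (map tdir ds) g (pr q)) * (1 - 0)"
    proof (rule integral_bound)
      fix t :: real assume t: "t \<in> {0..1}"
      have "cmod (of_real ((1 - t) ^ i)) \<le> 1" using t by (simp add: norm_power power_le_one del: of_real_power of_real_diff)
      then show "cmod (of_real ((1 - t) ^ i) * dops (map tdir ds) g (pr q)) \<le> cmod (dops (map tdir ds) g (pr q))"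
        unfolding norm_mult by (rule mult_left_le_one_le[OF norm_ge_zero norm_ge_zero])
    qed (auto intro!: continuous_intros)
    then have "cmod (dops ds (seg_int j g) q) \<le> cmod (dops (map tdir ds) g (pr q))"
      unfolding i[OF qD] seg_int_def seg_lift3[OF q] by simp
    also have "\<dots> \<le> C * C ^ length ds * fact (length ds) powr s * om (anti ds) (pr q)"
      using C(2)[OF pr_in[OF q], of "map tdir ds"] by (simp add: anti_map_tdir)
    finally show ?thesis .
  qed
  then show ?thesis unfolding gev_def using sm_seg_int[OF sm] C(1) by blast
qed

lemma dops_seg_zero:
  assumes g: "sm (D2 r) g" and q: "q \<in> D3 r"
  shows "dops ds (\<lambda>q. g (seg 0 q)) q = dops (map tdir ds) g (seg 0 q)"
  using q
proof (induction ds arbitrary: q)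
  case (Cons d ds)
  have "dops (map tdir ds) g differentiable (at (seg 0 q))"
    by (rule sm_differentiable[OF sm_dops[OF g] seg_in_D2[OF Cons.prems]]) simp
  then show ?case using dop_cong_open[OF open_D3 Cons.prems Cons.IH] by (simp add: dop_seg)
qed simp

lemma gev_seg_zero:
  assumes g: "gev s (D2 r) S om g" and S: "S \<subseteq> D2 r"
  shows "gev s (D3 r) (lift3 S) (\<lambda>b q. om b (pr q)) (\<lambda>q. g (seg 0 q))"
proof -
  obtain C where C: "C \<ge> 1"
    "\<And>P ds. P \<in> S \<Longrightarrow> cmod (dops ds g P) \<le> C * C ^ length ds * fact (length ds) powr s * om (anti ds) P"
    using g unfolding gev_def by blast
  have sm: "sm (D2 r) g" using g gev_sm by blast
  have "cmod (dops ds (\<lambda>q. g (seg 0 q)) q) \<le> C * C ^ length ds * fact (length ds) powr s * om (anti ds) (pr q)"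
    if q: "q \<in> lift3 S" for q ds
  proof -
    have "q \<in> D3 r" using lift3_subset[OF S] q by blast
    then show ?thesis
      using dops_seg_zero[OF sm, of q ds] C(2)[OF pr_in[OF q], of "map tdir ds"]
      by (simp add: anti_map_tdir seg_lift3[OF q])
  qed
  moreover have "sm (D3 r) (\<lambda>q. g (seg 0 q))" by (rule sm_comp_seg[OF sm]) simp
  ultimately show ?thesis unfolding gev_def using C(1) by blast
qed

section \<open>Matrices and the chain rule in the variables x, t, z\<close>

lemma gev_subset:
  assumes "gev s D S om u" "D' \<subseteq> D" "S' \<subseteq> S"
  shows "gev s D' S' om u"
  using assms sm_subset unfolding gev_def by blast

lemma sm_det:
  fixes M :: "complex^'k::finite \<Rightarrow> complex^'n::finite^'n"
  assumes "open D" "\<And>i j. sm D (\<lambda>q. M q $ i $ j)"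
  shows "sm D (\<lambda>q. det (M q))"
  unfolding det_def by (intro sm_sum sm_mult sm_prod sm_const assms)

text \<open>Over the empty set of points \<open>gev\<close> is plain smoothness, so the Gevrey
  statement specializes to this one.\<close>

lemma sm_matrix_inv:
  fixes M :: "complex^'k::finite \<Rightarrow> complex^'n::finite^'n"
  assumes "open D" "\<And>i j. sm D (\<lambda>q. M q $ i $ j)" "\<And>q. q \<in> D \<Longrightarrow> det (M q) \<noteq> 0"
  shows "sm D (\<lambda>q. matrix_inv (M q) $ i $ j)"
proof -
  have "gev 1 D {} (omG (\<lambda>_. 1)) (\<lambda>q. M q $ i $ j)" for i j
    using assms(2) by (auto simp: gev_def)
  from gev_sm[OF gevG_matrix_inv[of D "{}" 1 "\<lambda>_. 1" M 1, OF assms(1) _ _ _ this assms(3)]]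
  show ?thesis by (auto simp: unit_weight_def)
qed

lemma sum_UNIV_Plus:
  "(\<Sum>k\<in>(UNIV :: ('a::finite + 'b::finite) set). f k) = (\<Sum>i\<in>UNIV. f (Inl i)) + (\<Sum>i\<in>UNIV. f (Inr i))"
  unfolding UNIV_Plus_UNIV[symmetric] by (subst sum.Plus) (auto simp: o_def)

lemma matrix_inv_mult:
  fixes M :: "complex^'n::finite^'n"
  assumes "det M \<noteq> 0"
  shows "matrix_inv M *v (M *v x) = x"
proof -
  have "invertible M" using assms invertible_det_nz by blast
  from someI_ex[OF this[unfolded invertible_def]] show ?thesis
    by (simp add: matrix_vector_mul_assoc matrix_inv_def)
qed

text \<open>Block elimination for the system satisfied by the derivatives of \<open>z\<close> and \<open>cnj z\<close>.\<close>

lemma block_solve: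
  fixes A B C D :: "complex^'n::finite^'n"
  assumes "det D \<noteq> 0" "det (A - B ** (matrix_inv D ** C)) \<noteq> 0"
    and 1: "A *v u + B *v v = r" and 2: "C *v u + D *v v = r'"
  shows "u = matrix_inv (A - B ** (matrix_inv D ** C)) *v (r - B *v (matrix_inv D *v r'))"
    and "v = matrix_inv D *v (r' - C *v u)"
proof -
  have "D *v v = r' - C *v u" using 2 by (simp add: algebra_simps)
  then show v: "v = matrix_inv D *v (r' - C *v u)" using matrix_inv_mult[OF assms(1), of v] by simp
  have "(A - B ** (matrix_inv D ** C)) *v u = r - B *v (matrix_inv D *v r')"
    using 1 unfolding v
    by (simp add: matrix_vector_mult_diff_distrib matrix_vector_mult_diff_rdistrib matrix_vector_mul_assoc[symmetric] algebra_simps)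
  then show "u = matrix_inv (A - B ** (matrix_inv D ** C)) *v (r - B *v (matrix_inv D *v r'))"
    using matrix_inv_mult[OF assms(2), of u] by simp
qed

abbreviation zdir :: "'n \<Rightarrow> bool \<Rightarrow> ('n + ('n + 'n)) \<times> bool" where "zdir j b \<equiv> (Inr (Inr j), b)"

definition vf :: "(('n::finite + ('n + 'n)) \<times> bool \<Rightarrow> complex^('n + ('n + 'n)) \<Rightarrow> complex)
    \<Rightarrow> (complex^('n + ('n + 'n)) \<Rightarrow> complex) \<Rightarrow> complex^('n + ('n + 'n)) \<Rightarrow> complex" where
  "vf c u q = (\<Sum>d\<in>UNIV. c d q * dop d u q)"

lemma dop_trip_z:
  fixes h :: "complex^'n::finite \<Rightarrow> complex^'n"
  assumes u: "u differentiable (at (trip x t (h w)))" and h: "h differentiable (at w)"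
  shows "dop d (\<lambda>w. u (trip x t (h w))) w
    = (\<Sum>j\<in>UNIV. dop (zdir j False) u (trip x t (h w)) * dop d (\<lambda>w. h w $ j) w
        + dop (zdir j True) u (trip x t (h w)) * dop d (\<lambda>w. cnj (h w $ j)) w)"
proof -
  have "(\<lambda>w. trip x t (h w) $ k) differentiable (at w)" for k
    using differentiable_coord_comp[OF h] by (cases k rule: sum.exhaust; cases "projr k") (auto simp: trip_def)
  from dop_chain[OF u differentiable_componentwise[OF this], of d]
  show ?thesis by (simp add: sum_UNIV_Plus)
qed

lemma dop_trip_yz:
  fixes h :: "complex^'n::finite \<Rightarrow> complex^'n"
  assumes u: "u differentiable (at (trip x (y - x) (h y)))" and h: "h differentiable (at y)"
  shows "dop (i, False) (\<lambda>y. u (trip x (y - x) (h y))) y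
    = dop (Inr (Inl i), False) u (trip x (y - x) (h y))
      + (\<Sum>j\<in>UNIV. dop (zdir j False) u (trip x (y - x) (h y)) * dop (i, False) (\<lambda>y. h y $ j) y
        + dop (zdir j True) u (trip x (y - x) (h y)) * dop (i, False) (\<lambda>y. cnj (h y $ j)) y)"
proof -
  have dl: "(\<lambda>y. (y - x) $ l) differentiable (at y)" for l
    unfolding vector_minus_component by (intro differentiable_diff differentiable_coord differentiable_const)
  have "(\<lambda>y. trip x (y - x) (h y) $ k) differentiable (at y)" for k
    using differentiable_coord_comp[OF h] dl
    by (cases k rule: sum.exhaust; cases "projr k") (auto simp: trip_def)
  note c = dop_chain[OF u differentiable_componentwise[OF this], of "(i, False)"]
  have 1: "dop (i, False) (\<lambda>y. (y - x) $ l) y = (if l = i then 1 else 0)" for l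
    unfolding vector_minus_component
    by (subst dop_diff) (auto simp: dop_coord differentiable_coord)
  have 2: "dop (i, False) (\<lambda>y. cnj ((y - x) $ l)) y = 0" for l
  proof -
    have "dop (i, False) (\<lambda>y. cnj (y $ l) - cnj (x $ l)) y = 0"
      by (subst dop_diff) (auto simp: dop_cnj_coord differentiable_cnj_coord)
    then show ?thesis by simp
  qed
  have "(\<Sum>l\<in>UNIV. dop (Inr (Inl l), False) u (trip x (y - x) (h y)) * (if l = i then 1 else 0))
      = dop (Inr (Inl i), False) u (trip x (y - x) (h y))"
    by (simp add: if_distrib cong: if_cong)
  then show ?thesis using c by (simp add: sum_UNIV_Plus 1 2 del: vector_minus_component)
qed

section \<open>The phase \<theta> and its Jacobian in z\<close>

locale phase =
  fixes \<psi> :: "complex^'n::finite \<Rightarrow> complex^'n \<Rightarrow> complex" and r :: real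
  assumes r: "r > 0" and sm\<psi>: "sm (D2 r) (joint \<psi>)"
    and diffeo: "diffeo_onto_image (ball 0 r \<times> ball 0 r \<times> ball 0 r) (theta_map \<psi>)"
    and flat0: "\<And>i j. dop (Inr j, True) (dop (Inl i, False) (joint \<psi>)) (pair_vec 0 0) = 0"
begin

abbreviation W :: "((complex^'n) \<times> (complex^'n) \<times> (complex^'n)) set" where
  "W \<equiv> ball 0 r \<times> ball 0 r \<times> ball 0 r"

definition th :: "'n \<Rightarrow> complex^('n + ('n + 'n)) \<Rightarrow> complex" where
  "th l = seg_int 0 (dop (Inl l, False) (joint \<psi>))"

lemma sm_th: "sm (D3 r) (th l)"
  unfolding th_def by (rule sm_seg_int[OF sm_dop[OF sm\<psi>]])

lemma trip_in_D3: "trip x (y - x) z \<in> D3 \<delta> \<longleftrightarrow> x \<in> ball 0 \<delta> \<and> y \<in> ball 0 \<delta> \<and> z \<in> ball 0 \<delta>"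
  by (simp add: D3_def)

lemma pair_in_D2: "pair_vec x z \<in> D2 \<delta> \<longleftrightarrow> x \<in> ball 0 \<delta> \<and> z \<in> ball 0 \<delta>"
  by (simp add: D2_def)

lemma dop_slice_fst:
  assumes "joint g differentiable (at (pair_vec x z))"
  shows "Dz i (\<lambda>x'. g x' z) x = dop (Inl i, False) (joint g) (pair_vec x z)"
proof -
  have "dop (i, False) (\<lambda>x'. joint g (pair_vec x' z)) x = 1 * dop (Inl i, False) (joint g) (pair_vec x z)"
  proof (rule dop_chain_single[where h = "\<lambda>x'. pair_vec x' z", OF assms])
    fix k
    show "(\<lambda>x. pair_vec x z $ k) differentiable at x" by (cases k) (auto intro: differentiable_coord)
    show "dop (i, False) (\<lambda>x. pair_vec x z $ k) x = (if (Inl i, False) = (k, False) then 1 else 0)"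
      by (cases k) (auto simp: dop_coord)
    show "dop (i, False) (\<lambda>x. cnj (pair_vec x z $ k)) x = (if (Inl i, False) = (k, True) then 1 else 0)"
      by (cases k) (auto simp: dop_cnj_coord)
  qed
  then show ?thesis by (simp add: dop_def)
qed

lemma dop_slice_snd:
  assumes "u differentiable (at (pair_vec x z))"
  shows "Dz i (\<lambda>z'. u (pair_vec x z')) z = dop (Inr i, False) u (pair_vec x z)"
proof -
  have "dop (i, False) (\<lambda>z'. u (pair_vec x z')) z = 1 * dop (Inr i, False) u (pair_vec x z)"
  proof (rule dop_chain_single[where h = "\<lambda>z'. pair_vec x z'", OF assms])
    fix k
    show "(\<lambda>z. pair_vec x z $ k) differentiable at z" by (cases k) (auto intro: differentiable_coord)
    show "dop (i, False) (\<lambda>z. pair_vec x z $ k) z = (if (Inr i, False) = (k, False) then 1 else 0)"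
      by (cases k) (auto simp: dop_coord)
    show "dop (i, False) (\<lambda>z. cnj (pair_vec x z $ k)) z = (if (Inr i, False) = (k, True) then 1 else 0)"
      by (cases k) (auto simp: dop_cnj_coord)
  qed
  then show ?thesis by (simp add: dop_def)
qed

lemma theta_eq_th:
  assumes "x \<in> ball 0 r" "y \<in> ball 0 r" "z \<in> ball 0 r"
  shows "theta \<psi> x y z $ l = th l (trip x (y - x) z)"
proof -
  have q: "trip x (y - x) z \<in> D3 r" using assms trip_in_D3 by blast
  have "theta \<psi> x y z $ l = integral {0..1} (\<lambda>t. Dz l (\<lambda>x'. \<psi> x' z) (t *\<^sub>R x + (1 - t) *\<^sub>R y))"
    by (simp add: theta_def)
  also have "\<dots> = integral {0..1} (\<lambda>t. of_real ((1 - t) ^ 0) * dop (Inl l, False) (joint \<psi>) (seg t (trip x (y - x) z)))"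
  proof (rule integral_cong)
    fix t :: real assume t: "t \<in> {0..1}"
    have s: "seg t (trip x (y - x) z) = pair_vec (t *\<^sub>R x + (1 - t) *\<^sub>R y) z"
      by (simp add: seg_def algebra_simps)
    have "joint \<psi> differentiable (at (pair_vec (t *\<^sub>R x + (1 - t) *\<^sub>R y) z))"
      unfolding s[symmetric] by (rule sm_differentiable[OF sm\<psi> seg_in_D2[OF q t]])
    from dop_slice_fst[OF this]
    show "Dz l (\<lambda>x'. \<psi> x' z) (t *\<^sub>R x + (1 - t) *\<^sub>R y)
        = of_real ((1 - t) ^ 0) * dop (Inl l, False) (joint \<psi>) (seg t (trip x (y - x) z))"
      by (simp add: s)
  qed
  finally show ?thesis by (simp add: th_def seg_int_def)
qed

text \<open>\<open>Am\<close> and \<open>Bm\<close> are the derivatives of \<theta> in z and in cnj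
  z. With the conjugate blocks \<open>Ac\<close> and \<open>Bc\<close> they form the Jacobian of
  (\<theta>, cnj \<theta>) in (z, cnj z), and \<open>Sch\<close> is the Schur complement of the
  block \<open>Ac\<close>.\<close>

definition Am :: "complex^('n + ('n + 'n)) \<Rightarrow> complex^'n^'n" where
  "Am q = (\<chi> l j. dop (zdir j False) (th l) q)"
definition Bm :: "complex^('n + ('n + 'n)) \<Rightarrow> complex^'n^'n" where
  "Bm q = (\<chi> l j. dop (zdir j True) (th l) q)"
definition Ac :: "complex^('n + ('n + 'n)) \<Rightarrow> complex^'n^'n" where
  "Ac q = (\<chi> l j. cnj (dop (zdir j False) (th l) q))"
definition Bc :: "complex^('n + ('n + 'n)) \<Rightarrow> complex^'n^'n" where
  "Bc q = (\<chi> l j. cnj (dop (zdir j True) (th l) q))"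
definition Sch :: "complex^('n + ('n + 'n)) \<Rightarrow> complex^'n^'n" where
  "Sch q = Am q - Bm q ** (matrix_inv (Ac q) ** Bc q)"
definition Nm :: "complex^('n + ('n + 'n)) \<Rightarrow> complex^'n^'n" where
  "Nm q = (\<chi> i j. dop (Inr j, False) (dop (Inl i, False) (joint \<psi>)) (seg 0 q))"
definition Delta :: "complex^('n + ('n + 'n)) \<Rightarrow> complex" where
  "Delta q = det (Nm q) * inverse (det (Am q))"

lemma Delta0_eq:
  assumes "x \<in> ball 0 r" "y \<in> ball 0 r" "z \<in> ball 0 r"
  shows "Delta0 \<psi> x y z = Delta (trip x (y - x) z)"
proof -
  have 1: "Dz j (\<lambda>z'. Dz i (\<lambda>y'. \<psi> y' z') y) z = Nm (trip x (y - x) z) $ i $ j" for i j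
  proof -
    have "dop (j, False) (\<lambda>z'. Dz i (\<lambda>y'. \<psi> y' z') y) z = dop (j, False) (\<lambda>z'. dop (Inl i, False) (joint \<psi>) (pair_vec y z')) z"
      by (rule dop_cong_open[OF open_ball assms(3)], rule dop_slice_fst, rule sm_differentiable[OF sm\<psi>])
         (use assms pair_in_D2 in blast)
    also have "\<dots> = dop (Inr j, False) (dop (Inl i, False) (joint \<psi>)) (pair_vec y z)"
    proof -
      have "dop (Inl i, False) (joint \<psi>) differentiable (at (pair_vec y z))"
        by (rule sm_differentiable[OF sm_dop[OF sm\<psi>]]) (use assms pair_in_D2 in blast)
      from dop_slice_snd[OF this, of j] show ?thesis by (simp add: dop_def)
    qed
    finally show ?thesis by (simp add: Nm_def seg_def dop_def)
  qed
  have 2: "Dz j (\<lambda>z'. theta \<psi> x y z' $ i) z = Am (trip x (y - x) z) $ i $ j" for i j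
  proof -
    have "dop (j, False) (\<lambda>z'. theta \<psi> x y z' $ i) z = dop (j, False) (\<lambda>z'. th i (trip x (y - x) z')) z"
      by (rule dop_cong_open[OF open_ball assms(3)]) (rule theta_eq_th[OF assms(1,2)])
    also have "\<dots> = (\<Sum>k\<in>UNIV. dop (zdir k False) (th i) (trip x (y - x) z) * (if k = j then 1 else 0))"
    proof -
      have "th i differentiable (at (trip x (y - x) z))"
        by (rule sm_differentiable[OF sm_th]) (use assms trip_in_D3 in blast)
      from dop_trip_z[OF this differentiable_ident, of "(j, False)"]
      show ?thesis by (simp add: dop_coord dop_cnj_coord eq_commute[of j])
    qed
    also have "\<dots> = dop (zdir j False) (th i) (trip x (y - x) z)"
      by (simp add: if_distrib cong: if_cong)
    finally show ?thesis by (simp add: Am_def dop_def)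
  qed
  show ?thesis
    unfolding Delta0_def Delta_def 1 2 by (simp add: divide_inverse)
qed

lemma theta_inv_props:
  assumes \<delta>: "\<delta> \<le> r" and p: "(x, y, \<theta>) \<in> theta_map \<psi> ` (ball 0 \<delta> \<times> ball 0 \<delta> \<times> ball 0 \<delta>)"
  shows "x \<in> ball 0 \<delta>" "y \<in> ball 0 \<delta>" "theta_inv \<psi> W x y \<theta> \<in> ball 0 \<delta>"
    "theta \<psi> x y (theta_inv \<psi> W x y \<theta>) = \<theta>"
proof -
  from p obtain z where z: "x \<in> ball 0 \<delta>" "y \<in> ball 0 \<delta>" "z \<in> ball 0 \<delta>" "theta \<psi> x y z = \<theta>"
    by (auto simp: theta_map_def)
  have inj: "inj_on (theta_map \<psi>) W" using diffeo by (simp add: diffeo_onto_image_def)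
  have "(x, y, z) \<in> W" using z \<delta> by auto
  moreover have "theta_map \<psi> (x, y, z) = (x, y, \<theta>)" using z by (simp add: theta_map_def)
  ultimately have "inv_into W (theta_map \<psi>) (x, y, \<theta>) = (x, y, z)"
    using inv_into_f_f[OF inj] by metis
  then have "theta_inv \<psi> W x y \<theta> = z" by (simp add: theta_inv_def)
  then show "x \<in> ball 0 \<delta>" "y \<in> ball 0 \<delta>" "theta_inv \<psi> W x y \<theta> \<in> ball 0 \<delta>"
    "theta \<psi> x y (theta_inv \<psi> W x y \<theta>) = \<theta>" using z by auto
qed

lemma theta_inv_theta:
  assumes "x \<in> ball 0 r" "y \<in> ball 0 r" "z \<in> ball 0 r"
  shows "theta_inv \<psi> W x y (theta \<psi> x y z) = z"
proof -
  have inj: "inj_on (theta_map \<psi>) W" using diffeo by (simp add: diffeo_onto_image_def)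
  have "inv_into W (theta_map \<psi>) (theta_map \<psi> (x, y, z)) = (x, y, z)"
    using inv_into_f_f[OF inj] assms by simp
  then show ?thesis by (simp add: theta_inv_def theta_map_def)
qed

lemma inv_differentiable:
  assumes "p \<in> theta_map \<psi> ` W"
  shows "inv_into W (theta_map \<psi>) differentiable (at p)"
proof -
  have "Ck_on (Suc 0) (theta_map \<psi> ` W) (inv_into W (theta_map \<psi>))"
    using diffeo unfolding diffeo_onto_image_def smooth_on_def by blast
  then show ?thesis using assms unfolding Ck_on.simps by blast
qed

text \<open>Within the open image of \<open>W\<close>, the image of the smaller box is the preimage
  of that box under the continuous inverse.\<close>

lemma open_theta_image:
  assumes \<delta>: "\<delta> \<le> r"
  shows "open (theta_map \<psi> ` (ball 0 \<delta> \<times> ball 0 \<delta> \<times> ball 0 \<delta>))"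
proof -
  let ?V = "ball 0 \<delta> \<times> ball 0 \<delta> \<times> ball 0 \<delta> :: ((complex^'n) \<times> (complex^'n) \<times> (complex^'n)) set"
  let ?I = "inv_into W (theta_map \<psi>)"
  have inj: "inj_on (theta_map \<psi>) W" and op: "open (theta_map \<psi> ` W)"
    using diffeo by (simp_all add: diffeo_onto_image_def)
  have VW: "?V \<subseteq> W" using \<delta> by auto
  have "continuous_on (theta_map \<psi> ` W) ?I"
    using inv_differentiable by (meson continuous_at_imp_continuous_on differentiable_imp_continuous_within)
  then have "open (theta_map \<psi> ` W \<inter> ?I -` ?V)"
    by (intro continuous_open_preimage op open_Times open_ball)
  moreover have "theta_map \<psi> ` W \<inter> ?I -` ?V = theta_map \<psi> ` ?V"
    using inv_into_f_f[OF inj] VW by (force simp: image_iff)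
  ultimately show ?thesis by simp
qed

lemma theta_inv_differentiable:
  assumes p: "(x, y, \<theta>) \<in> theta_map \<psi> ` W"
  shows "(\<lambda>\<theta>'. theta_inv \<psi> W x y \<theta>') differentiable (at \<theta>)" "(\<lambda>y'. theta_inv \<psi> W x y' \<theta>) differentiable (at y)"
proof -
  obtain I' where I': "(inv_into W (theta_map \<psi>) has_derivative I') (at (x, y, \<theta>))"
    using inv_differentiable[OF p] by (auto simp: differentiable_def)
  have 1: "((\<lambda>\<theta>'. (x, y, \<theta>')) has_derivative (\<lambda>h. (0, 0, h))) (at \<theta>)"
    by (auto intro!: derivative_eq_intros)
  have 2: "((\<lambda>y'. (x, y', \<theta>)) has_derivative (\<lambda>h. (0, h, 0))) (at y)"
    by (auto intro!: derivative_eq_intros)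
  show "(\<lambda>\<theta>'. theta_inv \<psi> W x y \<theta>') differentiable (at \<theta>)"
    unfolding theta_inv_def differentiable_def
    using has_derivative_snd[OF has_derivative_snd[OF has_derivative_compose[OF 1 I']]] by blast
  show "(\<lambda>y'. theta_inv \<psi> W x y' \<theta>) differentiable (at y)"
    unfolding theta_inv_def differentiable_def
    using has_derivative_snd[OF has_derivative_snd[OF has_derivative_compose[OF 2 I']]] by blast
qed

lemma zero_trip: "trip (0::complex^'n) 0 0 = 0" "pair_vec (0::complex^'n) 0 = 0"
  by (auto simp: trip_def pair_vec_def vec_eq_iff split: sum.splits)

lemma Bm_zero: "Bm 0 = 0"
proof -
  have q0: "(0 :: complex^('n + ('n + 'n))) \<in> D3 r" using r by (simp add: D3_def xc_def tc_def zc_def zero_vec_def[symmetric])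
  have s0: "seg s (0 :: complex^('n + ('n + 'n))) = pair_vec 0 0" for s
    by (simp add: seg_def xc_def tc_def zc_def zero_vec_def[symmetric])
  have "dop (zdir j True) (th l) 0 = 0" for l j
    unfolding th_def dop_seg_int(2)[OF sm_dop[OF sm\<psi>] q0] seg_int_def s0 by (simp add: tdir_def flat0)
  then show ?thesis by (simp add: Bm_def vec_eq_iff)
qed

text \<open>The map sending z to \<theta>(0, 0, z) has a differentiable left inverse, coming from
  the diffeomorphism, so its derivative at 0 is injective. Since \<open>Bm 0 = 0\<close>, this
  derivative is complex linear with matrix \<open>Am 0\<close>.\<close>

lemma det_Am_zero: "det (Am 0) \<noteq> 0"
proof
  assume "det (Am 0) = 0"
  then obtain c where c: "c \<noteq> 0" "Am 0 *v c = 0"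
    using invertible_det_nz[of "Am 0"] invertible_left_inverse[of "Am 0"] matrix_left_invertible_ker[of "Am 0"] by metis
  have b0: "(0 :: complex^'n) \<in> ball 0 r" using r by simp
  define g where "g z = theta \<psi> 0 0 z" for z
  define Z where "Z \<theta> = theta_inv \<psi> W 0 0 \<theta>" for \<theta>
  have gl: "((\<lambda>z. g z $ l) has_derivative (\<lambda>h. (Am 0 *v h) $ l)) (at 0)" for l
  proof -
    have dt: "th l differentiable (at (trip 0 0 0))"
      using sm_differentiable[OF sm_th trip_in_D3[THEN iffD2, OF conjI[OF b0 conjI[OF b0 b0]]], of l]
      unfolding diff_self .
    have dz: "(\<lambda>z. trip 0 0 z) differentiable (at (0::complex^'n))"
    proof (rule differentiable_componentwise)
      show "(\<lambda>x. trip 0 0 x $ k) differentiable at (0::complex^'n)" for k :: "'n + ('n + 'n)"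
        by (cases k rule: sum.exhaust; cases "projr k") (auto simp: trip_def intro: differentiable_coord)
    qed
    have "(\<lambda>z. th l (trip 0 0 z)) differentiable (at 0)"
      using differentiable_chain_at[OF dz dt] by (simp add: o_def)
    then obtain f' where f': "((\<lambda>z. th l (trip 0 0 z)) has_derivative f') (at 0)" by (auto simp: differentiable_def)
    have "dop (i, b) (\<lambda>z. th l (trip 0 0 z)) 0 = dop (zdir i b) (th l) 0" for i b
    proof -
      have "dop (i, b) (\<lambda>z. th l (trip 0 0 z)) 0
          = (\<Sum>k\<in>UNIV. if k = i then dop (zdir i b) (th l) 0 else 0)"
        unfolding dop_trip_z[OF dt differentiable_ident]
        by (rule sum.cong) (auto simp: dop_coord dop_cnj_coord zero_trip)
      then show ?thesis by simp
    qed
    then have "f' h = (\<Sum>i\<in>UNIV. h $ i * Am 0 $ l $ i + cnj (h $ i) * Bm 0 $ l $ i)" for h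
      unfolding has_derivative_Wirtinger[OF f'] by (simp add: Am_def Bm_def)
    then have "f' = (\<lambda>h. (Am 0 *v h) $ l)"
      by (simp add: Bm_zero matrix_vector_mult_def mult.commute fun_eq_iff)
    note f'' = f'[unfolded this]
    show ?thesis
      by (rule has_derivative_transform_within_open[OF f'' open_ball b0])
         (use theta_eq_th[OF b0 b0] in \<open>simp add: g_def\<close>)
  qed
  have g_der: "(g has_derivative (\<lambda>h. Am 0 *v h)) (at 0)"
  proof -
    have "g differentiable (at 0)"
      by (rule differentiable_componentwise) (use gl in \<open>auto simp: differentiable_def\<close>)
    then obtain g' where g': "(g has_derivative g') (at 0)" by (auto simp: differentiable_def)
    have "(\<lambda>h. g' h $ l) = (\<lambda>h. (Am 0 *v h) $ l)" for l
      using has_derivative_unique[OF has_derivative_compose[OF g' has_derivative_coord] gl] .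
    then have "g' = (\<lambda>h. Am 0 *v h)" by (auto simp: vec_eq_iff fun_eq_iff)
    then show ?thesis using g' by simp
  qed
  have "(0, 0, g 0) \<in> theta_map \<psi> ` W"
    using b0 by (auto simp: theta_map_def g_def intro!: image_eqI[of _ _ "(0, 0, 0)"])
  then have "Z differentiable (at (g 0))" unfolding Z_def[abs_def] by (rule theta_inv_differentiable(1))
  then obtain Z' where Z': "(Z has_derivative Z') (at (g 0))" by (auto simp: differentiable_def)
  have "((\<lambda>z. Z (g z)) has_derivative (\<lambda>h. Z' (Am 0 *v h))) (at 0)"
    by (rule has_derivative_compose[OF g_der Z'])
  moreover have "((\<lambda>z. Z (g z)) has_derivative (\<lambda>h. h)) (at 0)"
    by (rule has_derivative_transform_within_open[OF has_derivative_ident open_ball b0])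
       (use theta_inv_theta[OF b0 b0] in \<open>simp add: Z_def g_def\<close>)
  ultimately have "(\<lambda>h. Z' (Am 0 *v h)) = (\<lambda>h. h)" by (rule has_derivative_unique)
  then have "c = Z' (Am 0 *v c)" by (simp add: fun_eq_iff)
  also have "\<dots> = 0" using c(2) linear_0[OF has_derivative_linear[OF Z']] by simp
  finally show False using c(1) by simp
qed

end

section \<open>A neighbourhood on which the linear system is solvable\<close>

lemma det_cnj:
  fixes M :: "complex^'n::finite^'n"
  shows "det (\<chi> i j. cnj (M $ i $ j)) = cnj (det M)"
  by (simp add: det_def)

lemma norm_le_components: "norm q \<le> norm (xc q) + norm (tc q) + norm (zc q)"
proof -
  have "(norm q)\<^sup>2 = (norm (xc q))\<^sup>2 + ((norm (tc q))\<^sup>2 + (norm (zc q))\<^sup>2)"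
    by (simp add: norm_vec_def L2_set_def sum_nonneg sum_UNIV_Plus xc_def tc_def zc_def add_nonneg_nonneg)
  also have "\<dots> \<le> (norm (xc q) + norm (tc q) + norm (zc q))\<^sup>2"
    by (simp add: power2_eq_square algebra_simps)
  finally show ?thesis by (rule power2_le_imp_le) simp
qed

lemma gev_uminus:
  assumes "open D" "S \<subseteq> D" "gev s D S om u"
  shows "gev s D S om (\<lambda>x. - u x)"
proof -
  have sm: "sm D u" using assms(3) gev_sm by blast
  have sm': "sm D (\<lambda>x. - u x)" using sm_mult[OF assms(1) sm_const sm, of "-1"] by simp
  have "dops ds (\<lambda>x. - u x) P = - dops ds u P" if "P \<in> S" for P ds
    using dops_cmult[OF assms(1) sm subsetD[OF assms(2) that], of ds "-1"] by simp
  then show ?thesis using assms(3) sm' unfolding gev_def by simp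
qed

lemma gev_diff:
  assumes "open D" "S \<subseteq> D" "gev s D S om u" "gev s D S om v" "\<And>b P. P \<in> S \<Longrightarrow> om b P \<ge> 0"
  shows "gev s D S om (\<lambda>x. u x - v x)"
  using gev_add[OF assms(1-3) gev_uminus[OF assms(1,2,4)] assms(5)] by simp

context phase
begin

lemma sm_Am: "sm (D3 r) (\<lambda>q. Am q $ i $ j)" and sm_Bm: "sm (D3 r) (\<lambda>q. Bm q $ i $ j)"
  and sm_Ac: "sm (D3 r) (\<lambda>q. Ac q $ i $ j)" and sm_Bc: "sm (D3 r) (\<lambda>q. Bc q $ i $ j)"
  unfolding Am_def Bm_def Ac_def Bc_def by (simp_all add: sm_dop sm_cnj open_D3 sm_th)

lemma det_Ac: "det (Ac q) = cnj (det (Am q))"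
  using det_cnj[of "Am q"] by (simp add: Am_def Ac_def)

lemma Sch_nth: "Sch q $ i $ j = Am q $ i $ j - (\<Sum>k\<in>UNIV. Bm q $ i $ k * (\<Sum>l\<in>UNIV. matrix_inv (Ac q) $ k $ l * Bc q $ l $ j))"
  by (simp add: Sch_def matrix_matrix_mult_def)

text \<open>Continuity of the determinants, in two rounds: \<open>Sch\<close> contains the inverse
  of \<open>Ac\<close>, so its smoothness is available only after det Am has been bounded below on
  \<open>Da\<close>. At 0 the two determinants agree because \<open>Bm 0 = 0\<close>.\<close>

lemma exists_nbhd:
  obtains \<delta> c where "0 < \<delta>" "\<delta> \<le> r" "c > 0"
    "\<And>q. q \<in> D3 \<delta> \<Longrightarrow> c \<le> cmod (det (Am q))" "\<And>q. q \<in> D3 \<delta> \<Longrightarrow> c \<le> cmod (det (Sch q))"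
proof -
  define c where "c = cmod (det (Am 0)) / 2"
  have c: "c > 0" using det_Am_zero by (simp add: c_def)
  define Da where "Da = D3 r \<inter> (\<lambda>q. cmod (det (Am q))) -` {c<..}"
  have z: "(0 :: complex^('n + ('n + 'n))) \<in> D3 r" using r by (simp add: D3_def xc_def tc_def zc_def zero_vec_def[symmetric])
  have cA: "c < cmod (det (Am 0))" using c unfolding c_def by linarith
  have oDa: "open Da"
    unfolding Da_def
    by (intro continuous_open_preimage open_D3 open_greaterThan continuous_on_norm sm_continuous_on sm_det sm_Am)
  have 0: "0 \<in> Da" using z cA by (simp add: Da_def)
  have nz: "det (Ac q) \<noteq> 0" if "q \<in> Da" for q using that c by (auto simp: Da_def det_Ac)
  have sub: "Da \<subseteq> D3 r" by (auto simp: Da_def)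
  have sinv: "sm Da (\<lambda>q. matrix_inv (Ac q) $ i $ j)" for i j
    by (rule sm_matrix_inv[OF oDa sm_subset[OF sm_Ac sub] nz])
  have sS: "sm Da (\<lambda>q. Sch q $ i $ j)" for i j
  proof -
    have "sm Da (\<lambda>q. Am q $ i $ j + (-1) * (\<Sum>k\<in>UNIV. Bm q $ i $ k * (\<Sum>l\<in>UNIV. matrix_inv (Ac q) $ k $ l * Bc q $ l $ j)))"
      by (intro sm_add sm_mult sm_sum sm_const oDa sinv sm_subset[OF sm_Am sub] sm_subset[OF sm_Bm sub] sm_subset[OF sm_Bc sub])
    then show ?thesis unfolding Sch_nth by simp
  qed
  define Db where "Db = Da \<inter> (\<lambda>q. cmod (det (Sch q))) -` {c<..}"
  have "open Db"
    unfolding Db_def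
    by (intro continuous_open_preimage oDa open_greaterThan continuous_on_norm sm_continuous_on sm_det sS)
  moreover have "0 \<in> Db"
  proof -
    have "Sch 0 $ i $ j = Am 0 $ i $ j" for i j by (simp add: Sch_nth Bm_zero)
    then have "Sch 0 = Am 0" by (simp add: vec_eq_iff)
    then show ?thesis using 0 cA by (simp add: Db_def)
  qed
  ultimately obtain e where e: "e > 0" "ball 0 e \<subseteq> Db" using open_contains_ball by blast
  \<comment> \<open>A point of \<open>D3 \<delta>\<close> has |x| < \<delta>, |z| < \<delta> and |t|
    \<le> |x + t| + |x| < 2\<delta>, hence norm below 4\<delta> \<le> e.\<close>
  define \<delta> where "\<delta> = min r (e / 4)"
  have \<delta>: "\<delta> > 0" "\<delta> \<le> r" "4 * \<delta> \<le> e" using r e by (auto simp: \<delta>_def)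
  have "q \<in> Db" if "q \<in> D3 \<delta>" for q
  proof -
    have n: "norm (xc q) < \<delta>" "norm (xc q + tc q) < \<delta>" "norm (zc q) < \<delta>" using that by (auto simp: D3_def)
    have "norm (tc q) \<le> norm (xc q + tc q) + norm (xc q)"
      using norm_triangle_ineq4[of "xc q + tc q" "xc q"] by simp
    then have "norm q < e" using norm_le_components[of q] n \<delta>(3) by linarith
    then show ?thesis using e(2) by auto
  qed
  then show thesis using that[OF \<delta>(1,2) c] by (auto simp: Db_def Da_def subset_iff less_imp_le)
qed

end

section \<open>The derivatives in \<theta> and y as vector fields\<close>

locale phase_nbhd = phase \<psi> r for \<psi> :: "complex^'n::finite \<Rightarrow> complex^'n \<Rightarrow> complex" and r :: real +
  fixes \<delta> c :: real
  assumes \<delta>: "0 < \<delta>" "\<delta> \<le> r" and c: "c > 0"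
    and detA: "\<And>q. q \<in> D3 \<delta> \<Longrightarrow> c \<le> cmod (det (Am q))"
    and detS: "\<And>q. q \<in> D3 \<delta> \<Longrightarrow> c \<le> cmod (det (Sch q))"
begin

lemma det_nz:
  assumes "q \<in> D3 \<delta>"
  shows "det (Am q) \<noteq> 0" "det (Ac q) \<noteq> 0" "det (Sch q) \<noteq> 0"
  using detA[OF assms] detS[OF assms] c by (auto simp: det_Ac)

text \<open>The solution of the block system with right-hand side (a, b), in the form of
  \<open>block_solve\<close>: \<open>Xs\<close> is the part for z, \<open>Xsc\<close> the part for
  cnj z.\<close>

definition Xs :: "complex^'n \<Rightarrow> complex^'n \<Rightarrow> complex^('n + ('n + 'n)) \<Rightarrow> complex^'n" where
  "Xs a b q = matrix_inv (Sch q) *v (a - Bm q *v (matrix_inv (Ac q) *v b))"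
definition Xsc :: "complex^'n \<Rightarrow> complex^'n \<Rightarrow> complex^('n + ('n + 'n)) \<Rightarrow> complex^'n" where
  "Xsc a b q = matrix_inv (Ac q) *v (b - Bc q *v Xs a b q)"
text \<open>With \<theta> held fixed, differentiation in y moves the t-derivative of \<theta> to the
  right-hand side. In the conjugate equation the holomorphic derivative of cnj \<theta> is the
  conjugate of an antiholomorphic one, so \<open>rYc\<close> is flat.\<close>

definition rY :: "'n \<Rightarrow> complex^('n + ('n + 'n)) \<Rightarrow> complex^'n" where
  "rY i q = (\<chi> l. - dop (Inr (Inl i), False) (th l) q)"
definition rYc :: "'n \<Rightarrow> complex^('n + ('n + 'n)) \<Rightarrow> complex^'n" where
  "rYc i q = (\<chi> l. - cnj (dop (Inr (Inl i), True) (th l) q))"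

text \<open>The derivatives with respect to \<open>\<theta>\<^sub>i\<close> and \<open>y\<^sub>i\<close>, as vector fields in the coordinates \<open>(x, t, z)\<close>.\<close>

definition cT :: "'n \<Rightarrow> ('n + ('n + 'n)) \<times> bool \<Rightarrow> complex^('n + ('n + 'n)) \<Rightarrow> complex" where
  "cT i d q = (case fst d of Inl l \<Rightarrow> 0 | Inr k \<Rightarrow> (case k of Inl l \<Rightarrow> 0
     | Inr j \<Rightarrow> (if snd d then Xsc (axis i 1) 0 q $ j else Xs (axis i 1) 0 q $ j)))"
definition cY :: "'n \<Rightarrow> ('n + ('n + 'n)) \<times> bool \<Rightarrow> complex^('n + ('n + 'n)) \<Rightarrow> complex" where
  "cY i d q = (case fst d of Inl l \<Rightarrow> 0 | Inr k \<Rightarrow> (case k of Inl l \<Rightarrow> (if l = i \<and> \<not> snd d then 1 else 0)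
     | Inr j \<Rightarrow> (if snd d then Xsc (rY i q) (rYc i q) q $ j else Xs (rY i q) (rYc i q) q $ j)))"

text \<open>A function of (x, t, z) read in the coordinates (x, y, \<theta>) of the
  recursion.\<close>

definition pull :: "complex^'n \<Rightarrow> (complex^('n + ('n + 'n)) \<Rightarrow> complex) \<Rightarrow> complex^'n \<Rightarrow> complex^'n \<Rightarrow> complex" where
  "pull x u y \<theta> = u (trip x (y - x) (theta_inv \<psi> W x y \<theta>))"

definition Om :: "((complex^'n) \<times> (complex^'n) \<times> (complex^'n)) set" where
  "Om = theta_map \<psi> ` (ball 0 \<delta> \<times> ball 0 \<delta> \<times> ball 0 \<delta>)"

lemma open_Om: "open Om" unfolding Om_def by (rule open_theta_image[OF \<delta>(2)])

lemma Om_props: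
  assumes "(x, y, \<theta>) \<in> Om"
  shows "(x, y, \<theta>) \<in> theta_map \<psi> ` W" "trip x (y - x) (theta_inv \<psi> W x y \<theta>) \<in> D3 \<delta>"
    "theta \<psi> x y (theta_inv \<psi> W x y \<theta>) = \<theta>"
    "\<And>l. th l (trip x (y - x) (theta_inv \<psi> W x y \<theta>)) = \<theta> $ l"
    "x \<in> ball 0 \<delta>" "y \<in> ball 0 \<delta>"
proof -
  note p = theta_inv_props[OF \<delta>(2) assms[unfolded Om_def]]
  show "(x, y, \<theta>) \<in> theta_map \<psi> ` W" using assms \<delta>(2) by (force simp: Om_def)
  show "trip x (y - x) (theta_inv \<psi> W x y \<theta>) \<in> D3 \<delta>" using p trip_in_D3 by blast
  show t: "theta \<psi> x y (theta_inv \<psi> W x y \<theta>) = \<theta>" by (rule p(4))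
  show "x \<in> ball 0 \<delta>" "y \<in> ball 0 \<delta>" using p by blast+
  show "th l (trip x (y - x) (theta_inv \<psi> W x y \<theta>)) = \<theta> $ l" for l
    using theta_eq_th[of x y "theta_inv \<psi> W x y \<theta>" l] p(1-3) \<delta>(2) t by auto
qed

lemma open_slice:
  "open {\<theta>. (x, y, \<theta>) \<in> Om}" "open {y. (x, y, \<theta>) \<in> Om}"
proof -
  have "open ((\<lambda>\<theta>. (x, y, \<theta>)) -` Om)" "open ((\<lambda>y. (x, y, \<theta>)) -` Om)"
    by (rule open_vimage[OF open_Om], intro continuous_intros)+
  then show "open {\<theta>. (x, y, \<theta>) \<in> Om}" "open {y. (x, y, \<theta>) \<in> Om}" by (simp_all add: vimage_def)
qed

lemma th_differentiable: "q \<in> D3 \<delta> \<Longrightarrow> th l differentiable (at q)"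
proof (rule sm_differentiable[OF sm_th])
  show "q \<in> D3 \<delta> \<Longrightarrow> q \<in> D3 r" using \<delta>(2) by (auto simp: D3_def)
qed

lemma vf_cT: "vf (cT i) u q = (\<Sum>j\<in>UNIV. dop (zdir j False) u q * Xs (axis i 1) 0 q $ j
    + dop (zdir j True) u q * Xsc (axis i 1) 0 q $ j)"
  unfolding vf_def by (simp add: sum_pair_bool sum_UNIV_Plus cT_def sum.distrib mult.commute)

lemma vf_cY: "vf (cY i) u q = dop (Inr (Inl i), False) u q
   + (\<Sum>j\<in>UNIV. dop (zdir j False) u q * Xs (rY i q) (rYc i q) q $ j
    + dop (zdir j True) u q * Xsc (rY i q) (rYc i q) q $ j)"
  unfolding vf_def
  by (simp add: sum_pair_bool sum_UNIV_Plus cY_def sum.distrib mult.commute if_distrib cong: if_cong)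

text \<open>Differentiating \<theta>(x, y, z(x,y,\<theta>)) = \<theta> and its conjugate in
  \<theta>_i gives a linear system for the derivatives of z and cnj z, with right-hand sides the
  i-th unit vector and 0. Its solution is expressed by functions of (x, t, z).\<close>

lemma pull_T:
  assumes u: "sm (D3 \<delta>) u" and p: "(x, y, \<theta>) \<in> Om"
  shows "Dz i (\<lambda>\<theta>'. pull x u y \<theta>') \<theta> = pull x (vf (cT i) u) y \<theta>"
proof -
  define Z where "Z = theta_inv \<psi> W x y"
  define q where "q = trip x (y - x) (Z \<theta>)"
  note op = Om_props[OF p, folded Z_def]
  have q: "q \<in> D3 \<delta>" using op(2) by (simp add: q_def)
  have Zd: "Z differentiable (at \<theta>)"
    unfolding Z_def using theta_inv_differentiable(1)[OF op(1)] by simp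
  define \<zeta> where "\<zeta> = (\<chi> j. dop (i, False) (\<lambda>\<theta>. Z \<theta> $ j) \<theta>)"
  define \<zeta>c where "\<zeta>c = (\<chi> j. dop (i, False) (\<lambda>\<theta>. cnj (Z \<theta> $ j)) \<theta>)"
  have ch: "dop (i, False) (\<lambda>\<theta>'. v (trip x (y - x) (Z \<theta>'))) \<theta>
     = (\<Sum>j\<in>UNIV. dop (zdir j False) v q * \<zeta> $ j + dop (zdir j True) v q * \<zeta>c $ j)"
    if "v differentiable (at q)" for v
    using dop_trip_z[OF that[unfolded q_def] Zd, of "(i, False)"] by (simp add: q_def \<zeta>_def \<zeta>c_def)
  have op': "\<theta> \<in> {\<theta>'. (x, y, \<theta>') \<in> Om}" using p by simp
  have thZ: "th l (trip x (y - x) (Z \<theta>')) = \<theta>' $ l" if "\<theta>' \<in> {\<theta>'. (x, y, \<theta>') \<in> Om}" for \<theta>' l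
    using Om_props(4)[of x y \<theta>' l] that by (simp add: Z_def)
  have e1: "Am q *v \<zeta> + Bm q *v \<zeta>c = axis i 1"
  proof -
    have "(\<Sum>j\<in>UNIV. dop (zdir j False) (th l) q * \<zeta> $ j + dop (zdir j True) (th l) q * \<zeta>c $ j) = axis i 1 $ l" for l
    proof -
      have "dop (i, False) (\<lambda>\<theta>'. th l (trip x (y - x) (Z \<theta>'))) \<theta> = dop (i, False) (\<lambda>\<theta>'. \<theta>' $ l) \<theta>"
        by (rule dop_cong_open[OF open_slice(1) op' thZ])
      then show ?thesis unfolding ch[OF th_differentiable[OF q]] by (simp add: dop_coord axis_def)
    qed
    then show ?thesis by (simp add: vec_eq_iff matrix_vector_mult_def Am_def Bm_def sum.distrib)
  qed
  have e2: "Bc q *v \<zeta> + Ac q *v \<zeta>c = 0"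
  proof -
    have "(\<Sum>j\<in>UNIV. cnj (dop (zdir j True) (th l) q) * \<zeta> $ j + cnj (dop (zdir j False) (th l) q) * \<zeta>c $ j) = 0" for l
    proof -
      have "dop (i, False) (\<lambda>\<theta>'. cnj (th l (trip x (y - x) (Z \<theta>')))) \<theta> = dop (i, False) (\<lambda>\<theta>'. cnj (\<theta>' $ l)) \<theta>"
        by (rule dop_cong_open[OF open_slice(1) op']) (simp add: thZ)
      then show ?thesis
        unfolding ch[OF differentiable_cnj[OF th_differentiable[OF q]]] dop_cnj[OF th_differentiable[OF q]]
        by (simp add: dop_cnj_coord)
    qed
    then show ?thesis by (simp add: vec_eq_iff matrix_vector_mult_def Ac_def Bc_def sum.distrib)
  qed
  note sol = block_solve[OF det_nz(2)[OF q] _ e1 e2, folded Sch_def, OF det_nz(3)[OF q]]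
  have \<zeta>: "\<zeta> = Xs (axis i 1) 0 q" using sol(1) by (simp add: Xs_def)
  then have \<zeta>c: "\<zeta>c = Xsc (axis i 1) 0 q" using sol(2) by (simp add: Xsc_def)
  have "Dz i (\<lambda>\<theta>'. pull x u y \<theta>') \<theta> = dop (i, False) (\<lambda>\<theta>'. u (trip x (y - x) (Z \<theta>'))) \<theta>"
    by (simp add: dop_def pull_def Z_def)
  also have "\<dots> = vf (cT i) u q"
    unfolding ch[OF sm_differentiable[OF u q]] vf_cT \<zeta> \<zeta>c ..
  finally show ?thesis by (simp add: pull_def q_def Z_def)
qed

text \<open>The same system with \<theta> constant. Now y occurs also through t = y - x, which adds
  the coefficient 1 in direction t_i and the right-hand sides \<open>rY\<close> and
  \<open>rYc\<close>.\<close>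

lemma pull_Y:
  assumes u: "sm (D3 \<delta>) u" and p: "(x, y, \<theta>) \<in> Om"
  shows "Dz i (\<lambda>y'. pull x u y' \<theta>) y = pull x (vf (cY i) u) y \<theta>"
proof -
  define Z where "Z y = theta_inv \<psi> W x y \<theta>" for y
  define q where "q = trip x (y - x) (Z y)"
  note op = Om_props[OF p, folded Z_def]
  have q: "q \<in> D3 \<delta>" using op(2) by (simp add: q_def)
  have Zd: "Z differentiable (at y)"
    unfolding Z_def[abs_def] using theta_inv_differentiable(2)[OF op(1)] by simp
  define \<zeta> where "\<zeta> = (\<chi> j. dop (i, False) (\<lambda>y. Z y $ j) y)"
  define \<zeta>c where "\<zeta>c = (\<chi> j. dop (i, False) (\<lambda>y. cnj (Z y $ j)) y)"
  have ch: "dop (i, False) (\<lambda>y. v (trip x (y - x) (Z y))) y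
     = dop (Inr (Inl i), False) v q + (\<Sum>j\<in>UNIV. dop (zdir j False) v q * \<zeta> $ j + dop (zdir j True) v q * \<zeta>c $ j)"
    if "v differentiable (at q)" for v
    using dop_trip_yz[OF that[unfolded q_def] Zd, of i] by (simp add: q_def \<zeta>_def \<zeta>c_def)
  have op': "y \<in> {y. (x, y, \<theta>) \<in> Om}" using p by simp
  have thZ: "th l (trip x (y - x) (Z y)) = \<theta> $ l" if "y \<in> {y. (x, y, \<theta>) \<in> Om}" for y l
    using Om_props(4)[of x y \<theta> l] that by (simp add: Z_def)
  have e1: "Am q *v \<zeta> + Bm q *v \<zeta>c = rY i q"
  proof -
    have "(\<Sum>j\<in>UNIV. dop (zdir j False) (th l) q * \<zeta> $ j + dop (zdir j True) (th l) q * \<zeta>c $ j) = rY i q $ l" for l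
    proof -
      have "dop (i, False) (\<lambda>y. th l (trip x (y - x) (Z y))) y = dop (i, False) (\<lambda>_. \<theta> $ l) y"
        by (rule dop_cong_open[OF open_slice(2) op' thZ])
      then show ?thesis unfolding ch[OF th_differentiable[OF q]] by (simp add: rY_def eq_neg_iff_add_eq_0 add.commute)
    qed
    then show ?thesis by (simp add: vec_eq_iff matrix_vector_mult_def Am_def Bm_def sum.distrib)
  qed
  have e2: "Bc q *v \<zeta> + Ac q *v \<zeta>c = rYc i q"
  proof -
    have "(\<Sum>j\<in>UNIV. cnj (dop (zdir j True) (th l) q) * \<zeta> $ j + cnj (dop (zdir j False) (th l) q) * \<zeta>c $ j) = rYc i q $ l" for l
    proof -
      have "dop (i, False) (\<lambda>y. cnj (th l (trip x (y - x) (Z y)))) y = dop (i, False) (\<lambda>_. cnj (\<theta> $ l)) y"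
        by (rule dop_cong_open[OF open_slice(2) op']) (simp add: thZ)
      then show ?thesis
        unfolding ch[OF differentiable_cnj[OF th_differentiable[OF q]]] dop_cnj[OF th_differentiable[OF q]]
        by (simp add: rYc_def eq_neg_iff_add_eq_0 add.commute)
    qed
    then show ?thesis by (simp add: vec_eq_iff matrix_vector_mult_def Ac_def Bc_def sum.distrib)
  qed
  note sol = block_solve[OF det_nz(2)[OF q] _ e1 e2, folded Sch_def, OF det_nz(3)[OF q]]
  have \<zeta>: "\<zeta> = Xs (rY i q) (rYc i q) q" using sol(1) by (simp add: Xs_def)
  then have \<zeta>c: "\<zeta>c = Xsc (rY i q) (rYc i q) q" using sol(2) by (simp add: Xsc_def)
  have "Dz i (\<lambda>y'. pull x u y' \<theta>) y = dop (i, False) (\<lambda>y. u (trip x (y - x) (Z y))) y"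
    by (simp add: dop_def pull_def Z_def)
  also have "\<dots> = vf (cY i) u q"
    unfolding ch[OF sm_differentiable[OF u q]] vf_cY \<zeta> \<zeta>c ..
  finally show ?thesis by (simp add: pull_def q_def Z_def)
qed

definition Lop :: "(complex^('n + ('n + 'n)) \<Rightarrow> complex) \<Rightarrow> complex^('n + ('n + 'n)) \<Rightarrow> complex" where
  "Lop u q = (\<Sum>i\<in>UNIV. vf (cY i) (vf (cT i) u) q)"

section \<open>Gevrey estimates for the coefficients of the vector fields\<close>

context
  fixes s :: real and S :: "(complex^('n + 'n)) set" and w :: "complex^('n + 'n) \<Rightarrow> real"
  assumes s: "s \<ge> 1" and S: "S \<subseteq> D2 \<delta>" and w: "unit_weight w S"
    and g: "gev s (D2 r) S (omG w) (joint \<psi>)"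
begin

abbreviation "w3 \<equiv> (\<lambda>q. w (pr q))"

lemma S3: "lift3 S \<subseteq> D3 \<delta>" by (rule lift3_subset[OF S])

lemma S2r: "S \<subseteq> D2 r" using S \<delta>(2) by (force simp: D2_def)

lemma D3_mono: "D3 \<delta> \<subseteq> D3 r" using \<delta>(2) by (auto simp: D3_def)

lemma w3: "unit_weight w3 (lift3 S)"
  using w pr_in[of _ S] by (auto simp: unit_weight_def)

lemma w3_props: "q \<in> lift3 S \<Longrightarrow> 0 \<le> w3 q" "q \<in> lift3 S \<Longrightarrow> w3 q \<le> 1"
  using w3 by (auto simp: unit_weight_def)

lemmas om3 = omG_props[OF w3]

lemma g_dop: "gev s (D2 r) S (omG w) (dop (k, False) (joint \<psi>))"
  by (rule gev_dop[OF g]) (use s omG_props[OF w] in auto)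

lemma omG_pr: "(\<lambda>b q. omG w b (pr q)) = omG w3"
  by (intro ext) (simp add: omG_def)

lemma gth: "gev s (D3 \<delta>) (lift3 S) (omG w3) (th l)"
proof -
  have "gev s (D3 r) (lift3 S) (\<lambda>b q. omG w b (pr q)) (th l)"
    unfolding th_def by (rule gev_seg_int[OF g_dop S2r])
  then show ?thesis
    unfolding omG_pr using gev_subset[OF _ D3_mono order_refl] by blast
qed

lemma gG_dop: "gev s (D3 \<delta>) (lift3 S) (omG w3) u \<Longrightarrow> gev s (D3 \<delta>) (lift3 S) (omG w3) (dop (k, False) u)"
  by (rule gev_dop) (use s om3 in auto)

lemma gI_dop: "gev s (D3 \<delta>) (lift3 S) (omG w3) u \<Longrightarrow> gev s (D3 \<delta>) (lift3 S) (\<lambda>_. w3) (dop (k, True) u)"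
  by (rule gev_dop) (use s om3 in \<open>auto simp: omG_def\<close>)

text \<open>Three classes are used. G, with weight \<open>omG w3\<close>: almost holomorphic. I,
  with weight \<open>w3\<close> on all words, the function itself included: flat. H, with weight 1:
  merely Gevrey. I lies in G and G in H, products of H and I are in I, and conjugation maps I to I
  but G only to H.\<close>

lemma gI_imp_G: "gev s (D3 \<delta>) (lift3 S) (\<lambda>_. w3) u \<Longrightarrow> gev s (D3 \<delta>) (lift3 S) (omG w3) u"
  by (erule gev_mono) (rule om3)

lemma gG_imp_H: "gev s (D3 \<delta>) (lift3 S) (omG w3) u \<Longrightarrow> gev s (D3 \<delta>) (lift3 S) (\<lambda>_ _. 1) u"
  by (erule gev_mono) (rule om3)

lemma gHI_mult:
  "gev s (D3 \<delta>) (lift3 S) (\<lambda>_ _. 1) u \<Longrightarrow> gev s (D3 \<delta>) (lift3 S) (\<lambda>_. w3) v \<Longrightarrow> gev s (D3 \<delta>) (lift3 S) (\<lambda>_. w3) (\<lambda>x. u x * v x)"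
  by (rule gev_mult[OF open_D3 S3 s, of "\<lambda>_ _. 1" _ "\<lambda>_. w3"]) (use w3_props in auto)

lemma gIH_mult:
  "gev s (D3 \<delta>) (lift3 S) (\<lambda>_. w3) u \<Longrightarrow> gev s (D3 \<delta>) (lift3 S) (\<lambda>_ _. 1) v \<Longrightarrow> gev s (D3 \<delta>) (lift3 S) (\<lambda>_. w3) (\<lambda>x. u x * v x)"
  by (rule gev_mult[OF open_D3 S3 s, of "\<lambda>_. w3" _ "\<lambda>_ _. 1"]) (use w3_props in auto)

lemmas gG_mult = gevG_mult[OF open_D3 S3 s w3]
lemmas gG_sum = gev_sum[OF open_D3 S3 _ om3(1)]
lemmas gI_sum = gev_sum[OF open_D3 S3, where om = "\<lambda>_. w3", OF _ w3_props(1)]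
lemmas gG_diff = gev_diff[OF open_D3 S3 _ _ om3(1)]
lemmas gI_diff = gev_diff[OF open_D3 S3, where om = "\<lambda>_. w3", OF _ _ w3_props(1)]

lemma gA: "gev s (D3 \<delta>) (lift3 S) (omG w3) (\<lambda>q. Am q $ i $ j)"
  unfolding Am_def by (simp add: gG_dop gth)

lemma gB: "gev s (D3 \<delta>) (lift3 S) (\<lambda>_. w3) (\<lambda>q. Bm q $ i $ j)"
  unfolding Bm_def by (simp add: gI_dop gth)

lemma gAc: "gev s (D3 \<delta>) (lift3 S) (\<lambda>_ _. 1) (\<lambda>q. Ac q $ i $ j)"
proof -
  have "gev s (D3 \<delta>) (lift3 S) (\<lambda>_. \<lambda>_. 1) (\<lambda>q. cnj (dop (zdir j False) (th i) q))"
    by (rule gev_cnj[OF open_D3 S3 gG_dop[OF gth]]) (rule om3)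
  then show ?thesis by (simp add: Ac_def)
qed

lemma gBc: "gev s (D3 \<delta>) (lift3 S) (\<lambda>_. w3) (\<lambda>q. Bc q $ i $ j)"
proof -
  have "gev s (D3 \<delta>) (lift3 S) (\<lambda>_. w3) (\<lambda>q. cnj (dop (zdir j True) (th i) q))"
    by (rule gev_cnj[OF open_D3 S3 gI_dop[OF gth]]) simp
  then show ?thesis by (simp add: Bc_def)
qed

lemma gAi: "gev s (D3 \<delta>) (lift3 S) (\<lambda>_ _. 1) (\<lambda>q. matrix_inv (Ac q) $ i $ j)"
proof -
  have "gev s (D3 \<delta>) (lift3 S) (omG (\<lambda>_. 1)) (\<lambda>q. matrix_inv (Ac q) $ i $ j)"
  proof (rule gevG_matrix_inv[OF open_D3 S3 s unit_weight_one _ det_nz(2) c])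
    show "gev s (D3 \<delta>) (lift3 S) (omG (\<lambda>_. 1)) (\<lambda>q. Ac q $ i $ j)" for i j
      unfolding omG_one by (rule gAc)
    show "c \<le> cmod (det (Ac P))" if "P \<in> lift3 S" for P
      using detA[of P] that S3 by (auto simp: det_Ac)
  qed
  then show ?thesis unfolding omG_one .
qed

text \<open>\<open>Ac\<close> is a conjugate and its inverse only in H, but in \<open>Sch\<close> it
  stands between the flat blocks \<open>Bm\<close> and \<open>Bc\<close>. The correction to
  \<open>Am\<close> is therefore flat, and \<open>Sch\<close> stays almost holomorphic.\<close>

lemma gSi: "gev s (D3 \<delta>) (lift3 S) (omG w3) (\<lambda>q. matrix_inv (Sch q) $ i $ j)"
proof (rule gevG_matrix_inv[OF open_D3 S3 s w3 _ det_nz(3) c])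
  show "gev s (D3 \<delta>) (lift3 S) (omG w3) (\<lambda>q. Sch q $ i $ j)" for i j
    unfolding Sch_nth
    by (intro gG_diff gA gI_imp_G gI_sum gIH_mult gB) (intro gI_imp_G gG_imp_H gI_sum gHI_mult gAi gBc)
  show "c \<le> cmod (det (Sch P))" if "P \<in> lift3 S" for P using detS that S3 by blast
qed

text \<open>The inverse of \<open>Ac\<close> is always multiplied by a flat factor, coming from b or
  from \<open>Bc\<close>. Hence \<open>Xs\<close> is almost holomorphic and \<open>Xsc\<close> is
  flat, as befits the derivatives of z and cnj z in a holomorphic direction.\<close>

lemma gXs:
  assumes "\<And>l. gev s (D3 \<delta>) (lift3 S) (omG w3) (\<lambda>q. a q $ l)" "\<And>l. gev s (D3 \<delta>) (lift3 S) (\<lambda>_. w3) (\<lambda>q. b q $ l)"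
  shows "gev s (D3 \<delta>) (lift3 S) (omG w3) (\<lambda>q. Xs (a q) (b q) q $ j)"
    and "gev s (D3 \<delta>) (lift3 S) (\<lambda>_. w3) (\<lambda>q. Xsc (a q) (b q) q $ j)"
proof -
  have 1: "gev s (D3 \<delta>) (lift3 S) (\<lambda>_. w3) (\<lambda>q. (matrix_inv (Ac q) *v b q) $ l)" for l
    by (simp add: matrix_vector_mult_def gI_sum gHI_mult gAi assms(2))
  have 2: "gev s (D3 \<delta>) (lift3 S) (\<lambda>_. w3) (\<lambda>q. (Bm q *v (matrix_inv (Ac q) *v b q)) $ l)" for l
    unfolding matrix_vector_mult_def[of "Bm _"] vec_lambda_beta
    by (intro gI_sum gIH_mult gB gG_imp_H gI_imp_G 1)
  have 3: "gev s (D3 \<delta>) (lift3 S) (omG w3) (\<lambda>q. Xs (a q) (b q) q $ l)" for l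
    unfolding Xs_def matrix_vector_mult_def[of "matrix_inv (Sch _)"] vec_lambda_beta vector_minus_component
    by (intro gG_sum gG_mult gSi gG_diff assms(1) gI_imp_G[OF 2])
  show "gev s (D3 \<delta>) (lift3 S) (omG w3) (\<lambda>q. Xs (a q) (b q) q $ j)" by (rule 3)
  have 4: "gev s (D3 \<delta>) (lift3 S) (\<lambda>_. w3) (\<lambda>q. (Bc q *v Xs (a q) (b q) q) $ l)" for l
    unfolding matrix_vector_mult_def vec_lambda_beta
    by (intro gI_sum gIH_mult gBc gG_imp_H 3)
  show "gev s (D3 \<delta>) (lift3 S) (\<lambda>_. w3) (\<lambda>q. Xsc (a q) (b q) q $ j)"
    unfolding Xsc_def matrix_vector_mult_def[of "matrix_inv (Ac _)"] vec_lambda_beta vector_minus_component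
    by (intro gI_sum gHI_mult gAi gI_diff assms(2) 4)
qed

lemma gzero: "gev s (D3 \<delta>) (lift3 S) (\<lambda>_. w3) (\<lambda>_. 0)"
  using gI_sum[of "{}" s "\<lambda>_ _. 0"] by simp

lemma g_cT: "gev s (D3 \<delta>) (lift3 S) (omG w3) (cT i d)"
proof -
  have X: "gev s (D3 \<delta>) (lift3 S) (omG w3) (\<lambda>q. Xs (axis i 1) 0 q $ j)"
    "gev s (D3 \<delta>) (lift3 S) (\<lambda>_. w3) (\<lambda>q. Xsc (axis i 1) 0 q $ j)" for j
    using gXs[of "\<lambda>_. axis i 1" "\<lambda>_. 0" j] gzero gevG_const[OF w3] by auto
  obtain k b where d: "d = (k, b)" by (cases d)
  show ?thesis
    unfolding cT_def[abs_def] d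
    by (cases k rule: sum.exhaust; cases "projr k"; cases b) (auto intro: X(1) gI_imp_G[OF X(2)] gevG_const[OF w3])
qed

lemma g_cY: "gev s (D3 \<delta>) (lift3 S) (omG w3) (cY i d)"
proof -
  have 1: "gev s (D3 \<delta>) (lift3 S) (omG w3) (\<lambda>q. rY i q $ l)" for l
    unfolding rY_def vec_lambda_beta by (intro gev_uminus[OF open_D3 S3] gG_dop gth)
  have 2: "gev s (D3 \<delta>) (lift3 S) (\<lambda>_. w3) (\<lambda>q. rYc i q $ l)" for l
    unfolding rYc_def vec_lambda_beta
    by (rule gev_uminus[OF open_D3 S3], rule gev_cnj[OF open_D3 S3 gI_dop[OF gth]]) simp
  note X = gXs[OF 1 2]
  obtain k b where d: "d = (k, b)" by (cases d)
  show ?thesis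
    unfolding cY_def[abs_def] d
    by (cases k rule: sum.exhaust; cases "projr k"; cases b) (auto intro: X(1) gI_imp_G[OF X(2)] gevG_const[OF w3])
qed

lemma g_Delta: "gev s (D3 \<delta>) (lift3 S) (omG w3) Delta"
proof -
  have "gev s (D2 r) S (omG w) (dop (Inr j, False) (dop (Inl i, False) (joint \<psi>)))" for i j
    by (rule gev_dop[OF g_dop]) (use s omG_props[OF w] in auto)
  from gev_subset[OF gev_seg_zero[OF this S2r] D3_mono order_refl]
  have N: "gev s (D3 \<delta>) (lift3 S) (omG w3) (\<lambda>q. Nm q $ i $ j)" for i j
    unfolding omG_pr by (simp add: Nm_def)
  show ?thesis
    unfolding Delta_def[abs_def]
  proof (intro gG_mult gevG_det[OF open_D3 S3 s w3] N gevG_inverse[OF open_D3 S3 s w3 _ det_nz(1) c] gA)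
    show "c \<le> cmod (det (Am P))" if "P \<in> lift3 S" for P using detA that S3 by blast
  qed
qed

end

end

section \<open>Further operations on jets\<close>

lemma jet_cmult:
  assumes "open D" "S \<subseteq> D" "jet s D S w R k M u"
  shows "jet s D S w R k (cmod a * M) (\<lambda>x. a * u x)"
  unfolding jet_def
proof (intro conjI ballI allI)
  have sm: "sm D u" using assms(3) by (simp add: jet_def)
  show "sm D (\<lambda>x. a * u x)" by (intro sm_mult sm_const sm assms(1))
  fix P ds assume P: "P \<in> S"
  have "cmod (dops ds (\<lambda>x. a * u x) P) = cmod a * cmod (dops ds u P)"
    by (simp add: dops_cmult[OF assms(1) sm subsetD[OF assms(2) P]] norm_mult)
  also have "\<dots> \<le> cmod a * (M * R ^ length ds * fact (k + length ds) powr s * omG w (anti ds) P)"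
    using assms(3) P by (intro mult_left_mono) (auto simp: jet_def)
  finally show "cmod (dops ds (\<lambda>x. a * u x) P) \<le> cmod a * M * R ^ length ds * fact (k + length ds) powr s * omG w (anti ds) P"
    by (simp add: mult_ac)
qed

lemma jet_mono:
  assumes "unit_weight w S" "jet s D S w R k M u" "M \<le> M'" "R \<ge> 0"
  shows "jet s D S w R k M' u"
  unfolding jet_def
proof (intro conjI ballI allI)
  show "sm D u" using assms(2) by (simp add: jet_def)
  fix P ds assume P: "P \<in> S"
  have "cmod (dops ds u P) \<le> M * R ^ length ds * fact (k + length ds) powr s * omG w (anti ds) P"
    using assms(2) P by (simp add: jet_def)
  also have "\<dots> \<le> M' * R ^ length ds * fact (k + length ds) powr s * omG w (anti ds) P"
    using assms(3,4) omG_props(1)[OF assms(1) P] by (intro mult_right_mono) auto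
  finally show "cmod (dops ds u P) \<le> M' * R ^ length ds * fact (k + length ds) powr s * omG w (anti ds) P" .
qed

lemma jet_cong:
  assumes "open D" "S \<subseteq> D" "\<And>x. x \<in> D \<Longrightarrow> u x = v x" "jet s D S w R k M u"
  shows "jet s D S w R k M v"
proof -
  have "dops ds u P = dops ds v P" if "P \<in> S" for P ds
    by (rule dops_cong_open[OF assms(1) subsetD[OF assms(2) that] assms(3)])
  moreover have smu: "sm D u" using assms(4) unfolding jet_def by blast
  have "sm D v" using sm_cong[OF assms(1,3) smu] .
  ultimately show ?thesis using assms(4) \<open>sm D v\<close> by (simp add: jet_def)
qed

text \<open>K (1 + 2C) is the growth rate of the convolution inequality that the bounds of the
  coefficients satisfy; with it the sum stays below its own m-th power.\<close>

lemma geometric_convolution: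
  fixes K C :: real
  shows "(\<Sum>l=1..m. K ^ l * (2 * C * (K * (1 + 2 * C)) ^ (m - l))) = (K * (1 + 2 * C)) ^ m - K ^ m"
proof (induction m)
  case (Suc m)
  define A where "A = K * (1 + 2 * C)"
  have "(\<Sum>l=1..Suc m. K ^ l * (2 * C * A ^ (Suc m - l))) = (\<Sum>l=1..m. K ^ l * (2 * C * A ^ (Suc m - l))) + K ^ Suc m * (2 * C)"
    by simp
  also have "(\<Sum>l=1..m. K ^ l * (2 * C * A ^ (Suc m - l))) = A * (\<Sum>l=1..m. K ^ l * (2 * C * A ^ (m - l)))"
    unfolding sum_distrib_left by (rule sum.cong) (auto simp: Suc_diff_le)
  also have "(\<Sum>l=1..m. K ^ l * (2 * C * A ^ (m - l))) = A ^ m - K ^ m" using Suc by (simp add: A_def)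
  also have "A * (A ^ m - K ^ m) + K ^ Suc m * (2 * C) = A ^ Suc m - K ^ Suc m"
    by (simp add: A_def algebra_simps)
  finally show ?case by (simp only: A_def)
qed simp

text \<open>Restriction to y = x, extended to all t as a constant. It keeps every coefficient a
  function of (x, t, z), so that the recursion is iterated in one space.\<close>

definition proj0 :: "complex^('n::finite + ('n + 'n)) \<Rightarrow> complex^('n + ('n + 'n))" where
  "proj0 q = trip (xc q) 0 (zc q)"

lemma proj0_in: "q \<in> D3 r \<Longrightarrow> proj0 q \<in> D3 r" by (auto simp: proj0_def D3_def)

lemma proj0_nth: "proj0 q $ k = (if is_t (k, b) then 0 else q $ k)"
proof (cases k)
  case (Inr j)
  then show ?thesis by (cases j) (auto simp: proj0_def is_t_def xc_def zc_def)
qed (auto simp: proj0_def is_t_def xc_def zc_def)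

lemma dop_proj0:
  fixes g :: "complex^('n::finite + ('n + 'n)) \<Rightarrow> complex"
  assumes "g differentiable (at (proj0 q))"
  shows "dop d (\<lambda>q. g (proj0 q)) q = (if is_t d then 0 else 1) * dop d g (proj0 q)"
proof (rule dop_chain_single[where h = proj0, OF assms])
  fix k :: "'n + ('n + 'n)"
  have p: "(\<lambda>x::complex^('n + ('n + 'n)). proj0 x $ k) = (if is_t (k, True) then (\<lambda>_. 0) else (\<lambda>x. x $ k))"
    by (intro ext) (simp add: proj0_nth[of _ k True])
  have pc: "(\<lambda>x::complex^('n + ('n + 'n)). cnj (proj0 x $ k)) = (if is_t (k, True) then (\<lambda>_. 0) else (\<lambda>x. cnj (x $ k)))"
    by (intro ext) (simp add: proj0_nth[of _ k True])
  show "(\<lambda>x. proj0 x $ k) differentiable at q" unfolding p by (auto intro: differentiable_coord)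
  show "dop d (\<lambda>x. proj0 x $ k) q = (if d = (k, False) then if is_t d then 0 else 1 else 0)"
    unfolding p by (auto simp: dop_coord is_t_def)
  show "dop d (\<lambda>x. cnj (proj0 x $ k)) q = (if d = (k, True) then if is_t d then 0 else 1 else 0)"
    unfolding pc by (auto simp: dop_cnj_coord is_t_def)
qed

lemma dops_proj0:
  assumes g: "sm (D3 r) g" and q: "q \<in> D3 r"
  shows "dops ds (\<lambda>q. g (proj0 q)) q = (if \<exists>d\<in>set ds. is_t d then 0 else 1) * dops ds g (proj0 q)"
  using q
proof (induction ds arbitrary: q)
  case (Cons d ds)
  define e where "e = (if \<exists>d\<in>set ds. is_t d then 0 else 1 :: complex)"
  have df: "dops ds g differentiable (at (proj0 q))"
    by (rule sm_differentiable[OF sm_dops[OF g] proj0_in[OF Cons.prems]])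
  have dp: "(\<lambda>q. dops ds g (proj0 q)) differentiable (at q)"
  proof -
    have "(\<lambda>x. proj0 x $ k) differentiable (at q)" for k
      by (cases "is_t (k, True)") (auto simp: proj0_nth[of _ _ True] intro: differentiable_coord)
    from differentiable_chain_at[OF differentiable_componentwise[OF this] df] show ?thesis by (simp add: o_def)
  qed
  have "dops (d # ds) (\<lambda>q. g (proj0 q)) q = dop d (\<lambda>q. e * dops ds g (proj0 q)) q"
    using dop_cong_open[OF open_D3 Cons.prems Cons.IH] by (simp add: e_def)
  also have "\<dots> = e * ((if is_t d then 0 else 1) * dop d (dops ds g) (proj0 q))"
    unfolding dop_cmult[OF dp] dop_proj0[OF df] ..
  finally show ?case by (auto simp: e_def)
qed simp

lemma sm_proj0:
  assumes g: "sm (D3 r) g"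
  shows "sm (D3 r) (\<lambda>q. g (proj0 q))"
proof (rule sm_compose[OF open_D3 g _ proj0_in])
  show "sm (D3 r) (\<lambda>q. proj0 q $ k)" for k
    by (cases "is_t (k, True)") (auto simp: proj0_nth[of _ _ True] sm_const sm_coord)
qed

text \<open>Words with a letter in t are annihilated, the others are unchanged at points with t = 0,
  so the bounds persist with the same constants.\<close>

lemma jet_proj0:
  assumes "jet s (D3 r) (lift3 S) w R k M u" "lift3 S \<subseteq> D3 r" "unit_weight w (lift3 S)" "M \<ge> 0" "R \<ge> 0"
  shows "jet s (D3 r) (lift3 S) w R k M (\<lambda>q. u (proj0 q))"
  unfolding jet_def
proof (intro conjI ballI allI)
  have sm: "sm (D3 r) u" using assms(1) by (simp add: jet_def)
  show "sm (D3 r) (\<lambda>q. u (proj0 q))" by (rule sm_proj0[OF sm])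
  fix P and ds :: "(('a + ('a + 'a)) \<times> bool) list" assume P: "P \<in> lift3 S"
  have P0: "proj0 P = P"
  proof -
    have "tc P = 0" using P by (simp add: lift3_def)
    then show ?thesis using trip_simps(7)[of P] by (simp add: proj0_def)
  qed
  have "cmod (dops ds (\<lambda>q. u (proj0 q)) P) \<le> cmod (dops ds u P)"
    using dops_proj0[OF sm subsetD[OF assms(2) P], of ds] by (auto simp: P0)
  also have "\<dots> \<le> M * R ^ length ds * fact (k + length ds) powr s * omG w (anti ds) P"
    using assms(1) P by (simp add: jet_def)
  finally show "cmod (dops ds (\<lambda>q. u (proj0 q)) P) \<le> M * R ^ length ds * fact (k + length ds) powr s * omG w (anti ds) P" .
qed

section \<open>The recursion for the coefficients\<close>

context phase_nbhd
begin

lemma sm_cT: "sm (D3 \<delta>) (cT i d)" and sm_cY: "sm (D3 \<delta>) (cY i d)" and sm_Delta: "sm (D3 \<delta>) Delta"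
proof -
  have g: "gev 1 (D2 r) {} (omG (\<lambda>_. 1)) (joint \<psi>)" using sm\<psi> by (auto simp: gev_def)
  have w: "unit_weight (\<lambda>_. 1) {}" by (rule unit_weight_one)
  show "sm (D3 \<delta>) (cT i d)" by (rule gev_sm[OF g_cT[OF _ _ w g]]) auto
  show "sm (D3 \<delta>) (cY i d)" by (rule gev_sm[OF g_cY[OF _ _ w g]]) auto
  show "sm (D3 \<delta>) Delta" by (rule gev_sm[OF g_Delta[OF _ _ w g]]) auto
qed

lemma sm_vf: "(\<And>d. sm (D3 \<delta>) (e d)) \<Longrightarrow> sm (D3 \<delta>) u \<Longrightarrow> sm (D3 \<delta>) (vf e u)"
  unfolding vf_def[abs_def] by (intro sm_sum sm_mult sm_dop open_D3)

lemma sm_Lop: "sm (D3 \<delta>) u \<Longrightarrow> sm (D3 \<delta>) (Lop u)"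
  unfolding Lop_def[abs_def] by (intro sm_sum sm_vf sm_cT sm_cY open_D3)

text \<open>Agreement with a pulled back function on the open set \<open>Om\<close> is preserved by
  the operator, so its powers can be followed in \<open>Dy_Dtheta_power_pull\<close>.\<close>

lemma Dy_Dtheta_pull:
  assumes u: "sm (D3 \<delta>) u" and G: "\<And>y \<theta>. (x, y, \<theta>) \<in> Om \<Longrightarrow> G y \<theta> = pull x u y \<theta>" and p: "(x, y, \<theta>) \<in> Om"
  shows "Dy_Dtheta G y \<theta> = pull x (Lop u) y \<theta>"
proof -
  have 1: "Dz i (\<lambda>\<theta>'. G y' \<theta>') \<theta> = pull x (vf (cT i) u) y' \<theta>" if p': "(x, y', \<theta>) \<in> Om" for i y'
  proof -
    have "dop (i, False) (\<lambda>\<theta>'. G y' \<theta>') \<theta> = dop (i, False) (\<lambda>\<theta>'. pull x u y' \<theta>') \<theta>"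
      by (rule dop_cong_open[OF open_slice(1)[of x y']]) (use p' G in auto)
    then show ?thesis using pull_T[OF u p'] by (simp add: dop_def)
  qed
  have 2: "Dz i (\<lambda>y'. Dz i (\<lambda>\<theta>'. G y' \<theta>') \<theta>) y = pull x (vf (cY i) (vf (cT i) u)) y \<theta>" for i
  proof -
    have "dop (i, False) (\<lambda>y'. Dz i (\<lambda>\<theta>'. G y' \<theta>') \<theta>) y = dop (i, False) (\<lambda>y'. pull x (vf (cT i) u) y' \<theta>) y"
      by (rule dop_cong_open[OF open_slice(2)[of x \<theta>]]) (use p 1 in auto)
    then show ?thesis using pull_Y[OF sm_vf[OF sm_cT u] p] by (simp add: dop_def)
  qed
  show ?thesis unfolding Dy_Dtheta_def 2 by (simp add: pull_def Lop_def)
qed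

lemma Dy_Dtheta_power_pull:
  assumes u: "sm (D3 \<delta>) u" and G: "\<And>y \<theta>. (x, y, \<theta>) \<in> Om \<Longrightarrow> G y \<theta> = pull x u y \<theta>"
  shows "sm (D3 \<delta>) ((Lop ^^ l) u) \<and> (\<forall>y \<theta>. (x, y, \<theta>) \<in> Om \<longrightarrow> (Dy_Dtheta ^^ l) G y \<theta> = pull x ((Lop ^^ l) u) y \<theta>)"
proof (induction l)
  case (Suc l)
  then show ?case using sm_Lop Dy_Dtheta_pull[of "(Lop ^^ l) u" x "(Dy_Dtheta ^^ l) G"] by simp
qed (use u G in simp)

definition ext3 :: "(complex^'n \<Rightarrow> complex^'n \<Rightarrow> complex) \<Rightarrow> complex^('n + ('n + 'n)) \<Rightarrow> complex" where
  "ext3 b q = b (xc q) (zc q)"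

text \<open>For \<theta> = \<theta>(x, x, z) one has z(x, x, \<theta>) = z, so evaluating the pulled
  back function at y = x means evaluating it at \<open>proj0 q\<close>.\<close>

lemma recursion_ext3:
  assumes rec: "bergman_recursion \<psi> (ball 0 r) bm" and m: "m \<ge> 1" and q: "q \<in> D3 \<delta>"
    and sm: "\<And>j. j < m \<Longrightarrow> sm (D3 \<delta>) (ext3 (bm j))"
  shows "ext3 (bm m) q = - (\<Sum>l=1..m. (Lop ^^ l) (\<lambda>q. Delta q * ext3 (bm (m - l)) q) (proj0 q) / fact l)"
proof -
  define x z where "x = xc q" and "z = zc q"
  have xz: "x \<in> ball 0 \<delta>" "z \<in> ball 0 \<delta>" using q by (auto simp: x_def z_def D3_def)
  then have xzr: "x \<in> ball 0 r" "z \<in> ball 0 r" using \<delta>(2) by auto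
  define G where "G l y \<theta> = bm (m - l) x (theta_inv \<psi> W x y \<theta>) * Delta0 \<psi> x y (theta_inv \<psi> W x y \<theta>)" for l y \<theta>
  define u where "u l = (\<lambda>q. Delta q * ext3 (bm (m - l)) q)" for l
  have p: "(x, x, theta \<psi> x x z) \<in> Om"
    using xz by (auto simp: Om_def theta_map_def intro!: image_eqI[of _ _ "(x, x, z)"])
  have Gp: "G l y \<theta> = pull x (u l) y \<theta>" if "(x, y, \<theta>) \<in> Om" for l y \<theta>
  proof -
    have "x \<in> ball 0 r" "y \<in> ball 0 r" "theta_inv \<psi> W x y \<theta> \<in> ball 0 r"
      using theta_inv_props[OF \<delta>(2) that[unfolded Om_def]] \<delta>(2) by auto
    from Delta0_eq[OF this] show ?thesis by (simp add: G_def pull_def u_def ext3_def)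
  qed
  have step: "(Dy_Dtheta ^^ l) (G l) x (theta \<psi> x x z) = (Lop ^^ l) (u l) (proj0 q)" if "l \<in> {1..m}" for l
  proof -
    have "sm (D3 \<delta>) (u l)" unfolding u_def using that m by (intro sm_mult sm_Delta sm open_D3) auto
    from Dy_Dtheta_power_pull[OF this Gp, of l] p
    have "(Dy_Dtheta ^^ l) (G l) x (theta \<psi> x x z) = pull x ((Lop ^^ l) (u l)) x (theta \<psi> x x z)" by blast
    also have "\<dots> = (Lop ^^ l) (u l) (proj0 q)"
      unfolding pull_def theta_inv_theta[OF xzr(1) xzr(1) xzr(2)] by (simp add: proj0_def x_def z_def)
    finally show ?thesis .
  qed
  have "bm m x z = - (\<Sum>l=1..m. (Dy_Dtheta ^^ l) (G l) x (theta \<psi> x x z) / fact l)"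
    using rec m xzr unfolding bergman_recursion_def G_def by blast
  also have "(\<Sum>l=1..m. (Dy_Dtheta ^^ l) (G l) x (theta \<psi> x x z) / fact l)
     = (\<Sum>l=1..m. (Lop ^^ l) (u l) (proj0 q) / fact l)"
    by (rule sum.cong) (use step in auto)
  finally show ?thesis by (simp add: ext3_def x_def z_def u_def)
qed

text \<open>Each \<open>Lop\<close> raises the shift by 2 and multiplies M by K, so
  \<open>Lop ^^ l\<close> applied to the coefficient m - l has shift 2(m - l) + 2l = 2m for every l.
  The factor 1/l! is estimated by 1, and the constants sum up to at most A^m by
  \<open>geometric_convolution\<close>.\<close>

lemma coefficient_jets:
  assumes s: "s \<ge> 1" and S: "S \<subseteq> D2 \<delta>" and w: "unit_weight w S"
    and g: "gev s (D2 r) S (omG w) (joint \<psi>)" and rec: "bergman_recursion \<psi> (ball 0 r) bm"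
  obtains A R where "A \<ge> 1" "R \<ge> 1"
    "\<And>m. jet s (D3 \<delta>) (lift3 S) (\<lambda>q. w (pr q)) R (2 * m) (A ^ m) (ext3 (bm m))"
proof -
  note S3 = S3[OF s S w g]
  note w3 = w3[OF s S w g]
  note om = omG_props[OF w3]
  have fin: "finite (UNIV :: ('n \<times> (('n + ('n + 'n)) \<times> bool)) set)" by simp
  obtain Ca where Ca: "Ca \<ge> 1" "\<And>i d P ds. P \<in> lift3 S \<Longrightarrow>
      cmod (dops ds (cT i d) P) \<le> Ca * Ca ^ length ds * fact (length ds) powr s * omG (\<lambda>q. w (pr q)) (anti ds) P"
    using gev_uniform[OF fin, of s "D3 \<delta>" "lift3 S" "omG (\<lambda>q. w (pr q))" "\<lambda>(i, d). cT i d"] g_cT[OF s S w g] om(1)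
    by (auto simp: split_paired_All)
  obtain Cb where Cb: "Cb \<ge> 1" "\<And>i d P ds. P \<in> lift3 S \<Longrightarrow>
      cmod (dops ds (cY i d) P) \<le> Cb * Cb ^ length ds * fact (length ds) powr s * omG (\<lambda>q. w (pr q)) (anti ds) P"
    using gev_uniform[OF fin, of s "D3 \<delta>" "lift3 S" "omG (\<lambda>q. w (pr q))" "\<lambda>(i, d). cY i d"] g_cY[OF s S w g] om(1)
    by (auto simp: split_paired_All)
  obtain Cd where Cd: "Cd \<ge> 1" "\<And>P ds. P \<in> lift3 S \<Longrightarrow>
      cmod (dops ds Delta P) \<le> Cd * Cd ^ length ds * fact (length ds) powr s * omG (\<lambda>q. w (pr q)) (anti ds) P"
    using g_Delta[OF s S w g] unfolding gev_def by blast
  define C where "C = max Ca (max Cb Cd)"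
  have C: "C \<ge> 1" "Ca \<le> C" "Cb \<le> C" "Cd \<le> C" using Ca(1) by (auto simp: C_def)
  have up: "X \<le> C * C ^ n * fact n powr s * omG (\<lambda>q. w (pr q)) b P"
    if "X \<le> E * E ^ n * fact n powr s * omG (\<lambda>q. w (pr q)) b P" "1 \<le> E" "E \<le> C" "P \<in> lift3 S" for X E n b P
    by (rule order.trans[OF that(1)]) (intro mult_right_mono mult_mono power_mono, use that(2-) om(1)[OF that(4)] in auto)
  \<comment> \<open>The smallest rate allowed in \<open>leibniz_bound\<close>; it serves for all
    m.\<close>
  define R where "R = 2 * C"
  have R: "R \<ge> 1" "2 * C \<le> R" "R \<ge> 0" using C by (auto simp: R_def)
  define N where "N = real CARD(('n + ('n + 'n)) \<times> bool) * (2 * C * R)"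
  have N1: "real CARD(('n + ('n + 'n)) \<times> bool) \<ge> 1"
    using zero_less_card_finite[where 'a="('n + ('n + 'n)) \<times> bool"] by linarith
  have N: "N \<ge> 1"
  proof -
    have "1 * (1 * 1) \<le> real CARD(('n + ('n + 'n)) \<times> bool) * (2 * C * R)"
      using N1 C R by (intro mult_mono) auto
    then show ?thesis by (simp add: N_def)
  qed
  \<comment> \<open>The cost of one \<open>Lop\<close>: a sum over n indices of two vector fields,
    each with a factor N.\<close>
  define K where "K = real CARD('n) * (N * N)"
  have K: "K \<ge> 1"
  proof -
    have "real CARD('n) \<ge> 1" using zero_less_card_finite[where 'a='n] by linarith
    then have "1 * (1 * 1) \<le> real CARD('n) * (N * N)" using N by (intro mult_mono) auto
    then show ?thesis by (simp add: K_def)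
  qed
  define A where "A = K * (1 + 2 * C)"
  have A: "A \<ge> 1" using mult_mono[of 1 K 1 "1 + 2 * C"] K C by (simp add: A_def)
  let ?J = "jet s (D3 \<delta>) (lift3 S) (\<lambda>q. w (pr q)) R"
  have JT: "?J (Suc k) (N * M) (vf (cT i) u)" if "?J k M u" "M \<ge> 0" for k M i u
    unfolding vf_def[abs_def] N_def
    by (rule jet_vector_field[OF open_D3 S3 s w3 sm_cT C(1) R(2) that(2) up[OF Ca(2) Ca(1) C(2)] that(1)])
  have JY: "?J (Suc k) (N * M) (vf (cY i) u)" if "?J k M u" "M \<ge> 0" for k M i u
    unfolding vf_def[abs_def] N_def
    by (rule jet_vector_field[OF open_D3 S3 s w3 sm_cY C(1) R(2) that(2) up[OF Cb(2) Cb(1) C(3)] that(1)])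
  have JL: "?J (k + 2) (K * M) (Lop u)" if u: "?J k M u" and M: "M \<ge> 0" for k M u
  proof -
    have "?J (Suc (Suc k)) (\<Sum>i\<in>(UNIV :: 'n set). N * (N * M)) (\<lambda>q. \<Sum>i\<in>UNIV. vf (cY i) (vf (cT i) u) q)"
      by (intro jet_sum[OF open_D3 S3] JY JT u) (use N M in auto)
    then show ?thesis by (simp add: Lop_def[abs_def] K_def mult_ac)
  qed
  have JLl: "?J (k + 2 * l) (K ^ l * M) ((Lop ^^ l) u)" if u: "?J k M u" and M: "M \<ge> 0" for k M u l
  proof (induction l)
    case (Suc l)
    have "?J (k + 2 * l + 2) (K * (K ^ l * M)) (Lop ((Lop ^^ l) u))"
      by (rule JL[OF Suc]) (use K M in auto)
    then show ?case by (simp add: mult_ac)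
  qed (use u in simp)
  have main: "?J (2 * m) (A ^ m) (ext3 (bm m))" for m
  proof (induction m rule: less_induct)
    case (less m)
    show ?case
    proof (cases "m = 0")
      case True
      have "?J 0 1 (\<lambda>_. 1)"
        unfolding jet_def
      proof (intro conjI ballI allI)
        fix P and ds :: "(('n + ('n + 'n)) \<times> bool) list" assume "P \<in> lift3 S"
        then show "cmod (dops ds (\<lambda>_. 1) P) \<le> 1 * R ^ length ds * fact (0 + length ds) powr s * omG (\<lambda>q. w (pr q)) (anti ds) P"
          using R om(1) by (cases ds) (auto simp: dops_const omG_def)
      qed (rule sm_const)
      then have "?J 0 1 (ext3 (bm 0))"
      proof (rule jet_cong[OF open_D3 S3, rotated])
        fix q :: "complex^('n + ('n + 'n))" assume "q \<in> D3 \<delta>"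
        then have "xc q \<in> ball 0 r" "zc q \<in> ball 0 r" using \<delta>(2) by (auto simp: D3_def)
        then show "1 = ext3 (bm 0) q" using rec unfolding bergman_recursion_def ext3_def by metis
      qed
      then show ?thesis using True by simp
    next
      case False
      then have m: "m \<ge> 1" by simp
      have sm: "sm (D3 \<delta>) (ext3 (bm j))" if "j < m" for j using less[OF that] by (simp add: jet_def)
      have A0: "0 \<le> A ^ j" for j using A by simp
      define u where "u l = (Lop ^^ l) (\<lambda>q. Delta q * ext3 (bm (m - l)) q)" for l
      have Ju: "?J (2 * m) (K ^ l * (2 * C * A ^ (m - l))) (u l)" if l: "l \<in> {1..m}" for l
      proof -
        have "?J (2 * (m - l)) (2 * C * A ^ (m - l)) (\<lambda>q. Delta q * ext3 (bm (m - l)) q)"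
          using l m by (intro jet_mult[OF open_D3 S3 s w3 sm_Delta C(1) R(2) A0 up[OF Cd(2) Cd(1) C(4)]] less) auto
        from JLl[OF this, of l] have "?J (2 * (m - l) + 2 * l) (K ^ l * (2 * C * A ^ (m - l))) (u l)"
          using C A0 by (simp add: u_def)
        then show ?thesis using l by (simp add: algebra_simps flip: distrib_left)
      qed
      have "?J (2 * m) (\<Sum>l=1..m. cmod (- 1 / fact l) * (K ^ l * (2 * C * A ^ (m - l))))
          (\<lambda>q. \<Sum>l=1..m. (- 1 / fact l) * u l (proj0 q))"
        using K C A0 R by (intro jet_sum[OF open_D3 S3] jet_cmult[OF open_D3 S3] jet_proj0[OF Ju S3 w3]) auto
      moreover have "(\<Sum>l=1..m. cmod (- 1 / fact l) * (K ^ l * (2 * C * A ^ (m - l)))) \<le> A ^ m"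
      proof -
        have "(\<Sum>l=1..m. cmod (- 1 / fact l) * (K ^ l * (2 * C * A ^ (m - l)))) \<le> (\<Sum>l=1..m. 1 * (K ^ l * (2 * C * A ^ (m - l))))"
        proof (rule sum_mono, rule mult_right_mono)
          fix l
          have "(1 :: real) \<le> fact l" by (rule fact_ge_1)
          then show "cmod (- 1 / fact l) \<le> 1" by (simp add: norm_divide)
          show "0 \<le> K ^ l * (2 * C * A ^ (m - l))" using K C A0 by simp
        qed
        also have "\<dots> = A ^ m - K ^ m" using geometric_convolution[of K C m] by (simp add: A_def)
        also have "\<dots> \<le> A ^ m" using K by simp
        finally show ?thesis .
      qed
      ultimately have J: "?J (2 * m) (A ^ m) (\<lambda>q. \<Sum>l=1..m. (- 1 / fact l) * u l (proj0 q))"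
        using jet_mono[OF w3] R by blast
      show ?thesis
      proof (rule jet_cong[OF open_D3 S3 _ J])
        fix q :: "complex^('n + ('n + 'n))" assume q: "q \<in> D3 \<delta>"
        show "(\<Sum>l=1..m. (- 1 / fact l) * u l (proj0 q)) = ext3 (bm m) q"
        proof -
          have "ext3 (bm m) q = - (\<Sum>l=1..m. u l (proj0 q) / fact l)"
            using recursion_ext3[OF rec m q sm] by (simp add: u_def)
          then show ?thesis by (simp add: sum_negf)
        qed
      qed
    qed
  qed
  show thesis by (rule that[OF A R(1) main])
qed

section \<open>Back to the variables x, z\<close>

definition edir :: "('n + 'n) \<times> bool \<Rightarrow> ('n + ('n + 'n)) \<times> bool" where
  "edir d = (case fst d of Inl i \<Rightarrow> (Inl i, snd d) | Inr i \<Rightarrow> (Inr (Inr i), snd d))"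

lemma anti_map_edir: "anti (map edir ds) = anti ds"
  by (induction ds) (auto simp: edir_def split: sum.splits)

definition emb :: "complex^('n + 'n) \<Rightarrow> complex^('n + ('n + 'n))" where
  "emb v = trip (yv v) 0 (zv v)"

lemma emb_nth: "emb v $ Inl i = v $ Inl i" "emb v $ Inr (Inl i) = 0" "emb v $ Inr (Inr i) = v $ Inr i"
  by (simp_all add: emb_def yv_def zv_def)

lemma emb_in: "v \<in> D2 \<delta> \<Longrightarrow> emb v \<in> D3 \<delta>" by (simp add: emb_def D2_def D3_def)

lemma joint_eq_ext3: "joint b v = ext3 b (emb v)"
  by (simp add: joint_def ext3_def emb_def yv_def zv_def)

lemma differentiable_emb_nth: "(\<lambda>v. emb v $ k) differentiable (at v)"
  by (cases k rule: sum.exhaust; cases "projr k") (auto simp: emb_nth intro: differentiable_coord)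

lemma dop_emb:
  assumes "g differentiable (at (emb v))"
  shows "dop d (\<lambda>v. g (emb v)) v = 1 * dop (edir d) g (emb v)"
proof (rule dop_chain_single[where h = emb, OF assms differentiable_emb_nth])
  fix k
  show "dop d (\<lambda>x. emb x $ k) v = (if edir d = (k, False) then 1 else 0)"
    by (cases d; cases "fst d"; cases k rule: sum.exhaust; cases "projr k") (auto simp: emb_nth dop_coord edir_def)
  show "dop d (\<lambda>x. cnj (emb x $ k)) v = (if edir d = (k, True) then 1 else 0)"
    by (cases d; cases "fst d"; cases k rule: sum.exhaust; cases "projr k") (auto simp: emb_nth dop_cnj_coord edir_def)
qed

text \<open>b is the restriction to t = 0 of its extension \<open>ext3 b\<close>; letters in x and z
  go to the same letters among three groups of variables, and none in t arises.\<close>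

lemma dops_joint:
  assumes "sm (D3 \<delta>) (ext3 b)" "v \<in> D2 \<delta>"
  shows "dops ds (joint b) v = dops (map edir ds) (ext3 b) (emb v)"
  using assms(2)
proof (induction ds arbitrary: v)
  case (Cons d ds)
  have "dops (map edir ds) (ext3 b) differentiable (at (emb v))"
    by (rule sm_differentiable[OF sm_dops[OF assms(1)] emb_in[OF Cons.prems]])
  from dop_emb[OF this, of d] show ?case
    using dop_cong_open[OF open_D2 Cons.prems Cons.IH] by simp
qed (simp add: joint_eq_ext3)

lemma coefficient_bound:
  assumes J: "jet s (D3 \<delta>) (lift3 S) (\<lambda>q. w (pr q)) R k M (ext3 b)" and S: "S \<subseteq> D2 \<delta>" and v: "v \<in> S"
  shows "cmod (dops ds (joint b) v) \<le> M * R ^ length ds * fact (k + length ds) powr s * omG w (anti ds) v"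
proof -
  have p: "pr (emb v) = v" by (simp add: pr_def emb_def)
  have e: "emb v \<in> lift3 S" using v by (simp add: lift3_def emb_def)
  have "cmod (dops (map edir ds) (ext3 b) (emb v))
      \<le> M * R ^ length (map edir ds) * fact (k + length (map edir ds)) powr s * omG (\<lambda>q. w (pr q)) (anti (map edir ds)) (emb v)"
    using J e unfolding jet_def by blast
  moreover have "dops ds (joint b) v = dops (map edir ds) (ext3 b) (emb v)"
    by (rule dops_joint[OF _ subsetD[OF S v]]) (use J in \<open>simp add: jet_def\<close>)
  ultimately show ?thesis by (cases "anti ds") (simp_all add: anti_map_edir omG_def p)
qed

end

text \<open>The factorial (2m + n)! separates into m!^2 \<alpha>! \<beta>! at the cost of geometric
  factors. Raised to the power a + \<epsilon>, the square m!^2 produces the exponent 2a +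
  2\<epsilon>.\<close>

lemma fact_split_bound:
  fixes \<alpha> \<beta> :: "'k::finite \<Rightarrow> nat"
  shows "(fact (2 * m + (mi_abs \<alpha> + mi_abs \<beta>)) :: real)
    \<le> 16 ^ m * (4 * 2 ^ CARD('k)) ^ (mi_abs \<alpha> + mi_abs \<beta>) * ((fact m)\<^sup>2 * mi_fact \<alpha> * mi_fact \<beta>)"
proof -
  define n where "n = mi_abs \<alpha> + mi_abs \<beta>"
  have ab: "(fact n :: real) \<le> 2 ^ n * (2 ^ CARD('k)) ^ n * (mi_fact \<alpha> * mi_fact \<beta>)"
  proof -
    have mf: "(fact (mi_abs \<gamma>) :: real) \<le> (2 ^ CARD('k)) ^ mi_abs \<gamma> * mi_fact \<gamma>" for \<gamma> :: "'k \<Rightarrow> nat"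
      using fact_sum_le_prod_fact[of "UNIV :: 'k set" \<gamma>] by (simp add: mi_abs_def mi_fact_def)
    have "(fact n :: real) \<le> 2 ^ n * (fact (mi_abs \<alpha>) * fact (mi_abs \<beta>))" unfolding n_def by (rule fact_add_le)
    also have "\<dots> \<le> 2 ^ n * (((2 ^ CARD('k)) ^ mi_abs \<alpha> * mi_fact \<alpha>) * ((2 ^ CARD('k)) ^ mi_abs \<beta> * mi_fact \<beta>))"
      using mi_fact_pos[of \<alpha>] by (intro mult_left_mono mult_mono mf) auto
    finally show ?thesis by (simp add: n_def power_add mult_ac)
  qed
  have "(fact (2 * m + n) :: real) \<le> 2 ^ (2 * m + n) * (fact (2 * m) * fact n)" by (rule fact_add_le)
  also have "\<dots> \<le> 2 ^ (2 * m + n) * ((2 ^ (m + m) * (fact m * fact m)) * (2 ^ n * (2 ^ CARD('k)) ^ n * (mi_fact \<alpha> * mi_fact \<beta>)))"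
    using fact_add_le[of m m] by (intro mult_left_mono mult_mono ab) (auto simp: mult_2)
  also have "\<dots> = (2 ^ (2 * m) * 2 ^ (m + m)) * ((2 ^ n * 2 ^ n) * (2 ^ CARD('k)) ^ n) * ((fact m)\<^sup>2 * mi_fact \<alpha> * mi_fact \<beta>)"
    by (simp add: power_add power2_eq_square mult_ac)
  also have "(2 ^ (2 * m) * 2 ^ (m + m) :: real) = 16 ^ m"
  proof -
    have "(16::real) ^ m = (2 ^ 4) ^ m" by simp
    also have "\<dots> = 2 ^ (4 * m)" by (simp only: power_mult)
    finally show ?thesis by (simp add: power_add[symmetric])
  qed
  also have "((2 ^ n * 2 ^ n) * (2 ^ CARD('k)) ^ n :: real) = (4 * 2 ^ CARD('k)) ^ n"
  proof -
    have "(4 * 2 ^ CARD('k)) ^ n = (2 * 2 * 2 ^ CARD('k) :: real) ^ n" by simp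
    then show ?thesis by (simp only: power_mult_distrib)
  qed
  finally show ?thesis by (simp add: n_def)
qed

text \<open>The conclusion is stated for all larger constants, so that the two estimates of the
  theorem can share one constant.\<close>

lemma coefficient_estimates_of_bounds:
  fixes bm :: "nat \<Rightarrow> complex^'n::finite \<Rightarrow> complex^'n \<Rightarrow> complex"
  assumes bd: "\<And>m x z ds. (x, z) \<in> S \<Longrightarrow> cmod (dops ds (joint (bm m)) (pair_vec x z))
      \<le> A ^ m * R ^ length ds * fact (2 * m + length ds) powr (a + \<epsilon>) * omG w (anti ds) (pair_vec x z)"
    and w: "\<And>x z. (x, z) \<in> S \<Longrightarrow> w (pair_vec x z) = flat_factor a b 1 x z"
    and A: "A \<ge> 1" and R: "R \<ge> 1" and s: "a + \<epsilon> \<ge> 1"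
  shows "\<exists>C>0. \<forall>C'\<ge>C. coefficient_estimates a \<epsilon> b C' S bm"
proof -
  define s where "s = a + \<epsilon>"
  define c1 where "c1 = A * 16 powr s"
  define c2 where "c2 = R * (4 * 2 ^ CARD('n + 'n)) powr s"
  have c: "c1 > 0" "c2 > 0" using A R by (auto simp: c1_def c2_def)
  have main: "cmod (DD \<alpha> \<beta> (joint (bm m)) (pair_vec x z))
      \<le> C ^ (m + mi_abs \<alpha> + mi_abs \<beta>) * (fact m) powr (2 * a + 2 * \<epsilon>)
             * mi_fact \<alpha> powr (a + \<epsilon>) * mi_fact \<beta> powr (a + \<epsilon>) * flat_factor a b (mi_abs \<beta>) x z"
    if xz: "(x, z) \<in> S" and C: "C \<ge> c1 + c2" for m \<alpha> \<beta> x z C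
  proof -
    define n where "n = mi_abs \<alpha> + mi_abs \<beta>"
    define ds where "ds = mi_word False \<alpha> @ mi_word True \<beta>"
    have len: "length ds = n" by (simp add: ds_def length_mi_word n_def)
    have om: "omG w (anti ds) (pair_vec x z) = flat_factor a b (mi_abs \<beta>) x z"
      using w[OF xz] by (auto simp: omG_def ds_def anti_mi_word flat_factor_def)
    have ff: "flat_factor a b (mi_abs \<beta>) x z \<ge> 0" by (simp add: flat_factor_def)
    have "cmod (DD \<alpha> \<beta> (joint (bm m)) (pair_vec x z)) \<le> A ^ m * R ^ n * fact (2 * m + n) powr s * flat_factor a b (mi_abs \<beta>) x z"
      using bd[OF xz, of ds m] unfolding DD_eq_dops ds_def[symmetric] len om s_def .
    also have "\<dots> \<le> A ^ m * R ^ n * (16 ^ m * (4 * 2 ^ CARD('n + 'n)) ^ n * ((fact m)\<^sup>2 * mi_fact \<alpha> * mi_fact \<beta>)) powr s * flat_factor a b (mi_abs \<beta>) x z"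
      using fact_split_bound[of m \<alpha> \<beta>] s A R ff unfolding n_def s_def
      by (intro mult_right_mono mult_left_mono powr_mono2) auto
    also have "(16 ^ m * (4 * 2 ^ CARD('n + 'n)) ^ n * ((fact m)\<^sup>2 * mi_fact \<alpha> * mi_fact \<beta>)) powr s
      = (16 powr s) ^ m * ((4 * 2 ^ CARD('n + 'n)) powr s) ^ n * (fact m powr (2 * s) * mi_fact \<alpha> powr s * mi_fact \<beta> powr s)"
    proof -
      have "((fact m :: real)\<^sup>2) powr s = fact m powr (2 * s)"
        by (simp only: power2_eq_square powr_mult fact_ge_zero powr_add[symmetric] mult_2)
      then show ?thesis
        using mi_fact_pos[of \<alpha>] mi_fact_pos[of \<beta>] by (simp add: powr_mult power_powr_swap power_mult_distrib)
    qed
    also have "A ^ m * R ^ n * ((16 powr s) ^ m * ((4 * 2 ^ CARD('n + 'n)) powr s) ^ n * (fact m powr (2 * s) * mi_fact \<alpha> powr s * mi_fact \<beta> powr s))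
        * flat_factor a b (mi_abs \<beta>) x z
      = (c1 ^ m * c2 ^ n) * (fact m powr (2 * s) * mi_fact \<alpha> powr s * mi_fact \<beta> powr s * flat_factor a b (mi_abs \<beta>) x z)"
      by (simp add: c1_def c2_def power_mult_distrib mult_ac)
    also have "\<dots> \<le> (C ^ m * C ^ n) * (fact m powr (2 * s) * mi_fact \<alpha> powr s * mi_fact \<beta> powr s * flat_factor a b (mi_abs \<beta>) x z)"
      using c C ff by (intro mult_right_mono mult_mono power_mono) auto
    also have "C ^ m * C ^ n = C ^ (m + mi_abs \<alpha> + mi_abs \<beta>)" by (simp add: n_def power_add mult_ac)
    finally show ?thesis by (simp add: s_def distrib_left mult_ac)
  qed
  have "coefficient_estimates a \<epsilon> b C S bm" if C: "C \<ge> c1 + c2" for C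
    unfolding coefficient_estimates_def
  proof (intro conjI allI ballI; clarify)
    fix m x z assume xz: "(x, z) \<in> S"
    \<comment> \<open>The sup bound is the case \<alpha> = \<beta> = 0, in which the flat factor is
      1.\<close>
    have word0: "DD (\<lambda>_. 0) (\<lambda>_. 0) (joint (bm m)) = joint (bm m)"
    proof -
      have "mi_word fl (\<lambda>_ :: 'n + 'n. 0) = []" for fl
        using length_mi_word[of fl "\<lambda>_ :: 'n + 'n. 0"] by (simp add: mi_abs_def)
      then show ?thesis by (simp add: DD_eq_dops)
    qed
    show "cmod (bm m x z) \<le> C ^ m * fact m powr (2 * a + 2 * \<epsilon>)"
      using main[OF xz C, of "\<lambda>_. 0" "\<lambda>_. 0" m] unfolding word0
      by (simp add: mi_abs_def mi_fact_def flat_factor_def)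
  next
    fix m \<alpha> \<beta> x z assume "(x, z) \<in> S"
    from main[OF this C] show "cmod (DD \<alpha> \<beta> (joint (bm m)) (pair_vec x z))
      \<le> C ^ (m + mi_abs \<alpha> + mi_abs \<beta>) * (fact m) powr (2 * a + 2 * \<epsilon>)
             * mi_fact \<alpha> powr (a + \<epsilon>) * mi_fact \<beta> powr (a + \<epsilon>) * flat_factor a b (mi_abs \<beta>) x z" .
  qed
  moreover have "c1 + c2 > 0" using c by simp
  ultimately show ?thesis by blast
qed

lemma cnjv_cnjv [simp]: "cnjv (cnjv x) = x"
  by (simp add: cnjv_def vec_eq_iff)

theorem theorem1p5:
  fixes A :: "('m::t2_space, 'n::finite) atlas"
    and L :: "('i, 'm) herm_line_bundle"
    and \<mu> :: "'m measure"
    and K :: "nat \<Rightarrow> 'i \<Rightarrow> 'i \<Rightarrow> 'm \<Rightarrow> 'm \<Rightarrow> complex"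
    and V :: "'m set" and \<kappa> :: "'m \<Rightarrow> complex^'n" and p :: 'm
    and \<sigma> :: "'i \<Rightarrow> 'm \<Rightarrow> complex"
    and \<phi> :: "complex^'n \<Rightarrow> real"
    and \<B> :: "nat \<Rightarrow> complex^'n \<Rightarrow> complex"
    and r a C0 C1 :: real
  assumes "compact_complex_manifold A"
    and "hermitian_line_bundle A L" and "positive_line_bundle A L"
    and "kaehler_volume A L \<mu>"
    and "\<And>k. k \<ge> 1 \<Longrightarrow> bergman_kernel A L \<mu> k (K k)"
    and "holomorphic_coordinates A V \<kappa>" and "p \<in> V" and "\<kappa> p = 0"
    and "r > 0" and "\<kappa> ` V = ball 0 r"
    and "holomorphic_frame A L V \<sigma>" and "local_potential L V \<kappa> \<sigma> \<phi>"
    and "bergman_coefficients L V \<kappa> \<sigma> \<phi> K \<B>"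
    and "a > 1" and "gevrey_with a (ball 0 r) (\<lambda>w. complex_of_real (\<phi> w)) C0 C1"
  shows "\<exists>b>0. \<forall>\<epsilon>>0. \<forall>chi \<psi> \<rho> B bm.
           gevrey_cutoff (1 + \<epsilon>) chi \<longrightarrow>
           \<psi> = gevrey_extension a C1 chi (\<lambda>w. complex_of_real (\<phi> w)) \<longrightarrow>
           0 < \<rho> \<longrightarrow> \<rho> \<le> r \<longrightarrow> B = ball 0 \<rho> \<longrightarrow>
           diffeo_onto_image (B \<times> B \<times> B) (theta_map \<psi>) \<longrightarrow>
           bergman_recursion \<psi> B bm \<longrightarrow>
           (\<forall>m. \<forall>x\<in>B. bm m x (cnjv x) = \<B> m x) \<longrightarrow>
           (\<exists>U C. open U \<and> 0 \<in> U \<and> U \<subseteq> B \<and> C > 0 \<and>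
              coefficient_estimates a \<epsilon> b C (U \<times> U) bm \<and>
              coefficient_estimates a 0 b C {(x, z) \<in> U \<times> U. z = cnjv x} bm)"
proof -
  define f where "f = (\<lambda>w. complex_of_real (\<phi> w))"
  interpret gevrey_potential f a C0 C1 r
    using assms by unfold_locales (simp_all add: f_def)
  have rho_pair: "rho (pair_vec x z) = norm (x - cnjv z)" for x z :: "complex^'n"
    by (simp add: rho_def)
  have main: "\<exists>U C. open U \<and> 0 \<in> U \<and> U \<subseteq> ball 0 \<rho> \<and> C > 0 \<and>
              coefficient_estimates a \<epsilon> flat_const C (U \<times> U) bm \<and>
              coefficient_estimates a 0 flat_const C {(x, z) \<in> U \<times> U. z = cnjv x} bm"
    if e: "\<epsilon> > 0" and cut: "gevrey_cutoff (1 + \<epsilon>) chi" and \<rho>: "0 < \<rho>" "\<rho> \<le> r"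
      and diff: "diffeo_onto_image (ball 0 \<rho> \<times> ball 0 \<rho> \<times> ball 0 \<rho>) (theta_map (gevrey_extension a C1 chi f))"
      and rec: "bergman_recursion (gevrey_extension a C1 chi f) (ball 0 \<rho>) bm"
    for \<epsilon> chi \<rho> bm
  proof -
    define \<psi> where "\<psi> = gevrey_extension a C1 chi f"
    have "\<bar>t\<bar> \<ge> 1 \<Longrightarrow> chi t = 0" for t using cut by (simp add: gevrey_cutoff_def)
    then have j: "joint \<psi> = psi2 chi"
      unfolding \<psi>_def by (intro ext gevrey_extension_eq)
    have sub: "D2 \<delta> \<subseteq> D2 r" if "\<delta> \<le> r" for \<delta> using that by (auto simp: D2_def)
    note g = psi2_gev[OF cut e, folded j]
    have sm: "sm (D2 \<rho>) (joint \<psi>)" using sm_subset[OF gev_sm[OF g(1)] sub[OF \<rho>(2)]] .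
    \<comment> \<open>The origin satisfies z = cnj x, and in the class with weight 0 every
      derivative with an antiholomorphic letter vanishes there.\<close>
    have flat: "dop (Inr j, True) (dop (Inl i, False) (joint \<psi>)) (pair_vec 0 0) = 0" for i j
    proof -
      obtain C where C: "\<And>P ds. P \<in> {v \<in> D2 r. rho v = 0} \<Longrightarrow>
          cmod (dops ds (joint \<psi>) P) \<le> C * C ^ length ds * fact (length ds) powr a * omG (\<lambda>_. 0) (anti ds) P"
        using g(2) unfolding gev_def by blast
      have "pair_vec 0 (0 :: complex^'n) \<in> {v \<in> D2 r. rho v = 0}"
        using r by (simp add: D2_def rho_pair cnjv_def zero_vec_def[symmetric])
      from C[OF this, of "[(Inr j, True), (Inl i, False)]"] show ?thesis by (simp add: omG_def)
    qed
    interpret P: phase \<psi> \<rho>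
      using \<rho>(1) sm diff flat by unfold_locales (simp_all add: \<psi>_def)
    obtain \<delta> c where \<delta>: "0 < \<delta>" "\<delta> \<le> \<rho>" "c > 0"
      "\<And>q. q \<in> D3 \<delta> \<Longrightarrow> c \<le> cmod (det (P.Am q))" "\<And>q. q \<in> D3 \<delta> \<Longrightarrow> c \<le> cmod (det (P.Sch q))"
      using P.exists_nbhd by blast
    interpret N: phase_nbhd \<psi> \<rho> \<delta> c by unfold_locales (fact \<delta>)+
    have \<delta>r: "\<delta> \<le> r" using \<delta>(2) \<rho>(2) by simp
    have rec': "bergman_recursion \<psi> (ball 0 \<rho>) bm" using rec by (simp add: \<psi>_def)
    \<comment> \<open>The points z = cnj x, on which order a and weight 0 are available. They have
      no interior, which is admissible because all estimates are pointwise.\<close>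
    define T where "T = {v \<in> D2 \<delta> :: (complex^('n + 'n)) set. rho v = 0}"
    have g1: "gev (a + \<epsilon>) (D2 \<rho>) (D2 \<delta>) (omG wt) (joint \<psi>)"
      by (rule gev_subset[OF g(1) sub[OF \<rho>(2)] sub[OF \<delta>r]])
    have g2: "gev a (D2 \<rho>) T (omG (\<lambda>_. 0)) (joint \<psi>)"
      by (rule gev_subset[OF g(2) sub[OF \<rho>(2)]]) (use sub[OF \<delta>r] in \<open>auto simp: T_def\<close>)
    have T: "T \<subseteq> D2 \<delta>" by (auto simp: T_def)
    have w0: "unit_weight (\<lambda>_. 0) T" by (simp add: unit_weight_def)
    have s1: "a + \<epsilon> \<ge> 1" and s2: "a + 0 \<ge> 1" using a e by auto
    obtain A1 R1 where A1: "A1 \<ge> 1" "R1 \<ge> 1" and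
      J1: "\<And>m. jet (a + \<epsilon>) (D3 \<delta>) (lift3 (D2 \<delta>)) (\<lambda>q. wt (pr q)) R1 (2 * m) (A1 ^ m) (N.ext3 (bm m))"
      using N.coefficient_jets[OF s1 order_refl unit_weight_wt g1 rec'] by blast
    obtain A2 R2 where A2: "A2 \<ge> 1" "R2 \<ge> 1" and
      J2: "\<And>m. jet (a + 0) (D3 \<delta>) (lift3 T) (\<lambda>q. 0) R2 (2 * m) (A2 ^ m) (N.ext3 (bm m))"
      using N.coefficient_jets[OF s2 T w0 _ rec'] g2 by (metis add_0_right)
    define U where "U = (ball 0 \<delta> :: (complex^'n) set)"
    have pU: "pair_vec x z \<in> D2 \<delta>" if "(x, z) \<in> U \<times> U" for x z using that P.pair_in_D2 by (auto simp: U_def)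
    have ff: "wt (pair_vec x z) = flat_factor a flat_const 1 x z" for x z
      by (simp add: wt_def flat_factor_def rho_pair)
    have E1: "\<exists>C>0. \<forall>C'\<ge>C. coefficient_estimates a \<epsilon> flat_const C' (U \<times> U) bm"
      by (rule coefficient_estimates_of_bounds[OF _ ff A1 s1], rule N.coefficient_bound[OF J1 order_refl pU])
    have E2: "\<exists>C>0. \<forall>C'\<ge>C. coefficient_estimates a 0 flat_const C' {(x, z) \<in> U \<times> U. z = cnjv x} bm"
    proof (rule coefficient_estimates_of_bounds[OF _ _ A2 s2, where w = "\<lambda>_. 0"])
      fix x z assume xz: "(x, z) \<in> {(x, z) \<in> U \<times> U. z = cnjv x}"
      then show "0 = flat_factor a flat_const 1 x z" by (auto simp: flat_factor_def)
      have "pair_vec x z \<in> T" using xz pU[of x z] by (auto simp: T_def rho_pair)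
      then show "cmod (dops ds (joint (bm m)) (pair_vec x z))
          \<le> A2 ^ m * R2 ^ length ds * fact (2 * m + length ds) powr (a + 0) * omG (\<lambda>_. 0) (anti ds) (pair_vec x z)" for m ds
        using N.coefficient_bound[where w = "\<lambda>_. 0", OF J2 T] by blast
    qed
    from E1 E2 obtain c1 c2 where cc: "c1 > 0" "\<And>C. C \<ge> c1 \<Longrightarrow> coefficient_estimates a \<epsilon> flat_const C (U \<times> U) bm"
      "\<And>C. C \<ge> c2 \<Longrightarrow> coefficient_estimates a 0 flat_const C {(x, z) \<in> U \<times> U. z = cnjv x} bm" by blast
    show ?thesis
      by (intro exI[of _ U] exI[of _ "max c1 c2"] conjI cc)
         (use \<delta> cc(1) in \<open>auto simp: U_def\<close>)
  qed
  \<comment> \<open>The witness for b is available before \<epsilon>, the cut-off and the ball are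
    chosen, because it depends on a and C1 only.\<close>
  show ?thesis
  proof (intro exI[of _ flat_const] conjI allI impI flat_const_pos)
    fix \<epsilon> :: real and chi \<psi> \<rho> B bm
    assume h: "\<epsilon> > 0" "gevrey_cutoff (1 + \<epsilon>) chi" "\<psi> = gevrey_extension a C1 chi (\<lambda>w. complex_of_real (\<phi> w))"
      "0 < \<rho>" "\<rho> \<le> r" "B = ball 0 \<rho>" "diffeo_onto_image (B \<times> B \<times> B) (theta_map \<psi>)" "bergman_recursion \<psi> B bm"
    show "\<exists>U C. open U \<and> 0 \<in> U \<and> U \<subseteq> B \<and> C > 0 \<and>
              coefficient_estimates a \<epsilon> flat_const C (U \<times> U) bm \<and>
              coefficient_estimates a 0 flat_const C {(x, z) \<in> U \<times> U. z = cnjv x} bm"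
      unfolding h(6)
      by (rule main[OF h(1,2,4,5) h(7)[unfolded h(3,6), folded f_def] h(8)[unfolded h(3,6), folded f_def]])
  qed
qed

end
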